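(* Let $\mathcal{C}$ and $\mathcal{D}$ be categories with finite limits and let $\Sigma_{\mathcal{D}}\dashv\mathcal{D}^*:\mathcal{D}\rightleftarrows\mathcal{C}$ be an adjunction (with $\Sigma_{\mathcal{D}}:\mathcal{D}\to\mathcal{C}$). The following are equivalent: 1. There exists an internal groupoid $\mathbb{G}$ in $\mathcal{C}$ and an equivalence $\Theta:\mathcal{D}\xrightarrow{\simeq}[\mathbb{G},\mathcal{C}]$ such that $\Theta\mathcal{D}^*\cong\mathbb{G}^*$. 2. There exists an object $G_0$ of $\mathcal{C}$ and a stably Frobenius adjunction $\mathbb{T}\dashv U:\mathcal{C}/G_0\rightleftarrows\mathcal{D}$ which is over $\mathcal{C}$ and is such that $U$ is monadic. 3. There exists an object $G_0$ of $\mathcal{C}$ and an adjunction $\mathbb{T}\dashv U:\mathcal{C}/G_0\rightleftarrows\mathcal{D}$, Frobenius at $\mathcal{D}^*G_0$, which is over $\mathcal{C}$ and is such that $U$ is monadic. 4. There exists an object $W$ of $\mathcal{D}$ such that $!^W:W\to1$ is an effective descent morphism and $(\Sigma_{\mathcal{D}})_W:\mathcal{D}/W\to\mathcal{C}/\Sigma_{\mathcal{D}}W$, $(V\xrightarrow{h}W)\mapsto(\Sigma_{\mathcal{D}}V\xrightarrow{\Sigma_{\mathcal{D}}h}\Sigma_{\mathcal{D}}W)$, is an equivalence of categories.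
   Context: All categories have finite limits. An adjunction $L\dashv R:\mathcal{A}\rightleftarrows\mathcal{B}$ has $L:\mathcal{A}\to\mathcal{B}$ left adjoint to $R:\mathcal{B}\to\mathcal{A}$. It is Frobenius if for all $W\in\mathcal{A}$, $X\in\mathcal{B}$ the canonical map $L(W\times RX)\to LW\times X$ (components $L\pi_1$ and $\epsilon_XL\pi_2$) is an isomorphism. For $X\in\mathcal{B}$ the sliced adjunction $L_X\dashv R_X:\mathcal{A}/RX\rightleftarrows\mathcal{B}/X$ has $L_X(g)$ the adjoint transpose of $g$ and $R_X(f)=Rf$. $L\dashv R$ is Frobenius at $X$ if $L_X\dashv R_X$ is Frobenius, and stably Frobenius if it is Frobenius at every $X\in\mathcal{B}$. For an object $G_0$ of $\mathcal{C}$, $\Sigma_{G_0}:\mathcal{C}/G_0\to\mathcal{C}$ is the domain functor. An adjunction $\mathbb{T}\dashv U:\mathcal{C}/G_0\rightleftarrows\mathcal{D}$ is over $\mathcal{C}$ if there is (given) a natural isomorphism $\Sigma_{\mathcal{D}}\mathbb{T}\cong\Sigma_{G_0}$. A morphism $f:X\to Y$ of a category $\mathcal{A}$ is an effective descent morphism if the pullback functor $f^*:\mathcal{A}/Y\to\mathcal{A}/X$ is monadic. Internal groupoid in $\mathcal{C}$: $\mathbb{G}=(d_0,d_1:G_1\rightrightarrows G_0,\ m,e,i)$. A $\mathbb{G}$-object is $(X_f,a)$ with $f:X\to G_0$ and an action $a:G_1\times_{G_0}X\to X$ (pullback of $d_0$ and $f$) with $fa=d_1\pi_1$ and the usual unit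 and associativity laws; these with equivariant maps over $G_0$ form the category $[\mathbb{G},\mathcal{C}]$. $\mathbb{G}^*:\mathcal{C}\to[\mathbb{G},\mathcal{C}]$ sends $X$ to $\pi_1:G_0\times X\to G_0$ with the trivial action $d_1\times\mathrm{Id}_X:G_1\times X\to G_0\times X$. *)

theory Defs
  imports Main
begin

section \<open>Categories, functors, natural transformations\<close>

text \<open>\<open>g \<cdot>\<^bsub>C\<^esub> f\<close> is composition in the usual order (first \<open>f\<close>, then \<open>g\<close>). Every map in a category
  has its domain and codomain attached, which is why maps of slices and similar categories are
  triples (source, underlying map, target) below.\<close>

record ('o, 'a) cat =
  Ob :: "'o set"
  Ar :: "'a set"
  Dom :: "'a \<Rightarrow> 'o"
  Cod :: "'a \<Rightarrow> 'o"
  idt :: "'o \<Rightarrow> 'a"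
  cmp :: "'a \<Rightarrow> 'a \<Rightarrow> 'a" (infixr \<open>\<cdot>\<index>\<close> 70)

definition hom :: "('o, 'a) cat \<Rightarrow> 'o \<Rightarrow> 'o \<Rightarrow> 'a set" where
  "hom C X Y = {f \<in> Ar C. Dom C f = X \<and> Cod C f = Y}"

locale category =
  fixes C :: "('o, 'a) cat" (structure)
  assumes Dom_in: "f \<in> Ar C \<Longrightarrow> Dom C f \<in> Ob C"
    and Cod_in: "f \<in> Ar C \<Longrightarrow> Cod C f \<in> Ob C"
    and idt_in: "X \<in> Ob C \<Longrightarrow> idt C X \<in> hom C X X"
    and comp_in: "f \<in> hom C X Y \<Longrightarrow> g \<in> hom C Y Z \<Longrightarrow> g \<cdot> f \<in> hom C X Z"
    and comp_idt: "f \<in> hom C X Y \<Longrightarrow> f \<cdot> idt C X = f"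
    and idt_comp: "f \<in> hom C X Y \<Longrightarrow> idt C Y \<cdot> f = f"
    and comp_assoc: "f \<in> hom C W X \<Longrightarrow> g \<in> hom C X Y \<Longrightarrow> h \<in> hom C Y Z \<Longrightarrow>
      (h \<cdot> g) \<cdot> f = h \<cdot> (g \<cdot> f)"

definition is_iso :: "('o, 'a) cat \<Rightarrow> 'a \<Rightarrow> bool" where
  "is_iso C f \<longleftrightarrow> f \<in> Ar C \<and>
    (\<exists>g \<in> hom C (Cod C f) (Dom C f).
      g \<cdot>\<^bsub>C\<^esub> f = idt C (Dom C f) \<and> f \<cdot>\<^bsub>C\<^esub> g = idt C (Cod C f))"

record ('o, 'a, 'p, 'b) func =
  fob :: "'o \<Rightarrow> 'p"
  far :: "'a \<Rightarrow> 'b"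

locale cat_functor = A: category A + B: category B
  for A :: "('o, 'a) cat" and B :: "('p, 'b) cat" +
  fixes F :: "('o, 'a, 'p, 'b) func"
  assumes fob_in: "X \<in> Ob A \<Longrightarrow> fob F X \<in> Ob B"
    and far_in: "f \<in> hom A X Y \<Longrightarrow> far F f \<in> hom B (fob F X) (fob F Y)"
    and far_idt: "X \<in> Ob A \<Longrightarrow> far F (idt A X) = idt B (fob F X)"
    and far_comp: "f \<in> hom A X Y \<Longrightarrow> g \<in> hom A Y Z \<Longrightarrow>
      far F (g \<cdot>\<^bsub>A\<^esub> f) = far F g \<cdot>\<^bsub>B\<^esub> far F f"

definition id_functor :: "('o, 'a, 'o, 'a) func" where
  "id_functor = \<lparr>fob = (\<lambda>X. X), far = (\<lambda>f. f)\<rparr>"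

definition comp_functor ::
  "('p, 'b, 'q, 'c) func \<Rightarrow> ('o, 'a, 'p, 'b) func \<Rightarrow> ('o, 'a, 'q, 'c) func" (infixr \<open>\<circ>\<^sub>F\<close> 65) where
  "G \<circ>\<^sub>F F = \<lparr>fob = (\<lambda>X. fob G (fob F X)), far = (\<lambda>f. far G (far F f))\<rparr>"

locale nat_trans = F: cat_functor A B F + G: cat_functor A B G
  for A :: "('o, 'a) cat" and B :: "('p, 'b) cat" and F G +
  fixes \<alpha> :: "'o \<Rightarrow> 'b"
  assumes component_in: "X \<in> Ob A \<Longrightarrow> \<alpha> X \<in> hom B (fob F X) (fob G X)"
    and naturality: "f \<in> hom A X Y \<Longrightarrow> \<alpha> Y \<cdot>\<^bsub>B\<^esub> far F f = far G f \<cdot>\<^bsub>B\<^esub> \<alpha> X"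

definition naturally_isomorphic ::
  "('o, 'a) cat \<Rightarrow> ('p, 'b) cat \<Rightarrow> ('o, 'a, 'p, 'b) func \<Rightarrow> ('o, 'a, 'p, 'b) func \<Rightarrow> bool" where
  "naturally_isomorphic A B F G \<longleftrightarrow>
    (\<exists>\<alpha>. nat_trans A B F G \<alpha> \<and> (\<forall>X \<in> Ob A. is_iso B (\<alpha> X)))"

definition equivalence_functor ::
  "('o, 'a) cat \<Rightarrow> ('p, 'b) cat \<Rightarrow> ('o, 'a, 'p, 'b) func \<Rightarrow> bool" where
  "equivalence_functor A B F \<longleftrightarrow> cat_functor A B F \<and>
    (\<exists>G. cat_functor B A G \<and>
      naturally_isomorphic A A id_functor (G \<circ>\<^sub>F F) \<and>
      naturally_isomorphic B B (F \<circ>\<^sub>F G) id_functor)"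


section \<open>Limits\<close>

definition limit_cone ::
  "('j, 'u) cat \<Rightarrow> ('o, 'a) cat \<Rightarrow> ('j, 'u, 'o, 'a) func \<Rightarrow> 'o \<Rightarrow> ('j \<Rightarrow> 'a) \<Rightarrow> bool" where
  "limit_cone J C F X \<pi> \<longleftrightarrow>
    (let cone = (\<lambda>Y \<sigma>. Y \<in> Ob C \<and> (\<forall>j \<in> Ob J. \<sigma> j \<in> hom C Y (fob F j)) \<and>
                  (\<forall>u \<in> Ar J. far F u \<cdot>\<^bsub>C\<^esub> \<sigma> (Dom J u) = \<sigma> (Cod J u)))
     in cone X \<pi> \<and>
        (\<forall>Y \<sigma>. cone Y \<sigma> \<longrightarrow> (\<exists>!h. h \<in> hom C Y X \<and> (\<forall>j \<in> Ob J. \<pi> j \<cdot>\<^bsub>C\<^esub> h = \<sigma> j))))"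

text \<open>Every finite category is isomorphic to one whose objects and maps are natural numbers, so these
  are all the finite shapes.\<close>

definition has_finite_limits :: "('o, 'a) cat \<Rightarrow> bool" where
  "has_finite_limits C \<longleftrightarrow>
    (\<forall>(J :: (nat, nat) cat) F. finite (Ob J) \<and> finite (Ar J) \<and> cat_functor J C F \<longrightarrow>
      (\<exists>X \<pi>. limit_cone J C F X \<pi>))"

definition is_terminal :: "('o, 'a) cat \<Rightarrow> 'o \<Rightarrow> bool" where
  "is_terminal C T \<longleftrightarrow> T \<in> Ob C \<and> (\<forall>X \<in> Ob C. \<exists>!h. h \<in> hom C X T)"

definition is_product :: "('o, 'a) cat \<Rightarrow> 'o \<Rightarrow> 'o \<Rightarrow> 'a \<Rightarrow> 'a \<Rightarrow> bool" where
  "is_product C X Y p q \<longleftrightarrow> p \<in> hom C (Dom C p) X \<and> q \<in> hom C (Dom C p) Y \<and>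
    (\<forall>Z. \<forall>u \<in> hom C Z X. \<forall>v \<in> hom C Z Y.
      \<exists>!h. h \<in> hom C Z (Dom C p) \<and> p \<cdot>\<^bsub>C\<^esub> h = u \<and> q \<cdot>\<^bsub>C\<^esub> h = v)"

definition is_pullback :: "('o, 'a) cat \<Rightarrow> 'a \<Rightarrow> 'a \<Rightarrow> 'a \<Rightarrow> 'a \<Rightarrow> bool" where
  "is_pullback C f g p q \<longleftrightarrow>
    p \<in> hom C (Dom C p) (Dom C f) \<and> q \<in> hom C (Dom C p) (Dom C g) \<and>
    f \<cdot>\<^bsub>C\<^esub> p = g \<cdot>\<^bsub>C\<^esub> q \<and>
    (\<forall>Z. \<forall>u \<in> hom C Z (Dom C f). \<forall>v \<in> hom C Z (Dom C g). f \<cdot>\<^bsub>C\<^esub> u = g \<cdot>\<^bsub>C\<^esub> v \<longrightarrow>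
      (\<exists>!h. h \<in> hom C Z (Dom C p) \<and> p \<cdot>\<^bsub>C\<^esub> h = u \<and> q \<cdot>\<^bsub>C\<^esub> h = v))"

text \<open>Chosen limits; meaningful only in categories where the limits exist. The pullback object of
  \<open>f\<close> and \<open>g\<close> is \<open>Dom C (pb1 C f g)\<close>, the product of \<open>X\<close> and \<open>Y\<close> is \<open>Dom C (prd1 C X Y)\<close>.\<close>

definition terminal_ob :: "('o, 'a) cat \<Rightarrow> 'o" where
  "terminal_ob C = (SOME T. is_terminal C T)"

definition bang :: "('o, 'a) cat \<Rightarrow> 'o \<Rightarrow> 'a" where
  "bang C X = (THE h. h \<in> hom C X (terminal_ob C))"

definition prd1 :: "('o, 'a) cat \<Rightarrow> 'o \<Rightarrow> 'o \<Rightarrow> 'a" where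
  "prd1 C X Y = fst (SOME pq. is_product C X Y (fst pq) (snd pq))"

definition prd2 :: "('o, 'a) cat \<Rightarrow> 'o \<Rightarrow> 'o \<Rightarrow> 'a" where
  "prd2 C X Y = snd (SOME pq. is_product C X Y (fst pq) (snd pq))"

definition prd_pair :: "('o, 'a) cat \<Rightarrow> 'o \<Rightarrow> 'o \<Rightarrow> 'a \<Rightarrow> 'a \<Rightarrow> 'a" where
  "prd_pair C X Y u v = (THE h. h \<in> hom C (Dom C u) (Dom C (prd1 C X Y)) \<and>
    prd1 C X Y \<cdot>\<^bsub>C\<^esub> h = u \<and> prd2 C X Y \<cdot>\<^bsub>C\<^esub> h = v)"

definition prd_map :: "('o, 'a) cat \<Rightarrow> 'a \<Rightarrow> 'a \<Rightarrow> 'a" where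
  "prd_map C f g = prd_pair C (Cod C f) (Cod C g)
    (f \<cdot>\<^bsub>C\<^esub> prd1 C (Dom C f) (Dom C g)) (g \<cdot>\<^bsub>C\<^esub> prd2 C (Dom C f) (Dom C g))"

definition pb1 :: "('o, 'a) cat \<Rightarrow> 'a \<Rightarrow> 'a \<Rightarrow> 'a" where
  "pb1 C f g = fst (SOME pq. is_pullback C f g (fst pq) (snd pq))"

definition pb2 :: "('o, 'a) cat \<Rightarrow> 'a \<Rightarrow> 'a \<Rightarrow> 'a" where
  "pb2 C f g = snd (SOME pq. is_pullback C f g (fst pq) (snd pq))"

definition pb_pair :: "('o, 'a) cat \<Rightarrow> 'a \<Rightarrow> 'a \<Rightarrow> 'a \<Rightarrow> 'a \<Rightarrow> 'a" where
  "pb_pair C f g u v = (THE h. h \<in> hom C (Dom C u) (Dom C (pb1 C f g)) \<and>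
    pb1 C f g \<cdot>\<^bsub>C\<^esub> h = u \<and> pb2 C f g \<cdot>\<^bsub>C\<^esub> h = v)"


section \<open>Slice categories\<close>

definition slice :: "('o, 'a) cat \<Rightarrow> 'o \<Rightarrow> ('a, 'a \<times> 'a \<times> 'a) cat" where
  "slice C X = \<lparr>
    Ob = {f \<in> Ar C. Cod C f = X},
    Ar = {(f, h, g). f \<in> Ar C \<and> Cod C f = X \<and> g \<in> Ar C \<and> Cod C g = X \<and>
            h \<in> hom C (Dom C f) (Dom C g) \<and> g \<cdot>\<^bsub>C\<^esub> h = f},
    Dom = (\<lambda>(f, h, g). f),
    Cod = (\<lambda>(f, h, g). g),
    idt = (\<lambda>f. (f, idt C (Dom C f), f)),
    cmp = (\<lambda>(g', k, r) (f, h, g). (f, k \<cdot>\<^bsub>C\<^esub> h, r))\<rparr>"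

definition slice_dom :: "('o, 'a) cat \<Rightarrow> ('a, 'a \<times> 'a \<times> 'a, 'o, 'a) func" where
  "slice_dom C = \<lparr>fob = Dom C, far = (\<lambda>(f, h, g). h)\<rparr>"

text \<open>The functor \<open>A/X \<rightarrow> B/FX\<close> induced by \<open>F : A \<rightarrow> B\<close>; for each \<open>X\<close> it is given by the same data.\<close>

definition slice_functor ::
  "('o, 'a, 'p, 'b) func \<Rightarrow> ('a, 'a \<times> 'a \<times> 'a, 'b, 'b \<times> 'b \<times> 'b) func" where
  "slice_functor F = \<lparr>fob = far F, far = (\<lambda>(f, h, g). (far F f, far F h, far F g))\<rparr>"

definition pullback_functor ::
  "('o, 'a) cat \<Rightarrow> 'a \<Rightarrow> ('a, 'a \<times> 'a \<times> 'a, 'a, 'a \<times> 'a \<times> 'a) func" where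
  "pullback_functor C f = \<lparr>
    fob = (\<lambda>g. pb1 C f g),
    far = (\<lambda>(g, h, k). (pb1 C f g, pb_pair C f k (pb1 C f g) (h \<cdot>\<^bsub>C\<^esub> pb2 C f g), pb1 C f k))\<rparr>"


section \<open>Adjunctions and monadicity\<close>

locale adjunction =
  L: cat_functor A B L + R: cat_functor B A R +
  unit: nat_trans A A id_functor "R \<circ>\<^sub>F L" \<eta> +
  counit: nat_trans B B "L \<circ>\<^sub>F R" id_functor \<epsilon>
  for A :: "('o, 'a) cat" and B :: "('p, 'b) cat" and L R \<eta> \<epsilon> +
  assumes triangle_left: "X \<in> Ob A \<Longrightarrow> \<epsilon> (fob L X) \<cdot>\<^bsub>B\<^esub> far L (\<eta> X) = idt B (fob L X)"
    and triangle_right: "Y \<in> Ob B \<Longrightarrow> far R (\<epsilon> Y) \<cdot>\<^bsub>A\<^esub> \<eta> (fob R Y) = idt A (fob R Y)"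

definition em_category :: "('o, 'a) cat \<Rightarrow> ('o, 'a, 'o, 'a) func \<Rightarrow> ('o \<Rightarrow> 'a) \<Rightarrow> ('o \<Rightarrow> 'a) \<Rightarrow>
    ('o \<times> 'a, ('o \<times> 'a) \<times> 'a \<times> ('o \<times> 'a)) cat" where
  "em_category A T \<eta> \<mu> =
    (let algebras = {(X, a). X \<in> Ob A \<and> a \<in> hom A (fob T X) X \<and>
           a \<cdot>\<^bsub>A\<^esub> \<eta> X = idt A X \<and> a \<cdot>\<^bsub>A\<^esub> \<mu> X = a \<cdot>\<^bsub>A\<^esub> far T a}
     in \<lparr>
    Ob = algebras,
    Ar = {((X, a), h, (Y, b)). (X, a) \<in> algebras \<and> (Y, b) \<in> algebras \<and>
            h \<in> hom A X Y \<and> h \<cdot>\<^bsub>A\<^esub> a = b \<cdot>\<^bsub>A\<^esub> far T h},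
    Dom = (\<lambda>(x, h, y). x),
    Cod = (\<lambda>(x, h, y). y),
    idt = (\<lambda>(X, a). ((X, a), idt A X, (X, a))),
    cmp = (\<lambda>(y', k, z) (x, h, y). (x, k \<cdot>\<^bsub>A\<^esub> h, z))\<rparr>)"

definition comparison_functor :: "('p, 'b, 'o, 'a) func \<Rightarrow> ('p, 'b) cat \<Rightarrow> ('p \<Rightarrow> 'b) \<Rightarrow>
    ('p, 'b, 'o \<times> 'a, ('o \<times> 'a) \<times> 'a \<times> ('o \<times> 'a)) func" where
  "comparison_functor R B \<epsilon> =
    (let K = (\<lambda>Y. (fob R Y, far R (\<epsilon> Y)))
     in \<lparr>fob = K, far = (\<lambda>h. (K (Dom B h), far R h, K (Cod B h)))\<rparr>)"

definition monadic :: "('p, 'b) cat \<Rightarrow> ('o, 'a) cat \<Rightarrow> ('p, 'b, 'o, 'a) func \<Rightarrow> bool" where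
  "monadic B A R \<longleftrightarrow>
    (\<exists>L \<eta> \<epsilon>. adjunction A B L R \<eta> \<epsilon> \<and>
      equivalence_functor B (em_category A (R \<circ>\<^sub>F L) \<eta> (\<lambda>X. far R (\<epsilon> (fob L X))))
        (comparison_functor R B \<epsilon>))"

definition effective_descent :: "('o, 'a) cat \<Rightarrow> 'a \<Rightarrow> bool" where
  "effective_descent C f \<longleftrightarrow> f \<in> Ar C \<and>
    monadic (slice C (Cod C f)) (slice C (Dom C f)) (pullback_functor C f)"


section \<open>Frobenius adjunctions\<close>

text \<open>For an adjunction \<open>L \<stileturn> R : A \<rightleftarrows> B\<close> with counit \<open>\<epsilon>\<close>.\<close>

definition frobenius_map :: "('o, 'a) cat \<Rightarrow> ('p, 'b) cat \<Rightarrow> ('o, 'a, 'p, 'b) func \<Rightarrow>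
    ('p, 'b, 'o, 'a) func \<Rightarrow> ('p \<Rightarrow> 'b) \<Rightarrow> 'o \<Rightarrow> 'p \<Rightarrow> 'b" where
  "frobenius_map A B L R \<epsilon> W X = prd_pair B (fob L W) X
    (far L (prd1 A W (fob R X))) (\<epsilon> X \<cdot>\<^bsub>B\<^esub> far L (prd2 A W (fob R X)))"

definition frobenius :: "('o, 'a) cat \<Rightarrow> ('p, 'b) cat \<Rightarrow> ('o, 'a, 'p, 'b) func \<Rightarrow>
    ('p, 'b, 'o, 'a) func \<Rightarrow> ('p \<Rightarrow> 'b) \<Rightarrow> bool" where
  "frobenius A B L R \<epsilon> \<longleftrightarrow>
    (\<forall>W \<in> Ob A. \<forall>X \<in> Ob B. is_iso B (frobenius_map A B L R \<epsilon> W X))"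

definition sliced_left :: "('p, 'b) cat \<Rightarrow> ('o, 'a, 'p, 'b) func \<Rightarrow> ('p \<Rightarrow> 'b) \<Rightarrow> 'p \<Rightarrow>
    ('a, 'a \<times> 'a \<times> 'a, 'b, 'b \<times> 'b \<times> 'b) func" where
  "sliced_left B L \<epsilon> X = \<lparr>
    fob = (\<lambda>g. \<epsilon> X \<cdot>\<^bsub>B\<^esub> far L g),
    far = (\<lambda>(f, h, g). (\<epsilon> X \<cdot>\<^bsub>B\<^esub> far L f, far L h, \<epsilon> X \<cdot>\<^bsub>B\<^esub> far L g))\<rparr>"

definition sliced_counit :: "('p, 'b) cat \<Rightarrow> ('o, 'a, 'p, 'b) func \<Rightarrow> ('p, 'b, 'o, 'a) func \<Rightarrow>
    ('p \<Rightarrow> 'b) \<Rightarrow> 'p \<Rightarrow> 'b \<Rightarrow> 'b \<times> 'b \<times> 'b" where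
  "sliced_counit B L R \<epsilon> X f = (\<epsilon> X \<cdot>\<^bsub>B\<^esub> far L (far R f), \<epsilon> (Dom B f), f)"

definition frobenius_at :: "('o, 'a) cat \<Rightarrow> ('p, 'b) cat \<Rightarrow> ('o, 'a, 'p, 'b) func \<Rightarrow>
    ('p, 'b, 'o, 'a) func \<Rightarrow> ('p \<Rightarrow> 'b) \<Rightarrow> 'p \<Rightarrow> bool" where
  "frobenius_at A B L R \<epsilon> X \<longleftrightarrow>
    frobenius (slice A (fob R X)) (slice B X)
      (sliced_left B L \<epsilon> X) (slice_functor R) (sliced_counit B L R \<epsilon> X)"

definition stably_frobenius :: "('o, 'a) cat \<Rightarrow> ('p, 'b) cat \<Rightarrow> ('o, 'a, 'p, 'b) func \<Rightarrow>
    ('p, 'b, 'o, 'a) func \<Rightarrow> ('p \<Rightarrow> 'b) \<Rightarrow> bool" where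
  "stably_frobenius A B L R \<epsilon> \<longleftrightarrow> (\<forall>X \<in> Ob B. frobenius_at A B L R \<epsilon> X)"


section \<open>Internal groupoids and their actions\<close>

text \<open>In elements: \<open>g \<in> G1\<close> goes from \<open>d0 g\<close> to \<open>d1 g\<close>, and \<open>gmul(g, h)\<close> (first \<open>h\<close>, then \<open>g\<close>) is defined
  when \<open>d0 g = d1 h\<close>. With this order the associativity law of an action reads
  \<open>a(gmul(g, h), x) = a(g, a(h, x))\<close>.\<close>

record ('o, 'a) igpd =
  G0 :: 'o
  G1 :: 'o
  d0 :: 'a
  d1 :: 'a
  gmul :: 'a
  gunit :: 'a
  ginv :: 'a

text \<open>Both associativity laws below are stated on the pullback of
  \<open>d0 \<circ> \<pi>\<^sub>2 : G1 \<times>\<^bsub>G0\<^esub> G1 \<rightarrow> G0\<close> along the third map, i.e. on \<open>G1 \<times>\<^bsub>G0\<^esub> G1 \<times>\<^bsub>G0\<^esub> G1\<close>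
  respectively \<open>G1 \<times>\<^bsub>G0\<^esub> G1 \<times>\<^bsub>G0\<^esub> X\<close>.\<close>

locale internal_groupoid = category C
  for C :: "('o, 'a) cat" (structure) +
  fixes G :: "('o, 'a) igpd"
  assumes G0_in: "G0 G \<in> Ob C"
    and G1_in: "G1 G \<in> Ob C"
    and d0_in: "d0 G \<in> hom C (G1 G) (G0 G)"
    and d1_in: "d1 G \<in> hom C (G1 G) (G0 G)"
    and m_in: "gmul G \<in> hom C (Dom C (pb1 C (d0 G) (d1 G))) (G1 G)"
    and e_in: "gunit G \<in> hom C (G0 G) (G1 G)"
    and i_in: "ginv G \<in> hom C (G1 G) (G1 G)"
    and d0_m: "d0 G \<cdot> gmul G = d0 G \<cdot> pb2 C (d0 G) (d1 G)"
    and d1_m: "d1 G \<cdot> gmul G = d1 G \<cdot> pb1 C (d0 G) (d1 G)"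
    and d0_e: "d0 G \<cdot> gunit G = idt C (G0 G)"
    and d1_e: "d1 G \<cdot> gunit G = idt C (G0 G)"
    and d0_i: "d0 G \<cdot> ginv G = d1 G"
    and d1_i: "d1 G \<cdot> ginv G = d0 G"
    and unit_left: "gmul G \<cdot> pb_pair C (d0 G) (d1 G) (gunit G \<cdot> d1 G) (idt C (G1 G)) = idt C (G1 G)"
    and unit_right: "gmul G \<cdot> pb_pair C (d0 G) (d1 G) (idt C (G1 G)) (gunit G \<cdot> d0 G) = idt C (G1 G)"
    and m_assoc: "
      let p = pb1 C (d0 G) (d1 G); q = pb2 C (d0 G) (d1 G);
          gh = pb1 C (d0 G \<cdot> q) (d1 G); k = pb2 C (d0 G \<cdot> q) (d1 G)
      in gmul G \<cdot> pb_pair C (d0 G) (d1 G) (gmul G \<cdot> gh) k =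
         gmul G \<cdot> pb_pair C (d0 G) (d1 G) (p \<cdot> gh) (gmul G \<cdot> pb_pair C (d0 G) (d1 G) (q \<cdot> gh) k)"
    and inverse_left: "gmul G \<cdot> pb_pair C (d0 G) (d1 G) (ginv G) (idt C (G1 G)) = gunit G \<cdot> d0 G"
    and inverse_right: "gmul G \<cdot> pb_pair C (d0 G) (d1 G) (idt C (G1 G)) (ginv G) = gunit G \<cdot> d1 G"

text \<open>A \<open>G\<close>-object is the pair \<open>(f, a)\<close>; its underlying object is \<open>X = Dom C f\<close>.\<close>

definition is_gobject :: "('o, 'a) cat \<Rightarrow> ('o, 'a) igpd \<Rightarrow> 'a \<times> 'a \<Rightarrow> bool" where
  "is_gobject C G = (\<lambda>(f, a).
    f \<in> Ar C \<and> Cod C f = G0 G \<and>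
    a \<in> hom C (Dom C (pb1 C (d0 G) f)) (Dom C f) \<and>
    f \<cdot>\<^bsub>C\<^esub> a = d1 G \<cdot>\<^bsub>C\<^esub> pb1 C (d0 G) f \<and>
    a \<cdot>\<^bsub>C\<^esub> pb_pair C (d0 G) f (gunit G \<cdot>\<^bsub>C\<^esub> f) (idt C (Dom C f)) = idt C (Dom C f) \<and>
    (let p = pb1 C (d0 G) (d1 G); q = pb2 C (d0 G) (d1 G);
         gh = pb1 C (d0 G \<cdot>\<^bsub>C\<^esub> q) f; x = pb2 C (d0 G \<cdot>\<^bsub>C\<^esub> q) f
     in a \<cdot>\<^bsub>C\<^esub> pb_pair C (d0 G) f (gmul G \<cdot>\<^bsub>C\<^esub> gh) x =
        a \<cdot>\<^bsub>C\<^esub> pb_pair C (d0 G) f (p \<cdot>\<^bsub>C\<^esub> gh)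
          (a \<cdot>\<^bsub>C\<^esub> pb_pair C (d0 G) f (q \<cdot>\<^bsub>C\<^esub> gh) x)))"

definition gobj_cat ::
  "('o, 'a) cat \<Rightarrow> ('o, 'a) igpd \<Rightarrow> ('a \<times> 'a, ('a \<times> 'a) \<times> 'a \<times> ('a \<times> 'a)) cat" where
  "gobj_cat C G = \<lparr>
    Ob = {x. is_gobject C G x},
    Ar = {((f, a), h, (g, b)). is_gobject C G (f, a) \<and> is_gobject C G (g, b) \<and>
            h \<in> hom C (Dom C f) (Dom C g) \<and> g \<cdot>\<^bsub>C\<^esub> h = f \<and>
            h \<cdot>\<^bsub>C\<^esub> a =
              b \<cdot>\<^bsub>C\<^esub> pb_pair C (d0 G) g (pb1 C (d0 G) f) (h \<cdot>\<^bsub>C\<^esub> pb2 C (d0 G) f)},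
    Dom = (\<lambda>(x, h, y). x),
    Cod = (\<lambda>(x, h, y). y),
    idt = (\<lambda>(f, a). ((f, a), idt C (Dom C f), (f, a))),
    cmp = (\<lambda>(y', k, z) (x, h, y). (x, k \<cdot>\<^bsub>C\<^esub> h, z))\<rparr>"

text \<open>The action on \<open>\<pi>\<^sub>1 : G0 \<times> X \<rightarrow> G0\<close> has as its domain the pullback of \<open>d0\<close> and \<open>\<pi>\<^sub>1\<close>, so
  \<open>d1 \<times> Id\<^sub>X\<close> is precomposed with the canonical isomorphism from that pullback to \<open>G1 \<times> X\<close>.\<close>

definition gstar_ob :: "('o, 'a) cat \<Rightarrow> ('o, 'a) igpd \<Rightarrow> 'o \<Rightarrow> 'a \<times> 'a" where
  "gstar_ob C G X =
    (let f = prd1 C (G0 G) X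
     in (f, prd_map C (d1 G) (idt C X) \<cdot>\<^bsub>C\<^esub>
            prd_pair C (G1 G) X (pb1 C (d0 G) f) (prd2 C (G0 G) X \<cdot>\<^bsub>C\<^esub> pb2 C (d0 G) f)))"

definition gstar :: "('o, 'a) cat \<Rightarrow> ('o, 'a) igpd \<Rightarrow>
    ('o, 'a, 'a \<times> 'a, ('a \<times> 'a) \<times> 'a \<times> ('a \<times> 'a)) func" where
  "gstar C G = \<lparr>
    fob = gstar_ob C G,
    far = (\<lambda>u. (gstar_ob C G (Dom C u), prd_map C (idt C (G0 G)) u, gstar_ob C G (Cod C u)))\<rparr>"

end

theory Submission
  imports Defs
begin

text \<open>The conditions are proved to imply one another cyclically. Monadicity is used in Beck's form, which
  does not mention the left adjoint and can be transported along equivalences.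

  \<open>1 \<Rightarrow> 2\<close>: \<open>U\<close> is \<open>\<Theta>\<close> followed by the forgetful functor. Elements of a free action are uniquely of the form
  \<open>\<gamma> \<cdot> \<eta>(v)\<close>, so the pullback in the Frobenius condition is computed by moving elements with \<open>\<gamma>\<close> and its inverse.

  \<open>3 \<Rightarrow> 4\<close>: Let \<open>W = T(1)\<close>. The Frobenius condition at \<open>D\<^sup>* G\<^sub>0\<close>, applied to the map \<open>1 \<rightarrow> U D\<^sup>* G\<^sub>0\<close> given by the
  diagonal of \<open>G\<^sub>0\<close>, says that maps \<open>Y \<rightarrow> T f\<close> over \<open>W\<close> are maps \<open>\<Sigma> Y \<rightarrow> Dom f\<close> over \<open>G\<^sub>0\<close>. Hence \<open>\<Sigma>\<close> and \<open>T\<close> induce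
  equivalences of \<open>D/W\<close> with \<open>C/\<Sigma> W\<close> and \<open>C/G\<^sub>0\<close>, under which \<open>U\<close> becomes \<open>W \<times> -\<close>.

  \<open>4 \<Rightarrow> 1\<close>: \<open>\<Sigma>\<close> preserves pullbacks over \<open>W\<close> and so sends the codiscrete groupoid on \<open>W\<close> to a groupoid in \<open>C\<close>,
  which acts on \<open>\<Sigma>(W \<times> Y)\<close> for every \<open>Y\<close>. That every action arises in this way is descent along \<open>W \<rightarrow> 1\<close>.\<close>

section \<open>Arrows, isomorphisms and functors\<close>

text \<open>The canonical map in the Frobenius condition refers to chosen products of slices.
  Products in a slice are pullbacks, so the condition becomes a statement free of choices:
  transposition turns every pullback of a map along some \<open>U g\<close> into a pullback in
  \<open>D\<close>. The condition is used and verified in that form. The obstacle in building the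
  groupoid is that \<Sigma> is only known to respect pullbacks over \<open>W\<close>, and only up to
  isomorphism, while the groupoid and its actions live on chosen pullbacks of \<open>C\<close>. The
  remedy is the equivalence of the slices over \<open>W\<close> and over \<Sigma> \<open>W\<close>:
  a generalized element of \<open>C\<close> over \<Sigma> \<open>W\<close> becomes, after an
  isomorphism of its domain, the image of a map of \<open>D\<close> over \<open>W\<close>. Laws in
  \<open>C\<close> are thereby checked in \<open>D\<close>, where an element of \<open>W x W\<close>
  is a pair and the laws of the codiscrete groupoid are visible. The same device identifies the
  image of \<open>W x Dst X\<close> with the product of \<Sigma> \<open>W\<close> and
  \<open>X\<close>, which is what compatibility with the trivial actions rests on.\<close>

lemma mem_hom [simp]: "f \<in> hom C X Y \<longleftrightarrow> f \<in> Ar C \<and> Dom C f = X \<and> Cod C f = Y"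
  by (simp add: hom_def)

context category
begin

lemma Dom_ob [simp]: "f \<in> Ar C \<Longrightarrow> Dom C f \<in> Ob C"
  by (rule Dom_in)

lemma Cod_ob [simp]: "f \<in> Ar C \<Longrightarrow> Cod C f \<in> Ob C"
  by (rule Cod_in)

lemma idt_Ar [simp]: "X \<in> Ob C \<Longrightarrow> idt C X \<in> Ar C"
  and Dom_idt [simp]: "X \<in> Ob C \<Longrightarrow> Dom C (idt C X) = X"
  and Cod_idt [simp]: "X \<in> Ob C \<Longrightarrow> Cod C (idt C X) = X"
  using idt_in by simp_all

lemma comp_Ar [simp]: "\<lbrakk>g \<in> Ar C; f \<in> Ar C; Dom C g = Cod C f\<rbrakk> \<Longrightarrow> g \<cdot> f \<in> Ar C"
  and Dom_comp [simp]: "\<lbrakk>g \<in> Ar C; f \<in> Ar C; Dom C g = Cod C f\<rbrakk> \<Longrightarrow> Dom C (g \<cdot> f) = Dom C f"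
  and Cod_comp [simp]: "\<lbrakk>g \<in> Ar C; f \<in> Ar C; Dom C g = Cod C f\<rbrakk> \<Longrightarrow> Cod C (g \<cdot> f) = Cod C g"
  using comp_in[of f "Dom C f" "Cod C f" g "Cod C g"] by simp_all

lemma comp_id_right [simp]: "\<lbrakk>f \<in> Ar C; Dom C f = X\<rbrakk> \<Longrightarrow> f \<cdot> idt C X = f"
  and comp_id_left [simp]: "\<lbrakk>f \<in> Ar C; Cod C f = X\<rbrakk> \<Longrightarrow> idt C X \<cdot> f = f"
  using comp_idt idt_comp by auto

lemma assoc [simp]:
  "\<lbrakk>h \<in> Ar C; g \<in> Ar C; f \<in> Ar C; Dom C h = Cod C g; Dom C g = Cod C f\<rbrakk> \<Longrightarrow>
    (h \<cdot> g) \<cdot> f = h \<cdot> (g \<cdot> f)"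
  by (rule comp_assoc) auto

text \<open>The simplifier nests composites to the right, where an equation about \<open>g \<cdot> f\<close> matches only in this form.\<close>

lemma reassoc:
  "\<lbrakk>g \<cdot> f = k; g \<in> Ar C; f \<in> Ar C; x \<in> Ar C; Dom C g = Cod C f; Dom C f = Cod C x\<rbrakk> \<Longrightarrow>
    g \<cdot> (f \<cdot> x) = k \<cdot> x"
  by (metis assoc)

lemma is_isoI:
  "\<lbrakk>f \<in> hom C X Y; g \<in> hom C Y X; g \<cdot> f = idt C X; f \<cdot> g = idt C Y\<rbrakk> \<Longrightarrow> is_iso C f"
  unfolding is_iso_def by auto

lemma is_isoE:
  assumes "is_iso C f" "f \<in> hom C X Y"
  obtains g where "g \<in> hom C Y X" "g \<cdot> f = idt C X" "f \<cdot> g = idt C Y" "is_iso C g"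
  using assms unfolding is_iso_def by fastforce

lemma iso_idt [simp]: "X \<in> Ob C \<Longrightarrow> is_iso C (idt C X)"
  by (rule is_isoI[where g = "idt C X"]) auto

lemma iso_comp:
  assumes "is_iso C g" "is_iso C f" "Dom C g = Cod C f"
  shows "is_iso C (g \<cdot> f)"
proof -
  have ar: "f \<in> Ar C" "g \<in> Ar C" using assms unfolding is_iso_def by auto
  obtain f' where f': "f' \<in> hom C (Cod C f) (Dom C f)" "f' \<cdot> f = idt C (Dom C f)"
      "f \<cdot> f' = idt C (Cod C f)"
    using assms(2) unfolding is_iso_def by auto
  obtain g' where g': "g' \<in> hom C (Cod C g) (Dom C g)" "g' \<cdot> g = idt C (Dom C g)"
      "g \<cdot> g' = idt C (Cod C g)"
    using assms(1) unfolding is_iso_def by auto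
  show ?thesis
  proof (rule is_isoI)
    show "g \<cdot> f \<in> hom C (Dom C f) (Cod C g)" "f' \<cdot> g' \<in> hom C (Cod C g) (Dom C f)"
      using ar f' g' assms(3) by auto
    show "(f' \<cdot> g') \<cdot> g \<cdot> f = idt C (Dom C f)"
      using ar f' g' assms(3) reassoc[OF g'(2)] by simp
    show "(g \<cdot> f) \<cdot> f' \<cdot> g' = idt C (Cod C g)"
      using ar f' g' assms(3) reassoc[OF f'(3)] by simp
  qed
qed

lemma iso_cancel_left:
  assumes "is_iso C i" "u \<in> Ar C" "v \<in> Ar C" "Cod C u = Dom C i" "Cod C v = Dom C i" "i \<cdot> u = i \<cdot> v"
  shows "u = v"
proof -
  have i: "i \<in> Ar C" using assms(1) by (simp add: is_iso_def)
  then obtain j where j: "j \<in> hom C (Cod C i) (Dom C i)" "j \<cdot> i = idt C (Dom C i)"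
    using assms(1) is_isoE[of i "Dom C i" "Cod C i"] by auto
  have "u = j \<cdot> i \<cdot> u" "v = j \<cdot> i \<cdot> v"
    using reassoc[OF j(2)] assms(2-5) j i by simp_all
  then show ?thesis using assms(6) by simp
qed

lemma split_epi_cancel:
  assumes "q \<cdot> s = idt C (Cod C q)" "q \<in> Ar C" "s \<in> Ar C" "Dom C q = Cod C s" "u \<in> Ar C" "v \<in> Ar C"
    "Dom C u = Cod C q" "Dom C v = Cod C q" "u \<cdot> q = v \<cdot> q"
  shows "u = v"
proof -
  have "(u \<cdot> q) \<cdot> s = (v \<cdot> q) \<cdot> s" using assms(9) by simp
  then show ?thesis using assms(1-8) by simp
qed

lemma iso_cancel_right:
  assumes "is_iso C i" "u \<in> Ar C" "v \<in> Ar C" "Dom C u = Cod C i" "Dom C v = Cod C i" "u \<cdot> i = v \<cdot> i"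
  shows "u = v"
proof -
  have i: "i \<in> Ar C" using assms(1) by (simp add: is_iso_def)
  then obtain j where j: "j \<in> hom C (Cod C i) (Dom C i)" "i \<cdot> j = idt C (Cod C i)"
    using assms(1) is_isoE[of i "Dom C i" "Cod C i"] by auto
  then show ?thesis using split_epi_cancel[of i j u v] assms i by auto
qed

end

lemma id_functor_simps [simp]: "fob id_functor X = X" "far id_functor f = f"
  by (simp_all add: id_functor_def)

lemma comp_functor_simps [simp]:
  "fob (G \<circ>\<^sub>F F) X = fob G (fob F X)" "far (G \<circ>\<^sub>F F) f = far G (far F f)"
  by (simp_all add: comp_functor_def)

context cat_functor
begin

lemma fob_Ob [simp]: "X \<in> Ob A \<Longrightarrow> fob F X \<in> Ob B"
  by (rule fob_in)

lemma far_Ar [simp]: "f \<in> Ar A \<Longrightarrow> far F f \<in> Ar B"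
  and Dom_far [simp]: "f \<in> Ar A \<Longrightarrow> Dom B (far F f) = fob F (Dom A f)"
  and Cod_far [simp]: "f \<in> Ar A \<Longrightarrow> Cod B (far F f) = fob F (Cod A f)"
  using far_in[of f "Dom A f" "Cod A f"] by simp_all

lemma far_idt' [simp]: "X \<in> Ob A \<Longrightarrow> far F (idt A X) = idt B (fob F X)"
  by (rule far_idt)

lemma far_cmp [simp]:
  "\<lbrakk>g \<in> Ar A; f \<in> Ar A; Dom A g = Cod A f\<rbrakk> \<Longrightarrow> far F (g \<cdot>\<^bsub>A\<^esub> f) = far F g \<cdot>\<^bsub>B\<^esub> far F f"
  by (rule far_comp) auto

lemma far_iso: "is_iso A f \<Longrightarrow> is_iso B (far F f)"
  unfolding is_iso_def by (metis Cod_far Dom_far far_Ar far_cmp far_idt' mem_hom A.Dom_ob A.Cod_ob)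

end

lemma cat_functorI:
  assumes "category A" "category B" "\<And>X. X \<in> Ob A \<Longrightarrow> fob F X \<in> Ob B"
    "\<And>f. f \<in> Ar A \<Longrightarrow> far F f \<in> hom B (fob F (Dom A f)) (fob F (Cod A f))"
    "\<And>X. X \<in> Ob A \<Longrightarrow> far F (idt A X) = idt B (fob F X)"
    "\<And>f g. \<lbrakk>f \<in> Ar A; g \<in> Ar A; Dom A g = Cod A f\<rbrakk> \<Longrightarrow> far F (g \<cdot>\<^bsub>A\<^esub> f) = far F g \<cdot>\<^bsub>B\<^esub> far F f"
  shows "cat_functor A B F"
  using assms unfolding cat_functor_def cat_functor_axioms_def by fastforce

lemma id_functor: "category A \<Longrightarrow> cat_functor A A id_functor"
  by (rule cat_functorI) auto

lemma comp_functor: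
  assumes "cat_functor A B F" "cat_functor B C G"
  shows "cat_functor A C (G \<circ>\<^sub>F F)"
proof -
  interpret F: cat_functor A B F by fact
  interpret G: cat_functor B C G by fact
  show ?thesis by (rule cat_functorI) (auto intro: F.A.category_axioms G.B.category_axioms)
qed

lemma nat_transI:
  assumes "cat_functor A B F" "cat_functor A B G" "\<And>X. X \<in> Ob A \<Longrightarrow> \<alpha> X \<in> hom B (fob F X) (fob G X)"
    "\<And>f. f \<in> Ar A \<Longrightarrow> \<alpha> (Cod A f) \<cdot>\<^bsub>B\<^esub> far F f = far G f \<cdot>\<^bsub>B\<^esub> \<alpha> (Dom A f)"
  shows "nat_trans A B F G \<alpha>"
  using assms unfolding nat_trans_def nat_trans_axioms_def by auto

context nat_trans
begin

lemma component_Ar [simp]: "X \<in> Ob A \<Longrightarrow> \<alpha> X \<in> Ar B"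
  and Dom_component [simp]: "X \<in> Ob A \<Longrightarrow> Dom B (\<alpha> X) = fob F X"
  and Cod_component [simp]: "X \<in> Ob A \<Longrightarrow> Cod B (\<alpha> X) = fob G X"
  using component_in by auto

lemma naturality': "f \<in> Ar A \<Longrightarrow> \<alpha> (Cod A f) \<cdot>\<^bsub>B\<^esub> far F f = far G f \<cdot>\<^bsub>B\<^esub> \<alpha> (Dom A f)"
  by (rule naturality) auto

end

lemma naturally_isomorphicI:
  assumes "cat_functor A B F" "cat_functor A B G" "\<And>X. X \<in> Ob A \<Longrightarrow> \<alpha> X \<in> hom B (fob F X) (fob G X)"
    "\<And>f. f \<in> Ar A \<Longrightarrow> \<alpha> (Cod A f) \<cdot>\<^bsub>B\<^esub> far F f = far G f \<cdot>\<^bsub>B\<^esub> \<alpha> (Dom A f)"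
    "\<And>X. X \<in> Ob A \<Longrightarrow> is_iso B (\<alpha> X)"
  shows "naturally_isomorphic A B F G"
  unfolding naturally_isomorphic_def using nat_transI[OF assms(1-4)] assms(5) by blast

lemma naturally_isomorphic_sym:
  assumes "naturally_isomorphic A B F G"
  shows "naturally_isomorphic A B G F"
proof -
  obtain \<alpha> where a: "nat_trans A B F G \<alpha>" and iso: "\<And>X. X \<in> Ob A \<Longrightarrow> is_iso B (\<alpha> X)"
    using assms unfolding naturally_isomorphic_def by auto
  interpret nat_trans A B F G \<alpha> by fact
  have "\<forall>X. \<exists>b. X \<in> Ob A \<longrightarrow> b \<in> hom B (fob G X) (fob F X) \<and> b \<cdot>\<^bsub>B\<^esub> \<alpha> X = idt B (fob F X) \<and>
      \<alpha> X \<cdot>\<^bsub>B\<^esub> b = idt B (fob G X) \<and> is_iso B b"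
    using iso component_in F.B.is_isoE by metis
  then obtain \<beta> where b: "\<And>X. X \<in> Ob A \<Longrightarrow> \<beta> X \<in> hom B (fob G X) (fob F X) \<and>
      \<beta> X \<cdot>\<^bsub>B\<^esub> \<alpha> X = idt B (fob F X) \<and> \<alpha> X \<cdot>\<^bsub>B\<^esub> \<beta> X = idt B (fob G X) \<and> is_iso B (\<beta> X)"
    by metis
  show ?thesis
  proof (rule naturally_isomorphicI)
    fix f assume f: "f \<in> Ar A"
    show "\<beta> (Cod A f) \<cdot>\<^bsub>B\<^esub> far G f = far F f \<cdot>\<^bsub>B\<^esub> \<beta> (Dom A f)"
    proof (rule F.B.iso_cancel_left[OF iso])
      show "\<alpha> (Cod A f) \<cdot>\<^bsub>B\<^esub> \<beta> (Cod A f) \<cdot>\<^bsub>B\<^esub> far G f = \<alpha> (Cod A f) \<cdot>\<^bsub>B\<^esub> far F f \<cdot>\<^bsub>B\<^esub> \<beta> (Dom A f)"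
        using f b[of "Cod A f"] b[of "Dom A f"] F.B.reassoc[OF naturality'[OF f], of "\<beta> (Dom A f)"]
          F.B.reassoc[of "\<alpha> (Cod A f)" "\<beta> (Cod A f)" _ "far G f"] by simp
    qed (use f b in auto)
  qed (use b F.cat_functor_axioms G.cat_functor_axioms in auto)
qed

section \<open>Equivalences\<close>

text \<open>Unique existence lets preimages of maps be named by \<open>THE\<close>, which is how the
  quasi-inverse and its unit are defined below.\<close>

locale ff_functor = cat_functor A B F for A :: "('o, 'a) cat" and B :: "('p, 'b) cat" and F +
  assumes ff: "\<lbrakk>X \<in> Ob A; Y \<in> Ob A; h \<in> hom B (fob F X) (fob F Y)\<rbrakk> \<Longrightarrow>
    \<exists>!f. f \<in> hom A X Y \<and> far F f = h"
begin

lemma faithful: "\<lbrakk>f \<in> Ar A; g \<in> Ar A; Dom A f = Dom A g; Cod A f = Cod A g; far F f = far F g\<rbrakk> \<Longrightarrow> f = g"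
  using ff[of "Dom A f" "Cod A f" "far F f"] by fastforce

lemma full:
  assumes "X \<in> Ob A" "Y \<in> Ob A" "h \<in> hom B (fob F X) (fob F Y)"
  obtains f where "f \<in> hom A X Y" "far F f = h"
  using ff[OF assms] by blast

lemma reflects_iso:
  assumes "f \<in> Ar A" "is_iso B (far F f)"
  shows "is_iso A f"
proof -
  obtain g where g: "g \<in> hom B (fob F (Cod A f)) (fob F (Dom A f))"
    "g \<cdot>\<^bsub>B\<^esub> far F f = idt B (fob F (Dom A f))" "far F f \<cdot>\<^bsub>B\<^esub> g = idt B (fob F (Cod A f))"
    using assms B.is_isoE[of "far F f" "fob F (Dom A f)" "fob F (Cod A f)"] by auto
  obtain k where k: "k \<in> hom A (Cod A f) (Dom A f)" "far F k = g"
    using full[of "Cod A f" "Dom A f" g] g assms by auto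
  show ?thesis
  proof (rule A.is_isoI)
    show "f \<in> hom A (Dom A f) (Cod A f)" "k \<in> hom A (Cod A f) (Dom A f)" using assms k by auto
    show "k \<cdot>\<^bsub>A\<^esub> f = idt A (Dom A f)" by (rule faithful) (use assms k g in auto)
    show "f \<cdot>\<^bsub>A\<^esub> k = idt A (Cod A f)" by (rule faithful) (use assms k g in auto)
  qed
qed

end

locale ff_eso_functor = ff_functor A B F for A :: "('o, 'a) cat" and B :: "('p, 'b) cat" and F +
  assumes ess_surj: "Y \<in> Ob B \<Longrightarrow> \<exists>X \<in> Ob A. \<exists>i \<in> hom B Y (fob F X). is_iso B i"
begin

lemma eso:
  assumes "Y \<in> Ob B"
  obtains X i j where "X \<in> Ob A" "i \<in> hom B Y (fob F X)" "j \<in> hom B (fob F X) Y"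
    "j \<cdot>\<^bsub>B\<^esub> i = idt B Y" "i \<cdot>\<^bsub>B\<^esub> j = idt B (fob F X)" "is_iso B i" "is_iso B j"
  using ess_surj[OF assms] B.is_isoE by metis

text \<open>Choosing for each object an isomorphic one in the image, maps are transported along the
  chosen isomorphisms and pulled back by \<open>ff\<close>. Every law of the quasi-inverse then
  holds because it holds after applying \<open>F\<close>, where neighbouring \<open>j\<close> and
  \<open>i\<close> cancel.\<close>

lemma is_equivalence: "equivalence_functor A B F"
proof -
  have "\<forall>Y. \<exists>X i j. Y \<in> Ob B \<longrightarrow> X \<in> Ob A \<and> i \<in> hom B Y (fob F X) \<and> j \<in> hom B (fob F X) Y \<and>
    j \<cdot>\<^bsub>B\<^esub> i = idt B Y \<and> i \<cdot>\<^bsub>B\<^esub> j = idt B (fob F X) \<and> is_iso B i \<and> is_iso B j"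
    using eso by metis
  then obtain gob i j where "\<forall>Y. Y \<in> Ob B \<longrightarrow> gob Y \<in> Ob A \<and>
      i Y \<in> hom B Y (fob F (gob Y)) \<and> j Y \<in> hom B (fob F (gob Y)) Y \<and> j Y \<cdot>\<^bsub>B\<^esub> i Y = idt B Y \<and>
      i Y \<cdot>\<^bsub>B\<^esub> j Y = idt B (fob F (gob Y)) \<and> is_iso B (i Y) \<and> is_iso B (j Y)"
    by metis
  then have g [simp]: "\<And>Y. Y \<in> Ob B \<Longrightarrow> gob Y \<in> Ob A"
      "\<And>Y. Y \<in> Ob B \<Longrightarrow> i Y \<in> Ar B" "\<And>Y. Y \<in> Ob B \<Longrightarrow> Dom B (i Y) = Y"
      "\<And>Y. Y \<in> Ob B \<Longrightarrow> Cod B (i Y) = fob F (gob Y)"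
      "\<And>Y. Y \<in> Ob B \<Longrightarrow> j Y \<in> Ar B" "\<And>Y. Y \<in> Ob B \<Longrightarrow> Cod B (j Y) = Y"
      "\<And>Y. Y \<in> Ob B \<Longrightarrow> Dom B (j Y) = fob F (gob Y)"
      "\<And>Y. Y \<in> Ob B \<Longrightarrow> j Y \<cdot>\<^bsub>B\<^esub> i Y = idt B Y"
      "\<And>Y. Y \<in> Ob B \<Longrightarrow> i Y \<cdot>\<^bsub>B\<^esub> j Y = idt B (fob F (gob Y))"
      "\<And>Y. Y \<in> Ob B \<Longrightarrow> is_iso B (i Y)" "\<And>Y. Y \<in> Ob B \<Longrightarrow> is_iso B (j Y)"
    by auto
  have ji: "j Y \<cdot>\<^bsub>B\<^esub> i Y \<cdot>\<^bsub>B\<^esub> x = x" if "Y \<in> Ob B" "x \<in> Ar B" "Cod B x = Y" for x Y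
    using B.reassoc[of "j Y" "i Y" _ x] that by simp
  define gar where "gar h = (THE f. f \<in> hom A (gob (Dom B h)) (gob (Cod B h)) \<and>
    far F f = i (Cod B h) \<cdot>\<^bsub>B\<^esub> h \<cdot>\<^bsub>B\<^esub> j (Dom B h))" for h
  have gar: "gar h \<in> hom A (gob (Dom B h)) (gob (Cod B h)) \<and>
    far F (gar h) = i (Cod B h) \<cdot>\<^bsub>B\<^esub> h \<cdot>\<^bsub>B\<^esub> j (Dom B h)" if "h \<in> Ar B" for h
    unfolding gar_def by (rule theI') (rule ff, use that in auto)
  then have gar' [simp]: "gar h \<in> Ar A" "Dom A (gar h) = gob (Dom B h)" "Cod A (gar h) = gob (Cod B h)"
    "far F (gar h) = i (Cod B h) \<cdot>\<^bsub>B\<^esub> h \<cdot>\<^bsub>B\<^esub> j (Dom B h)" if "h \<in> Ar B" for h using that by auto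
  define G where "G = \<lparr>fob = gob, far = gar\<rparr>"
  have [simp]: "fob G = gob" "far G = gar" by (simp_all add: G_def)
  have G: "cat_functor B A G"
  proof (rule cat_functorI)
    fix X assume "X \<in> Ob B"
    then show "far G (idt B X) = idt A (fob G X)" by (intro faithful) auto
  next
    fix f g assume "f \<in> Ar B" "g \<in> Ar B" "Dom B g = Cod B f"
    then show "far G (g \<cdot>\<^bsub>B\<^esub> f) = far G g \<cdot>\<^bsub>A\<^esub> far G f" by (intro faithful) (auto simp: ji)
  qed (auto intro: A.category_axioms B.category_axioms)
  define u where "u X = (THE f. f \<in> hom A X (gob (fob F X)) \<and> far F f = i (fob F X))" for X
  have u: "u X \<in> hom A X (gob (fob F X)) \<and> far F (u X) = i (fob F X)" if "X \<in> Ob A" for X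
    unfolding u_def by (rule theI') (rule ff, use that in auto)
  have "naturally_isomorphic A A id_functor (G \<circ>\<^sub>F F)"
  proof (rule naturally_isomorphicI)
    fix f assume "f \<in> Ar A"
    then show "u (Cod A f) \<cdot>\<^bsub>A\<^esub> far id_functor f = far (G \<circ>\<^sub>F F) f \<cdot>\<^bsub>A\<^esub> u (Dom A f)"
      using u by (intro faithful) (auto simp: ji)
  next
    fix X assume "X \<in> Ob A"
    then show "is_iso A (u X)" using u[of X] by (intro reflects_iso) auto
  qed (use u in \<open>auto intro!: id_functor comp_functor[OF _ G] A.category_axioms cat_functor_axioms\<close>)
  moreover have "naturally_isomorphic B B (F \<circ>\<^sub>F G) id_functor"
    by (rule naturally_isomorphicI[where \<alpha> = j])
      (auto simp: ji intro!: id_functor comp_functor[OF G] B.category_axioms cat_functor_axioms)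
  ultimately show ?thesis
    unfolding equivalence_functor_def using G cat_functor_axioms by blast
qed

end

text \<open>Naturality makes \<open>f\<close> the conjugate of \<open>far G (far F f)\<close> by two
  isomorphisms, so \<open>far F f\<close> determines it.\<close>

lemma naturally_isomorphic_faithful:
  assumes "naturally_isomorphic A A id_functor (G \<circ>\<^sub>F F)" "f \<in> Ar A" "g \<in> Ar A" "Dom A f = Dom A g"
    "Cod A f = Cod A g" "far F f = far F g"
  shows "f = g"
proof -
  obtain \<alpha> where a: "nat_trans A A id_functor (G \<circ>\<^sub>F F) \<alpha>" "\<And>X. X \<in> Ob A \<Longrightarrow> is_iso A (\<alpha> X)"
    using assms unfolding naturally_isomorphic_def by blast
  interpret a: nat_trans A A id_functor "G \<circ>\<^sub>F F" \<alpha> by fact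
  show ?thesis
    using a.naturality'[OF assms(2)] a.naturality'[OF assms(3)] assms a(2)
    by (intro a.F.A.iso_cancel_left[of "\<alpha> (Cod A f)" f g]) auto
qed

lemma equivalence_ff_eso:
  assumes "equivalence_functor A B F"
  shows "ff_eso_functor A B F"
proof -
  obtain G where F: "cat_functor A B F" and G: "cat_functor B A G"
    and a: "naturally_isomorphic A A id_functor (G \<circ>\<^sub>F F)"
    and b: "naturally_isomorphic B B (F \<circ>\<^sub>F G) id_functor"
    using assms unfolding equivalence_functor_def by blast
  interpret F: cat_functor A B F by fact
  interpret G: cat_functor B A G by fact
  obtain \<alpha> where al: "nat_trans A A id_functor (G \<circ>\<^sub>F F) \<alpha>" "\<And>X. X \<in> Ob A \<Longrightarrow> is_iso A (\<alpha> X)"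
    using a unfolding naturally_isomorphic_def by blast
  interpret a: nat_trans A A id_functor "G \<circ>\<^sub>F F" \<alpha> by fact
  note b' = naturally_isomorphic_sym[OF b]
  obtain \<beta> where be: "nat_trans B B id_functor (F \<circ>\<^sub>F G) \<beta>" "\<And>X. X \<in> Ob B \<Longrightarrow> is_iso B (\<beta> X)"
    using b' unfolding naturally_isomorphic_def by blast
  interpret b: nat_trans B B id_functor "F \<circ>\<^sub>F G" \<beta> by fact
  show ?thesis
  proof
    fix Y assume "Y \<in> Ob B"
    then show "\<exists>X \<in> Ob A. \<exists>i \<in> hom B Y (fob F X). is_iso B i"
      using be(2)[of Y] b.component_in[of Y] by (intro bexI[of _ "fob G Y"] bexI[of _ "\<beta> Y"]) auto
  next
    fix X Y h assume X: "X \<in> Ob A" and Y: "Y \<in> Ob A" and h: "h \<in> hom B (fob F X) (fob F Y)"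
    obtain j where j: "j \<in> hom A (fob G (fob F Y)) Y" "\<alpha> Y \<cdot>\<^bsub>A\<^esub> j = idt A (fob G (fob F Y))"
      using F.A.is_isoE[OF al(2)[OF Y], of Y "fob G (fob F Y)"] Y by auto
    \<comment> \<open>Conjugating \<open>far G h\<close> by the isomorphism gives a candidate with
      \<open>far G (far F f) = far G h\<close>; that \<open>far F f\<close> itself is
      \<open>h\<close> then needs faithfulness of \<open>G\<close>, supplied by the other
      isomorphism \<open>b'\<close>.\<close>
    define f where "f = j \<cdot>\<^bsub>A\<^esub> far G h \<cdot>\<^bsub>A\<^esub> \<alpha> X"
    have f: "f \<in> hom A X Y" unfolding f_def using j h X Y by auto
    have "far G (far F f) \<cdot>\<^bsub>A\<^esub> \<alpha> X = \<alpha> Y \<cdot>\<^bsub>A\<^esub> f"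
      using a.naturality'[of f] f by simp
    also have "\<dots> = far G h \<cdot>\<^bsub>A\<^esub> \<alpha> X"
      unfolding f_def using X Y h j F.A.reassoc[OF j(2), of "far G h \<cdot>\<^bsub>A\<^esub> \<alpha> X"] by simp
    finally have "far G (far F f) = far G h"
      using F.A.iso_cancel_right[OF al(2)[OF X]] f h X by auto
    then have "far F f = h"
      using naturally_isomorphic_faithful[OF b', of "far F f" h] f h by auto
    then show "\<exists>!f. f \<in> hom A X Y \<and> far F f = h"
      using f naturally_isomorphic_faithful[OF a] by (intro ex1I[of _ f]) auto
  qed
qed

section \<open>Universal arrows and adjunctions\<close>

text \<open>An initial object of the comma category of \<open>X\<close> over \<open>R\<close>. Left
  adjoints are handled one object at a time in this form, because it survives a change of either
  category along an equivalence.\<close>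

definition universal_arrow ::
  "('o, 'a) cat \<Rightarrow> ('p, 'b) cat \<Rightarrow> ('p, 'b, 'o, 'a) func \<Rightarrow> 'o \<Rightarrow> 'p \<Rightarrow> 'a \<Rightarrow> bool" where
  "universal_arrow A B R X P e \<longleftrightarrow> P \<in> Ob B \<and> e \<in> hom A X (fob R P) \<and>
    (\<forall>Z \<in> Ob B. \<forall>f \<in> hom A X (fob R Z). \<exists>!h. h \<in> hom B P Z \<and> far R h \<cdot>\<^bsub>A\<^esub> e = f)"

lemma universal_arrowE:
  assumes "universal_arrow A B R X P e" "Z \<in> Ob B" "f \<in> hom A X (fob R Z)"
  obtains h where "h \<in> hom B P Z" "far R h \<cdot>\<^bsub>A\<^esub> e = f"
  using assms unfolding universal_arrow_def by blast

lemma universal_arrow_unique: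
  assumes "universal_arrow A B R X P e" "cat_functor B A R" "h \<in> Ar B" "h' \<in> Ar B" "Dom B h = P"
    "Dom B h' = P" "Cod B h = Cod B h'" "far R h \<cdot>\<^bsub>A\<^esub> e = far R h' \<cdot>\<^bsub>A\<^esub> e"
  shows "h = h'"
proof -
  interpret R: cat_functor B A R by fact
  have e: "P \<in> Ob B" "e \<in> hom A X (fob R P)" using assms(1) unfolding universal_arrow_def by auto
  have "\<exists>!k. k \<in> hom B P (Cod B h) \<and> far R k \<cdot>\<^bsub>A\<^esub> e = far R h \<cdot>\<^bsub>A\<^esub> e"
    using assms(1) e assms(3-6) unfolding universal_arrow_def by auto
  then show ?thesis using assms by auto
qed

lemma universal_arrow_iso:
  assumes R: "cat_functor B A R" and u: "universal_arrow A B R X P e" "universal_arrow A B R X P' e'"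
  obtains k where "k \<in> hom B P P'" "is_iso B k" "far R k \<cdot>\<^bsub>A\<^esub> e = e'"
proof -
  interpret R: cat_functor B A R by fact
  have e: "P \<in> Ob B" "e \<in> Ar A" "Dom A e = X" "Cod A e = fob R P"
    "P' \<in> Ob B" "e' \<in> Ar A" "Dom A e' = X" "Cod A e' = fob R P'"
    using u unfolding universal_arrow_def by auto
  obtain k where k: "k \<in> hom B P P'" "far R k \<cdot>\<^bsub>A\<^esub> e = e'"
    using universal_arrowE[OF u(1), of P' e'] e by auto
  obtain l where l: "l \<in> hom B P' P" "far R l \<cdot>\<^bsub>A\<^esub> e' = e"
    using universal_arrowE[OF u(2), of P e] e by auto
  have "is_iso B k"
  proof (rule R.A.is_isoI[OF k(1) l(1)])
    show "l \<cdot>\<^bsub>B\<^esub> k = idt B P"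
      by (rule universal_arrow_unique[OF u(1) R]) (use k l e in auto)
    show "k \<cdot>\<^bsub>B\<^esub> l = idt B P'"
      by (rule universal_arrow_unique[OF u(2) R]) (use k l e in auto)
  qed
  then show ?thesis using that k by blast
qed

context adjunction
begin

abbreviation compA (infixr \<open>\<bullet>\<close> 70) where
  "g \<bullet> f \<equiv> g \<cdot>\<^bsub>A\<^esub> f"

abbreviation compB (infixr \<open>\<star>\<close> 70) where
  "g \<star> f \<equiv> g \<cdot>\<^bsub>B\<^esub> f"

lemma unit_Ar [simp]: "X \<in> Ob A \<Longrightarrow> \<eta> X \<in> Ar A" "X \<in> Ob A \<Longrightarrow> Dom A (\<eta> X) = X"
  "X \<in> Ob A \<Longrightarrow> Cod A (\<eta> X) = fob R (fob L X)"
  using unit.component_in[of X] by auto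

lemma counit_Ar [simp]: "Y \<in> Ob B \<Longrightarrow> \<epsilon> Y \<in> Ar B" "Y \<in> Ob B \<Longrightarrow> Cod B (\<epsilon> Y) = Y"
  "Y \<in> Ob B \<Longrightarrow> Dom B (\<epsilon> Y) = fob L (fob R Y)"
  using counit.component_in[of Y] by auto

lemma unit_nat: "f \<in> Ar A \<Longrightarrow> far R (far L f) \<bullet> \<eta> (Dom A f) = \<eta> (Cod A f) \<bullet> f"
  using unit.naturality'[of f] by simp

lemma counit_nat: "g \<in> Ar B \<Longrightarrow> \<epsilon> (Cod B g) \<star> far L (far R g) = g \<star> \<epsilon> (Dom B g)"
  using counit.naturality'[of g] by simp

lemma transpose_right:
  assumes "f \<in> Ar A" "Cod A f = fob R Y" "Y \<in> Ob B"
  shows "far R (\<epsilon> Y) \<bullet> far R (far L f) \<bullet> \<eta> (Dom A f) = f"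
  using assms unit_nat[of f] triangle_right[of Y] L.A.reassoc[OF triangle_right, of Y f] by simp

lemma transpose_left:
  assumes "g \<in> Ar B" "Dom B g = fob L X" "X \<in> Ob A"
  shows "\<epsilon> (Cod B g) \<star> far L (far R g) \<star> far L (\<eta> X) = g"
  using assms L.B.reassoc[OF counit_nat, of g "far L (\<eta> X)"] triangle_left[of X] by simp

lemma transpose_right':
  "\<lbrakk>f \<in> Ar A; Cod A f = fob R Y; Y \<in> Ob B\<rbrakk> \<Longrightarrow> far R (\<epsilon> Y \<star> far L f) \<bullet> \<eta> (Dom A f) = f"
  using transpose_right[of f Y] by simp

text \<open>Applying \<open>L\<close> to the square and naturality of the counit at
  \<open>g\<close>. This is the commutativity of the square that the Frobenius condition asks to be
  a pullback.\<close>

lemma transpose_square: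
  assumes "g \<in> Ar B" "f \<in> Ar A" "Cod A f = fob R (Cod B g)" "p \<in> Ar A" "Cod A p = Dom A f"
    "q \<in> Ar A" "Dom A q = Dom A p" "Cod A q = fob R (Dom B g)" "f \<bullet> p = far R g \<bullet> q"
  shows "(\<epsilon> (Cod B g) \<star> far L f) \<star> far L p = g \<star> \<epsilon> (Dom B g) \<star> far L q"
proof -
  have "far L f \<star> far L p = far L (far R g) \<star> far L q"
    using arg_cong[OF assms(9), of "far L"] assms(1-8) by simp
  then show ?thesis
    using L.B.reassoc[OF counit_nat, of g "far L q"] assms(1-8) by simp
qed

lemma universal_unit:
  assumes X: "X \<in> Ob A"
  shows "universal_arrow A B R X (fob L X) (\<eta> X)"
  unfolding universal_arrow_def
proof (intro conjI ballI)
  show "fob L X \<in> Ob B" "\<eta> X \<in> hom A X (fob R (fob L X))" using X by auto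
  fix Z f assume Z: "Z \<in> Ob B" and f: "f \<in> hom A X (fob R Z)"
  show "\<exists>!h. h \<in> hom B (fob L X) Z \<and> far R h \<bullet> \<eta> X = f"
  proof (rule ex1I[of _ "\<epsilon> Z \<star> far L f"])
    show "\<epsilon> Z \<star> far L f \<in> hom B (fob L X) Z \<and> far R (\<epsilon> Z \<star> far L f) \<bullet> \<eta> X = f"
      using X Z f transpose_right[of f Z] by auto
    fix h assume h: "h \<in> hom B (fob L X) Z \<and> far R h \<bullet> \<eta> X = f"
    then have "far L f = far L (far R h) \<star> far L (\<eta> X)"
      using X by (metis L.far_cmp R.far_Ar R.Dom_far mem_hom unit_Ar)
    then show "h = \<epsilon> Z \<star> far L f" using transpose_left[of h X] h X by auto
  qed
qed

end

text \<open>Uniqueness in the universal property leaves one possible value of \<open>L\<close> on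
  maps and of the counit, namely the factorizations of \<open>e (Cod A f) \<cdot> f\<close> and of
  the identity of \<open>fob R Y\<close>. Functoriality, naturality of the counit and the left
  triangle law are further instances of uniqueness.\<close>

lemma adjunction_from_universal_arrows:
  fixes A :: "('o, 'a) cat" (structure)
  assumes R: "cat_functor B A R" and u: "\<And>X. X \<in> Ob A \<Longrightarrow> \<exists>P e. universal_arrow A B R X P e"
  shows "\<exists>L \<eta> \<epsilon>. adjunction A B L R \<eta> \<epsilon>"
proof -
  interpret R: cat_functor B A R by fact
  obtain P e where u: "\<And>X. X \<in> Ob A \<Longrightarrow> universal_arrow A B R X (P X) (e X)"
    using u by metis
  have [simp]: "P X \<in> Ob B" "e X \<in> Ar A" "Dom A (e X) = X" "Cod A (e X) = fob R (P X)" if "X \<in> Ob A" for X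
    using u[OF that] unfolding universal_arrow_def by auto
  define lar where "lar f = (THE h. h \<in> hom B (P (Dom A f)) (P (Cod A f)) \<and>
    far R h \<cdot> e (Dom A f) = e (Cod A f) \<cdot> f)" for f
  have lar: "lar f \<in> hom B (P (Dom A f)) (P (Cod A f)) \<and> far R (lar f) \<cdot> e (Dom A f) = e (Cod A f) \<cdot> f"
    if "f \<in> Ar A" for f
    unfolding lar_def by (rule theI') (use u[of "Dom A f"] that in \<open>auto simp: universal_arrow_def\<close>)
  have [simp]: "lar f \<in> Ar B" "Dom B (lar f) = P (Dom A f)" "Cod B (lar f) = P (Cod A f)"
    and lar_e: "far R (lar f) \<cdot> e (Dom A f) = e (Cod A f) \<cdot> f"
    if "f \<in> Ar A" for f using lar that by auto
  define \<epsilon> where "\<epsilon> Y = (THE h. h \<in> hom B (P (fob R Y)) Y \<and> far R h \<cdot> e (fob R Y) = idt A (fob R Y))" for Y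
  have "\<epsilon> Y \<in> hom B (P (fob R Y)) Y \<and> far R (\<epsilon> Y) \<cdot> e (fob R Y) = idt A (fob R Y)" if "Y \<in> Ob B" for Y
    unfolding \<epsilon>_def by (rule theI') (use u[of "fob R Y"] that in \<open>auto simp: universal_arrow_def\<close>)
  then have [simp]: "\<epsilon> Y \<in> Ar B" "Dom B (\<epsilon> Y) = P (fob R Y)" "Cod B (\<epsilon> Y) = Y"
      "far R (\<epsilon> Y) \<cdot> e (fob R Y) = idt A (fob R Y)" if "Y \<in> Ob B" for Y using that by auto
  define L where "L = \<lparr>fob = P, far = lar\<rparr>"
  have [simp]: "fob L = P" "far L = lar" by (simp_all add: L_def)
  note uu = universal_arrow_unique[OF u R]
  have L: "cat_functor A B L"
  proof (rule cat_functorI)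
    fix X assume "X \<in> Ob A"
    then show "far L (idt A X) = idt B (fob L X)" using lar_e[of "idt A X"] by (intro uu) auto
  next
    fix f g assume fg: "f \<in> Ar A" "g \<in> Ar A" "Dom A g = Cod A f"
    then have "far R (lar g) \<cdot> e (Cod A f) = e (Cod A g) \<cdot> g" using lar_e[of g] by simp
    with fg show "far L (g \<cdot> f) = far L g \<cdot>\<^bsub>B\<^esub> far L f"
      using lar_e[of f] lar_e[of "g \<cdot> f"] R.B.reassoc[of "far R (lar g)" "e (Cod A f)" _ f]
      by (intro uu) auto
  qed (auto intro: R.A.category_axioms R.B.category_axioms)
  note fs = L R R.A.category_axioms R.B.category_axioms
  have "nat_trans A A id_functor (R \<circ>\<^sub>F L) e"
    by (rule nat_transI) (auto simp: lar_e intro!: id_functor comp_functor fs)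
  moreover have "nat_trans B B (L \<circ>\<^sub>F R) id_functor \<epsilon>"
  proof (rule nat_transI)
    fix f assume f: "f \<in> Ar B"
    show "\<epsilon> (Cod B f) \<cdot>\<^bsub>B\<^esub> far (L \<circ>\<^sub>F R) f = far id_functor f \<cdot>\<^bsub>B\<^esub> \<epsilon> (Dom B f)"
      by (rule uu[of "fob R (Dom B f)"])
        (use f lar_e[of "far R f"] R.B.reassoc[of "far R (\<epsilon> (Cod B f))" "e (fob R (Cod B f))" _ "far R f"] in auto)
  qed (auto intro!: id_functor comp_functor fs)
  moreover have "\<epsilon> (fob L X) \<cdot>\<^bsub>B\<^esub> far L (e X) = idt B (fob L X)" if "X \<in> Ob A" for X
    by (rule uu[of X])
      (use that lar_e[of "e X"] R.B.reassoc[of "far R (\<epsilon> (P X))" "e (fob R (P X))" _ "e X"] in auto)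
  ultimately have "adjunction A B L R e \<epsilon>"
    unfolding adjunction_def adjunction_axioms_def using L R by auto
  then show ?thesis by blast
qed

section \<open>Beck's monadicity theorem\<close>

definition coequalizer :: "('o, 'a) cat \<Rightarrow> 'a \<Rightarrow> 'a \<Rightarrow> 'a \<Rightarrow> bool" where
  "coequalizer B f g c \<longleftrightarrow> c \<in> Ar B \<and> Dom B c = Cod B f \<and> c \<cdot>\<^bsub>B\<^esub> f = c \<cdot>\<^bsub>B\<^esub> g \<and>
    (\<forall>z \<in> Ar B. Dom B z = Cod B f \<longrightarrow> z \<cdot>\<^bsub>B\<^esub> f = z \<cdot>\<^bsub>B\<^esub> g \<longrightarrow>
      (\<exists>!k. k \<in> hom B (Cod B c) (Cod B z) \<and> k \<cdot>\<^bsub>B\<^esub> c = z))"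

text \<open>The map \<open>t\<close> is a section of \<open>f\<close>, not of \<open>g\<close>. The
  data are equations between maps, so every functor preserves them and they make \<open>q\<close> an
  absolute coequalizer.\<close>

definition split_coequalizer :: "('o, 'a) cat \<Rightarrow> 'a \<Rightarrow> 'a \<Rightarrow> 'a \<Rightarrow> 'a \<Rightarrow> 'a \<Rightarrow> bool" where
  "split_coequalizer A f g q s t \<longleftrightarrow> f \<in> Ar A \<and> g \<in> Ar A \<and> Dom A f = Dom A g \<and> Cod A f = Cod A g \<and>
    q \<in> Ar A \<and> Dom A q = Cod A f \<and> s \<in> hom A (Cod A q) (Cod A f) \<and> t \<in> hom A (Cod A f) (Dom A f) \<and>
    q \<cdot>\<^bsub>A\<^esub> f = q \<cdot>\<^bsub>A\<^esub> g \<and> q \<cdot>\<^bsub>A\<^esub> s = idt A (Cod A q) \<and> f \<cdot>\<^bsub>A\<^esub> t = idt A (Cod A f) \<and>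
    g \<cdot>\<^bsub>A\<^esub> t = s \<cdot>\<^bsub>A\<^esub> q"

text \<open>Beck's conditions. Unlike \<open>monadic\<close>, they do not mention a left adjoint, which makes them easy to
  transport along equivalences.\<close>

definition beck :: "('p, 'b) cat \<Rightarrow> ('o, 'a) cat \<Rightarrow> ('p, 'b, 'o, 'a) func \<Rightarrow> bool" where
  "beck B A R \<longleftrightarrow> cat_functor B A R \<and> (\<forall>X \<in> Ob A. \<exists>P e. universal_arrow A B R X P e) \<and>
    (\<forall>h \<in> Ar B. is_iso A (far R h) \<longrightarrow> is_iso B h) \<and>
    (\<forall>f \<in> Ar B. \<forall>g \<in> Ar B. \<forall>q s t. Dom B f = Dom B g \<longrightarrow> Cod B f = Cod B g \<longrightarrow>
      split_coequalizer A (far R f) (far R g) q s t \<longrightarrow>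
      (\<exists>c j. coequalizer B f g c \<and> j \<in> hom A (Cod A q) (fob R (Cod B c)) \<and> is_iso A j \<and>
        j \<cdot>\<^bsub>A\<^esub> q = far R c))"

lemma beckD:
  assumes "beck B A R"
  shows "cat_functor B A R" "X \<in> Ob A \<Longrightarrow> \<exists>P e. universal_arrow A B R X P e"
    "\<lbrakk>h \<in> Ar B; is_iso A (far R h)\<rbrakk> \<Longrightarrow> is_iso B h"
  using assms unfolding beck_def by blast+

lemma beck_coequalizerE:
  assumes "beck B A R" "f \<in> Ar B" "g \<in> Ar B" "Dom B f = Dom B g" "Cod B f = Cod B g"
    "split_coequalizer A (far R f) (far R g) q s t"
  obtains c j where "coequalizer B f g c" "j \<in> hom A (Cod A q) (fob R (Cod B c))" "is_iso A j"
    "j \<cdot>\<^bsub>A\<^esub> q = far R c"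
  using assms unfolding beck_def by blast

lemma coequalizerE:
  assumes "coequalizer B f g c" "z \<in> Ar B" "Dom B z = Cod B f" "z \<cdot>\<^bsub>B\<^esub> f = z \<cdot>\<^bsub>B\<^esub> g"
  obtains k where "k \<in> hom B (Cod B c) (Cod B z)" "k \<cdot>\<^bsub>B\<^esub> c = z"
  using assms unfolding coequalizer_def by blast

context category
begin

lemma coequalizer_epi:
  assumes c: "coequalizer C f g c" "f \<in> Ar C" "g \<in> Ar C" "Dom C f = Dom C g" "Cod C f = Cod C g"
    and "u \<in> Ar C" "v \<in> Ar C" "Dom C u = Cod C c" "Dom C v = Cod C c" "u \<cdot> c = v \<cdot> c"
  shows "u = v"
proof -
  have c': "c \<in> Ar C" "Dom C c = Cod C f" "c \<cdot> f = c \<cdot> g" using c unfolding coequalizer_def by auto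
  have "Cod C u = Cod C v"
    using assms c' by (metis Cod_comp)
  moreover have "\<exists>!k. k \<in> hom C (Cod C c) (Cod C (u \<cdot> c)) \<and> k \<cdot> c = u \<cdot> c"
    using c(1) assms c' unfolding coequalizer_def
    by (metis (no_types, lifting) Cod_comp Dom_comp comp_Ar assoc)
  ultimately show ?thesis using assms c' by auto
qed

lemma coequalizer_iso:
  assumes c: "coequalizer C f g c" "f \<in> Ar C" "g \<in> Ar C" "Dom C f = Dom C g" "Cod C f = Cod C g"
    and k: "is_iso C k" "Dom C k = Cod C c"
  shows "coequalizer C f g (k \<cdot> c)"
proof -
  have c': "c \<in> Ar C" "Dom C c = Cod C f" "c \<cdot> f = c \<cdot> g" using c unfolding coequalizer_def by auto
  have k': "k \<in> Ar C" using k by (simp add: is_iso_def)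
  obtain l where l: "l \<in> hom C (Cod C k) (Dom C k)" "l \<cdot> k = idt C (Dom C k)" "k \<cdot> l = idt C (Cod C k)"
    using is_isoE[OF k(1)] k' by auto
  have lk: "l \<cdot> k \<cdot> c = c" using reassoc[OF l(2)] l k k' c' by simp
  show ?thesis unfolding coequalizer_def
  proof (intro conjI ballI impI)
    fix z assume z: "z \<in> Ar C" "Dom C z = Cod C f" "z \<cdot> f = z \<cdot> g"
    obtain m where m: "m \<in> hom C (Cod C c) (Cod C z)" "m \<cdot> c = z" using coequalizerE[OF c(1) z] .
    show "\<exists>!m. m \<in> hom C (Cod C (k \<cdot> c)) (Cod C z) \<and> m \<cdot> k \<cdot> c = z"
    proof (rule ex1I[of _ "m \<cdot> l"])
      show "m \<cdot> l \<in> hom C (Cod C (k \<cdot> c)) (Cod C z) \<and> (m \<cdot> l) \<cdot> k \<cdot> c = z"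
        using m l k k' c' lk by auto
      fix n assume n: "n \<in> hom C (Cod C (k \<cdot> c)) (Cod C z) \<and> n \<cdot> k \<cdot> c = z"
      then have "(n \<cdot> k) \<cdot> c = m \<cdot> c" using m k k' c' by simp
      then have "n \<cdot> k = m"
        by - (rule coequalizer_epi[OF c], use n m k k' c' in simp_all)
      then show "n = m \<cdot> l" using n k k' l c' by auto
    qed
  qed (use k k' c' c in auto)
qed

lemma right_inverse_iso:
  assumes j: "is_iso C j" "j \<in> hom C X Y" and k: "k \<in> hom C Y X" "k \<cdot> j = idt C X"
  shows "is_iso C k"
proof -
  obtain l where l: "l \<in> hom C Y X" "l \<cdot> j = idt C X" "is_iso C l" using is_isoE[OF j] by metis
  have "k = l" by (rule iso_cancel_right[OF j(1)]) (use j(2) k l in simp_all)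
  then show ?thesis using l by simp
qed

end

section \<open>The comparison functor to the category of algebras\<close>

context adjunction
begin

abbreviation "EM \<equiv> em_category A (R \<circ>\<^sub>F L) \<eta> (\<lambda>X. far R (\<epsilon> (fob L X)))"

abbreviation "comparison \<equiv> comparison_functor R B \<epsilon>"

lemma EM_Ob: "(X, a) \<in> Ob EM \<longleftrightarrow> X \<in> Ob A \<and> a \<in> hom A (fob R (fob L X)) X \<and>
    a \<bullet> \<eta> X = idt A X \<and> a \<bullet> far R (\<epsilon> (fob L X)) = a \<bullet> far R (far L a)"
  by (simp add: em_category_def Let_def)

lemma EM_Ar: "(x, h, y) \<in> Ar EM \<longleftrightarrow> x \<in> Ob EM \<and> y \<in> Ob EM \<and> h \<in> hom A (fst x) (fst y) \<and>
    h \<bullet> snd x = snd y \<bullet> far R (far L h)"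
  by (cases x; cases y) (auto simp add: em_category_def Let_def)

lemma EM_simps [simp]: "Dom EM (x, h, y) = x" "Cod EM (x, h, y) = y"
  "idt EM x = (x, idt A (fst x), x)" "(y', k, z) \<cdot>\<^bsub>EM\<^esub> (x, h, y) = (x, k \<bullet> h, z)"
  by (simp_all add: em_category_def Let_def split: prod.split)

lemma comparison_simps [simp]:
  "fob comparison Y = (fob R Y, far R (\<epsilon> Y))"
  "far comparison h = ((fob R (Dom B h), far R (\<epsilon> (Dom B h))), far R h, (fob R (Cod B h), far R (\<epsilon> (Cod B h))))"
  by (simp_all add: comparison_functor_def Let_def)

lemma category_EM: "category EM"
proof
  fix f assume f: "f \<in> Ar EM"
  show "Dom EM f \<in> Ob EM" "Cod EM f \<in> Ob EM" using f by (cases f; auto simp: EM_Ar)+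
next
  fix x assume "x \<in> Ob EM"
  then show "idt EM x \<in> hom EM x x" by (cases x) (auto simp: EM_Ar EM_Ob)
next
  fix f x y g z assume f: "f \<in> hom EM x y" and g: "g \<in> hom EM y z"
  obtain h where h: "f = (x, h, y)" "(x, h, y) \<in> Ar EM" using f by (cases f) auto
  obtain k where k: "g = (y, k, z)" "(y, k, z) \<in> Ar EM" using g by (cases g) auto
  show "g \<cdot>\<^bsub>EM\<^esub> f \<in> hom EM x z"
  proof (cases x; cases y; cases z)
    fix X a Y b Z c assume [simp]: "x = (X, a)" "y = (Y, b)" "z = (Z, c)"
    have "(k \<bullet> h) \<bullet> a = c \<bullet> far R (far L (k \<bullet> h))"
      using h(2) k(2) L.A.reassoc[of k b _ "far R (far L h)"] by (simp add: EM_Ar EM_Ob)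
    then show ?thesis unfolding h k using h(2) k(2) by (simp add: EM_Ar EM_Ob)
  qed
next
  fix f x y assume f: "f \<in> hom EM x y"
  obtain h where h: "f = (x, h, y)" "(x, h, y) \<in> Ar EM" using f by (cases f) auto
  show "f \<cdot>\<^bsub>EM\<^esub> idt EM x = f" "idt EM y \<cdot>\<^bsub>EM\<^esub> f = f" using h by (simp_all add: EM_Ar)
next
  fix f w x g y h z assume fgh: "f \<in> hom EM w x" "g \<in> hom EM x y" "h \<in> hom EM y z"
  obtain f' where f': "f = (w, f', x)" "(w, f', x) \<in> Ar EM" using fgh by (cases f) auto
  obtain g' where g': "g = (x, g', y)" "(x, g', y) \<in> Ar EM" using fgh by (cases g) auto
  obtain h' where h': "h = (y, h', z)" "(y, h', z) \<in> Ar EM" using fgh by (cases h) auto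
  show "(h \<cdot>\<^bsub>EM\<^esub> g) \<cdot>\<^bsub>EM\<^esub> f = h \<cdot>\<^bsub>EM\<^esub> (g \<cdot>\<^bsub>EM\<^esub> f)"
    using f' g' h' by (simp add: EM_Ar)
qed

lemma mult_counit: "Y \<in> Ob B \<Longrightarrow>
    far R (\<epsilon> Y) \<bullet> far R (\<epsilon> (fob L (fob R Y))) = far R (\<epsilon> Y) \<bullet> far R (far L (far R (\<epsilon> Y)))"
  using counit_nat[of "\<epsilon> Y"] by (simp flip: R.far_cmp)

lemma comparison_Ob: "Y \<in> Ob B \<Longrightarrow> (fob R Y, far R (\<epsilon> Y)) \<in> Ob EM"
  by (simp add: EM_Ob triangle_right mult_counit)

lemma comparison_functor: "cat_functor B EM comparison"
proof (rule cat_functorI)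
  fix f assume f: "f \<in> Ar B"
  have "far R f \<bullet> far R (\<epsilon> (Dom B f)) = far R (\<epsilon> (Cod B f)) \<bullet> far R (far L (far R f))"
    using counit_nat[OF f] f by (simp flip: R.far_cmp)
  then show "far comparison f \<in> hom EM (fob comparison (Dom B f)) (fob comparison (Cod B f))"
    using f comparison_Ob by (simp add: EM_Ar)
qed (auto simp: comparison_Ob intro: L.B.category_axioms category_EM)

text \<open>The bar presentation of \<open>Y\<close> by free objects: the triangle identity and
  naturality of the unit split its image under \<open>R\<close> by two unit components.\<close>

lemma counit_split:
  assumes Y: "Y \<in> Ob B"
  shows "split_coequalizer A (far R (\<epsilon> (fob L (fob R Y)))) (far R (far L (far R (\<epsilon> Y))))
    (far R (\<epsilon> Y)) (\<eta> (fob R Y)) (\<eta> (fob R (fob L (fob R Y))))"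
  using Y mult_counit[OF Y] triangle_right[of Y] triangle_right[of "fob L (fob R Y)"] unit_nat[of "far R (\<epsilon> Y)"]
  unfolding split_coequalizer_def by simp

text \<open>Beck's condition supplies some coequalizer \<open>c\<close> whose image is the split one
  up to \<open>j\<close>. The induced map from \<open>c\<close> to \<open>\<epsilon> Y\<close>
  becomes under \<open>R\<close> a one-sided inverse of the isomorphism \<open>j\<close>, hence
  invertible, so it is an isomorphism already in \<open>B\<close>.\<close>

lemma beck_counit_coequalizer:
  assumes "beck B A R" and Y: "Y \<in> Ob B"
  shows "coequalizer B (\<epsilon> (fob L (fob R Y))) (far L (far R (\<epsilon> Y))) (\<epsilon> Y)"
proof -
  let ?f = "\<epsilon> (fob L (fob R Y))" and ?g = "far L (far R (\<epsilon> Y))"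
  have fg: "?f \<in> Ar B" "?g \<in> Ar B" "Dom B ?f = Dom B ?g" "Cod B ?f = Cod B ?g" using Y by auto
  obtain c j where c: "coequalizer B ?f ?g c" and j: "j \<in> hom A (fob R Y) (fob R (Cod B c))" "is_iso A j"
    "j \<bullet> far R (\<epsilon> Y) = far R c"
    using beck_coequalizerE[OF assms(1) fg counit_split[OF Y]] Y by auto
  have c': "c \<in> Ar B" "Dom B c = fob L (fob R Y)" using c Y by (auto simp: coequalizer_def)
  have "\<epsilon> Y \<star> ?f = \<epsilon> Y \<star> ?g" using counit_nat[of "\<epsilon> Y"] Y by simp
  then obtain k where k: "k \<in> hom B (Cod B c) Y" "k \<star> c = \<epsilon> Y"
    using coequalizerE[OF c, of "\<epsilon> Y"] Y by auto
  have kq: "far R k \<bullet> j \<bullet> far R (\<epsilon> Y) = far R (\<epsilon> Y)"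
    using k j c' by (simp flip: R.far_cmp)
  have "far R k \<bullet> j = idt A (fob R Y)"
    by (rule L.A.split_epi_cancel[of "far R (\<epsilon> Y)" "\<eta> (fob R Y)"])
      (use Y kq k j c' triangle_right[OF Y] in auto)
  then have "is_iso A (far R k)"
    using L.A.right_inverse_iso[OF j(2,1)] k c' by auto
  then have "is_iso B k" using beckD(3)[OF assms(1), of k] k by auto
  then show ?thesis using L.B.coequalizer_iso[OF c fg, of k] k by auto
qed

text \<open>Since \<open>Y\<close> is the coequalizer of its bar presentation, an algebra map
  \<open>u\<close> is obtained by descending its transpose \<open>?z\<close>. An algebra
  \<open>(X, a)\<close> is itself a split coequalizer of free algebras in \<open>A\<close>, and the
  coequalizer of that pair in \<open>B\<close> is the object which the comparison functor sends to
  it up to isomorphism.\<close>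

lemma beck_comparison_ff_eso:
  assumes bk: "beck B A R"
  shows "ff_eso_functor B EM comparison"
proof -
  interpret K: cat_functor B EM comparison by (rule comparison_functor)
  have pair: "\<epsilon> (fob L (fob R Y)) \<in> Ar B" "far L (far R (\<epsilon> Y)) \<in> Ar B" 
    "Dom B (\<epsilon> (fob L (fob R Y))) = Dom B (far L (far R (\<epsilon> Y)))"
    "Cod B (\<epsilon> (fob L (fob R Y))) = Cod B (far L (far R (\<epsilon> Y)))" if "Y \<in> Ob B" for Y
    using that by auto
  show ?thesis
  proof
    fix Y Z h assume Y: "Y \<in> Ob B" and Z: "Z \<in> Ob B" and h: "h \<in> hom EM (fob comparison Y) (fob comparison Z)"
    obtain u where u: "h = ((fob R Y, far R (\<epsilon> Y)), u, (fob R Z, far R (\<epsilon> Z)))"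
      using h by (cases h) auto
    have u': "u \<in> hom A (fob R Y) (fob R Z)" "u \<bullet> far R (\<epsilon> Y) = far R (\<epsilon> Z) \<bullet> far R (far L u)"
      using h u by (auto simp: EM_Ar)
    note co = beck_counit_coequalizer[OF bk Y]
    let ?z = "\<epsilon> Z \<star> far L u"
    have 1: "\<epsilon> Z \<star> far L (far R (\<epsilon> Z)) = \<epsilon> Z \<star> \<epsilon> (fob L (fob R Z))"
      using counit_nat[of "\<epsilon> Z"] Z by simp
    have 2: "\<epsilon> (fob L (fob R Z)) \<star> far L (far R (far L u)) = far L u \<star> \<epsilon> (fob L (fob R Y))"
      using counit_nat[of "far L u"] u' by simp
    have "?z \<star> far L (far R (\<epsilon> Y)) = \<epsilon> Z \<star> far L (u \<bullet> far R (\<epsilon> Y))"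
      using u'(1) Y Z by simp
    also have "\<dots> = \<epsilon> Z \<star> far L (far R (\<epsilon> Z)) \<star> far L (far R (far L u))"
      using u' Y Z by simp
    also have "\<dots> = \<epsilon> Z \<star> \<epsilon> (fob L (fob R Z)) \<star> far L (far R (far L u))"
      using L.B.reassoc[OF 1, of "far L (far R (far L u))"] u' Y Z by simp
    also have "\<dots> = ?z \<star> \<epsilon> (fob L (fob R Y))"
      using 2 u' Y Z by simp
    finally obtain k where k: "k \<in> hom B Y Z" "k \<star> \<epsilon> Y = ?z"
      using coequalizerE[OF co, of ?z] u' Y Z by auto
    have "far R k \<bullet> far R (\<epsilon> Y) = u \<bullet> far R (\<epsilon> Y)"
      using arg_cong[OF k(2), of "far R"] u' k(1) Y Z by simp
    then have Rk: "far R k = u"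
      by - (rule L.A.split_epi_cancel[of "far R (\<epsilon> Y)" "\<eta> (fob R Y)"],
        use k(1) u' Y triangle_right[OF Y] in auto)
    show "\<exists>!k. k \<in> hom B Y Z \<and> far comparison k = h"
    proof (rule ex1I[of _ k])
      show "k \<in> hom B Y Z \<and> far comparison k = h" using k Rk u by auto
      fix l assume l: "l \<in> hom B Y Z \<and> far comparison l = h"
      then have "far R l = far R k" using Rk u by auto
      then have "l \<star> \<epsilon> Y = k \<star> \<epsilon> Y" using counit_nat[of l] counit_nat[of k] l k by auto
      then show "l = k" by - (rule L.B.coequalizer_epi[OF co pair[OF Y]], use l k Y in auto)
    qed
  next
    fix x assume x: "x \<in> Ob EM"
    obtain X a where [simp]: "x = (X, a)" by (cases x)
    have X: "X \<in> Ob A" and a: "a \<in> hom A (fob R (fob L X)) X" "a \<bullet> \<eta> X = idt A X"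
      "a \<bullet> far R (\<epsilon> (fob L X)) = a \<bullet> far R (far L a)" using x by (auto simp: EM_Ob)
    have sp: "split_coequalizer A (far R (\<epsilon> (fob L X))) (far R (far L a)) a (\<eta> X) (\<eta> (fob R (fob L X)))"
      using X a triangle_right[of "fob L X"] unit_nat[of a] unfolding split_coequalizer_def by simp
    obtain q i where q: "coequalizer B (\<epsilon> (fob L X)) (far L a) q" and
      i: "i \<in> hom A X (fob R (Cod B q))" "is_iso A i" "i \<bullet> a = far R q"
      proof (rule beck_coequalizerE[OF bk _ _ _ _ sp])
    qed (use X a(1) that in simp_all)
    let ?Q = "Cod B q"
    have q': "q \<in> Ar B" "Dom B q = fob L X" "q \<star> \<epsilon> (fob L X) = q \<star> far L a"
      using q X by (auto simp: coequalizer_def)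
    have RLi: "far L i \<star> far L a = far L (far R q)"
      using i(1,3) a by (simp flip: L.far_cmp)
    have sRa: "far R (far L a) \<bullet> far R (far L (\<eta> X)) = idt A (fob R (fob L X))"
      using X a(1,2) by (simp flip: R.far_cmp L.far_cmp)
    \<comment> \<open>That \<open>i\<close> is an algebra map is tested after
      \<open>far R (far L a)\<close>, which the unit law of \<open>a\<close> splits.\<close>
    have "(far R (\<epsilon> ?Q) \<bullet> far R (far L i)) \<bullet> far R (far L a) = far R (\<epsilon> ?Q \<star> far L i \<star> far L a)"
      using i(1) a q' by simp
    also have "\<dots> = far R (q \<star> far L a)"
      using RLi counit_nat[of q] q' by simp
    also have "\<dots> = (i \<bullet> a) \<bullet> far R (far L a)"
      using q' a i by simp
    finally have "far R (\<epsilon> ?Q) \<bullet> far R (far L i) = i \<bullet> a"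
      by - (rule L.A.split_epi_cancel[of "far R (far L a)" "far R (far L (\<eta> X))"],
        use X a(1,2) i(1) q'(1,2) sRa in auto)
    then have ar: "(x, i, fob comparison ?Q) \<in> Ar EM"
      using x i q' comparison_Ob[of ?Q] by (simp add: EM_Ar)
    obtain j where j: "j \<in> hom A (fob R ?Q) X" "j \<bullet> i = idt A X" "i \<bullet> j = idt A (fob R ?Q)"
      using L.A.is_isoE[OF i(2,1)] by metis
    have "j \<bullet> far R (\<epsilon> ?Q) = a \<bullet> far R (far L j)"
    proof -
      have eq: "i \<bullet> a = far R (\<epsilon> ?Q) \<bullet> far R (far L i)" using ar by (simp add: EM_Ar)
      have ij: "far L i \<star> far L j = idt B (fob L (fob R ?Q))"
        using i(1) j q' by (simp flip: L.far_cmp)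
      have "i \<bullet> a \<bullet> far R (far L j) = far R (\<epsilon> ?Q) \<bullet> far R (far L i \<star> far L j)"
        using L.A.reassoc[OF eq, of "far R (far L j)"] i(1) a j(1) q' by simp
      also have "\<dots> = i \<bullet> j \<bullet> far R (\<epsilon> ?Q)"
        unfolding ij using L.A.reassoc[OF j(3), of "far R (\<epsilon> ?Q)"] i(1) j(1) q' by simp
      finally show ?thesis by - (rule L.A.iso_cancel_left[OF i(2)], use i(1) j(1) a q' X in auto)
    qed
    then have ar': "(fob comparison ?Q, j, x) \<in> Ar EM"
      using x j q' comparison_Ob[of ?Q] by (simp add: EM_Ar)
    have "is_iso EM (x, i, fob comparison ?Q)"
      by (rule K.B.is_isoI[of _ x "fob comparison ?Q" "(fob comparison ?Q, j, x)"])
        (use ar ar' j in \<open>auto\<close>)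
    then show "\<exists>Y \<in> Ob B. \<exists>i \<in> hom EM x (fob comparison Y). is_iso EM i"
      using ar q' by (intro bexI[of _ ?Q] bexI[of _ "(x, i, fob comparison ?Q)"]) auto
  qed
qed

text \<open>Through the equivalence, \<open>B\<close> may be treated as the category of algebras.
  There the inverse of an algebra map is again an algebra map, and the quotient of a split pair of
  algebra maps inherits a structure, which essential surjectivity turns back into an object of
  \<open>B\<close>.\<close>

lemma ff_eso_comparison_beck:
  assumes "ff_eso_functor B EM comparison"
  shows "beck B A R"
proof -
  interpret K: ff_eso_functor B EM comparison by fact
  have faithful: "k = l" if "k \<in> Ar B" "l \<in> Ar B" "Dom B k = Dom B l" "Cod B k = Cod B l" "far R k = far R l" for k l
    using that by (intro K.faithful) auto
  have full: "\<exists>k. k \<in> hom B Y Z \<and> far R k = u" if yz: "Y \<in> Ob B" "Z \<in> Ob B" "u \<in> hom A (fob R Y) (fob R Z)"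
    "u \<bullet> far R (\<epsilon> Y) = far R (\<epsilon> Z) \<bullet> far R (far L u)" for Y Z u
  proof -
    have "(fob comparison Y, u, fob comparison Z) \<in> hom EM (fob comparison Y) (fob comparison Z)"
      using yz comparison_Ob by (auto simp: EM_Ar)
    then obtain k where "k \<in> hom B Y Z" "far comparison k = (fob comparison Y, u, fob comparison Z)"
      using K.full yz(1,2) by metis
    then show ?thesis by auto
  qed
  show ?thesis unfolding beck_def
  proof (intro conjI ballI allI impI)
    show "cat_functor B A R" by (rule R.cat_functor_axioms)
    show "\<exists>P e. universal_arrow A B R X P e" if "X \<in> Ob A" for X
      using universal_unit[OF that] by blast
  next
    fix h assume h: "h \<in> Ar B" and iso: "is_iso A (far R h)"
    obtain j where j: "j \<in> hom A (fob R (Cod B h)) (fob R (Dom B h))" "j \<bullet> far R h = idt A (fob R (Dom B h))"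
       "far R h \<bullet> j = idt A (fob R (Cod B h))"
      using L.A.is_isoE[OF iso] h by auto
    let ?Y = "Dom B h" and ?Z = "Cod B h"
    have eq: "far R (\<epsilon> ?Z) \<bullet> far R (far L (far R h)) = far R h \<bullet> far R (\<epsilon> ?Y)"
      using counit_nat[OF h] h by (simp flip: R.far_cmp)
    have ij: "far L (far R h) \<star> far L j = idt B (fob L (fob R ?Z))"
      using h j by (simp flip: L.far_cmp)
    have "far R h \<bullet> far R (\<epsilon> ?Y) \<bullet> far R (far L j) = far R (\<epsilon> ?Z) \<bullet> far R (far L (far R h) \<star> far L j)"
      using L.A.reassoc[OF eq[symmetric], of "far R (far L j)"] h j(1) by simp
    also have "\<dots> = far R h \<bullet> j \<bullet> far R (\<epsilon> ?Z)"
      unfolding ij using L.A.reassoc[OF j(3), of "far R (\<epsilon> ?Z)"] h j(1) by simp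
    finally have "j \<bullet> far R (\<epsilon> ?Z) = far R (\<epsilon> ?Y) \<bullet> far R (far L j)"
      by - (rule L.A.iso_cancel_left[OF iso], use h j(1) in auto)
    then obtain k where k: "k \<in> hom B ?Z ?Y" "far R k = j" using full[of ?Z ?Y j] h j by auto
    show "is_iso B h"
      by (rule L.B.is_isoI[of h ?Y ?Z k]) (use h k j in \<open>auto intro!: faithful\<close>)
  next
    fix f g q s t
    assume f: "f \<in> Ar B" and g: "g \<in> Ar B" and fg: "Dom B f = Dom B g" "Cod B f = Cod B g"
      and sp: "split_coequalizer A (far R f) (far R g) q s t"
    define P Q X where "P = Dom B f" and "Q = Cod B f" and "X = Cod A q"
    have ob: "P \<in> Ob B" "Q \<in> Ob B" "X \<in> Ob A" and fP: "Dom B f = P" "Cod B f = Q" "Dom B g = P" "Cod B g = Q"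
      using f g fg sp by (auto simp: P_def Q_def X_def split_coequalizer_def)
    have q: "q \<in> Ar A" "Dom A q = fob R Q" "Cod A q = X" and s: "s \<in> Ar A" "Dom A s = X" "Cod A s = fob R Q"
      and t: "t \<in> Ar A" "Dom A t = fob R Q" "Cod A t = fob R P"
      and e: "q \<bullet> far R f = q \<bullet> far R g" "q \<bullet> s = idt A X"
        "far R f \<bullet> t = idt A (fob R Q)" "far R g \<bullet> t = s \<bullet> q"
      using f g fP sp by (auto simp: X_def split_coequalizer_def)
    let ?E = "far R (\<epsilon> Q)"
    \<comment> \<open>The structure of \<open>fob R Q\<close>, carried to the quotient along the
      section \<open>s\<close>. It makes \<open>q\<close> an algebra map (\<open>aq\<close>):
      \<open>s \<bullet> q\<close> is \<open>far R g \<bullet> t\<close>, both maps of the pair are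
      algebra maps, and \<open>q\<close> identifies them.\<close>
    define a where "a = q \<bullet> ?E \<bullet> far R (far L s)"
    have a: "a \<in> Ar A" "Dom A a = fob R (fob L X)" "Cod A a = X" using q s ob by (auto simp: a_def)
    have LRs: "far L (far R h) \<star> far L k = far L (far R h \<bullet> k)" 
      if "h \<in> Ar B" "k \<in> Ar A" "Cod A k = fob R (Dom B h)" for h k using that by simp
    have f_nat: "far R f \<bullet> far R (\<epsilon> P) = ?E \<bullet> far R (far L (far R f))"
      using counit_nat[OF f] f fP ob by (simp flip: R.far_cmp)
    have g_nat: "far R g \<bullet> far R (\<epsilon> P) = ?E \<bullet> far R (far L (far R g))"
      using counit_nat[OF g] g fP ob by (simp flip: R.far_cmp)
    have aq: "a \<bullet> far R (far L q) = q \<bullet> ?E"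
    proof -
      have "a \<bullet> far R (far L q) = q \<bullet> ?E \<bullet> far R (far L (s \<bullet> q))"
        using q s ob by (simp add: a_def)
      also have "\<dots> = q \<bullet> (?E \<bullet> far R (far L (far R g))) \<bullet> far R (far L t)"
        unfolding e(4)[symmetric] using q t ob g fP by simp
      also have "\<dots> = (q \<bullet> far R g) \<bullet> far R (\<epsilon> P) \<bullet> far R (far L t)"
        unfolding g_nat[symmetric] using q t ob g fP by simp
      also have "\<dots> = q \<bullet> (far R f \<bullet> far R (\<epsilon> P)) \<bullet> far R (far L t)"
        unfolding e(1)[symmetric] using q t ob f fP by simp
      also have "\<dots> = q \<bullet> ?E \<bullet> far R (far L (far R f \<bullet> t))"
        unfolding f_nat using q t ob f fP by simp
      also have "\<dots> = q \<bullet> ?E" unfolding e(3) using q ob by simp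
      finally show ?thesis .
    qed
    have split: "far R (far L q) \<bullet> far R (far L s) = idt A (fob R (fob L X))"
      using e(2) q s ob by (simp flip: R.far_cmp L.far_cmp)
    \<comment> \<open>With \<open>T\<close> for the monad, associativity of \<open>a\<close> is an
      equation of maps out of \<open>T T X\<close> and is tested after the split epimorphism
      \<open>T T q\<close>.\<close>
    have split2: "far R (far L (far R (far L q))) \<bullet> far R (far L (far R (far L s))) =
        idt A (fob R (fob L (fob R (fob L X))))"
      using split q s ob by (simp flip: R.far_cmp L.far_cmp)
    have "(X, a) \<in> Ob EM" unfolding EM_Ob
    proof (intro conjI)
      have "a \<bullet> \<eta> X = q \<bullet> ?E \<bullet> \<eta> (fob R Q) \<bullet> s"
        using unit_nat[of s] q s ob by (simp add: a_def)
      also have "\<dots> = idt A X"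
        using L.A.reassoc[OF triangle_right, of Q s] q s ob e(2) by simp
      finally show "a \<bullet> \<eta> X = idt A X" .
      have "(a \<bullet> far R (far L a)) \<bullet> far R (far L (far R (far L q))) = a \<bullet> far R (far L (a \<bullet> far R (far L q)))"
        using a q ob by simp
      also have "\<dots> = a \<bullet> far R (far L (q \<bullet> ?E))"
        unfolding aq ..
      also have "\<dots> = (a \<bullet> far R (far L q)) \<bullet> far R (far L ?E)"
        using a q ob by simp
      also have "\<dots> = q \<bullet> ?E \<bullet> far R (\<epsilon> (fob L (fob R Q)))"
        unfolding aq using mult_counit[OF ob(2)] q ob by simp
      also have "\<dots> = (a \<bullet> far R (far L q)) \<bullet> far R (\<epsilon> (fob L (fob R Q)))"
        unfolding aq using q ob by simp
      also have "\<dots> = a \<bullet> far R (far L q \<star> \<epsilon> (fob L (fob R Q)))"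
        using a q ob by simp
      also have "\<dots> = (a \<bullet> far R (\<epsilon> (fob L X))) \<bullet> far R (far L (far R (far L q)))"
        using counit_nat[of "far L q", symmetric] a q ob by simp
      finally have *: "(a \<bullet> far R (far L a)) \<bullet> far R (far L (far R (far L q))) =
         (a \<bullet> far R (\<epsilon> (fob L X))) \<bullet> far R (far L (far R (far L q)))" .
      show "a \<bullet> far R (\<epsilon> (fob L X)) = a \<bullet> far R (far L a)"
        by (rule sym, rule L.A.split_epi_cancel[OF _ _ _ _ _ _ _ _ *, of "far R (far L (far R (far L s)))"])
          (use split2 a q s ob in auto)
    qed (use a ob in auto)
    then obtain Y i j where Y: "Y \<in> Ob B" and i: "i \<in> hom EM (X, a) (fob comparison Y)" "is_iso EM i"
      and j: "j \<in> hom EM (fob comparison Y) (X, a)" and ji: "j \<cdot>\<^bsub>EM\<^esub> i = idt EM (X, a)" "i \<cdot>\<^bsub>EM\<^esub> j = idt EM (fob comparison Y)"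
      using K.eso[of "(X, a)"] by metis
    obtain i' where i': "i = ((X, a), i', fob comparison Y)" using i by (cases i) auto
    obtain j' where j': "j = (fob comparison Y, j', (X, a))" using j by (cases j) auto
    have I: "i' \<in> Ar A" "Dom A i' = X" "Cod A i' = fob R Y" "i' \<bullet> a = far R (\<epsilon> Y) \<bullet> far R (far L i')"
      using i i' by (auto simp: EM_Ar)
    have J: "j' \<in> Ar A" "Dom A j' = fob R Y" "Cod A j' = X" "j' \<bullet> far R (\<epsilon> Y) = a \<bullet> far R (far L j')"
      using j j' by (auto simp: EM_Ar)
    have JI: "j' \<bullet> i' = idt A X" "i' \<bullet> j' = idt A (fob R Y)" using ji i' j' by auto
    have "is_iso A i'" by (rule L.A.is_isoI[of _ X "fob R Y" j']) (use I J JI in auto)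
    have "(i' \<bullet> q) \<bullet> ?E = (i' \<bullet> a) \<bullet> far R (far L q)"
      using aq I(1-3) q a ob by simp
    also have "\<dots> = far R (\<epsilon> Y) \<bullet> far R (far L (i' \<bullet> q))"
      unfolding I(4) using I(1-3) q Y by simp
    finally obtain c where c: "c \<in> hom B Q Y" "far R c = i' \<bullet> q"
      using full[of Q Y "i' \<bullet> q"] I q Y ob by auto
    have cfg: "c \<star> f = c \<star> g"
      by (rule faithful) (use c f g fP e(1) I q in auto)
    have ex: "\<exists>!k. k \<in> hom B (Cod B c) (Cod B z) \<and> k \<star> c = z"
      if z: "z \<in> Ar B" "Dom B z = Cod B f" "z \<star> f = z \<star> g" for z
    proof -
      define Z where "Z = Cod B z"
      have z': "Dom B z = Q" "Cod B z = Z" "Z \<in> Ob B" using z fP by (auto simp: Z_def)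
      \<comment> \<open>As \<open>q\<close> is split by \<open>s\<close>, this is the only candidate
        for a factorization of \<open>far R z\<close> through \<open>q\<close>.\<close>
      let ?m = "far R z \<bullet> s"
      have zfg: "far R z \<bullet> far R f = far R z \<bullet> far R g"
        using z f g fP z' by (simp flip: R.far_cmp)
      have mq: "?m \<bullet> q = far R z"
      proof -
        have "?m \<bullet> q = (far R z \<bullet> far R g) \<bullet> t" using e(4) z z' s q t g fP by simp
        also have "\<dots> = far R z" unfolding zfg[symmetric] using e(3) z z' t f fP by simp
        finally show ?thesis .
      qed
      have z_nat: "far R z \<bullet> ?E = far R (\<epsilon> Z) \<bullet> far R (far L (far R z))"
        using counit_nat[OF z(1)] z z' ob by (simp flip: R.far_cmp)
      have "(?m \<bullet> a) \<bullet> far R (far L q) = (?m \<bullet> q) \<bullet> ?E"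
        using aq z z' s q a ob by simp
      also have "\<dots> = far R (\<epsilon> Z) \<bullet> far R (far L (?m \<bullet> q))"
        unfolding mq z_nat ..
      also have "\<dots> = (far R (\<epsilon> Z) \<bullet> far R (far L ?m)) \<bullet> far R (far L q)"
        using z z' s q ob by simp
      finally have ma: "?m \<bullet> a = far R (\<epsilon> Z) \<bullet> far R (far L ?m)"
        by - (rule L.A.split_epi_cancel[of "far R (far L q)" "far R (far L s)"],
          use split z z' s q a ob in auto)
      have "(?m \<bullet> j') \<bullet> far R (\<epsilon> Y) = (?m \<bullet> a) \<bullet> far R (far L j')"
        using J z z' s a Y by simp
      also have "\<dots> = far R (\<epsilon> Z) \<bullet> far R (far L (?m \<bullet> j'))"
        unfolding ma using J z z' s Y by simp
      finally obtain k where k: "k \<in> hom B Y Z" "far R k = ?m \<bullet> j'"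
        using full[of Y Z "?m \<bullet> j'"] J z z' s Y by auto
      show ?thesis
      proof (rule ex1I[of _ k])
        have "k \<star> c = z"
          by (rule faithful)
            (use k c z z' J I s q mq L.A.reassoc[OF JI(1), of q] in auto)
        then show "k \<in> hom B (Cod B c) (Cod B z) \<and> k \<star> c = z" using k c z' by auto
        fix l assume l: "l \<in> hom B (Cod B c) (Cod B z) \<and> l \<star> c = z"
        then have l': "l \<in> Ar B" "Dom B l = Y" "Cod B l = Z" using c z' by auto
        have "far R (l \<star> c) = far R z" using l by simp
        then have "far R l \<bullet> far R c = far R z" using l' c(1) by simp
        then have "(far R l \<bullet> i') \<bullet> q = ?m \<bullet> q"
          unfolding mq using c l' I q by simp
        then have "far R l \<bullet> i' = ?m"
          by - (rule L.A.split_epi_cancel[of q s], use l' I q s e z z' in auto)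
        then have "far R k = far R l"
          using k(2) JI I J l' L.A.assoc[of "far R l" i' j'] by auto
        then show "l = k" using k l' by (intro faithful) auto
      qed
    qed
    have "coequalizer B f g c" unfolding coequalizer_def
    proof (intro conjI ballI impI)
      show "c \<star> f = c \<star> g" by (rule cfg)
    qed (use c(1) fP ex in \<open>simp_all only: mem_hom\<close>)
    then show "\<exists>c j. coequalizer B f g c \<and> j \<in> hom A (Cod A q) (fob R (Cod B c)) \<and> is_iso A j \<and>
        j \<bullet> q = far R c"
      using c I \<open>is_iso A i'\<close> q by (intro exI[of _ c] exI[of _ i']) auto
  qed
qed

end

text \<open>\<open>monadic\<close> asserts the existence of some left adjoint whose comparison
  functor is an equivalence, so the adjunction assembled from universal arrows may serve as the
  witness.\<close>

theorem monadic_iff_beck: "monadic B A R \<longleftrightarrow> beck B A R"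
proof
  assume "monadic B A R"
  then obtain L \<eta> \<epsilon> where adj: "adjunction A B L R \<eta> \<epsilon>" and
    eq: "equivalence_functor B (em_category A (R \<circ>\<^sub>F L) \<eta> (\<lambda>X. far R (\<epsilon> (fob L X)))) (comparison_functor R B \<epsilon>)"
    unfolding monadic_def by blast
  interpret adjunction A B L R \<eta> \<epsilon> by (rule adj)
  show "beck B A R" by (rule ff_eso_comparison_beck[OF equivalence_ff_eso[OF eq]])
next
  assume bk: "beck B A R"
  obtain L \<eta> \<epsilon> where adj: "adjunction A B L R \<eta> \<epsilon>"
    using adjunction_from_universal_arrows[OF beckD(1,2)[OF bk]] by blast
  interpret adjunction A B L R \<eta> \<epsilon> by (rule adj)
  show "monadic B A R"
    unfolding monadic_def
    using adj ff_eso_functor.is_equivalence[OF beck_comparison_ff_eso[OF bk]] by blast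
qed

section \<open>Transport of Beck's conditions\<close>

lemma naturally_isomorphicE:
  assumes "naturally_isomorphic A B F G"
  obtains \<alpha> \<beta> where "\<And>X. X \<in> Ob A \<Longrightarrow> \<alpha> X \<in> hom B (fob F X) (fob G X)"
    "\<And>X. X \<in> Ob A \<Longrightarrow> \<beta> X \<in> hom B (fob G X) (fob F X)"
    "\<And>X. X \<in> Ob A \<Longrightarrow> \<beta> X \<cdot>\<^bsub>B\<^esub> \<alpha> X = idt B (fob F X)"
    "\<And>X. X \<in> Ob A \<Longrightarrow> \<alpha> X \<cdot>\<^bsub>B\<^esub> \<beta> X = idt B (fob G X)"
    "\<And>f. f \<in> Ar A \<Longrightarrow> \<alpha> (Cod A f) \<cdot>\<^bsub>B\<^esub> far F f = far G f \<cdot>\<^bsub>B\<^esub> \<alpha> (Dom A f)"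
    "\<And>f. f \<in> Ar A \<Longrightarrow> \<beta> (Cod A f) \<cdot>\<^bsub>B\<^esub> far G f = far F f \<cdot>\<^bsub>B\<^esub> \<beta> (Dom A f)"
    "\<And>X. X \<in> Ob A \<Longrightarrow> is_iso B (\<alpha> X)" "\<And>X. X \<in> Ob A \<Longrightarrow> is_iso B (\<beta> X)"
    "cat_functor A B F" "cat_functor A B G"
proof -
  obtain \<alpha> where a: "nat_trans A B F G \<alpha>" and iso: "\<And>X. X \<in> Ob A \<Longrightarrow> is_iso B (\<alpha> X)"
    using assms unfolding naturally_isomorphic_def by auto
  interpret nat_trans A B F G \<alpha> by fact
  have "\<forall>X. \<exists>b. X \<in> Ob A \<longrightarrow> b \<in> hom B (fob G X) (fob F X) \<and> b \<cdot>\<^bsub>B\<^esub> \<alpha> X = idt B (fob F X) \<and>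
      \<alpha> X \<cdot>\<^bsub>B\<^esub> b = idt B (fob G X) \<and> is_iso B b"
    using iso component_in F.B.is_isoE by metis
  then obtain \<beta> where b: "\<And>X. X \<in> Ob A \<Longrightarrow> \<beta> X \<in> hom B (fob G X) (fob F X) \<and>
      \<beta> X \<cdot>\<^bsub>B\<^esub> \<alpha> X = idt B (fob F X) \<and> \<alpha> X \<cdot>\<^bsub>B\<^esub> \<beta> X = idt B (fob G X) \<and> is_iso B (\<beta> X)"
    by metis
  have "\<beta> (Cod A f) \<cdot>\<^bsub>B\<^esub> far G f = far F f \<cdot>\<^bsub>B\<^esub> \<beta> (Dom A f)" if f: "f \<in> Ar A" for f
  proof (rule F.B.iso_cancel_left[OF iso])
    show "\<alpha> (Cod A f) \<cdot>\<^bsub>B\<^esub> \<beta> (Cod A f) \<cdot>\<^bsub>B\<^esub> far G f = \<alpha> (Cod A f) \<cdot>\<^bsub>B\<^esub> far F f \<cdot>\<^bsub>B\<^esub> \<beta> (Dom A f)"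
      using f b[of "Cod A f"] b[of "Dom A f"] F.B.reassoc[OF naturality'[OF f], of "\<beta> (Dom A f)"]
        F.B.reassoc[of "\<alpha> (Cod A f)" "\<beta> (Cod A f)" _ "far G f"] by simp
  qed (use f b in auto)
  then show thesis
    using that[of \<alpha> \<beta>] b iso component_in naturality' F.cat_functor_axioms G.cat_functor_axioms by blast
qed

text \<open>Split data in \<open>A'\<close> come from split data in \<open>A\<close>: the quotient
  object is replaced by an isomorphic one in the image of \<open>E\<close>, then the maps are pulled
  back by fullness and the equations by faithfulness.\<close>

lemma beck_post:
  fixes A' :: "('q, 'c) cat" (structure)
  assumes bk: "beck B A R" and E: "ff_eso_functor A A' E"
  shows "beck B A' (E \<circ>\<^sub>F R)"
proof -
  interpret E: ff_eso_functor A A' E by fact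
  interpret R: cat_functor B A R using beckD(1)[OF bk] .
  show ?thesis unfolding beck_def
  proof (intro conjI ballI allI impI)
    show "cat_functor B A' (E \<circ>\<^sub>F R)" by (rule comp_functor[OF R.cat_functor_axioms E.cat_functor_axioms])
  next
    fix X' assume "X' \<in> Ob A'"
    then obtain X i j where X: "X \<in> Ob A" and i: "i \<in> hom A' X' (fob E X)" and j: "j \<in> hom A' (fob E X) X'"
      and ji: "j \<cdot> i = idt A' X'" "i \<cdot> j = idt A' (fob E X)" "is_iso A' i"
      using E.eso by metis
    obtain P e where u: "universal_arrow A B R X P e" using beckD(2)[OF bk X] by blast
    have e: "P \<in> Ob B" "e \<in> hom A X (fob R P)" using u by (auto simp: universal_arrow_def)
    have "universal_arrow A' B (E \<circ>\<^sub>F R) X' P (far E e \<cdot> i)"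
      unfolding universal_arrow_def
    proof (intro conjI ballI)
      fix Z f assume Z: "Z \<in> Ob B" and f: "f \<in> hom A' X' (fob (E \<circ>\<^sub>F R) Z)"
      have "f \<cdot> j \<in> hom A' (fob E X) (fob E (fob R Z))" using f j by auto
      then obtain g where g: "g \<in> hom A X (fob R Z)" "far E g = f \<cdot> j"
        using E.full X Z R.fob_Ob by metis
      have eq: "far R h \<cdot>\<^bsub>A\<^esub> e = g \<longleftrightarrow> far (E \<circ>\<^sub>F R) h \<cdot> (far E e \<cdot> i) = f" if h: "h \<in> hom B P Z" for h
      proof
        assume "far R h \<cdot>\<^bsub>A\<^esub> e = g"
        then have "far E (far R h \<cdot>\<^bsub>A\<^esub> e) \<cdot> i = (f \<cdot> j) \<cdot> i" using g by simp
        then show "far (E \<circ>\<^sub>F R) h \<cdot> (far E e \<cdot> i) = f" using h e i j f ji by simp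
      next
        assume "far (E \<circ>\<^sub>F R) h \<cdot> (far E e \<cdot> i) = f"
        then have "far E (far R h \<cdot>\<^bsub>A\<^esub> e) = far E g"
          using h e i j ji g E.B.reassoc[of _ i _ j] by (auto simp: E.B.assoc)
        then show "far R h \<cdot>\<^bsub>A\<^esub> e = g" by (rule E.faithful[rotated -1]) (use h e g in auto)
      qed
      have "\<exists>!h. h \<in> hom B P Z \<and> far R h \<cdot>\<^bsub>A\<^esub> e = g" using u Z g by (simp add: universal_arrow_def)
      then show "\<exists>!h. h \<in> hom B P Z \<and> far (E \<circ>\<^sub>F R) h \<cdot> (far E e \<cdot> i) = f"
        using eq by (metis (no_types, lifting))
    qed (use e i in auto)
    then show "\<exists>P e. universal_arrow A' B (E \<circ>\<^sub>F R) X' P e" by blast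
  next
    fix h assume "h \<in> Ar B" "is_iso A' (far (E \<circ>\<^sub>F R) h)"
    then show "is_iso B h" using beckD(3)[OF bk] E.reflects_iso by auto
  next
    fix f g q s t
    assume f: "f \<in> Ar B" and g: "g \<in> Ar B" and fg: "Dom B f = Dom B g" "Cod B f = Cod B g"
      and sp: "split_coequalizer A' (far (E \<circ>\<^sub>F R) f) (far (E \<circ>\<^sub>F R) g) q s t"
    define X' where "X' = Cod A' q"
    have q: "q \<in> Ar A'" "Dom A' q = fob E (fob R (Cod B f))" "Cod A' q = X'"
      and s: "s \<in> Ar A'" "Dom A' s = X'" "Cod A' s = fob E (fob R (Cod B f))"
      and t: "t \<in> Ar A'" "Dom A' t = fob E (fob R (Cod B f))" "Cod A' t = fob E (fob R (Dom B f))"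
      and e: "q \<cdot> far E (far R f) = q \<cdot> far E (far R g)" "q \<cdot> s = idt A' X'"
        "far E (far R f) \<cdot> t = idt A' (fob E (fob R (Cod B f)))" "far E (far R g) \<cdot> t = s \<cdot> q"
      using f g fg sp by (auto simp: X'_def split_coequalizer_def)
    obtain X i j where X: "X \<in> Ob A" and i: "i \<in> hom A' X' (fob E X)" and j: "j \<in> hom A' (fob E X) X'"
      and ji: "j \<cdot> i = idt A' X'" "i \<cdot> j = idt A' (fob E X)" "is_iso A' i"
      using E.eso[of X'] q by (metis E.B.Cod_ob)
    obtain q0 where q0: "q0 \<in> hom A (fob R (Cod B f)) X" "far E q0 = i \<cdot> q"
      using E.full[of "fob R (Cod B f)" X "i \<cdot> q"] X q i f by auto
    obtain s0 where s0: "s0 \<in> hom A X (fob R (Cod B f))" "far E s0 = s \<cdot> j"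
      using E.full[of X "fob R (Cod B f)" "s \<cdot> j"] X s j f by auto
    obtain t0 where t0: "t0 \<in> hom A (fob R (Cod B f)) (fob R (Dom B f))" "far E t0 = t"
      using E.full[of "fob R (Cod B f)" "fob R (Dom B f)" t] t f by auto
    have qs: "q \<cdot> s \<cdot> j = j" using E.B.reassoc[OF e(2), of j] q s j by simp
    have sq: "s \<cdot> j \<cdot> i \<cdot> q = s \<cdot> q"
      using E.B.reassoc[OF ji(1), of q] q s i j by simp
    have "split_coequalizer A (far R f) (far R g) q0 s0 t0"
      unfolding split_coequalizer_def
    proof (intro conjI)
      show "q0 \<cdot>\<^bsub>A\<^esub> far R f = q0 \<cdot>\<^bsub>A\<^esub> far R g"
        by (rule E.faithful) (use q0 f g fg e(1) q i in auto)
      show "q0 \<cdot>\<^bsub>A\<^esub> s0 = idt A (Cod A q0)"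
        by (rule E.faithful) (use q0 s0 q i s j qs ji f X in auto)
      show "far R f \<cdot>\<^bsub>A\<^esub> t0 = idt A (Cod A (far R f))"
        by (rule E.faithful) (use t0 f e(3) in auto)
      show "far R g \<cdot>\<^bsub>A\<^esub> t0 = s0 \<cdot>\<^bsub>A\<^esub> q0"
        by (rule E.faithful) (use t0 f g fg e(4) q0 s0 sq q s i j in auto)
    qed (use q0 s0 t0 f g fg in auto)
    from beck_coequalizerE[OF bk f g fg this] obtain c k where
      c: "coequalizer B f g c" "k \<in> hom A (Cod A q0) (fob R (Cod B c))" "is_iso A k" "k \<cdot>\<^bsub>A\<^esub> q0 = far R c"
      by metis
    have "far E k \<cdot> far E q0 = far E (far R c)"
      using c(2) q0(1) by (simp flip: c(4))
    then have "(far E k \<cdot> i) \<cdot> q = far E (far R c)"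
      using q0 c(2) i q by simp
    moreover have "is_iso A' (far E k \<cdot> i)"
      using E.B.iso_comp[OF E.far_iso[OF c(3)] ji(3)] c(2) q0 i by auto
    ultimately show "\<exists>c j. coequalizer B f g c \<and> j \<in> hom A' (Cod A' q) (fob (E \<circ>\<^sub>F R) (Cod B c)) \<and>
        is_iso A' j \<and> j \<cdot> q = far (E \<circ>\<^sub>F R) c"
      using c q0 i q by (intro exI[of _ c] exI[of _ "far E k \<cdot> i"]) auto
  qed
qed

text \<open>A coequalizer found in \<open>B\<close> need not lie in the image of \<open>P\<close>;
  an isomorphism \<open>i\<close> moves its object there, and \<open>d\<close> is the preimage of
  the quotient map followed by \<open>i\<close>.\<close>

lemma beck_pre:
  fixes B :: "('p, 'b) cat" (structure)
  assumes bk: "beck B A R" and P: "ff_eso_functor B' B P"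
  shows "beck B' A (R \<circ>\<^sub>F P)"
proof -
  interpret P: ff_eso_functor B' B P by fact
  interpret R: cat_functor B A R using beckD(1)[OF bk] .
  show ?thesis unfolding beck_def
  proof (intro conjI ballI allI impI)
    show "cat_functor B' A (R \<circ>\<^sub>F P)" by (rule comp_functor[OF P.cat_functor_axioms R.cat_functor_axioms])
  next
    fix X assume X: "X \<in> Ob A"
    obtain Y e where u: "universal_arrow A B R X Y e" using beckD(2)[OF bk X] by blast
    have e: "Y \<in> Ob B" "e \<in> hom A X (fob R Y)" using u by (auto simp: universal_arrow_def)
    obtain Y' i j where Y: "Y' \<in> Ob B'" and i: "i \<in> hom B Y (fob P Y')" and j: "j \<in> hom B (fob P Y') Y"
      and ji: "j \<cdot> i = idt B Y" "i \<cdot> j = idt B (fob P Y')" "is_iso B i"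
      using P.eso[OF e(1)] by metis
    have "universal_arrow A B' (R \<circ>\<^sub>F P) X Y' (far R i \<cdot>\<^bsub>A\<^esub> e)"
      unfolding universal_arrow_def
    proof (intro conjI ballI)
      fix Z f assume Z: "Z \<in> Ob B'" and f: "f \<in> hom A X (fob (R \<circ>\<^sub>F P) Z)"
      obtain h where h: "h \<in> hom B Y (fob P Z)" "far R h \<cdot>\<^bsub>A\<^esub> e = f"
        using universal_arrowE[OF u, of "fob P Z" f] Z f by auto
      obtain k where k: "k \<in> hom B' Y' Z" "far P k = h \<cdot> j"
        using P.full[of Y' Z "h \<cdot> j"] Y Z h j by auto
      show "\<exists>!h. h \<in> hom B' Y' Z \<and> far (R \<circ>\<^sub>F P) h \<cdot>\<^bsub>A\<^esub> far R i \<cdot>\<^bsub>A\<^esub> e = f"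
      proof (rule ex1I[of _ k])
        have "far R (far P k \<cdot> i) \<cdot>\<^bsub>A\<^esub> e = f" 
          unfolding k(2) using h i j ji R.B.reassoc by simp
        then show "k \<in> hom B' Y' Z \<and> far (R \<circ>\<^sub>F P) k \<cdot>\<^bsub>A\<^esub> far R i \<cdot>\<^bsub>A\<^esub> e = f" using k(1) i e by simp
        fix l assume l: "l \<in> hom B' Y' Z \<and> far (R \<circ>\<^sub>F P) l \<cdot>\<^bsub>A\<^esub> far R i \<cdot>\<^bsub>A\<^esub> e = f"
        have "far P l \<cdot> i = h"
          by (rule universal_arrow_unique[OF u R.cat_functor_axioms]) (use l h i e in auto)
        then have "far P l = far P k"
          using k(2) l i j ji P.B.assoc[of "far P l" i j] by auto
        then show "l = k" by (rule P.faithful[rotated -1]) (use l k in auto)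
      qed
    qed (use Y e i in auto)
    then show "\<exists>Y e. universal_arrow A B' (R \<circ>\<^sub>F P) X Y e" by blast
  next
    fix h assume "h \<in> Ar B'" "is_iso A (far (R \<circ>\<^sub>F P) h)"
    then show "is_iso B' h" using beckD(3)[OF bk] P.reflects_iso by auto
  next
    fix f g q s t
    assume f: "f \<in> Ar B'" and g: "g \<in> Ar B'" and fg: "Dom B' f = Dom B' g" "Cod B' f = Cod B' g"
      and sp: "split_coequalizer A (far (R \<circ>\<^sub>F P) f) (far (R \<circ>\<^sub>F P) g) q s t"
    have pfg: "far P f \<in> Ar B" "far P g \<in> Ar B" "Dom B (far P f) = Dom B (far P g)" "Cod B (far P f) = Cod B (far P g)"
      using f g fg by auto
    from sp have sp': "split_coequalizer A (far R (far P f)) (far R (far P g)) q s t" by simp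
    from beck_coequalizerE[OF bk pfg sp'] obtain c k where
      c: "coequalizer B (far P f) (far P g) c" "k \<in> hom A (Cod A q) (fob R (Cod B c))" "is_iso A k"
        "k \<cdot>\<^bsub>A\<^esub> q = far R c" by metis
    have q: "q \<in> Ar A" using sp by (simp add: split_coequalizer_def)
    have c': "c \<in> Ar B" "Dom B c = fob P (Cod B' f)" "c \<cdot> far P f = c \<cdot> far P g"
      using c(1) f by (auto simp: coequalizer_def)
    obtain Y i j where Y: "Y \<in> Ob B'" and i: "i \<in> hom B (Cod B c) (fob P Y)" and j: "j \<in> hom B (fob P Y) (Cod B c)"
      and ji: "j \<cdot> i = idt B (Cod B c)" "i \<cdot> j = idt B (fob P Y)" "is_iso B i"
      using P.eso[of "Cod B c"] c' by (metis P.B.Cod_ob)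
    obtain d where d: "d \<in> hom B' (Cod B' f) Y" "far P d = i \<cdot> c"
      using P.full[of "Cod B' f" Y "i \<cdot> c"] f Y i c' by auto
    have "coequalizer B' f g d" unfolding coequalizer_def
    proof (intro conjI ballI impI)
      show "d \<cdot>\<^bsub>B'\<^esub> f = d \<cdot>\<^bsub>B'\<^esub> g"
        by (rule P.faithful) (use d f g fg c' i in auto)
      fix z assume z: "z \<in> Ar B'" "Dom B' z = Cod B' f" "z \<cdot>\<^bsub>B'\<^esub> f = z \<cdot>\<^bsub>B'\<^esub> g"
      have "far P z \<cdot> far P f = far P z \<cdot> far P g"
        using arg_cong[OF z(3), of "far P"] z(1,2) f g fg by simp
      then obtain m where m: "m \<in> hom B (Cod B c) (fob P (Cod B' z))" "m \<cdot> c = far P z"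
        using coequalizerE[OF c(1), of "far P z"] z f by auto
      obtain n where n: "n \<in> hom B' Y (Cod B' z)" "far P n = m \<cdot> j"
        using P.full[of Y "Cod B' z" "m \<cdot> j"] Y z m j by auto
      have jic: "j \<cdot> i \<cdot> c = c" using P.B.reassoc[OF ji(1), of c] i j c' by simp
      show "\<exists>!k. k \<in> hom B' (Cod B' d) (Cod B' z) \<and> k \<cdot>\<^bsub>B'\<^esub> d = z"
      proof (rule ex1I[of _ n])
        have "n \<cdot>\<^bsub>B'\<^esub> d = z"
          by (rule P.faithful) (use n d z f m j i c' jic in auto)
        then show "n \<in> hom B' (Cod B' d) (Cod B' z) \<and> n \<cdot>\<^bsub>B'\<^esub> d = z" using n d by auto
        fix l assume l: "l \<in> hom B' (Cod B' d) (Cod B' z) \<and> l \<cdot>\<^bsub>B'\<^esub> d = z"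
        then have l': "l \<in> hom B' Y (Cod B' z)" "far P (l \<cdot>\<^bsub>B'\<^esub> d) = m \<cdot> c" using m d by auto
        then have "(far P l \<cdot> i) \<cdot> c = m \<cdot> c" using l'(1) d i c'(1,2) by simp
        then have "far P l \<cdot> i = m"
          by - (rule P.B.coequalizer_epi[OF c(1) pfg], use l d i m in auto)
        then have "far P l = far P n"
          using n(2) l d i j ji P.B.assoc[of "far P l" i j] by auto
        then show "l = n" by (rule P.faithful[rotated -1]) (use l n d in auto)
      qed
    qed (use d f in auto)
    moreover have "is_iso A (far R i \<cdot>\<^bsub>A\<^esub> k)"
      using R.B.iso_comp[OF R.far_iso[OF ji(3)] c(3)] c(2) i by auto
    moreover have "(far R i \<cdot>\<^bsub>A\<^esub> k) \<cdot>\<^bsub>A\<^esub> q = far R (far P d)"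
      unfolding d(2) using i c(2,4) c' q by simp
    ultimately show "\<exists>c j. coequalizer B' f g c \<and> j \<in> hom A (Cod A q) (fob (R \<circ>\<^sub>F P) (Cod B' c)) \<and>
        is_iso A j \<and> j \<cdot>\<^bsub>A\<^esub> q = far (R \<circ>\<^sub>F P) c"
      using c(2) i d by (intro exI[of _ d] exI[of _ "far R i \<cdot>\<^bsub>A\<^esub> k"]) auto
  qed
qed

text \<open>Universal arrows are composed with \<theta>, and split data for \<open>R'\<close> are
  conjugated by \<theta> and its inverse into split data for \<open>R\<close> with the same quotient
  object.\<close>

lemma beck_naturally_isomorphic:
  fixes A :: "('o, 'a) cat" (structure)
  assumes bk: "beck B A R" and iso: "naturally_isomorphic B A R R'"
  shows "beck B A R'"
proof -
  obtain \<theta> \<theta>' where th0: "\<And>X. X \<in> Ob B \<Longrightarrow> \<theta> X \<in> hom A (fob R X) (fob R' X)"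
    "\<And>X. X \<in> Ob B \<Longrightarrow> \<theta>' X \<in> hom A (fob R' X) (fob R X)"
    "\<And>X. X \<in> Ob B \<Longrightarrow> \<theta>' X \<cdot> \<theta> X = idt A (fob R X)"
    "\<And>X. X \<in> Ob B \<Longrightarrow> \<theta> X \<cdot> \<theta>' X = idt A (fob R' X)"
    and nat: "\<And>f. f \<in> Ar B \<Longrightarrow> \<theta> (Cod B f) \<cdot> far R f = far R' f \<cdot> \<theta> (Dom B f)"
    "\<And>f. f \<in> Ar B \<Longrightarrow> \<theta>' (Cod B f) \<cdot> far R' f = far R f \<cdot> \<theta>' (Dom B f)"
    and isos: "\<And>X. X \<in> Ob B \<Longrightarrow> is_iso A (\<theta> X)" "\<And>X. X \<in> Ob B \<Longrightarrow> is_iso A (\<theta>' X)"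
    and "cat_functor B A R" and "cat_functor B A R'"
    using naturally_isomorphicE[OF iso] by blast
  interpret R: cat_functor B A R by fact
  interpret R': cat_functor B A R' by fact
  have th [simp]: "\<theta> X \<in> Ar A" "Dom A (\<theta> X) = fob R X" "Cod A (\<theta> X) = fob R' X"
    "\<theta>' X \<in> Ar A" "Dom A (\<theta>' X) = fob R' X" "Cod A (\<theta>' X) = fob R X"
    "\<theta>' X \<cdot> \<theta> X = idt A (fob R X)" "\<theta> X \<cdot> \<theta>' X = idt A (fob R' X)" if "X \<in> Ob B" for X
    using th0 that by auto
  have th2 [simp]: "\<theta>' X \<cdot> \<theta> X \<cdot> f = f" if "X \<in> Ob B" "f \<in> Ar A" "Cod A f = fob R X" for X f
    using R.B.reassoc[of "\<theta>' X" "\<theta> X" _ f] that by simp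
  have th3 [simp]: "\<theta> X \<cdot> \<theta>' X \<cdot> f = f" if "X \<in> Ob B" "f \<in> Ar A" "Cod A f = fob R' X" for X f
    using R.B.reassoc[of "\<theta> X" "\<theta>' X" _ f] that by simp
  have nat': "\<theta> Y \<cdot> far R f \<cdot> x = far R' f \<cdot> \<theta> X \<cdot> x"
    if "f \<in> hom B X Y" "x \<in> Ar A" "Cod A x = fob R X" for f X Y x
    using R.B.reassoc[OF nat(1), of f x] that by auto
  show ?thesis unfolding beck_def
  proof (intro conjI ballI allI impI)
    show "cat_functor B A R'" by fact
  next
    fix X assume X: "X \<in> Ob A"
    obtain P e where u: "universal_arrow A B R X P e" using beckD(2)[OF bk X] by blast
    have e: "P \<in> Ob B" "e \<in> hom A X (fob R P)" using u by (auto simp: universal_arrow_def)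
    have "universal_arrow A B R' X P (\<theta> P \<cdot> e)"
      unfolding universal_arrow_def
    proof (intro conjI ballI)
      fix Z f assume Z: "Z \<in> Ob B" and f: "f \<in> hom A X (fob R' Z)"
      have eq: "far R h \<cdot> e = \<theta>' Z \<cdot> f \<longleftrightarrow> far R' h \<cdot> \<theta> P \<cdot> e = f" if h: "h \<in> hom B P Z" for h
      proof -
        have 1: "far R' h \<cdot> \<theta> P \<cdot> e = \<theta> Z \<cdot> far R h \<cdot> e" using nat'[OF h, of e] e by simp
        have 2: "\<theta>' Z \<cdot> \<theta> Z \<cdot> far R h \<cdot> e = far R h \<cdot> e" using h e Z by simp
        have 3: "\<theta> Z \<cdot> \<theta>' Z \<cdot> f = f" using f Z by simp
        show ?thesis unfolding 1 using 2 3 by metis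
      qed
      have "\<exists>!h. h \<in> hom B P Z \<and> far R h \<cdot> e = \<theta>' Z \<cdot> f"
        using u Z f by (simp add: universal_arrow_def)
      then show "\<exists>!h. h \<in> hom B P Z \<and> far R' h \<cdot> \<theta> P \<cdot> e = f"
        using eq by (metis (no_types, lifting))
    qed (use e in auto)
    then show "\<exists>P e. universal_arrow A B R' X P e" by blast
  next
    fix h assume h: "h \<in> Ar B" "is_iso A (far R' h)"
    have "far R h = \<theta>' (Cod B h) \<cdot> far R' h \<cdot> \<theta> (Dom B h)"
      using nat(1)[of h] h th2[of "Cod B h" "far R h"] by simp
    then have "is_iso A (far R h)" using h isos by (auto intro!: R.B.iso_comp)
    then show "is_iso B h" using beckD(3)[OF bk] h by auto
  next
    fix f g q s t
    assume f: "f \<in> Ar B" and g: "g \<in> Ar B" and fg: "Dom B f = Dom B g" "Cod B f = Cod B g"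
      and sp: "split_coequalizer A (far R' f) (far R' g) q s t"
    define P Q X where "P = Dom B f" and "Q = Cod B f" and "X = Cod A q"
    have ob: "P \<in> Ob B" "Q \<in> Ob B" "X \<in> Ob A" and fP: "f \<in> hom B P Q" "g \<in> hom B P Q"
      using f g fg sp by (auto simp: P_def Q_def X_def split_coequalizer_def)
    have q: "q \<in> Ar A" "Dom A q = fob R' Q" "Cod A q = X" and s: "s \<in> Ar A" "Dom A s = X" "Cod A s = fob R' Q"
      and t: "t \<in> Ar A" "Dom A t = fob R' Q" "Cod A t = fob R' P"
      and e: "q \<cdot> far R' f = q \<cdot> far R' g" "q \<cdot> s = idt A X"
        "far R' f \<cdot> t = idt A (fob R' Q)" "far R' g \<cdot> t = s \<cdot> q"
      using f g fP sp by (auto simp: X_def split_coequalizer_def)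
    have n1: "\<theta>' Q \<cdot> far R' h \<cdot> x = far R h \<cdot> \<theta>' P \<cdot> x"
      if "h \<in> hom B P Q" "x \<in> Ar A" "Cod A x = fob R' P" for h x
      using R.B.reassoc[OF nat(2), of h x] that ob by auto
    have "split_coequalizer A (far R f) (far R g) (q \<cdot> \<theta> Q) (\<theta>' Q \<cdot> s) (\<theta>' P \<cdot> t \<cdot> \<theta> Q)"
      unfolding split_coequalizer_def
    proof (intro conjI)
      have "q \<cdot> \<theta> Q \<cdot> far R f = q \<cdot> \<theta> Q \<cdot> far R g"
        using nat(1)[OF f] nat(1)[OF g] R.B.reassoc[OF e(1), of "\<theta> P"] fP q ob by simp
      then show "(q \<cdot> \<theta> Q) \<cdot> far R f = (q \<cdot> \<theta> Q) \<cdot> far R g" using fP q ob by simp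
      show "(q \<cdot> \<theta> Q) \<cdot> \<theta>' Q \<cdot> s = idt A (Cod A (q \<cdot> \<theta> Q))"
        using q s ob e(2) by simp
      show "far R f \<cdot> \<theta>' P \<cdot> t \<cdot> \<theta> Q = idt A (Cod A (far R f))"
        using n1[OF fP(1), of "t \<cdot> \<theta> Q"] R.B.reassoc[OF e(3), of "\<theta> Q"] fP t ob by simp
      show "far R g \<cdot> \<theta>' P \<cdot> t \<cdot> \<theta> Q = (\<theta>' Q \<cdot> s) \<cdot> q \<cdot> \<theta> Q"
        using n1[OF fP(2), of "t \<cdot> \<theta> Q"] R.B.reassoc[OF e(4), of "\<theta> Q"] fP t s q ob by simp
    qed (use fP q s t ob in auto)
    from beck_coequalizerE[OF bk f g fg this] obtain c k where
      c: "coequalizer B f g c" "k \<in> hom A X (fob R (Cod B c))" "is_iso A k" "k \<cdot> q \<cdot> \<theta> Q = far R c"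
      using q ob by auto
    have c': "c \<in> Ar B" "Dom B c = Q" using c(1) by (auto simp: coequalizer_def Q_def)
    have "((\<theta> (Cod B c) \<cdot> k) \<cdot> q) \<cdot> \<theta> Q = far R' c \<cdot> \<theta> Q"
      using c(2,4) c' q ob nat(1)[of c] by simp
    then have "(\<theta> (Cod B c) \<cdot> k) \<cdot> q = far R' c"
      by - (rule R.B.iso_cancel_right[OF isos(1)[OF ob(2)]], use c(2) c' q ob in auto)
    moreover have "is_iso A (\<theta> (Cod B c) \<cdot> k)" using c c' isos by (auto intro!: R.B.iso_comp)
    ultimately show "\<exists>c j. coequalizer B f g c \<and> j \<in> hom A (Cod A q) (fob R' (Cod B c)) \<and>
        is_iso A j \<and> j \<cdot> q = far R' c"
      using c c' q by (intro exI[of _ c] exI[of _ "\<theta> (Cod B c) \<cdot> k"]) auto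
  qed
qed

section \<open>Pullbacks, products and terminal objects\<close>

text \<open>Inherited by slices, which is how the choice-free form of the Frobenius condition is
  reached there.\<close>

definition has_pullbacks :: "('o, 'a) cat \<Rightarrow> bool" where
  "has_pullbacks C \<longleftrightarrow> (\<forall>f \<in> Ar C. \<forall>g \<in> Ar C. Cod C f = Cod C g \<longrightarrow> (\<exists>p q. is_pullback C f g p q))"

lemma pullbackD:
  assumes "is_pullback C f g p q"
  shows "p \<in> Ar C" "q \<in> Ar C" "Dom C q = Dom C p" "Cod C p = Dom C f" "Cod C q = Dom C g"
    "f \<cdot>\<^bsub>C\<^esub> p = g \<cdot>\<^bsub>C\<^esub> q"
  using assms unfolding is_pullback_def by auto

lemma pullbackE:
  assumes "is_pullback C f g p q" "u \<in> hom C Z (Dom C f)" "v \<in> hom C Z (Dom C g)" "f \<cdot>\<^bsub>C\<^esub> u = g \<cdot>\<^bsub>C\<^esub> v"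
  obtains h where "h \<in> hom C Z (Dom C p)" "p \<cdot>\<^bsub>C\<^esub> h = u" "q \<cdot>\<^bsub>C\<^esub> h = v"
  using assms unfolding is_pullback_def by blast

lemma productD:
  assumes "is_product C X Y p q"
  shows "p \<in> Ar C" "q \<in> Ar C" "Dom C q = Dom C p" "Cod C p = X" "Cod C q = Y"
  using assms unfolding is_product_def by auto

lemma productE:
  assumes "is_product C X Y p q" "u \<in> hom C Z X" "v \<in> hom C Z Y"
  obtains h where "h \<in> hom C Z (Dom C p)" "p \<cdot>\<^bsub>C\<^esub> h = u" "q \<cdot>\<^bsub>C\<^esub> h = v"
  using assms unfolding is_product_def by blast

lemma pullbackI:
  assumes "p \<in> Ar C" "q \<in> Ar C" "Dom C q = Dom C p" "Cod C p = Dom C f" "Cod C q = Dom C g"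
    "f \<cdot>\<^bsub>C\<^esub> p = g \<cdot>\<^bsub>C\<^esub> q"
    "\<And>Z u v. \<lbrakk>u \<in> hom C Z (Dom C f); v \<in> hom C Z (Dom C g); f \<cdot>\<^bsub>C\<^esub> u = g \<cdot>\<^bsub>C\<^esub> v\<rbrakk> \<Longrightarrow>
      \<exists>h. h \<in> hom C Z (Dom C p) \<and> p \<cdot>\<^bsub>C\<^esub> h = u \<and> q \<cdot>\<^bsub>C\<^esub> h = v"
    "\<And>Z h h'. \<lbrakk>h \<in> hom C Z (Dom C p); h' \<in> hom C Z (Dom C p); p \<cdot>\<^bsub>C\<^esub> h = p \<cdot>\<^bsub>C\<^esub> h';
      q \<cdot>\<^bsub>C\<^esub> h = q \<cdot>\<^bsub>C\<^esub> h'\<rbrakk> \<Longrightarrow> h = h'"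
  shows "is_pullback C f g p q"
  unfolding is_pullback_def
proof (intro conjI allI ballI impI)
  fix Z u v assume "u \<in> hom C Z (Dom C f)" "v \<in> hom C Z (Dom C g)" "f \<cdot>\<^bsub>C\<^esub> u = g \<cdot>\<^bsub>C\<^esub> v"
  then obtain h where h: "h \<in> hom C Z (Dom C p)" "p \<cdot>\<^bsub>C\<^esub> h = u" "q \<cdot>\<^bsub>C\<^esub> h = v"
    using assms(7) by blast
  show "\<exists>!h. h \<in> hom C Z (Dom C p) \<and> p \<cdot>\<^bsub>C\<^esub> h = u \<and> q \<cdot>\<^bsub>C\<^esub> h = v"
  proof (rule ex1I[of _ h])
    fix h' assume "h' \<in> hom C Z (Dom C p) \<and> p \<cdot>\<^bsub>C\<^esub> h' = u \<and> q \<cdot>\<^bsub>C\<^esub> h' = v"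
    then show "h' = h" using h assms(8)[of h' Z h] by metis
  qed (use h in simp)
qed (use assms(1-6) in simp_all)

context category
begin

lemma pullback_eqI:
  assumes "is_pullback C f g p q" "h \<in> Ar C" "h' \<in> Ar C" "Dom C h = Dom C h'" "Cod C h = Dom C p"
    "Cod C h' = Dom C p" "p \<cdot> h = p \<cdot> h'" "q \<cdot> h = q \<cdot> h'" "f \<in> Ar C" "g \<in> Ar C"
  shows "h = h'"
proof -
  note pq = pullbackD[OF assms(1)]
  have "\<exists>!k. k \<in> hom C (Dom C h) (Dom C p) \<and> p \<cdot> k = p \<cdot> h \<and> q \<cdot> k = q \<cdot> h"
  proof -
    have "f \<cdot> p \<cdot> h = g \<cdot> q \<cdot> h" using reassoc[OF pq(6), of h] pq assms by simp
    moreover have "p \<cdot> h \<in> hom C (Dom C h) (Dom C f)" "q \<cdot> h \<in> hom C (Dom C h) (Dom C g)"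
      using pq assms by auto
    ultimately show ?thesis using assms(1) unfolding is_pullback_def by blast
  qed
  then show ?thesis using assms by auto
qed

lemma product_eqI:
  assumes "is_product C X Y p q" "h \<in> Ar C" "h' \<in> Ar C" "Dom C h = Dom C h'" "Cod C h = Dom C p"
    "Cod C h' = Dom C p" "p \<cdot> h = p \<cdot> h'" "q \<cdot> h = q \<cdot> h'"
  shows "h = h'"
proof -
  note pq = productD[OF assms(1)]
  have "p \<cdot> h \<in> hom C (Dom C h) X" "q \<cdot> h \<in> hom C (Dom C h) Y" using pq assms by auto
  then have "\<exists>!k. k \<in> hom C (Dom C h) (Dom C p) \<and> p \<cdot> k = p \<cdot> h \<and> q \<cdot> k = q \<cdot> h"
    using assms(1) unfolding is_product_def by blast
  then show ?thesis using assms by auto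
qed

lemma pullback_iso:
  assumes pb: "is_pullback C f g p q" "is_pullback C f g p' q'" and fg: "f \<in> Ar C" "g \<in> Ar C"
  obtains k where "k \<in> hom C (Dom C p') (Dom C p)" "is_iso C k" "p \<cdot> k = p'" "q \<cdot> k = q'"
proof -
  note d = pullbackD[OF pb(1)] and d' = pullbackD[OF pb(2)]
  obtain k where k: "k \<in> hom C (Dom C p') (Dom C p)" "p \<cdot> k = p'" "q \<cdot> k = q'"
    using pullbackE[OF pb(1), of p' "Dom C p'" q'] d' by auto
  obtain l where l: "l \<in> hom C (Dom C p) (Dom C p')" "p' \<cdot> l = p" "q' \<cdot> l = q"
    using pullbackE[OF pb(2), of p "Dom C p" q] d by auto
  have pk: "p \<cdot> k \<cdot> x = p' \<cdot> x" "q \<cdot> k \<cdot> x = q' \<cdot> x" if "x \<in> Ar C" "Cod C x = Dom C p'" for x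
    using reassoc[OF k(2), of x] reassoc[OF k(3), of x] d k that by simp_all
  have pl: "p' \<cdot> l \<cdot> x = p \<cdot> x" "q' \<cdot> l \<cdot> x = q \<cdot> x" if "x \<in> Ar C" "Cod C x = Dom C p" for x
    using reassoc[OF l(2), of x] reassoc[OF l(3), of x] d' l that by simp_all
  have "is_iso C k"
  proof (rule is_isoI[OF k(1) l(1)])
    show "l \<cdot> k = idt C (Dom C p')"
      by (rule pullback_eqI[OF pb(2)]) (use k l d d' fg pl in auto)
    show "k \<cdot> l = idt C (Dom C p)"
      by (rule pullback_eqI[OF pb(1)]) (use k l d d' fg pk in auto)
  qed
  with k that show thesis by blast
qed

lemma pullback_precomp_iso:
  assumes pb: "is_pullback C f g p q" and fg: "f \<in> Ar C" "g \<in> Ar C" "Cod C f = Cod C g"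
    and k: "is_iso C k" "Cod C k = Dom C p"
  shows "is_pullback C f g (p \<cdot> k) (q \<cdot> k)"
proof -
  note d = pullbackD[OF pb]
  have k': "k \<in> Ar C" using k by (simp add: is_iso_def)
  obtain l where l: "l \<in> hom C (Dom C p) (Dom C k)" "l \<cdot> k = idt C (Dom C k)" "k \<cdot> l = idt C (Dom C p)"
    using is_isoE[OF k(1)] k k' by auto
  show ?thesis
  proof (rule pullbackI)
    show "f \<cdot> p \<cdot> k = g \<cdot> q \<cdot> k" using reassoc[OF d(6), of k] d k k' fg by simp
  next
    fix Z u v assume "u \<in> hom C Z (Dom C f)" "v \<in> hom C Z (Dom C g)" "f \<cdot> u = g \<cdot> v"
    then obtain h where h: "h \<in> hom C Z (Dom C p)" "p \<cdot> h = u" "q \<cdot> h = v"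
      using pullbackE[OF pb] by metis
    have "k \<cdot> l \<cdot> h = h" using reassoc[OF l(3), of h] l k k' h by simp
    then show "\<exists>h. h \<in> hom C Z (Dom C (p \<cdot> k)) \<and> (p \<cdot> k) \<cdot> h = u \<and> (q \<cdot> k) \<cdot> h = v"
      using h l k k' d by (intro exI[of _ "l \<cdot> h"]) auto
  next
    fix Z h h' assume h: "h \<in> hom C Z (Dom C (p \<cdot> k))" "h' \<in> hom C Z (Dom C (p \<cdot> k))"
      "(p \<cdot> k) \<cdot> h = (p \<cdot> k) \<cdot> h'" "(q \<cdot> k) \<cdot> h = (q \<cdot> k) \<cdot> h'"
    have hh: "h \<in> Ar C" "h' \<in> Ar C" "Dom C h = Dom C h'" "Cod C h = Dom C k" "Cod C h' = Dom C k"
      using h d k k' by auto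
    have "p \<cdot> k \<cdot> h = p \<cdot> k \<cdot> h'" "q \<cdot> k \<cdot> h = q \<cdot> k \<cdot> h'" using h(3,4) hh d k k' by simp_all
    then have "k \<cdot> h = k \<cdot> h'"
      by - (rule pullback_eqI[OF pb], use hh d k k' fg in simp_all)
    then show "h = h'"
      by - (rule iso_cancel_left[OF k(1)], use hh in simp_all)
  qed (use d k k' in simp_all)
qed

text \<open>With \<open>h\<close> the comparison into a chosen product, invertibility of
  \<open>h\<close> becomes a universal property of the two composites, in which the choice no longer
  appears.\<close>

lemma product_comparison_iso_iff:
  assumes pr: "is_product C X Y p q" and h: "h \<in> Ar C" "Cod C h = Dom C p"
  shows "is_iso C h \<longleftrightarrow> is_product C X Y (p \<cdot> h) (q \<cdot> h)"
proof
  note d = productD[OF pr]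
  assume iso: "is_iso C h"
  obtain l where l: "l \<in> hom C (Dom C p) (Dom C h)" "l \<cdot> h = idt C (Dom C h)" "h \<cdot> l = idt C (Dom C p)"
    using is_isoE[OF iso] h by auto
  show "is_product C X Y (p \<cdot> h) (q \<cdot> h)" unfolding is_product_def
  proof (intro conjI allI ballI)
    fix Z u v assume "u \<in> hom C Z X" "v \<in> hom C Z Y"
    then obtain k where k: "k \<in> hom C Z (Dom C p)" "p \<cdot> k = u" "q \<cdot> k = v"
      using productE[OF pr] by metis
    have hl: "h \<cdot> l \<cdot> k = k" using reassoc[OF l(3), of k] l h k by simp
    show "\<exists>!k. k \<in> hom C Z (Dom C (p \<cdot> h)) \<and> (p \<cdot> h) \<cdot> k = u \<and> (q \<cdot> h) \<cdot> k = v"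
    proof (rule ex1I[of _ "l \<cdot> k"])
      show "l \<cdot> k \<in> hom C Z (Dom C (p \<cdot> h)) \<and> (p \<cdot> h) \<cdot> l \<cdot> k = u \<and> (q \<cdot> h) \<cdot> l \<cdot> k = v"
        using k l h d hl by auto
      fix m assume m: "m \<in> hom C Z (Dom C (p \<cdot> h)) \<and> (p \<cdot> h) \<cdot> m = u \<and> (q \<cdot> h) \<cdot> m = v"
      then have m': "m \<in> hom C Z (Dom C h)" "p \<cdot> h \<cdot> m = p \<cdot> k" "q \<cdot> h \<cdot> m = q \<cdot> k" using h d k by auto
      have "h \<cdot> m = k" by (rule product_eqI[OF pr]) (use m' h d k in auto)
      then show "m = l \<cdot> k" using reassoc[OF l(2), of m] l h m'(1) by auto
    qed
  qed (use d h in auto)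
next
  note d = productD[OF pr]
  assume pr': "is_product C X Y (p \<cdot> h) (q \<cdot> h)"
  obtain l where l: "l \<in> hom C (Dom C p) (Dom C h)" "(p \<cdot> h) \<cdot> l = p" "(q \<cdot> h) \<cdot> l = q"
    using productE[OF pr', of p "Dom C p" q] d h by auto
  have l': "p \<cdot> h \<cdot> l = p" "q \<cdot> h \<cdot> l = q" using l d h by auto
  have hl: "h \<cdot> l = idt C (Dom C p)" by (rule product_eqI[OF pr]) (use l l' h d in auto)
  show "is_iso C h"
  proof (rule is_isoI[of h "Dom C h" "Dom C p" l])
    show "l \<cdot> h = idt C (Dom C h)"
      by (rule product_eqI[OF pr']) (use l h d reassoc[OF hl, of h] in auto)
  qed (use h l hl in auto)
qed

end

section \<open>Terminal objects, pullbacks and products from finite limits\<close>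

definition empty_shape :: "(nat, nat) cat" where
  "empty_shape = \<lparr>Ob = {}, Ar = {}, Dom = id, Cod = id, idt = id, cmp = (\<lambda>_ f. f)\<rparr>"

text \<open>The cospan \<open>3 : 0 \<rightarrow> 2\<close>, \<open>4 : 1 \<rightarrow> 2\<close>; the objects are their own identities.\<close>

definition cospan_shape :: "(nat, nat) cat" where
  "cospan_shape = \<lparr>Ob = {0, 1, 2}, Ar = {0, 1, 2, 3, 4},
    Dom = (\<lambda>u. if u = 3 then 0 else if u = 4 then 1 else u), Cod = (\<lambda>u. if u > 2 then 2 else u),
    idt = id, cmp = (\<lambda>v u. if v \<le> 2 then u else v)\<rparr>"

lemma category_cospan_shape: "category cospan_shape"
  unfolding cospan_shape_def by standard auto

locale finite_limits = category C for C :: "('o, 'a) cat" (structure) +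
  assumes finite_limits: "has_finite_limits C"
begin

lemma terminal_exists: "\<exists>T. is_terminal C T"
proof -
  have "category empty_shape" by standard (auto simp: empty_shape_def)
  \<comment> \<open>There is nothing in the shape at which these values are taken.\<close>
  then have "cat_functor empty_shape C \<lparr>fob = undefined, far = undefined\<rparr>"
    by (rule cat_functorI[OF _ category_axioms]) (auto simp: empty_shape_def)
  then obtain X \<pi> where "limit_cone empty_shape C \<lparr>fob = undefined, far = undefined\<rparr> X \<pi>"
    using finite_limits unfolding has_finite_limits_def by (force simp: empty_shape_def)
  then show ?thesis
    unfolding limit_cone_def is_terminal_def
    by (intro exI[of _ X]) (simp add: Let_def empty_shape_def)
qed

text \<open>The legs of the limit at \<open>0\<close> and \<open>1\<close> serve as projections; a
  cone over the cospan is determined by these two, its leg at the vertex \<open>2\<close> being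
  their common composite.\<close>

lemma pullback_exists:
  assumes fg: "f \<in> Ar C" "g \<in> Ar C" "Cod C f = Cod C g"
  shows "\<exists>p q. is_pullback C f g p q"
proof -
  define F where "F = \<lparr>fob = (\<lambda>j::nat. if j = 0 then Dom C f else if j = 1 then Dom C g else Cod C f),
    far = (\<lambda>u::nat. if u = 3 then f else if u = 4 then g else
      idt C (if u = 0 then Dom C f else if u = 1 then Dom C g else Cod C f))\<rparr>"
  have "cat_functor cospan_shape C F"
  proof (rule cat_functorI[OF category_cospan_shape category_axioms])
    have Ar: "u = 0 \<or> u = 1 \<or> u = 2 \<or> u = 3 \<or> u = 4" if "u \<in> Ar cospan_shape" for u
      using that by (simp add: cospan_shape_def)
    show "far F u \<in> hom C (fob F (Dom cospan_shape u)) (fob F (Cod cospan_shape u))"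
      if "u \<in> Ar cospan_shape" for u
      using Ar[OF that] fg by (elim disjE) (simp_all add: cospan_shape_def F_def)
    show "far F (v \<cdot>\<^bsub>cospan_shape\<^esub> u) = far F v \<cdot> far F u"
      if "u \<in> Ar cospan_shape" "v \<in> Ar cospan_shape" "Dom cospan_shape v = Cod cospan_shape u" for u v
      using Ar[OF that(1)] Ar[OF that(2)] that(3) fg
      by (elim disjE) (simp_all add: cospan_shape_def F_def)
  qed (use fg in \<open>auto simp: cospan_shape_def F_def\<close>)
  moreover have "finite (Ob cospan_shape)" "finite (Ar cospan_shape)" by (auto simp: cospan_shape_def)
  ultimately obtain X \<pi> where lim: "limit_cone cospan_shape C F X \<pi>"
    using finite_limits unfolding has_finite_limits_def by blast
  have cone_iff: "(\<forall>j \<in> Ob cospan_shape. \<sigma> j \<in> hom C Y (fob F j)) \<and>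
      (\<forall>u \<in> Ar cospan_shape. far F u \<cdot> \<sigma> (Dom cospan_shape u) = \<sigma> (Cod cospan_shape u)) \<longleftrightarrow>
    \<sigma> 0 \<in> hom C Y (Dom C f) \<and> \<sigma> 1 \<in> hom C Y (Dom C g) \<and> \<sigma> 2 = f \<cdot> \<sigma> 0 \<and> \<sigma> 2 = g \<cdot> \<sigma> 1"
    for Y \<sigma>
    using fg by (auto simp: cospan_shape_def F_def)
  have pi: "\<pi> 0 \<in> hom C X (Dom C f)" "\<pi> 1 \<in> hom C X (Dom C g)" "\<pi> 2 = f \<cdot> \<pi> 0" "\<pi> 2 = g \<cdot> \<pi> 1"
    using lim[unfolded limit_cone_def Let_def] cone_iff[of \<pi> X] by blast+
  have lim': "\<exists>!h. h \<in> hom C Y X \<and> (\<forall>j \<in> Ob cospan_shape. \<pi> j \<cdot> h = \<sigma> j)"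
    if "Y \<in> Ob C" "(\<forall>j \<in> Ob cospan_shape. \<sigma> j \<in> hom C Y (fob F j)) \<and>
      (\<forall>u \<in> Ar cospan_shape. far F u \<cdot> \<sigma> (Dom cospan_shape u) = \<sigma> (Cod cospan_shape u))" for Y \<sigma>
    using lim[unfolded limit_cone_def Let_def] that by blast
  have univ: "\<exists>!h. h \<in> hom C Y X \<and> \<pi> 0 \<cdot> h = u \<and> \<pi> 1 \<cdot> h = v"
    if uv: "u \<in> hom C Y (Dom C f)" "v \<in> hom C Y (Dom C g)" "f \<cdot> u = g \<cdot> v" for Y u v
  proof -
    let ?s = "\<lambda>j::nat. if j = 0 then u else if j = 1 then v else f \<cdot> u"
    have "Y \<in> Ob C" using uv(1) by auto
    moreover have "(\<forall>j \<in> Ob cospan_shape. ?s j \<in> hom C Y (fob F j)) \<and>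
      (\<forall>w \<in> Ar cospan_shape. far F w \<cdot> ?s (Dom cospan_shape w) = ?s (Cod cospan_shape w))"
      by (rule cone_iff[of ?s Y, THEN iffD2]) (use uv in simp)
    ultimately have ex: "\<exists>!h. h \<in> hom C Y X \<and> (\<forall>j \<in> Ob cospan_shape. \<pi> j \<cdot> h = ?s j)"
      by (rule lim')
    have "(h \<in> hom C Y X \<and> (\<forall>j \<in> Ob cospan_shape. \<pi> j \<cdot> h = ?s j)) \<longleftrightarrow>
        (h \<in> hom C Y X \<and> \<pi> 0 \<cdot> h = u \<and> \<pi> 1 \<cdot> h = v)" for h
      using pi fg assoc[of f "\<pi> 0" h] by (auto simp: cospan_shape_def)
    with ex show ?thesis by simp
  qed
  have "is_pullback C f g (\<pi> 0) (\<pi> 1)"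
    unfolding is_pullback_def
  proof (intro conjI allI ballI impI)
    fix Z u v assume "u \<in> hom C Z (Dom C f)" "v \<in> hom C Z (Dom C g)" "f \<cdot> u = g \<cdot> v"
    then show "\<exists>!h. h \<in> hom C Z (Dom C (\<pi> 0)) \<and> \<pi> 0 \<cdot> h = u \<and> \<pi> 1 \<cdot> h = v"
      using univ[of u Z v] pi(1) by simp
  qed (use pi in simp_all)
  then show ?thesis by blast
qed

lemma has_pullbacks: "has_pullbacks C"
  unfolding has_pullbacks_def using pullback_exists by blast

lemma chosen_pullback:
  assumes "f \<in> Ar C" "g \<in> Ar C" "Cod C f = Cod C g"
  shows "is_pullback C f g (pb1 C f g) (pb2 C f g)"
  unfolding pb1_def pb2_def
  by (rule someI_ex[of "\<lambda>pq. is_pullback C f g (fst pq) (snd pq)"]) (use pullback_exists[OF assms] in auto)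

lemma pb_Ar [simp]:
  assumes "f \<in> Ar C" "g \<in> Ar C" "Cod C f = Cod C g"
  shows "pb1 C f g \<in> Ar C" "pb2 C f g \<in> Ar C" "Dom C (pb2 C f g) = Dom C (pb1 C f g)"
    "Cod C (pb1 C f g) = Dom C f" "Cod C (pb2 C f g) = Dom C g"
  using pullbackD[OF chosen_pullback[OF assms]] by auto

lemma pb_comm: "\<lbrakk>f \<in> Ar C; g \<in> Ar C; Cod C f = Cod C g\<rbrakk> \<Longrightarrow> f \<cdot> pb1 C f g = g \<cdot> pb2 C f g"
  using pullbackD(6)[OF chosen_pullback] .

lemma pb_pair:
  assumes "f \<in> Ar C" "g \<in> Ar C" "Cod C f = Cod C g" "u \<in> Ar C" "v \<in> Ar C" "Dom C u = Dom C v"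
    "Cod C u = Dom C f" "Cod C v = Dom C g" "f \<cdot> u = g \<cdot> v"
  shows "pb_pair C f g u v \<in> hom C (Dom C u) (Dom C (pb1 C f g)) \<and>
    pb1 C f g \<cdot> pb_pair C f g u v = u \<and> pb2 C f g \<cdot> pb_pair C f g u v = v"
  unfolding pb_pair_def
  by (rule theI') (use chosen_pullback[OF assms(1-3)] assms in \<open>auto simp: is_pullback_def\<close>)

lemma pb_pair_simps [simp]:
  assumes "f \<in> Ar C" "g \<in> Ar C" "Cod C f = Cod C g" "u \<in> Ar C" "v \<in> Ar C" "Dom C u = Dom C v"
    "Cod C u = Dom C f" "Cod C v = Dom C g" "f \<cdot> u = g \<cdot> v"
  shows "pb_pair C f g u v \<in> Ar C" "Dom C (pb_pair C f g u v) = Dom C v"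
    "Cod C (pb_pair C f g u v) = Dom C (pb1 C f g)"
    "pb1 C f g \<cdot> pb_pair C f g u v = u" "pb2 C f g \<cdot> pb_pair C f g u v = v"
  using pb_pair[OF assms] assms by auto

lemma pb_eqI:
  assumes "h \<in> Ar C" "h' \<in> Ar C" "Dom C h = Dom C h'" "Cod C h = Dom C (pb1 C f g)"
    "Cod C h' = Dom C (pb1 C f g)" "pb1 C f g \<cdot> h = pb1 C f g \<cdot> h'" "pb2 C f g \<cdot> h = pb2 C f g \<cdot> h'"
    "f \<in> Ar C" "g \<in> Ar C" "Cod C f = Cod C g"
  shows "h = h'"
  by (rule pullback_eqI[OF chosen_pullback[OF assms(8-10)]]) (use assms in auto)

lemma pb_pair_comp:
  assumes "f \<in> Ar C" "g \<in> Ar C" "Cod C f = Cod C g" "u \<in> Ar C" "v \<in> Ar C" "Dom C u = Dom C v"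
    "Cod C u = Dom C f" "Cod C v = Dom C g" "f \<cdot> u = g \<cdot> v" "k \<in> Ar C" "Cod C k = Dom C v"
  shows "pb_pair C f g u v \<cdot> k = pb_pair C f g (u \<cdot> k) (v \<cdot> k)"
proof -
  have fuk: "f \<cdot> u \<cdot> k = g \<cdot> v \<cdot> k" using reassoc[OF assms(9), of k] assms by simp
  show ?thesis
  proof (rule pb_eqI)
    show "pb1 C f g \<cdot> pb_pair C f g u v \<cdot> k = pb1 C f g \<cdot> pb_pair C f g (u \<cdot> k) (v \<cdot> k)"
      using reassoc[of "pb1 C f g" "pb_pair C f g u v" u k] assms fuk by simp
    show "pb2 C f g \<cdot> pb_pair C f g u v \<cdot> k = pb2 C f g \<cdot> pb_pair C f g (u \<cdot> k) (v \<cdot> k)"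
      using reassoc[of "pb2 C f g" "pb_pair C f g u v" v k] assms fuk by simp
  qed (use assms fuk in auto)
qed

lemma pb_pair_pb [simp]: "\<lbrakk>f \<in> Ar C; g \<in> Ar C; Cod C f = Cod C g\<rbrakk> \<Longrightarrow>
    pb_pair C f g (pb1 C f g) (pb2 C f g) = idt C (Dom C (pb1 C f g))"
  by (rule pb_eqI[of _ _ f g]) (simp_all add: pb_comm)

lemma terminal: "is_terminal C (terminal_ob C)"
  unfolding terminal_ob_def using terminal_exists by (rule someI_ex)

lemma terminal_in [simp]: "terminal_ob C \<in> Ob C"
  using terminal by (simp add: is_terminal_def)

lemma bang_in [simp]: "X \<in> Ob C \<Longrightarrow> bang C X \<in> Ar C" "X \<in> Ob C \<Longrightarrow> Dom C (bang C X) = X"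
  "X \<in> Ob C \<Longrightarrow> Cod C (bang C X) = terminal_ob C"
proof -
  assume X: "X \<in> Ob C"
  have "bang C X \<in> hom C X (terminal_ob C)"
    unfolding bang_def by (rule theI') (use terminal X in \<open>auto simp: is_terminal_def\<close>)
  then show "bang C X \<in> Ar C" "Dom C (bang C X) = X" "Cod C (bang C X) = terminal_ob C" by auto
qed

lemma bang_unique: "\<lbrakk>f \<in> Ar C; g \<in> Ar C; Dom C f = Dom C g; Cod C f = terminal_ob C; Cod C g = terminal_ob C\<rbrakk> \<Longrightarrow> f = g"
  using terminal unfolding is_terminal_def by (metis Dom_ob mem_hom)

lemma terminal_pullback_product:
  assumes "f \<in> hom C X (terminal_ob C)" "g \<in> hom C Y (terminal_ob C)"
  shows "is_pullback C f g p q \<longleftrightarrow> is_product C X Y p q"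
proof -
  have "f \<cdot> u = g \<cdot> v" if "u \<in> hom C Z X" "v \<in> hom C Z Y" for u v Z
    by (rule bang_unique) (use that assms in auto)
  with assms show ?thesis
    unfolding is_pullback_def is_product_def by auto
qed

lemma chosen_product:
  assumes "X \<in> Ob C" "Y \<in> Ob C"
  shows "is_product C X Y (prd1 C X Y) (prd2 C X Y)"
proof -
  obtain p q where "is_pullback C (bang C X) (bang C Y) p q" using pullback_exists[of "bang C X" "bang C Y"] assms by auto
  then have "is_product C X Y p q" using terminal_pullback_product[of "bang C X" X "bang C Y" Y] assms by auto
  then show ?thesis
    unfolding prd1_def prd2_def
    by (intro someI_ex[of "\<lambda>pq. is_product C X Y (fst pq) (snd pq)"]) auto
qed

lemma prd_Ar [simp]:
  assumes "X \<in> Ob C" "Y \<in> Ob C"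
  shows "prd1 C X Y \<in> Ar C" "prd2 C X Y \<in> Ar C" "Dom C (prd2 C X Y) = Dom C (prd1 C X Y)"
    "Cod C (prd1 C X Y) = X" "Cod C (prd2 C X Y) = Y"
  using productD[OF chosen_product[OF assms]] by auto

lemma prd_pair:
  assumes "X \<in> Ob C" "Y \<in> Ob C" "u \<in> Ar C" "v \<in> Ar C" "Dom C u = Dom C v" "Cod C u = X" "Cod C v = Y"
  shows "prd_pair C X Y u v \<in> hom C (Dom C u) (Dom C (prd1 C X Y)) \<and>
    prd1 C X Y \<cdot> prd_pair C X Y u v = u \<and> prd2 C X Y \<cdot> prd_pair C X Y u v = v"
  unfolding prd_pair_def
  by (rule theI') (use chosen_product[OF assms(1,2)] assms in \<open>auto simp: is_product_def\<close>)

lemma prd_pair_simps [simp]: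
  assumes "X \<in> Ob C" "Y \<in> Ob C" "u \<in> Ar C" "v \<in> Ar C" "Dom C u = Dom C v" "Cod C u = X" "Cod C v = Y"
  shows "prd_pair C X Y u v \<in> Ar C" "Dom C (prd_pair C X Y u v) = Dom C v"
    "Cod C (prd_pair C X Y u v) = Dom C (prd1 C X Y)"
    "prd1 C X Y \<cdot> prd_pair C X Y u v = u" "prd2 C X Y \<cdot> prd_pair C X Y u v = v"
  using prd_pair[OF assms] assms by auto

lemma prd_eqI:
  assumes "h \<in> Ar C" "h' \<in> Ar C" "Dom C h = Dom C h'" "Cod C h = Dom C (prd1 C X Y)"
    "Cod C h' = Dom C (prd1 C X Y)" "prd1 C X Y \<cdot> h = prd1 C X Y \<cdot> h'" "prd2 C X Y \<cdot> h = prd2 C X Y \<cdot> h'"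
    "X \<in> Ob C" "Y \<in> Ob C"
  shows "h = h'"
  by (rule product_eqI[OF chosen_product[OF assms(8-9)]]) (use assms in auto)

lemma prd_pair_reassoc [simp]:
  assumes "X \<in> Ob C" "Y \<in> Ob C" "u \<in> Ar C" "v \<in> Ar C" "Dom C u = Dom C v" "Cod C u = X" "Cod C v = Y"
    "k \<in> Ar C" "Cod C k = Dom C v"
  shows "prd1 C X Y \<cdot> prd_pair C X Y u v \<cdot> k = u \<cdot> k" "prd2 C X Y \<cdot> prd_pair C X Y u v \<cdot> k = v \<cdot> k"
  using reassoc[of "prd1 C X Y" "prd_pair C X Y u v" u k] reassoc[of "prd2 C X Y" "prd_pair C X Y u v" v k]
    assms by simp_all

lemma prd_pair_comp:
  assumes "X \<in> Ob C" "Y \<in> Ob C" "u \<in> Ar C" "v \<in> Ar C" "Dom C u = Dom C v" "Cod C u = X" "Cod C v = Y"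
    "k \<in> Ar C" "Cod C k = Dom C v"
  shows "prd_pair C X Y u v \<cdot> k = prd_pair C X Y (u \<cdot> k) (v \<cdot> k)"
  by (rule prd_eqI[of _ _ X Y]) (use assms in simp_all)

end

section \<open>Slices\<close>

lemma slice_simps [simp]:
  "f \<in> Ob (slice C X) \<longleftrightarrow> f \<in> Ar C \<and> Cod C f = X"
  "(f, h, g) \<in> Ar (slice C X) \<longleftrightarrow> f \<in> Ar C \<and> Cod C f = X \<and> g \<in> Ar C \<and> Cod C g = X \<and>
    h \<in> Ar C \<and> Dom C f = Dom C h \<and> Dom C g = Cod C h \<and> g \<cdot>\<^bsub>C\<^esub> h = f"
  "Dom (slice C X) (f, h, g) = f" "Cod (slice C X) (f, h, g) = g"
  "idt (slice C X) f = (f, idt C (Dom C f), f)"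
  "(g', k, r) \<cdot>\<^bsub>slice C X\<^esub> (f, h, g) = (f, k \<cdot>\<^bsub>C\<^esub> h, r)"
  by (auto simp: slice_def)

lemma slice_ArE:
  assumes "a \<in> Ar (slice C X)"
  obtains f h g where "a = (f, h, g)" "(f, h, g) \<in> Ar (slice C X)"
  using assms by (cases a) auto

context category
begin

lemma category_slice: "category (slice C X)"
proof
  show "Dom (slice C X) a \<in> Ob (slice C X)" "Cod (slice C X) a \<in> Ob (slice C X)"
    if "a \<in> Ar (slice C X)" for a using that by (cases a; auto)+
  show "idt (slice C X) f \<in> hom (slice C X) f f" if "f \<in> Ob (slice C X)" for f using that by auto
  show "b \<cdot>\<^bsub>slice C X\<^esub> a \<in> hom (slice C X) f h" if "a \<in> hom (slice C X) f g" "b \<in> hom (slice C X) g h" for a b f g h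
    using that by (cases a; cases b) (auto simp flip: assoc)
  show "a \<cdot>\<^bsub>slice C X\<^esub> idt (slice C X) f = a" "idt (slice C X) g \<cdot>\<^bsub>slice C X\<^esub> a = a"
    if "a \<in> hom (slice C X) f g" for a f g using that by (cases a; auto)+
  show "(c \<cdot>\<^bsub>slice C X\<^esub> b) \<cdot>\<^bsub>slice C X\<^esub> a = c \<cdot>\<^bsub>slice C X\<^esub> b \<cdot>\<^bsub>slice C X\<^esub> a"
    if "a \<in> hom (slice C X) f g" "b \<in> hom (slice C X) g h" "c \<in> hom (slice C X) h k" for a b c f g h k
    using that by (cases a; cases b; cases c) auto
qed

lemma slice_iso_iff:
  assumes "(f, h, g) \<in> Ar (slice C X)"
  shows "is_iso (slice C X) (f, h, g) \<longleftrightarrow> is_iso C h"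
proof
  assume "is_iso (slice C X) (f, h, g)"
  then obtain a where a: "a \<in> hom (slice C X) g f" "a \<cdot>\<^bsub>slice C X\<^esub> (f, h, g) = idt (slice C X) f"
    "(f, h, g) \<cdot>\<^bsub>slice C X\<^esub> a = idt (slice C X) g"
    unfolding is_iso_def slice_simps(3,4) by blast
  obtain k where "a = (g, k, f)" using a(1) by (cases a) auto
  with a assms show "is_iso C h" by (intro is_isoI[of h "Dom C f" "Dom C g" k]) auto
next
  interpret S: category "slice C X" by (rule category_slice)
  assume "is_iso C h"
  then obtain k where k: "k \<in> hom C (Dom C g) (Dom C f)" "k \<cdot> h = idt C (Dom C f)" "h \<cdot> k = idt C (Dom C g)"
    using assms is_isoE[of h "Dom C f" "Dom C g"] by auto
  have ty: "f \<in> Ar C" "g \<in> Ar C" "h \<in> Ar C" "Dom C f = Dom C h" "Dom C g = Cod C h" "Cod C f = X" "Cod C g = X"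
    and gh: "g \<cdot> h = f" using assms by simp_all
  have "(g \<cdot> h) \<cdot> k = g" using ty k by simp
  then have "f \<cdot> k = g" using gh by simp
  then show "is_iso (slice C X) (f, h, g)"
    by - (rule S.is_isoI[of _ f g "(g, k, f)"], use assms ty k in simp_all)
qed

lemma slice_dom_functor: "cat_functor (slice C X) C (slice_dom C)"
  by (rule cat_functorI[OF category_slice category_axioms]) (auto simp: slice_dom_def)

text \<open>Maps of a slice carry their domain and codomain, so the datum \<open>r\<close> has to be
  the diagonal of the square; apart from that, a pair of maps over \<open>X\<close> with a common
  source is a commutative square.\<close>

lemma slice_product_iff:
  assumes "f \<in> hom C Y X" "g \<in> hom C Z X"
  shows "is_product (slice C X) f g (r, p, f) (r, q, g) \<longleftrightarrow> r = f \<cdot> p \<and> is_pullback C f g p q"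
proof
  assume pr: "is_product (slice C X) f g (r, p, f) (r, q, g)"
  have t: "p \<in> Ar C" "q \<in> Ar C" "Dom C r = Dom C p" "Dom C q = Dom C p" "f \<cdot> p = r" "g \<cdot> q = r"
    "Cod C p = Dom C f" "Cod C q = Dom C g" "r \<in> Ar C"
    using productD[OF pr] by auto
  interpret S: category "slice C X" by (rule category_slice)
  have "is_pullback C f g p q"
  proof (rule pullbackI)
    fix U u v assume uv: "u \<in> hom C U (Dom C f)" "v \<in> hom C U (Dom C g)" "f \<cdot> u = g \<cdot> v"
    obtain h where h: "h \<in> hom (slice C X) (f \<cdot> u) r" "(r, p, f) \<cdot>\<^bsub>slice C X\<^esub> h = (f \<cdot> u, u, f)"
      "(r, q, g) \<cdot>\<^bsub>slice C X\<^esub> h = (f \<cdot> u, v, g)"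
      using productE[OF pr, of "(f \<cdot> u, u, f)" "f \<cdot> u" "(f \<cdot> u, v, g)"] assms uv by auto
    obtain h' where h': "h = (f \<cdot> u, h', r)" using h by (cases h) auto
    show "\<exists>h. h \<in> hom C U (Dom C p) \<and> p \<cdot> h = u \<and> q \<cdot> h = v"
      using h uv t assms unfolding h' by (intro exI[of _ h']) auto
  next
    fix U h h' assume hh: "h \<in> hom C U (Dom C p)" "h' \<in> hom C U (Dom C p)" "p \<cdot> h = p \<cdot> h'" "q \<cdot> h = q \<cdot> h'"
    have "(f \<cdot> p) \<cdot> h = (f \<cdot> p) \<cdot> h'" using hh(1-3) t(1-4,7-9) assms by simp
    then have "r \<cdot> h = r \<cdot> h'" using t(5) by simp
    then have "(r \<cdot> h, h, r) = (r \<cdot> h, h', r)"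
      by - (rule S.product_eqI[OF pr], use hh t assms in auto)
    then show "h = h'" by simp
  qed (use t assms in auto)
  then show "r = f \<cdot> p \<and> is_pullback C f g p q" using t by auto
next
  assume "r = f \<cdot> p \<and> is_pullback C f g p q"
  then have r: "r = f \<cdot> p" and pb: "is_pullback C f g p q" by auto
  note d = pullbackD[OF pb]
  show "is_product (slice C X) f g (r, p, f) (r, q, g)"
    unfolding is_product_def
  proof (intro conjI allI ballI)
    fix z a b assume a: "a \<in> hom (slice C X) z f" and b: "b \<in> hom (slice C X) z g"
    obtain u v where uv: "a = (z, u, f)" "b = (z, v, g)" using a b by (cases a; cases b) auto
    have t: "u \<in> Ar C" "v \<in> Ar C" "Dom C z = Dom C u" "Dom C v = Dom C u" "Cod C u = Dom C f" "Cod C v = Dom C g"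
      "f \<cdot> u = z" "g \<cdot> v = z" "z \<in> Ar C" "Cod C z = X" using a b uv by auto
    obtain h where h: "h \<in> hom C (Dom C z) (Dom C p)" "p \<cdot> h = u" "q \<cdot> h = v"
      using pullbackE[OF pb, of u "Dom C z" v] t by auto
    have "f \<cdot> p \<cdot> h = z" using h t by simp
    then show "\<exists>!h. h \<in> hom (slice C X) z (Dom (slice C X) (r, p, f)) \<and>
       (r, p, f) \<cdot>\<^bsub>slice C X\<^esub> h = a \<and> (r, q, g) \<cdot>\<^bsub>slice C X\<^esub> h = b"
    proof (intro ex1I[of _ "(z, h, r)"])
      fix c assume c: "c \<in> hom (slice C X) z (Dom (slice C X) (r, p, f)) \<and>
       (r, p, f) \<cdot>\<^bsub>slice C X\<^esub> c = a \<and> (r, q, g) \<cdot>\<^bsub>slice C X\<^esub> c = b"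
      then obtain k where k: "c = (z, k, r)" by (cases c) auto
      have k': "k \<in> Ar C" "Dom C z = Dom C k" "Cod C k = Dom C r" "p \<cdot> k = u" "q \<cdot> k = v"
        using c unfolding k uv by simp_all
      have "k = h"
      proof (rule pullback_eqI[OF pb])
        show "Dom C k = Dom C h" "Cod C k = Dom C p" using k'(2,3) h(1) r d(1,4) assms by simp_all
        show "p \<cdot> k = p \<cdot> h" "q \<cdot> k = q \<cdot> h" using k'(4,5) h(2,3) by simp_all
      qed (use k'(1) h(1) assms in simp_all)
      then show "c = (z, h, r)" using k by simp
    qed (use h t d assms in \<open>simp_all add: uv r\<close>)
  qed (use r d assms in auto)
qed

lemma slice_productE:
  assumes "f \<in> hom C Y X" "g \<in> hom C Z X" "is_product (slice C X) f g a b"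
  obtains p q where "a = (f \<cdot> p, p, f)" "b = (f \<cdot> p, q, g)" "is_pullback C f g p q"
proof -
  obtain r p where a: "a = (r, p, f)" using productD[OF assms(3)] by (cases a) auto
  obtain q where b: "b = (r, q, g)" using productD[OF assms(3)] a by (cases b) auto
  show thesis using assms slice_product_iff[OF assms(1,2), of r p q] that a b by auto
qed

text \<open>The structure map of the vertex is the composite along either leg, so the domain functor
  creates pullbacks.\<close>

lemma slice_pullback:
  assumes "(f, h, r) \<in> Ar (slice C X)" "(g, k, r) \<in> Ar (slice C X)"
  shows "is_pullback (slice C X) (f, h, r) (g, k, r) (s, p, f) (t, q, g) \<longleftrightarrow>
    s = f \<cdot> p \<and> t = s \<and> is_pullback C h k p q"
proof -
  have ty: "r \<in> Ar C" "h \<in> Ar C" "k \<in> Ar C" "Dom C r = Cod C k" "Cod C h = Cod C k" and eq: "r \<cdot> h = f" "r \<cdot> k = g"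
    using assms by simp_all
  show ?thesis
proof
  interpret S: category "slice C X" by (rule category_slice)
  assume pb: "is_pullback (slice C X) (f, h, r) (g, k, r) (s, p, f) (t, q, g)"
  have t: "t = s" "s \<in> Ar C" "p \<in> Ar C" "q \<in> Ar C" "Dom C s = Dom C p" "Dom C q = Dom C p" "Cod C p = Dom C f"
    "Cod C q = Dom C g" "f \<cdot> p = s" "g \<cdot> q = s" "h \<cdot> p = k \<cdot> q" "Cod C s = X"
    using pullbackD[OF pb] by auto
  have "is_pullback C h k p q"
  proof (rule pullbackI)
    fix U u v assume uv: "u \<in> hom C U (Dom C h)" "v \<in> hom C U (Dom C k)" "h \<cdot> u = k \<cdot> v"
    have "(r \<cdot> h) \<cdot> u = (r \<cdot> k) \<cdot> v" using ty uv by simp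
    then have fg: "f \<cdot> u = g \<cdot> v" using eq by simp
    obtain c where c: "c \<in> hom (slice C X) (f \<cdot> u) s" "(s, p, f) \<cdot>\<^bsub>slice C X\<^esub> c = (f \<cdot> u, u, f)"
      "(t, q, g) \<cdot>\<^bsub>slice C X\<^esub> c = (f \<cdot> u, v, g)"
      using pullbackE[OF pb, of "(f \<cdot> u, u, f)" "f \<cdot> u" "(f \<cdot> u, v, g)"] assms uv fg by auto
    obtain h' where h': "c = (f \<cdot> u, h', s)" using c by (cases c) auto
    show "\<exists>h. h \<in> hom C U (Dom C p) \<and> p \<cdot> h = u \<and> q \<cdot> h = v"
      using c uv t assms unfolding h' by (intro exI[of _ h']) auto
  next
    fix U m m' assume hh: "m \<in> hom C U (Dom C p)" "m' \<in> hom C U (Dom C p)" "p \<cdot> m = p \<cdot> m'" "q \<cdot> m = q \<cdot> m'"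
    have "(f \<cdot> p) \<cdot> m = (f \<cdot> p) \<cdot> m'" using hh(1-3) t(2-8,12) assms by simp
    then have "s \<cdot> m = s \<cdot> m'" using t(9) by simp
    then have "(s \<cdot> m, m, s) = (s \<cdot> m, m', s)"
      by - (rule S.pullback_eqI[OF pb], use hh t assms in auto)
    then show "m = m'" by simp
  qed (use t assms in auto)
  then show "s = f \<cdot> p \<and> t = s \<and> is_pullback C h k p q" using t by auto
next
  assume "s = f \<cdot> p \<and> t = s \<and> is_pullback C h k p q"
  then have s: "s = f \<cdot> p" "t = f \<cdot> p" and pb: "is_pullback C h k p q" by auto
  note d = pullbackD[OF pb]
  interpret S: category "slice C X" by (rule category_slice)
  have "(r \<cdot> h) \<cdot> p = (r \<cdot> k) \<cdot> q" using ty d by simp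
  then have gq: "g \<cdot> q = f \<cdot> p" using eq by simp
  show "is_pullback (slice C X) (f, h, r) (g, k, r) (s, p, f) (t, q, g)"
  proof (rule pullbackI)
    fix z a b assume a: "a \<in> hom (slice C X) z (Dom (slice C X) (f, h, r))"
      and b: "b \<in> hom (slice C X) z (Dom (slice C X) (g, k, r))"
      and ab: "(f, h, r) \<cdot>\<^bsub>slice C X\<^esub> a = (g, k, r) \<cdot>\<^bsub>slice C X\<^esub> b"
    obtain u v where uv: "a = (z, u, f)" "b = (z, v, g)" using a b by (cases a; cases b) auto
    have ut: "u \<in> Ar C" "v \<in> Ar C" "Dom C z = Dom C u" "Dom C v = Dom C u" "Cod C u = Dom C f" "Cod C v = Dom C g"
      "f \<cdot> u = z" "g \<cdot> v = z" "h \<cdot> u = k \<cdot> v" "z \<in> Ar C" "Cod C z = X"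
      using a b ab unfolding uv by simp_all
    have ft: "f \<in> Ar C" "Dom C f = Dom C h" "g \<in> Ar C" "Dom C g = Dom C k" "Cod C f = X" using assms by simp_all
    obtain m where m: "m \<in> hom C (Dom C u) (Dom C p)" "p \<cdot> m = u" "q \<cdot> m = v"
      using pullbackE[OF pb, of u "Dom C u" v] ut(1-6,9) ft by simp blast
    show "\<exists>c. c \<in> hom (slice C X) z (Dom (slice C X) (s, p, f)) \<and>
       (s, p, f) \<cdot>\<^bsub>slice C X\<^esub> c = a \<and> (t, q, g) \<cdot>\<^bsub>slice C X\<^esub> c = b"
      by (rule exI[of _ "(z, m, s)"]) (use m ut ft d in \<open>simp add: uv s\<close>)
  next
    fix z c c' assume c: "c \<in> hom (slice C X) z (Dom (slice C X) (s, p, f))"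
      "c' \<in> hom (slice C X) z (Dom (slice C X) (s, p, f))"
      and e: "(s, p, f) \<cdot>\<^bsub>slice C X\<^esub> c = (s, p, f) \<cdot>\<^bsub>slice C X\<^esub> c'"
      "(t, q, g) \<cdot>\<^bsub>slice C X\<^esub> c = (t, q, g) \<cdot>\<^bsub>slice C X\<^esub> c'"
    obtain m m' where m: "c = (z, m, s)" "c' = (z, m', s)" using c by (cases c; cases c') auto
    have m': "m \<in> Ar C" "m' \<in> Ar C" "Dom C z = Dom C m" "Dom C z = Dom C m'" "Cod C m = Dom C s"
      "Cod C m' = Dom C s" "p \<cdot> m = p \<cdot> m'" "q \<cdot> m = q \<cdot> m'"
      using c e unfolding m by simp_all
    have "Dom C s = Dom C p" using s d(1,4) assms by simp
    then have "m = m'"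
      by - (rule pullback_eqI[OF pb], use m' assms in simp_all)
    then show "c = c'" using m by simp
  qed (use s d gq assms in auto)
qed
qed

lemma slice_has_pullbacks:
  assumes "has_pullbacks C"
  shows "has_pullbacks (slice C X)"
  unfolding has_pullbacks_def
proof (intro ballI impI)
  fix a b assume a: "a \<in> Ar (slice C X)" and b: "b \<in> Ar (slice C X)" and ab: "Cod (slice C X) a = Cod (slice C X) b"
  obtain f h r where a': "a = (f, h, r)" by (cases a)
  obtain g k where b': "b = (g, k, r)" using ab a' by (cases b) auto
  have "h \<in> Ar C" "k \<in> Ar C" "Cod C h = Cod C k" using a b a' b' by simp_all
  then obtain p q where pb: "is_pullback C h k p q" using assms unfolding has_pullbacks_def by blast
  show "\<exists>p q. is_pullback (slice C X) a b p q"
    using slice_pullback[of f h r X g k "f \<cdot> p" p "f \<cdot> p" q] a b pb a' b' by blast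
qed

end

lemma slice_functor_simps [simp]: "fob (slice_functor F) f = far F f"
  "far (slice_functor F) (f, h, g) = (far F f, far F h, far F g)"
  by (simp_all add: slice_functor_def)

lemma slice_dom_simps [simp]: "fob (slice_dom C) f = Dom C f" "far (slice_dom C) (f, h, g) = h"
  by (simp_all add: slice_dom_def)

lemma (in cat_functor) slice_functor: "cat_functor (slice A X) (slice B (fob F X)) (slice_functor F)"
  by (rule cat_functorI[OF A.category_slice B.category_slice]) (auto simp flip: far_cmp)

section \<open>Frobenius adjunctions in terms of pullback squares\<close>

context adjunction
begin

text \<open>The canonical map is the pairing of \<open>u\<close> and \<open>v\<close> in the slice
  over \<open>X\<close>, and it is invertible exactly if these two form a product there, that is, a
  pullback in \<open>B\<close>. The chosen pullback in \<open>A\<close> may be replaced by any other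
  because \<open>L\<close> preserves the isomorphism between them.\<close>

lemma frobenius_map_iso_iff:
  assumes pbs: "has_pullbacks A" "has_pullbacks B" and X: "X \<in> Ob B"
    and f: "f \<in> Ar A" "Cod A f = fob R X" and g: "g \<in> Ar B" "Cod B g = X"
    and pb: "is_pullback A f (far R g) p q"
  shows "is_iso (slice B X) (frobenius_map (slice A (fob R X)) (slice B X) (sliced_left B L \<epsilon> X)
      (slice_functor R) (sliced_counit B L R \<epsilon> X) f g) \<longleftrightarrow>
    is_pullback B (\<epsilon> X \<star> far L f) g (far L p) (\<epsilon> (Dom B g) \<star> far L q)"
proof -
  let ?SA = "slice A (fob R X)" and ?SB = "slice B X" and ?f = "\<epsilon> X \<star> far L f"
  interpret SB: category ?SB by (rule L.B.category_slice)
  have gY: "g \<in> hom B (Dom B g) X" and fW: "f \<in> hom A (Dom A f) (fob R X)" using f g by auto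
  have Rg: "far R g \<in> hom A (fob R (Dom B g)) (fob R X)" using g by auto
  have f': "?f \<in> hom B (fob L (Dom A f)) X" using f X by auto
  \<comment> \<open>The products that \<open>frobenius_map\<close> chooses are known only to be some
    products in the slices; existence of one is shown so that the choice can be unfolded.\<close>
  have "\<exists>pq. is_product ?SA f (far R g) (fst pq) (snd pq)"
    using pb L.A.slice_product_iff[OF fW Rg, of "f \<bullet> p" p q]
    by (intro exI[of _ "((f \<bullet> p, p, f), (f \<bullet> p, q, far R g))"]) simp
  then have "is_product ?SA f (far R g) (prd1 ?SA f (far R g)) (prd2 ?SA f (far R g))"
    unfolding prd1_def prd2_def by (rule someI_ex)
  then obtain p0 q0 where prd: "prd1 ?SA f (far R g) = (f \<bullet> p0, p0, f)"
      "prd2 ?SA f (far R g) = (f \<bullet> p0, q0, far R g)" and pb0: "is_pullback A f (far R g) p0 q0"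
    using L.A.slice_productE[OF fW Rg] by metis
  note d0 = pullbackD[OF pb0]
  obtain k where k: "k \<in> hom A (Dom A p) (Dom A p0)" "is_iso A k" "p0 \<bullet> k = p" "q0 \<bullet> k = q"
    using L.A.pullback_iso[OF pb0 pb] f Rg by auto
  obtain p1 q1 where pb1: "is_pullback B ?f g p1 q1"
    using pbs(2) f' gY unfolding has_pullbacks_def mem_hom by metis
  have "\<exists>pq. is_product ?SB ?f g (fst pq) (snd pq)"
    using pb1 L.B.slice_product_iff[OF f' gY, of "?f \<star> p1" p1 q1]
    by (intro exI[of _ "((?f \<star> p1, p1, ?f), (?f \<star> p1, q1, g))"]) simp
  then have prB: "is_product ?SB ?f g (prd1 ?SB ?f g) (prd2 ?SB ?f g)"
    unfolding prd1_def prd2_def by (rule someI_ex)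
  define r where "r = \<epsilon> X \<star> far L (f \<bullet> p0)"
  define u where "u = (r, far L p0, ?f)"
  define v where "v = (r, \<epsilon> (Dom B g) \<star> far L q0, g)"
  define h where "h = frobenius_map ?SA ?SB (sliced_left B L \<epsilon> X) (slice_functor R) (sliced_counit B L R \<epsilon> X) f g"
  have r: "r = ?f \<star> far L p0" using f X d0(1-5) by (simp add: r_def)
  \<comment> \<open>Naturality of the counit at \<open>g\<close> makes the second component a map
    over \<open>X\<close>.\<close>
  have gq: "g \<star> \<epsilon> (Dom B g) \<star> far L q0 = r"
  proof -
    have "g \<star> \<epsilon> (Dom B g) \<star> far L q0 = \<epsilon> X \<star> far L (far R g \<bullet> q0)"
      using L.B.reassoc[OF counit_nat[OF g(1), symmetric], of "far L q0"] g d0(1-5) X by simp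
    then show ?thesis using d0(6) by (simp add: r_def)
  qed
  have u: "u \<in> hom ?SB r ?f" and v: "v \<in> hom ?SB r g"
    using f' g d0 r gq X by (auto simp: u_def v_def)
  have Du: "Dom ?SB u = r" using u by simp
  have "h = prd_pair ?SB ?f g u v"
    unfolding h_def frobenius_map_def slice_functor_simps prd
    by (simp add: sliced_left_def sliced_counit_def u_def v_def r_def)
  moreover have "\<exists>!h. h \<in> hom ?SB r (Dom ?SB (prd1 ?SB ?f g)) \<and> prd1 ?SB ?f g \<cdot>\<^bsub>?SB\<^esub> h = u \<and>
      prd2 ?SB ?f g \<cdot>\<^bsub>?SB\<^esub> h = v"
    using prB u v unfolding is_product_def by blast
  then have "prd_pair ?SB ?f g u v \<in> hom ?SB r (Dom ?SB (prd1 ?SB ?f g)) \<and>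
      prd1 ?SB ?f g \<cdot>\<^bsub>?SB\<^esub> prd_pair ?SB ?f g u v = u \<and> prd2 ?SB ?f g \<cdot>\<^bsub>?SB\<^esub> prd_pair ?SB ?f g u v = v"
    unfolding prd_pair_def Du by (rule theI')
  ultimately have h: "h \<in> hom ?SB r (Dom ?SB (prd1 ?SB ?f g))" "prd1 ?SB ?f g \<cdot>\<^bsub>?SB\<^esub> h = u"
    "prd2 ?SB ?f g \<cdot>\<^bsub>?SB\<^esub> h = v" by auto
  have "is_iso ?SB h \<longleftrightarrow> is_product ?SB ?f g u v"
    using SB.product_comparison_iso_iff[OF prB, of h] h by auto
  also have "\<dots> \<longleftrightarrow> is_pullback B ?f g (far L p0) (\<epsilon> (Dom B g) \<star> far L q0)"
    unfolding u_def v_def using L.B.slice_product_iff[OF f' gY] r by simp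
  also have "\<dots> \<longleftrightarrow> is_pullback B ?f g (far L p) (\<epsilon> (Dom B g) \<star> far L q)"
  proof
    assume P: "is_pullback B ?f g (far L p0) (\<epsilon> (Dom B g) \<star> far L q0)"
    have kt: "k \<in> Ar A" "Cod A k = Dom A p0" using k(1) by simp_all
    have "is_pullback B ?f g (far L p0 \<star> far L k) ((\<epsilon> (Dom B g) \<star> far L q0) \<star> far L k)"
      by (rule L.B.pullback_precomp_iso[OF P]) (use f' gY kt k(2) L.far_iso d0 in auto)
    moreover have "far L p0 \<star> far L k = far L p" "far L q0 \<star> far L k = far L q"
      using L.far_cmp[of p0 k] L.far_cmp[of q0 k] kt d0(1-3) unfolding k(3,4) by simp_all
    ultimately show "is_pullback B ?f g (far L p) (\<epsilon> (Dom B g) \<star> far L q)"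
      using kt d0(1-5) g by simp
  next
    assume P: "is_pullback B ?f g (far L p) (\<epsilon> (Dom B g) \<star> far L q)"
    obtain l where l: "l \<in> hom A (Dom A p0) (Dom A p)" "k \<bullet> l = idt A (Dom A p0)" "is_iso A l"
      using L.A.is_isoE[OF k(2,1)] by metis
    note d = pullbackD[OF pb]
    have lt: "l \<in> Ar A" "Cod A l = Dom A p" using l(1) by simp_all
    have kl: "(p0 \<bullet> k) \<bullet> l = p0" "(q0 \<bullet> k) \<bullet> l = q0" using k(1) l d0(1-5) by simp_all
    have pl: "p \<bullet> l = p0" "q \<bullet> l = q0" using kl unfolding k(3,4) .
    have "is_pullback B ?f g (far L p \<star> far L l) ((\<epsilon> (Dom B g) \<star> far L q) \<star> far L l)"
      by (rule L.B.pullback_precomp_iso[OF P]) (use f' gY lt l(3) L.far_iso d in auto)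
    moreover have "far L p \<star> far L l = far L p0" "far L q \<star> far L l = far L q0"
      using L.far_cmp[of p l] L.far_cmp[of q l] lt d(1-3) unfolding pl by simp_all
    ultimately show "is_pullback B ?f g (far L p0) (\<epsilon> (Dom B g) \<star> far L q0)"
      using lt d(1-5) g by simp
  qed
  finally show ?thesis unfolding h_def .
qed

lemma frobenius_at_pullback:
  assumes "has_pullbacks A" "has_pullbacks B" "X \<in> Ob B" "frobenius_at A B L R \<epsilon> X"
    "f \<in> Ar A" "Cod A f = fob R X" "g \<in> Ar B" "Cod B g = X" "is_pullback A f (far R g) p q"
  shows "is_pullback B (\<epsilon> X \<star> far L f) g (far L p) (\<epsilon> (Dom B g) \<star> far L q)"
  using frobenius_map_iso_iff[OF assms(1-3,5-9)] assms(4-8)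
  unfolding frobenius_at_def frobenius_def by simp

lemma frobenius_atI:
  assumes "has_pullbacks A" "has_pullbacks B" "X \<in> Ob B"
    "\<And>f g p q. \<lbrakk>f \<in> Ar A; Cod A f = fob R X; g \<in> Ar B; Cod B g = X; is_pullback A f (far R g) p q\<rbrakk> \<Longrightarrow>
      is_pullback B (\<epsilon> X \<star> far L f) g (far L p) (\<epsilon> (Dom B g) \<star> far L q)"
  shows "frobenius_at A B L R \<epsilon> X"
  unfolding frobenius_at_def frobenius_def
proof (intro ballI)
  fix f g assume "f \<in> Ob (slice A (fob R X))" "g \<in> Ob (slice B X)"
  then have fg: "f \<in> Ar A" "Cod A f = fob R X" "g \<in> Ar B" "Cod B g = X" by auto
  then obtain p q where pb: "is_pullback A f (far R g) p q"
    using assms(1) unfolding has_pullbacks_def by fastforce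
  show "is_iso (slice B X) (frobenius_map (slice A (fob R X)) (slice B X) (sliced_left B L \<epsilon> X)
      (slice_functor R) (sliced_counit B L R \<epsilon> X) f g)"
    using frobenius_map_iso_iff[OF assms(1-3) fg pb] assms(4)[OF fg pb] by simp
qed

end

section \<open>Couniversal property of the counit, pullback functors\<close>

context adjunction
begin

lemma counit_existence:
  assumes "X \<in> Ob A" "g \<in> hom B (fob L X) Y"
  obtains f where "f \<in> hom A X (fob R Y)" "\<epsilon> Y \<star> far L f = g"
proof
  show "far R g \<bullet> \<eta> X \<in> hom A X (fob R Y)" using assms by auto
  show "\<epsilon> Y \<star> far L (far R g \<bullet> \<eta> X) = g" using transpose_left[of g X] assms by auto
qed

lemma counit_uniqueness:
  assumes "f \<in> Ar A" "f' \<in> Ar A" "Dom A f = Dom A f'" "Cod A f = fob R Y" "Cod A f' = fob R Y" "Y \<in> Ob B"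
    "\<epsilon> Y \<star> far L f = \<epsilon> Y \<star> far L f'"
  shows "f = f'"
proof -
  have 1: "far R (\<epsilon> Y \<star> far L h) \<bullet> \<eta> (Dom A h) = h"
    if "h \<in> Ar A" "Cod A h = fob R Y" for h
    using transpose_right[of h Y] that assms(6) by simp
  show ?thesis
    using 1[OF assms(1,4)] 1[OF assms(2,5)] assms(3,7) by metis
qed

end

lemma pullback_functor_simps [simp]:
  "fob (pullback_functor C f) g = pb1 C f g"
  "far (pullback_functor C f) (g, h, k) =
    (pb1 C f g, pb_pair C f k (pb1 C f g) (h \<cdot>\<^bsub>C\<^esub> pb2 C f g), pb1 C f k)"
  by (simp_all add: pullback_functor_def)

context finite_limits
begin

lemma pullback_functor:
  assumes f: "f \<in> Ar C"
  shows "cat_functor (slice C (Cod C f)) (slice C (Dom C f)) (pullback_functor C f)"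
proof -
  have ty: "g \<in> Ar C" "h \<in> Ar C" "k \<in> Ar C" "Cod C g = Cod C f" "Cod C k = Cod C f" "Dom C g = Dom C h" "Dom C k = Cod C h"
      "f \<cdot> pb1 C f g = k \<cdot> h \<cdot> pb2 C f g"
    if "(g, h, k) \<in> Ar (slice C (Cod C f))" for g h k
  proof -
    show t: "g \<in> Ar C" "h \<in> Ar C" "k \<in> Ar C" "Cod C g = Cod C f" "Cod C k = Cod C f" "Dom C g = Dom C h" "Dom C k = Cod C h"
      using that by simp_all
    have "(k \<cdot> h) \<cdot> pb2 C f g = k \<cdot> h \<cdot> pb2 C f g" using t f by simp
    moreover have "k \<cdot> h = g" using that by simp
    ultimately show "f \<cdot> pb1 C f g = k \<cdot> h \<cdot> pb2 C f g" using t f pb_comm[of f g] by simp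
  qed
  show ?thesis
  proof (rule cat_functorI)
    fix a assume "a \<in> Ar (slice C (Cod C f))"
    then obtain g h k where a: "a = (g, h, k)" "(g, h, k) \<in> Ar (slice C (Cod C f))" by (rule slice_ArE)
    show "far (pullback_functor C f) a \<in> hom (slice C (Dom C f)) (fob (pullback_functor C f) (Dom (slice C (Cod C f)) a))
         (fob (pullback_functor C f) (Cod (slice C (Cod C f)) a))"
      using ty[OF a(2)] f by (simp add: a(1))
  next
    fix a b assume "a \<in> Ar (slice C (Cod C f))" "b \<in> Ar (slice C (Cod C f))"
      and ba: "Dom (slice C (Cod C f)) b = Cod (slice C (Cod C f)) a"
    then obtain g h k l m where a: "a = (g, h, k)" "(g, h, k) \<in> Ar (slice C (Cod C f))"
      and b: "b = (k, l, m)" "(k, l, m) \<in> Ar (slice C (Cod C f))"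
      by (metis slice_ArE slice_simps(3,4))
    note ta = ty[OF a(2)] and tb = ty[OF b(2)]
    have tya: "g \<in> Ar C" "h \<in> Ar C" "l \<in> Ar C" "m \<in> Ar C" "Dom C g = Dom C h" "Dom C l = Cod C h" "Dom C m = Cod C l"
      "Cod C g = Cod C f" "Cod C m = Cod C f" using ta(1-7) tb(1-7) by simp_all
    have "m \<cdot> l \<cdot> h = (m \<cdot> l) \<cdot> h" by (rule assoc[symmetric]) (use tya in simp_all)
    also have "\<dots> = g" using a(2) b(2) by simp
    finally have mlh: "m \<cdot> l \<cdot> h = g" .
    have "(g, l \<cdot> h, m) \<in> Ar (slice C (Cod C f))"
      using mlh tya by simp
    note tab = ty[OF this]
    have "pb_pair C f m (pb1 C f g) ((l \<cdot> h) \<cdot> pb2 C f g) =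
      pb_pair C f m (pb1 C f k) (l \<cdot> pb2 C f k) \<cdot> pb_pair C f k (pb1 C f g) (h \<cdot> pb2 C f g)"
      using ta(1-7) tb(1-7) ta(8) tb(8) tab(8) f
      by (subst pb_pair_comp) simp_all
    then show "far (pullback_functor C f) (b \<cdot>\<^bsub>slice C (Cod C f)\<^esub> a) =
        far (pullback_functor C f) b \<cdot>\<^bsub>slice C (Dom C f)\<^esub> far (pullback_functor C f) a"
      unfolding a(1) b(1) by simp
  qed (use f pb_pair_pb in \<open>auto intro: category_slice\<close>)
qed

text \<open>Over a terminal object the commutativity condition on slice maps is void.\<close>

lemma slice_terminal_ff_eso: "ff_eso_functor (slice C (terminal_ob C)) C (slice_dom C)"
proof -
  interpret F: cat_functor "slice C (terminal_ob C)" C "slice_dom C" by (rule slice_dom_functor)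
  show ?thesis
  proof
    fix f g h assume f: "f \<in> Ob (slice C (terminal_ob C))" and g: "g \<in> Ob (slice C (terminal_ob C))"
      and h: "h \<in> hom C (fob (slice_dom C) f) (fob (slice_dom C) g)"
    have "g \<cdot> h = f" by (rule bang_unique) (use f g h in simp_all)
    then show "\<exists>!a. a \<in> hom (slice C (terminal_ob C)) f g \<and> far (slice_dom C) a = h"
    proof (intro ex1I[of _ "(f, h, g)"])
      fix a assume a: "a \<in> hom (slice C (terminal_ob C)) f g \<and> far (slice_dom C) a = h"
      then obtain f' h' g' where "a = (f', h', g')" by (cases a)
      with a show "a = (f, h, g)" by simp
    qed (use f g h in simp)
  next
    fix Y assume "Y \<in> Ob C"
    then show "\<exists>X \<in> Ob (slice C (terminal_ob C)). \<exists>i \<in> hom C Y (fob (slice_dom C) X). is_iso C i"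
      by (intro bexI[of _ "bang C Y"] bexI[of _ "idt C Y"]) auto
  qed
qed

end

lemma slice_ArD:
  assumes "(f, h, g) \<in> Ar (slice C X)"
  shows "f \<in> Ar C" "Cod C f = X" "g \<in> Ar C" "Cod C g = X" "h \<in> Ar C" "Dom C h = Dom C f"
    "Cod C h = Dom C g" "g \<cdot>\<^bsub>C\<^esub> h = f"
  using assms by simp_all

section \<open>From a Frobenius adjunction over the base to effective descent\<close>

text \<open>\<open>al\<close> and \<open>be\<close> are the mutually inverse components of the
  isomorphism that places the adjunction over \<open>C\<close>, with naturality written for unpacked
  slice maps.\<close>

locale frobenius_over =
  C: finite_limits C + D: finite_limits D + SD: adjunction D C S Dst etaD epsD +
  TU: adjunction "slice C X0" D T U eta eps
  for C :: "('o, 'a) cat" (structure) and D :: "('p, 'b) cat" and S Dst etaD epsD X0 T U eta eps +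
  fixes al be :: "'a \<Rightarrow> 'a"
  assumes X0 [simp]: "X0 \<in> Ob C"
    and frob: "frobenius_at (slice C X0) D T U eps (fob Dst X0)"
    and al_in: "\<lbrakk>f \<in> Ar C; Cod C f = X0\<rbrakk> \<Longrightarrow> al f \<in> hom C (fob S (fob T f)) (Dom C f)"
    and be_in: "\<lbrakk>f \<in> Ar C; Cod C f = X0\<rbrakk> \<Longrightarrow> be f \<in> hom C (Dom C f) (fob S (fob T f))"
    and be_al: "\<lbrakk>f \<in> Ar C; Cod C f = X0\<rbrakk> \<Longrightarrow> be f \<cdot> al f = idt C (fob S (fob T f))"
    and al_be: "\<lbrakk>f \<in> Ar C; Cod C f = X0\<rbrakk> \<Longrightarrow> al f \<cdot> be f = idt C (Dom C f)"
    and al_nat: "(f, h, g) \<in> Ar (slice C X0) \<Longrightarrow> al g \<cdot> far S (far T (f, h, g)) = h \<cdot> al f"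
begin

abbreviation compD (infixr \<open>\<odot>\<close> 70) where
  "g \<odot> f \<equiv> g \<cdot>\<^bsub>D\<^esub> f"

abbreviation "A \<equiv> slice C X0"

abbreviation "P Y \<equiv> fob U (fob Dst Y)"

abbreviation "one \<equiv> idt C X0"

abbreviation "W \<equiv> fob T one"

abbreviation "t f \<equiv> far T (f, f, one)"

text \<open>By \<open>al\<close>, the composite of the two right adjoints is right adjoint to the
  domain functor, and so \<open>P Y\<close> plays the projection of \<open>X0 x Y\<close> to
  \<open>X0\<close>. This is the counit of the composite adjunction, that is, the other
  projection.\<close>

definition "rho Y = epsD Y \<cdot> far S (eps (fob Dst Y)) \<cdot> be (P Y)"

section \<open>Maps into \<open>P Y\<close> as maps into \<open>X0 x Y\<close>\<close>

lemma al_simps [simp]: "\<lbrakk>f \<in> Ar C; Cod C f = X0\<rbrakk> \<Longrightarrow> al f \<in> Ar C"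
  "\<lbrakk>f \<in> Ar C; Cod C f = X0\<rbrakk> \<Longrightarrow> Dom C (al f) = fob S (fob T f)"
  "\<lbrakk>f \<in> Ar C; Cod C f = X0\<rbrakk> \<Longrightarrow> Cod C (al f) = Dom C f"
  "\<lbrakk>f \<in> Ar C; Cod C f = X0\<rbrakk> \<Longrightarrow> be f \<in> Ar C"
  "\<lbrakk>f \<in> Ar C; Cod C f = X0\<rbrakk> \<Longrightarrow> Cod C (be f) = fob S (fob T f)"
  "\<lbrakk>f \<in> Ar C; Cod C f = X0\<rbrakk> \<Longrightarrow> Dom C (be f) = Dom C f"
  using al_in be_in by simp_all

lemma al_iso: "\<lbrakk>f \<in> Ar C; Cod C f = X0\<rbrakk> \<Longrightarrow> is_iso C (al f)"
  by (rule C.is_isoI[of _ "fob S (fob T f)" "Dom C f" "be f"]) (simp_all add: be_al al_be)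

lemma be_iso: "\<lbrakk>f \<in> Ar C; Cod C f = X0\<rbrakk> \<Longrightarrow> is_iso C (be f)"
  by (rule C.is_isoI[of _ "Dom C f" "fob S (fob T f)" "al f"]) (simp_all add: be_al al_be)

lemma U_ob [simp]: "Y \<in> Ob D \<Longrightarrow> fob U Y \<in> Ar C" "Y \<in> Ob D \<Longrightarrow> Cod C (fob U Y) = X0"
  using TU.R.fob_Ob[of Y] by simp_all

lemma rho_simps [simp]: "Y \<in> Ob C \<Longrightarrow> rho Y \<in> Ar C" "Y \<in> Ob C \<Longrightarrow> Dom C (rho Y) = Dom C (P Y)"
  "Y \<in> Ob C \<Longrightarrow> Cod C (rho Y) = Y"
  by (simp_all add: rho_def)

lemma far_U_E:
  assumes "k \<in> Ar D"
  obtains w where "far U k = (fob U (Dom D k), w, fob U (Cod D k))"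
    "(fob U (Dom D k), w, fob U (Cod D k)) \<in> Ar A"
proof -
  have k: "far U k \<in> Ar A" "Dom A (far U k) = fob U (Dom D k)" "Cod A (far U k) = fob U (Cod D k)"
    using assms by (simp_all del: slice_simps)
  obtain f w g where fwg: "far U k = (f, w, g)" by (cases "far U k")
  then have "f = fob U (Dom D k)" "g = fob U (Cod D k)" using k(2,3) by (simp_all only: slice_simps)
  then show thesis using that fwg k(1) by metis
qed

lemma be_al' [simp]: "\<lbrakk>f \<in> Ar C; Cod C f = X0; x \<in> Ar C; Cod C x = fob S (fob T f)\<rbrakk> \<Longrightarrow>
    be f \<cdot> al f \<cdot> x = x"
  using C.reassoc[OF be_al, of f x] by simp

text \<open>Transposing a slice map across both adjunctions amounts, up to \<open>al\<close>, to
  composing it with \<open>rho Y\<close>; naturality of \<open>al\<close> is what removes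
  \<open>T\<close>.\<close>

lemma transpose:
  assumes a: "(f, h, P Y) \<in> Ar A" and Y: "Y \<in> Ob C"
  shows "epsD Y \<cdot> far S (eps (fob Dst Y) \<odot> far T (f, h, P Y)) = rho Y \<cdot> h \<cdot> al f"
proof -
  have ty: "f \<in> Ar C" "h \<in> Ar C" "Cod C f = X0" "Dom C f = Dom C h" "Cod C h = Dom C (P Y)" using a by simp_all
  have "far T (f, h, P Y) \<in> hom D (fob T f) (fob T (P Y))" using TU.L.far_in[of _ f "P Y"] a by simp
  then have Ta: "far T (f, h, P Y) \<in> Ar D" "Dom D (far T (f, h, P Y)) = fob T f"
     "Cod D (far T (f, h, P Y)) = fob T (P Y)" by simp_all
  have "far S (far T (f, h, P Y)) = be (P Y) \<cdot> al (P Y) \<cdot> far S (far T (f, h, P Y))"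
    using Ta Y by simp
  also have "\<dots> = be (P Y) \<cdot> h \<cdot> al f"
    using al_nat[OF a] by simp
  finally have "far S (far T (f, h, P Y)) = be (P Y) \<cdot> h \<cdot> al f" .
  then show ?thesis using Ta Y ty by (simp add: rho_def)
qed

text \<open>Couniversality of the two counits in succession, after cancelling the isomorphism
  \<open>al f\<close>. With \<open>rho_uniqueness\<close> it lets slice maps into \<open>P Y\<close>
  be described by their second coordinate.\<close>

lemma rho_existence:
  assumes f: "f \<in> Ar C" "Cod C f = X0" and u: "u \<in> hom C (Dom C f) Y"
  obtains h where "(f, h, P Y) \<in> Ar A" "rho Y \<cdot> h = u"
proof -
  have Y: "Y \<in> Ob C" using u by auto
  obtain b where b: "b \<in> hom D (fob T f) (fob Dst Y)" "epsD Y \<cdot> far S b = u \<cdot> al f"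
    by (rule SD.counit_existence[of "fob T f" "u \<cdot> al f" Y]) (use f u in simp_all)
  obtain a where a: "a \<in> hom A f (P Y)" "eps (fob Dst Y) \<odot> far T a = b"
    by (rule TU.counit_existence[of f b "fob Dst Y"]) (use f b in simp_all)
  obtain h where h: "a = (f, h, P Y)" using a(1) by (cases a) simp
  have ar: "(f, h, P Y) \<in> Ar A" using a(1) by (simp only: h mem_hom)
  then have ht: "h \<in> Ar C" "Dom C h = Dom C f" "Cod C h = Dom C (P Y)" by simp_all
  have "(rho Y \<cdot> h) \<cdot> al f = u \<cdot> al f"
    using transpose[OF ar Y] a(2) b(2) h ht f Y by simp
  then have "rho Y \<cdot> h = u"
    by - (rule C.iso_cancel_right[OF al_iso[OF f]], use ht f u Y in simp_all)
  with ar that show thesis by blast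
qed

lemma rho_uniqueness:
  assumes a: "(f, h, P Y) \<in> Ar A" "(f, h', P Y) \<in> Ar A" and Y: "Y \<in> Ob C"
    and eq: "rho Y \<cdot> h = rho Y \<cdot> h'"
  shows "h = h'"
proof -
  have ty: "f \<in> Ar C" "Cod C f = X0" "h \<in> Ar C" "h' \<in> Ar C" "Dom C h = Dom C f" "Dom C h' = Dom C f"
    "Cod C h = Dom C (P Y)" "Cod C h' = Dom C (P Y)" using a by simp_all
  have Ta: "far T (f, k, P Y) \<in> Ar D \<and> Dom D (far T (f, k, P Y)) = fob T f \<and>
     Cod D (far T (f, k, P Y)) = fob T (P Y)" if "(f, k, P Y) \<in> Ar A" for k
    using TU.L.far_in[of _ f "P Y"] that by simp
  have "(rho Y \<cdot> h) \<cdot> al f = (rho Y \<cdot> h') \<cdot> al f" using eq by simp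
  then have "rho Y \<cdot> h \<cdot> al f = rho Y \<cdot> h' \<cdot> al f" using ty Y by simp
  then have "epsD Y \<cdot> far S (eps (fob Dst Y) \<odot> far T (f, h, P Y)) =
    epsD Y \<cdot> far S (eps (fob Dst Y) \<odot> far T (f, h', P Y))"
    unfolding transpose[OF a(1) Y] transpose[OF a(2) Y] .
  then have "eps (fob Dst Y) \<odot> far T (f, h, P Y) = eps (fob Dst Y) \<odot> far T (f, h', P Y)"
    by - (rule SD.counit_uniqueness[where Y = Y], use Ta[OF a(1)] Ta[OF a(2)] Y in simp_all)
  then have "(f, h, P Y) = (f, h', P Y)"
    by - (rule TU.counit_uniqueness[where Y = "fob Dst Y"], use a Y in simp_all)
  then show ?thesis by simp
qed

lemma rho_natural:
  assumes u: "u \<in> hom C Y Y'" and w: "far U (far Dst u) = (P Y, w, P Y')" "(P Y, w, P Y') \<in> Ar A"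
  shows "rho Y' \<cdot> w = u \<cdot> rho Y"
proof -
  have Y: "Y \<in> Ob C" "Y' \<in> Ob C" using u by auto
  have wt: "w \<in> Ar C" "Dom C w = Dom C (P Y)" "Cod C w = Dom C (P Y')" using w(2) by simp_all
  have "(rho Y' \<cdot> w) \<cdot> al (P Y) = epsD Y' \<cdot> far S (eps (fob Dst Y') \<odot> far T (far U (far Dst u)))"
    using transpose[OF w(2)] w(1) wt Y by simp
  also have "\<dots> = epsD Y' \<cdot> far S (far Dst u \<odot> eps (fob Dst Y))"
    using TU.counit_nat[of "far Dst u"] u by simp
  also have "\<dots> = u \<cdot> epsD Y \<cdot> far S (eps (fob Dst Y))"
    using C.reassoc[OF SD.counit_nat[of u], of "far S (eps (fob Dst Y))"] u Y by simp
  also have "\<dots> = (u \<cdot> rho Y) \<cdot> al (P Y)"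
    using u Y be_al[of "P Y"] by (simp add: rho_def)
  finally show ?thesis
    by - (rule C.iso_cancel_right[OF al_iso[of "P Y"]], use u Y wt in simp_all)
qed

text \<open>In terms of \<open>X0 x X0\<close> this is the diagonal, both of whose coordinates are
  the identity; as a map out of \<open>one\<close> it is a global element of \<open>P X0\<close> in
  the slice.\<close>

definition "dl = (SOME d. (one, d, P X0) \<in> Ar A \<and> rho X0 \<cdot> d = one)"

lemma dl: "(one, dl, P X0) \<in> Ar A" "rho X0 \<cdot> dl = one"
proof -
  have "\<exists>d. (one, d, P X0) \<in> Ar A \<and> rho X0 \<cdot> d = one"
    by (rule rho_existence[of one one X0]) (simp_all, blast)
  then have "(one, dl, P X0) \<in> Ar A \<and> rho X0 \<cdot> dl = one" unfolding dl_def by (rule someI_ex)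
  then show "(one, dl, P X0) \<in> Ar A" "rho X0 \<cdot> dl = one" by blast+
qed

lemma dl_simps [simp]: "dl \<in> Ar C" "Dom C dl = X0" "Cod C dl = Dom C (P X0)" "P X0 \<cdot> dl = one"
  using dl(1) by simp_all

text \<open>The transpose of the diagonal under \<open>T\<close> and \<open>U\<close>. A second
  transposition, under \<open>S\<close> and \<open>Dst\<close>, turns it into the isomorphism
  \<open>al one\<close> of \<open>fob S W\<close> with \<open>X0\<close>.\<close>

definition "kap = eps (fob Dst X0) \<odot> far T (one, dl, P X0)"

lemma kap_simps [simp]: "kap \<in> Ar D" "Dom D kap = W" "Cod D kap = fob Dst X0"
  using TU.L.far_in[of "(one, dl, P X0)" one "P X0"] dl(1) by (simp_all add: kap_def)

lemma kap_transpose: "epsD X0 \<cdot> far S kap = al one"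
  using transpose[OF dl(1)] C.reassoc[OF dl(2), of "al one"] by (simp add: kap_def)

section \<open>Objects represented over \<open>W\<close>\<close>

lemma frobenius_square:
  assumes "k \<in> hom D Y (fob Dst X0)" "is_pullback A (one, dl, P X0) (far U k) p q"
  shows "is_pullback D kap k (far T p) (eps Y \<odot> far T q)"
  using TU.frobenius_at_pullback[OF C.slice_has_pullbacks[OF C.has_pullbacks] D.has_pullbacks _ frob, of "(one, dl, P X0)" k p q]
    assms dl(1) unfolding kap_def by simp

lemma t_in [simp]:
  assumes "f \<in> Ar C" "Cod C f = X0"
  shows "t f \<in> Ar D" "Dom D (t f) = fob T f" "Cod D (t f) = W" "al one \<cdot> far S (t f) = f \<cdot> al f"
  using TU.L.far_in[of "(f, f, one)" f one] al_nat[of f f one] assms by simp_all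

text \<open>With \<open>P\<close> read as a product, \<open>q\<close> is the graph of
  \<open>f\<close> and \<open>far U (far Dst f)\<close> is \<open>X0 x f\<close>. A pair
  \<open>(a, b)\<close> is sent into the diagonal exactly if \<open>a = f b\<close>, so the pullback
  of the diagonal is the graph.\<close>

lemma representing_square:
  assumes f: "f \<in> Ar C" "Cod C f = X0" and q: "(f, q, P (Dom C f)) \<in> Ar A" "rho (Dom C f) \<cdot> q = idt C (Dom C f)"
  shows "is_pullback A (one, dl, P X0) (far U (far Dst f)) (f, f, one) (f, q, P (Dom C f))"
proof -
  let ?X = "Dom C f"
  have "far Dst f \<in> Ar D" "Dom D (far Dst f) = fob Dst ?X" "Cod D (far Dst f) = fob Dst X0" using f by simp_all
  then obtain w where w: "far U (far Dst f) = (P ?X, w, P X0)" "(P ?X, w, P X0) \<in> Ar A"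
    using far_U_E[of "far Dst f"] by metis
  have wt: "w \<in> Ar C" "Dom C w = Dom C (P ?X)" "Cod C w = Dom C (P X0)" "P X0 \<cdot> w = P ?X" using w(2) by simp_all
  have qt: "q \<in> Ar C" "Dom C q = ?X" "Cod C q = Dom C (P ?X)" "P ?X \<cdot> q = f"
    by (rule slice_ArD[OF q(1)])+
  have rw: "rho X0 \<cdot> w = f \<cdot> rho ?X" by (rule rho_natural) (use f w in simp_all)
  have wq: "P X0 \<cdot> w \<cdot> x = P ?X \<cdot> x" "rho X0 \<cdot> w \<cdot> x = f \<cdot> rho ?X \<cdot> x"
    if "x \<in> Ar C" "Cod C x = Dom C (P ?X)" for x
    using C.reassoc[OF wt(4), of x] C.reassoc[OF rw, of x] wt(1-3) f that by simp_all
  have dlx: "P X0 \<cdot> dl \<cdot> x = x" "rho X0 \<cdot> dl \<cdot> x = x" if "x \<in> Ar C" "Cod C x = X0" for x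
    using C.reassoc[OF dl_simps(4), of x] C.reassoc[OF dl(2), of x] that by simp_all
  have "is_pullback C dl w f q"
  proof (rule pullbackI)
    show "dl \<cdot> f = w \<cdot> q"
    proof (rule rho_uniqueness[where f = f and Y = X0])
      show "(f, dl \<cdot> f, P X0) \<in> Ar A" using f dlx by simp
      show "(f, w \<cdot> q, P X0) \<in> Ar A" using f wt(1-3) qt wq by simp
      show "rho X0 \<cdot> dl \<cdot> f = rho X0 \<cdot> w \<cdot> q" using f wt(1-3) qt wq dlx q(2) by simp
    qed simp
  next
    fix Z u v assume u: "u \<in> hom C Z (Dom C dl)" and v: "v \<in> hom C Z (Dom C w)" and uv: "dl \<cdot> u = w \<cdot> v"
    have ut: "u \<in> Ar C" "Dom C u = Z" "Cod C u = X0" and vt: "v \<in> Ar C" "Dom C v = Z" "Cod C v = Dom C (P ?X)"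
      using u v wt(2) by simp_all
    have 1: "u = f \<cdot> rho ?X \<cdot> v"
      using arg_cong[OF uv, of "\<lambda>x. rho X0 \<cdot> x"] dlx(2)[OF ut(1,3)] wq(2)[OF vt(1,3)] by simp
    have 2: "u = P ?X \<cdot> v"
      using arg_cong[OF uv, of "\<lambda>x. P X0 \<cdot> x"] dlx(1)[OF ut(1,3)] wq(1)[OF vt(1,3)] by simp
    have qr: "q \<cdot> rho ?X \<cdot> v = v"
    proof (rule rho_uniqueness[where f = u and Y = ?X])
      have "P ?X \<cdot> q \<cdot> rho ?X \<cdot> v = u"
        unfolding 1 by (rule C.reassoc[OF qt(4)]) (use qt(1-3) vt f in simp_all)
      then show "(u, q \<cdot> rho ?X \<cdot> v, P ?X) \<in> Ar A" using ut vt qt(1-3) f by simp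
      show "(u, v, P ?X) \<in> Ar A" using ut vt f 2[symmetric] by simp
      show "rho ?X \<cdot> q \<cdot> rho ?X \<cdot> v = rho ?X \<cdot> v"
        by (subst C.reassoc[OF q(2)]) (use qt(1-3) vt f in simp_all)
    qed (use f in simp)
    show "\<exists>h. h \<in> hom C Z (Dom C f) \<and> f \<cdot> h = u \<and> q \<cdot> h = v"
      by (rule exI[of _ "rho ?X \<cdot> v"]) (use 1[symmetric] qr vt f in simp)
  next
    fix Z h h' assume h: "h \<in> hom C Z (Dom C f)" "h' \<in> hom C Z (Dom C f)" "q \<cdot> h = q \<cdot> h'"
    have "rho ?X \<cdot> q \<cdot> h = rho ?X \<cdot> q \<cdot> h'" using h(3) by simp
    then show "h = h'"
      using C.reassoc[OF q(2), of h] C.reassoc[OF q(2), of h'] qt(1-3) h(1,2) f by simp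
  qed (use f qt wt in simp_all)
  then show ?thesis
    unfolding w(1)
    using C.slice_pullback[OF dl(1) w(2), of f f f q] f by simp
qed

text \<open>The Frobenius square of \<open>representing_square\<close> says that \<open>T f\<close> represents, over \<open>W\<close>, the pairs of
  a map \<open>y\<close> to \<open>W\<close> and a map from the image under \<open>S\<close> to \<open>Dom f\<close> over \<open>X0\<close>.\<close>

lemma representing:
  assumes f: "f \<in> Ar C" "Cod C f = X0"
  shows "\<exists>c. is_pullback D kap (far Dst f) (t f) c \<and> epsD (Dom C f) \<cdot> far S c = al f"
proof -
  let ?X = "Dom C f"
  obtain q where q: "(f, q, P ?X) \<in> Ar A" "rho ?X \<cdot> q = idt C ?X"
    by (rule rho_existence[OF f, of "idt C ?X" ?X]) (use f in simp, use that in blast)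
  have "is_pullback D kap (far Dst f) (t f) (eps (fob Dst ?X) \<odot> far T (f, q, P ?X))"
    by (rule frobenius_square[OF _ representing_square[OF f q]]) (use f in simp)
  moreover have "q \<in> Ar C" "Dom C q = ?X" "Cod C q = Dom C (P ?X)" by (rule slice_ArD[OF q(1)])+
  then have "epsD ?X \<cdot> far S (eps (fob Dst ?X) \<odot> far T (f, q, P ?X)) = al f"
    using transpose[OF q(1)] C.reassoc[OF q(2), of "al f"] f by simp
  ultimately show ?thesis by blast
qed

text \<open>A map into the pullback \<open>fob T f\<close> is a map \<open>y\<close> to
  \<open>W\<close> with a map \<open>b\<close> to \<open>fob Dst ?X\<close> that agree in
  \<open>fob Dst X0\<close>. Transposed, \<open>b\<close> is \<open>k\<close>, and agreement is
  \<open>fk\<close>, because the transpose of \<open>kap\<close> is \<open>al one\<close>.\<close>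

lemma rep_existence:
  assumes f: "f \<in> Ar C" "Cod C f = X0" and y: "y \<in> hom D Y W" and k: "k \<in> hom C (fob S Y) (Dom C f)"
    and fk: "f \<cdot> k = al one \<cdot> far S y"
  obtains z where "z \<in> hom D Y (fob T f)" "t f \<odot> z = y" "al f \<cdot> far S z = k"
proof -
  let ?X = "Dom C f"
  obtain c where c: "is_pullback D kap (far Dst f) (t f) c" "epsD ?X \<cdot> far S c = al f"
    using representing[OF f] by blast
  note d = pullbackD[OF c(1)]
  have Y: "Y \<in> Ob D" using y by auto
  obtain b where b: "b \<in> hom D Y (fob Dst ?X)" "epsD ?X \<cdot> far S b = k"
    by (rule SD.counit_existence[OF Y k])
  have "kap \<odot> y = far Dst f \<odot> b"
  proof (rule SD.counit_uniqueness[where Y = X0])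
    have "epsD X0 \<cdot> far S (kap \<odot> y) = al one \<cdot> far S y"
      using C.reassoc[OF kap_transpose, of "far S y"] y by simp
    moreover have "epsD X0 \<cdot> far S (far Dst f \<odot> b) = f \<cdot> epsD ?X \<cdot> far S b"
      using C.reassoc[OF SD.counit_nat[OF f(1)], of "far S b"] b(1) f by simp
    ultimately show "epsD X0 \<cdot> far S (kap \<odot> y) = epsD X0 \<cdot> far S (far Dst f \<odot> b)"
      using b(2) fk by simp
  qed (use y b(1) f in simp_all)
  then obtain z where z: "z \<in> hom D Y (Dom D (t f))" "t f \<odot> z = y" "c \<odot> z = b"
    by (rule pullbackE[OF c(1), of y Y b, rotated 2]) (use y b(1) f in simp_all)
  have "al f \<cdot> far S z = epsD ?X \<cdot> far S (c \<odot> z)"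
    using C.reassoc[OF c(2), of "far S z"] d z(1) f by simp
  then show thesis using that z b(2) f by simp
qed

lemma rep_uniqueness:
  assumes f: "f \<in> Ar C" "Cod C f = X0" and z: "z \<in> Ar D" "z' \<in> Ar D" "Dom D z = Dom D z'"
      "Cod D z = fob T f" "Cod D z' = fob T f"
    and eq: "t f \<odot> z = t f \<odot> z'" "far S z = far S z'"
  shows "z = z'"
proof -
  let ?X = "Dom C f"
  obtain c where c: "is_pullback D kap (far Dst f) (t f) c" "epsD ?X \<cdot> far S c = al f"
    using representing[OF f] by blast
  note d = pullbackD[OF c(1)]
  have 1: "epsD ?X \<cdot> far S (c \<odot> x) = al f \<cdot> far S x" if "x \<in> Ar D" "Cod D x = fob T f" for x
    using C.reassoc[OF c(2), of "far S x"] d f that by simp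
  have "c \<odot> z = c \<odot> z'"
  proof (rule SD.counit_uniqueness[where Y = ?X])
    show "epsD ?X \<cdot> far S (c \<odot> z) = epsD ?X \<cdot> far S (c \<odot> z')"
      using 1[OF z(1,4)] 1[OF z(2,5)] eq(2) by simp
  qed (use z d f in simp_all)
  then show ?thesis
    by - (rule D.pullback_eqI[OF c(1)], use z eq d f in simp_all)
qed

text \<open>Every \<open>Y\<close> over \<open>W\<close> is an equalizer of representing objects: with \<open>TQ\<close> the pullback of \<open>kap\<close> and
  \<open>kap \<circ> g\<close> and \<open>TQ'\<close> the kernel pair of \<open>kap\<close>, it is the equalizer of the two evident maps
  \<open>TQ \<rightarrow> TQ'\<close> over \<open>W\<close>.\<close>

lemma kernel_pullback:
  assumes k: "k \<in> hom D Y (fob Dst X0)"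
  obtains Q c where "Q \<in> Ar C" "Cod C Q = X0" "is_pullback D kap k (t Q) c"
proof -
  have "(one, dl, P X0) \<in> Ar A" "far U k \<in> Ar A" "Cod A (one, dl, P X0) = Cod A (far U k)"
    using dl(1) TU.R.far_in[of k Y "fob Dst X0"] k by simp_all
  then obtain p q where pb: "is_pullback A (one, dl, P X0) (far U k) p q"
    using C.slice_has_pullbacks[OF C.has_pullbacks, of X0] unfolding has_pullbacks_def by blast
  have p: "p \<in> Ar A" "Cod A p = one" using pullbackD[OF pb] by simp_all
  obtain Q h where h: "p = (Q, h, one)" using p(2) by (cases p) simp
  have ht: "Q \<in> Ar C" "Cod C Q = X0" "h \<in> Ar C" "Cod C h = X0" "one \<cdot> h = Q" using slice_ArD[OF p(1)[unfolded h]] by simp_all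
  have "h = Q" using C.comp_id_left[OF ht(3,4)] ht(5) by simp
  then have "p = (Q, Q, one)" using h by simp
  then show thesis using frobenius_square[OF k pb] ht that by simp
qed

text \<open>In elements, \<open>fob T Q\<close> consists of pairs \<open>(w, y)\<close> with
  \<open>w\<close> and \<open>g y\<close> identified by \<open>kap\<close>, \<open>i\<close> takes
  \<open>y\<close> to \<open>(g y, y)\<close>, and \<open>u\<close>, \<open>v\<close> send
  \<open>(w, y)\<close> to \<open>(w, g y)\<close> and \<open>(w, w)\<close>. Faithfulness holds
  because \<open>i\<close> is split by \<open>c\<close> and maps into \<open>fob T Q\<close> are
  determined by \<open>t Q\<close> and \<open>S\<close>. For fullness, the lift of
  \<open>far S i \<cdot> k\<close> to \<open>fob T Q\<close> equalizes \<open>u\<close> and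
  \<open>v\<close>, whence its coordinate in \<open>Y\<close> lies over \<open>g'\<close>.\<close>

lemma over_W_full_faithful:
  assumes g: "g \<in> hom D Y W"
  shows over_W_full: "\<lbrakk>g' \<in> hom D Z W; k \<in> hom C (fob S Z) (fob S Y); far S g \<cdot> k = far S g'\<rbrakk> \<Longrightarrow>
      \<exists>z. z \<in> hom D Z Y \<and> g \<odot> z = g' \<and> far S z = k"
    and over_W_faithful: "\<lbrakk>z \<in> hom D Z Y; z' \<in> hom D Z Y; g \<odot> z = g \<odot> z'; far S z = far S z'\<rbrakk> \<Longrightarrow> z = z'"
proof -
  have gt: "g \<in> Ar D" "Dom D g = Y" "Cod D g = W" and Y: "Y \<in> Ob D" using g by auto
  obtain Q c where Q: "Q \<in> Ar C" "Cod C Q = X0" and pb: "is_pullback D kap (kap \<odot> g) (t Q) c"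
    by (rule kernel_pullback[of "kap \<odot> g" Y]) (use gt in simp_all)
  obtain Q' c' where Q': "Q' \<in> Ar C" "Cod C Q' = X0" and pb': "is_pullback D kap kap (t Q') c'"
    by (rule kernel_pullback[of kap W]) simp_all
  have ct: "c \<in> Ar D" "Dom D c = fob T Q" "Cod D c = Y" "kap \<odot> t Q = kap \<odot> g \<odot> c"
    using pullbackD[OF pb] gt Q by simp_all
  have ct': "c' \<in> Ar D" "Dom D c' = fob T Q'" "Cod D c' = W" using pullbackD[OF pb'] Q' by simp_all
  obtain i where i: "i \<in> hom D Y (fob T Q)" "t Q \<odot> i = g" "c \<odot> i = idt D Y"
    by (rule pullbackE[OF pb, of g Y "idt D Y"]) (use gt Y Q in simp_all)
  obtain u where u: "u \<in> hom D (fob T Q) (fob T Q')" "t Q' \<odot> u = t Q" "c' \<odot> u = g \<odot> c"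
    by (rule pullbackE[OF pb', of "t Q" "fob T Q" "g \<odot> c"]) (use gt Q Q' ct in simp_all)
  obtain v where v: "v \<in> hom D (fob T Q) (fob T Q')" "t Q' \<odot> v = t Q" "c' \<odot> v = t Q"
    by (rule pullbackE[OF pb', of "t Q" "fob T Q" "t Q"]) (use Q Q' in simp_all)
  have it: "i \<in> Ar D" "Dom D i = Y" "Cod D i = fob T Q" 
    and ut: "u \<in> Ar D" "Dom D u = fob T Q" "Cod D u = fob T Q'"
    and vt: "v \<in> Ar D" "Dom D v = fob T Q" "Cod D v = fob T Q'" using i u v by simp_all
  have ui: "t Q' \<odot> u \<odot> x = t Q \<odot> x" "t Q' \<odot> v \<odot> x = t Q \<odot> x" 
    "c' \<odot> u \<odot> x = g \<odot> c \<odot> x" "c' \<odot> v \<odot> x = t Q \<odot> x"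
    if "x \<in> Ar D" "Cod D x = fob T Q" for x
    using D.reassoc[OF u(2), of x] D.reassoc[OF v(2), of x] D.reassoc[OF u(3), of x] D.reassoc[OF v(3), of x]
      ut vt ct(1-3) ct' gt Q Q' that by simp_all
  have uvi: "u \<odot> i = v \<odot> i"
    by (rule D.pullback_eqI[OF pb']) (use ui[OF it(1,3)] it ut vt ct(1-3) ct' gt Q Q' i(2,3) in simp_all)
  show "z = z'" if z: "z \<in> hom D Z Y" "z' \<in> hom D Z Y" "g \<odot> z = g \<odot> z'" "far S z = far S z'"
  proof -
    have zt: "z \<in> Ar D" "z' \<in> Ar D" "Dom D z = Z" "Dom D z' = Z" "Cod D z = Y" "Cod D z' = Y" using z by simp_all
    have ti: "t Q \<odot> i \<odot> x = g \<odot> x" "c \<odot> i \<odot> x = x" if "x \<in> Ar D" "Cod D x = Y" for x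
      using D.reassoc[OF i(2), of x] D.reassoc[OF i(3), of x] it ct(1-3) Q that by simp_all
    have "i \<odot> z = i \<odot> z'"
      by (rule rep_uniqueness[OF Q]) (use zt it ti(1)[OF zt(1,5)] ti(1)[OF zt(2,6)] z(3,4) in simp_all)
    then have "c \<odot> i \<odot> z = c \<odot> i \<odot> z'" by simp
    then show ?thesis using ti(2)[OF zt(1,5)] ti(2)[OF zt(2,6)] by simp
  qed
  show "\<exists>z. z \<in> hom D Z Y \<and> g \<odot> z = g' \<and> far S z = k"
    if g': "g' \<in> hom D Z W" and k: "k \<in> hom C (fob S Z) (fob S Y)" and gk: "far S g \<cdot> k = far S g'"
  proof -
    have kt: "k \<in> Ar C" "Dom C k = fob S Z" "Cod C k = fob S Y" using k by simp_all
    have "Q \<cdot> al Q \<cdot> far S i \<cdot> k = al one \<cdot> far S (t Q) \<cdot> far S i \<cdot> k"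
      using C.reassoc[OF t_in(4)[OF Q], of "far S i \<cdot> k"] Q it kt by simp
    also have "\<dots> = al one \<cdot> far S (t Q \<odot> i) \<cdot> k" using Q it kt by simp
    also have "\<dots> = al one \<cdot> far S g'" unfolding i(2) gk ..
    finally obtain z where z: "z \<in> hom D Z (fob T Q)" "t Q \<odot> z = g'" "al Q \<cdot> far S z = al Q \<cdot> far S i \<cdot> k"
      by (rule rep_existence[OF Q g', of "al Q \<cdot> far S i \<cdot> k", rotated 1]) (use Q it kt in simp_all)
    have zt: "z \<in> Ar D" "Dom D z = Z" "Cod D z = fob T Q" using z(1) by simp_all
    have Sz: "far S z = far S i \<cdot> k"
      by (rule C.iso_cancel_left[OF al_iso[OF Q]]) (use z(3) zt Q it kt in simp_all)
    have "far S u \<cdot> far S i = far S v \<cdot> far S i"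
      using arg_cong[OF uvi, of "far S"] ut vt it by simp
    from C.reassoc[OF this, of k] have Suv: "far S u \<cdot> far S z = far S v \<cdot> far S z"
      unfolding Sz using ut vt it kt by simp
    have "u \<odot> z = v \<odot> z"
      by (rule rep_uniqueness[OF Q']) (use ui[OF zt(1,3)] Suv zt ut vt in simp_all)
    then have "c' \<odot> u \<odot> z = c' \<odot> v \<odot> z" by simp
    then have gcz: "g \<odot> c \<odot> z = g'" using ui[OF zt(1,3)] z(2) by simp
    have "far S (c \<odot> z) = far S (c \<odot> i) \<cdot> k" using Sz zt ct(1-3) it kt by simp
    also have "\<dots> = k" unfolding i(3) using kt Y by simp
    finally show ?thesis using gcz zt ct(1-3) by (intro exI[of _ "c \<odot> z"]) simp
  qed
qed

text \<open>For essential surjectivity, \<open>al one\<close> identifies \<open>fob S W\<close> with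
  \<open>X0\<close>; an object \<open>x\<close> over \<open>fob S W\<close> thereby becomes
  \<open>f\<close> over \<open>X0\<close>, and naturality of \<open>al\<close> shows that
  \<open>t f\<close> is sent to \<open>x\<close> up to \<open>be f\<close>.\<close>

lemma sliced_S_equivalence: "ff_eso_functor (slice D W) (slice C (fob S W)) (slice_functor S)"
proof -
  interpret F: cat_functor "slice D W" "slice C (fob S W)" "slice_functor S"
    by (rule SD.L.slice_functor)
  show ?thesis
  proof
    fix f g h assume f: "f \<in> Ob (slice D W)" and g: "g \<in> Ob (slice D W)"
      and h: "h \<in> hom (slice C (fob S W)) (fob (slice_functor S) f) (fob (slice_functor S) g)"
    obtain k where k: "h = (far S f, k, far S g)" using h by (cases h) simp
    have ft: "f \<in> hom D (Dom D f) W" "g \<in> hom D (Dom D g) W" using f g by simp_all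
    have kt: "k \<in> hom C (fob S (Dom D f)) (fob S (Dom D g))" "far S g \<cdot> k = far S f"
      using h ft unfolding k by simp_all
    obtain z where z: "z \<in> hom D (Dom D f) (Dom D g)" "g \<odot> z = f" "far S z = k"
      using over_W_full[OF ft(2,1) kt] by blast
    show "\<exists>!a. a \<in> hom (slice D W) f g \<and> far (slice_functor S) a = h"
    proof (rule ex1I[of _ "(f, z, g)"])
      show "(f, z, g) \<in> hom (slice D W) f g \<and> far (slice_functor S) (f, z, g) = h"
        using z ft by (simp add: k)
      fix a assume a: "a \<in> hom (slice D W) f g \<and> far (slice_functor S) a = h"
      obtain z' where z': "a = (f, z', g)" using a by (cases a) simp
      have zt': "z' \<in> hom D (Dom D f) (Dom D g)" "g \<odot> z' = f" "far S z' = k" using a unfolding z' k by simp_all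
      have "z' = z" by (rule over_W_faithful[OF ft(2) zt'(1) z(1)]) (use z zt' in simp_all)
      then show "a = (f, z, g)" using z' by simp
    qed
  next
    fix x assume "x \<in> Ob (slice C (fob S W))"
    then have x: "x \<in> Ar C" "Cod C x = fob S W" by simp_all
    define f where "f = al one \<cdot> x"
    have f: "f \<in> Ar C" "Cod C f = X0" "Dom C f = Dom C x" using x by (simp_all add: f_def)
    have "al one \<cdot> far S (t f) = al one \<cdot> x \<cdot> al f"
      using t_in(4)[OF f(1,2)] x f by (simp add: f_def)
    then have St: "far S (t f) = x \<cdot> al f"
      by - (rule C.iso_cancel_left[OF al_iso[of one]], use f x in simp_all)
    have ar: "(x, be f, far S (t f)) \<in> Ar (slice C (fob S W))"
      using f x St al_be[OF f(1,2)] by simp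
    then have "is_iso (slice C (fob S W)) (x, be f, far S (t f))"
      using C.slice_iso_iff be_iso[OF f(1,2)] by blast
    with ar show "\<exists>g \<in> Ob (slice D W). \<exists>i \<in> hom (slice C (fob S W)) x (fob (slice_functor S) g). is_iso (slice C (fob S W)) i"
      using f by (intro bexI[of _ "t f"] bexI[of _ "(x, be f, far S (t f))"]) simp_all
  qed
qed

section \<open>The equivalence of \<open>slice C X0\<close> with \<open>slice D W\<close> induced by
  \<open>T\<close>\<close>

definition "E = \<lparr>fob = (\<lambda>f. t f), far = (\<lambda>(f, h, g). (t f, far T (f, h, g), t g))\<rparr>"

lemma E_simps [simp]: "fob E f = t f" "far E (f, h, g) = (t f, far T (f, h, g), t g)"
  by (simp_all add: E_def)

lemma far_T_in:
  assumes "(f, h, g) \<in> Ar A"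
  shows "far T (f, h, g) \<in> Ar D" "Dom D (far T (f, h, g)) = fob T f" "Cod D (far T (f, h, g)) = fob T g"
  using TU.L.far_in[of "(f, h, g)" f g] assms by simp_all

lemma far_T_comp:
  assumes "(f, h, g) \<in> Ar A" "(g, k, r) \<in> Ar A"
  shows "far T (g, k, r) \<odot> far T (f, h, g) = far T (f, k \<cdot> h, r)"
  using TU.L.far_comp[of "(f, h, g)" f g "(g, k, r)" r] assms by simp

lemma t_far_T:
  assumes "(f, h, g) \<in> Ar A"
  shows "t g \<odot> far T (f, h, g) = t f"
proof -
  have "g \<cdot> h = f" "(g, g, one) \<in> Ar A" using slice_ArD[OF assms] by simp_all
  then show ?thesis using far_T_comp[OF assms, of g one] by (simp only:)
qed

text \<open>The candidate \<open>h\<close> is \<open>far S z\<close> conjugated by \<open>al\<close>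
  and \<open>be\<close>. Its image under \<open>T\<close> agrees with \<open>z\<close> after
  \<open>S\<close> and after \<open>t g\<close>, which suffices because \<open>fob T g\<close> is a
  representing object.\<close>

lemma E_full:
  assumes f: "f \<in> Ar C" "Cod C f = X0" and g: "g \<in> Ar C" "Cod C g = X0"
    and z: "z \<in> hom D (fob T f) (fob T g)" "t g \<odot> z = t f"
  obtains h where "(f, h, g) \<in> Ar A" "far T (f, h, g) = z"
proof -
  have zt: "z \<in> Ar D" "Dom D z = fob T f" "Cod D z = fob T g" using z by simp_all
  define h where "h = al g \<cdot> far S z \<cdot> be f"
  have ht: "h \<in> Ar C" "Dom C h = Dom C f" "Cod C h = Dom C g" using f g zt by (simp_all add: h_def)
  have "g \<cdot> h = (g \<cdot> al g) \<cdot> far S z \<cdot> be f" using f g zt by (simp add: h_def)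
  also have "\<dots> = al one \<cdot> far S (t g \<odot> z) \<cdot> be f"
    unfolding t_in(4)[OF g, symmetric] using f g zt by (simp del: t_in(4))
  also have "\<dots> = (f \<cdot> al f) \<cdot> be f"
    unfolding z(2) t_in(4)[OF f, symmetric] using f by (simp del: t_in(4))
  also have "\<dots> = f" using f al_be[OF f] by simp
  finally have ar: "(f, h, g) \<in> Ar A" using f g ht by simp
  note T = far_T_in[OF ar]
  have "al g \<cdot> far S (far T (f, h, g)) = al g \<cdot> far S z"
    using al_nat[OF ar] be_al[OF f] f g zt by (simp add: h_def)
  then have "far S (far T (f, h, g)) = far S z"
    by - (rule C.iso_cancel_left[OF al_iso[OF g]], use T zt g in simp_all)
  then have "far T (f, h, g) = z"
    by - (rule rep_uniqueness[OF g], use T zt t_far_T[OF ar] z(2) in simp_all)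
  with ar that show thesis by blast
qed

lemma E_faithful:
  assumes a: "(f, h, g) \<in> Ar A" "(f, h', g) \<in> Ar A" and eq: "far T (f, h, g) = far T (f, h', g)"
  shows "h = h'"
proof -
  note t = slice_ArD[OF a(1)] slice_ArD[OF a(2)]
  have "h \<cdot> al f = h' \<cdot> al f" using al_nat[OF a(1)] al_nat[OF a(2)] eq by simp
  then show ?thesis by - (rule C.iso_cancel_right[OF al_iso[OF t(1,2)]], use t in simp_all)
qed

text \<open>Viewing the identity of \<open>fob S V\<close> as a map into \<open>Dom C f\<close>,
  representability yields \<open>z\<close> over \<open>W\<close> with \<open>far S z = be f\<close>;
  since \<open>S\<close> reflects isomorphisms over \<open>W\<close>, \<open>z\<close> is
  invertible.\<close>

lemma covering_iso:
  assumes g: "g \<in> hom D V W"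
  obtains f z z' where "f \<in> Ar C" "Cod C f = X0" "z \<in> hom D V (fob T f)" "z' \<in> hom D (fob T f) V"
    "z' \<odot> z = idt D V" "z \<odot> z' = idt D (fob T f)" "t f \<odot> z = g"
proof -
  interpret S: ff_eso_functor "slice D W" "slice C (fob S W)" "slice_functor S"
    by (rule sliced_S_equivalence)
  have gt: "g \<in> Ar D" "Dom D g = V" "Cod D g = W" and V: "V \<in> Ob D" using g by auto
  define f where "f = al one \<cdot> far S g"
  have f: "f \<in> Ar C" "Cod C f = X0" "Dom C f = fob S V" using gt by (simp_all add: f_def)
  obtain z where z: "z \<in> hom D V (fob T f)" "t f \<odot> z = g" "al f \<cdot> far S z = idt C (fob S V)"
    by (rule rep_existence[OF f(1,2) g, of "idt C (fob S V)"]) (use f V gt in \<open>simp_all add: f_def\<close>)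
  have zt: "z \<in> Ar D" "Dom D z = V" "Cod D z = fob T f" using z by simp_all
  have "al f \<cdot> far S z = al f \<cdot> be f" using z(3) al_be[OF f(1,2)] f by simp
  then have "far S z = be f"
    by - (rule C.iso_cancel_left[OF al_iso[OF f(1,2)]], use f zt in simp_all)
  then have "is_iso C (far S z)" using be_iso[OF f(1,2)] by simp
  moreover have ar: "(g, z, t f) \<in> Ar (slice D W)" using zt z(2) gt f by simp
  moreover have "(far S g, far S z, far S (t f)) \<in> Ar (slice C (fob S W))"
    using S.far_Ar[OF ar] by (simp only: slice_functor_simps)
  ultimately have "is_iso (slice C (fob S W)) (far (slice_functor S) (g, z, t f))"
    by (simp only: slice_functor_simps C.slice_iso_iff)
  then have "is_iso (slice D W) (g, z, t f)" by (rule S.reflects_iso[OF ar])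
  then have iso: "is_iso D z" using D.slice_iso_iff[OF ar] by simp
  obtain z' where "z' \<in> hom D (fob T f) V" "z' \<odot> z = idt D V" "z \<odot> z' = idt D (fob T f)"
    by (rule D.is_isoE[OF iso z(1)])
  with that f z show thesis by blast
qed

lemma E_equivalence: "ff_eso_functor A (slice D W) E"
proof -
  have "cat_functor A (slice D W) E"
  proof (rule cat_functorI[OF C.category_slice D.category_slice])
    fix a assume "a \<in> Ar A"
    then obtain f h g where a: "a = (f, h, g)" "(f, h, g) \<in> Ar A" by (rule slice_ArE)
    show "far E a \<in> hom (slice D W) (fob E (Dom A a)) (fob E (Cod A a))"
      using far_T_in[OF a(2)] t_far_T[OF a(2)] slice_ArD(1-4)[OF a(2)] by (simp add: a(1))
  next
    fix a b assume "a \<in> Ar A" "b \<in> Ar A" and ba: "Dom A b = Cod A a"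
    then obtain f h g k r where a: "a = (f, h, g)" "(f, h, g) \<in> Ar A" and b: "b = (g, k, r)" "(g, k, r) \<in> Ar A"
      by (metis slice_ArE slice_simps(3,4))
    show "far E (b \<cdot>\<^bsub>A\<^esub> a) = far E b \<cdot>\<^bsub>slice D W\<^esub> far E a"
      using far_T_comp[OF a(2) b(2)] by (simp add: a(1) b(1))
  next
    fix f assume f: "f \<in> Ob A"
    then show "far E (idt A f) = idt (slice D W) (fob E f)" using TU.L.far_idt[OF f] by simp
  qed simp
  then interpret E: cat_functor A "slice D W" E .
  show ?thesis
  proof
    fix f g c assume f: "f \<in> Ob A" and g: "g \<in> Ob A" and c: "c \<in> hom (slice D W) (fob E f) (fob E g)"
    have f': "f \<in> Ar C" "Cod C f = X0" and g': "g \<in> Ar C" "Cod C g = X0" using f g by simp_all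
    obtain z where z: "c = (t f, z, t g)" using c by (cases c) simp
    have zt: "z \<in> hom D (fob T f) (fob T g)" "t g \<odot> z = t f"
      using c f' g' unfolding z by simp_all
    obtain h where h: "(f, h, g) \<in> Ar A" "far T (f, h, g) = z" by (rule E_full[OF f' g' zt])
    show "\<exists>!a. a \<in> hom A f g \<and> far E a = c"
    proof (rule ex1I[of _ "(f, h, g)"])
      show "(f, h, g) \<in> hom A f g \<and> far E (f, h, g) = c" using h z by (simp del: slice_simps(1,2) add: h(1))
      fix a assume a: "a \<in> hom A f g \<and> far E a = c"
      obtain h' where h': "a = (f, h', g)" using a by (cases a) simp
      have "(f, h', g) \<in> Ar A" "far T (f, h', g) = z" using a unfolding h' z by (simp_all only: mem_hom E_simps prod.inject)
      then have "h' = h" using E_faithful[of f h' g h] h by simp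
      then show "a = (f, h, g)" using h' by simp
    qed
  next
    fix g assume "g \<in> Ob (slice D W)"
    then have g: "g \<in> hom D (Dom D g) W" by simp
    obtain f z z' where f: "f \<in> Ar C" "Cod C f = X0" and z: "z \<in> hom D (Dom D g) (fob T f)"
      "z' \<in> hom D (fob T f) (Dom D g)" "z' \<odot> z = idt D (Dom D g)" "z \<odot> z' = idt D (fob T f)" "t f \<odot> z = g"
      by (rule covering_iso[OF g])
    have ar: "(g, z, t f) \<in> Ar (slice D W)" using z g f by simp
    have "is_iso D z" by (rule D.is_isoI[OF z(1,2)]) (use z in simp_all)
    then have "is_iso (slice D W) (g, z, t f)" using D.slice_iso_iff[OF ar] by simp
    with ar f show "\<exists>f \<in> Ob A. \<exists>i \<in> hom (slice D W) g (fob E f). is_iso (slice D W) i"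
      by (intro bexI[of _ f] bexI[of _ "(g, z, t f)"]) simp_all
  qed
qed

text \<open>A map to \<open>W\<close> may be taken to be some \<open>t f\<close>, by
  \<open>covering_iso\<close>. Maps from \<open>fob T f\<close> to \<open>Y\<close> are slice maps
  from \<open>f\<close> to \<open>fob U Y\<close>, and by full faithfulness of \<open>T\<close> over
  \<open>W\<close> these are the maps over \<open>W\<close> from \<open>fob T f\<close> to
  \<open>fob T (fob U Y)\<close>.\<close>

lemma product_with_W:
  assumes Y: "Y \<in> Ob D"
  shows "is_product D W Y (t (fob U Y)) (eps Y)"
  unfolding is_product_def
proof (intro conjI allI ballI)
  let ?u = "fob U Y"
  have uo: "?u \<in> Ar C" "Cod C ?u = X0" using Y by simp_all
  fix Z w y assume w: "w \<in> hom D Z W" and y: "y \<in> hom D Z Y"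
  obtain f z z' where f: "f \<in> Ar C" "Cod C f = X0" and z: "z \<in> hom D Z (fob T f)"
      "z' \<in> hom D (fob T f) Z" "z' \<odot> z = idt D Z" "z \<odot> z' = idt D (fob T f)" "t f \<odot> z = w"
    by (rule covering_iso[OF w])
  have zt: "z \<in> Ar D" "Dom D z = Z" "Cod D z = fob T f" "z' \<in> Ar D" "Dom D z' = fob T f" "Cod D z' = Z"
    "y \<in> Ar D" "Dom D y = Z" "Cod D y = Y" using z y by simp_all
  obtain a where a: "a \<in> hom A f ?u" "eps Y \<odot> far T a = y \<odot> z'"
    by (rule TU.counit_existence[of f "y \<odot> z'" Y]) (use f zt in simp_all)
  obtain h where h: "a = (f, h, ?u)" using a(1) by (cases a) simp
  have ar: "(f, h, ?u) \<in> Ar A" using a(1) by (simp only: h mem_hom)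
  note Ta = far_T_in[OF ar]
  have z'z: "x \<odot> z' \<odot> z = x" if "x \<in> Ar D" "Dom D x = Z" for x
    using z(3) that by simp
  show "\<exists>!h. h \<in> hom D Z (Dom D (t ?u)) \<and> t ?u \<odot> h = w \<and> eps Y \<odot> h = y"
  proof (rule ex1I[of _ "far T a \<odot> z"])
    have "t ?u \<odot> far T a \<odot> z = w"
      using D.reassoc[OF t_far_T[OF ar], of z] Ta zt z(5) f uo by (simp add: h)
    moreover have "eps Y \<odot> far T a \<odot> z = y"
      using D.reassoc[OF a(2), of z] Ta zt z'z[of y] Y by (simp add: h)
    ultimately show "far T a \<odot> z \<in> hom D Z (Dom D (t ?u)) \<and> t ?u \<odot> far T a \<odot> z = w \<and>
        eps Y \<odot> far T a \<odot> z = y"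
      using Ta zt uo by (simp add: h)
    fix k assume k: "k \<in> hom D Z (Dom D (t ?u)) \<and> t ?u \<odot> k = w \<and> eps Y \<odot> k = y"
    then have kt: "k \<in> Ar D" "Dom D k = Z" "Cod D k = fob T ?u" "t ?u \<odot> k = w" "eps Y \<odot> k = y" using uo by simp_all
    have "t ?u \<odot> k \<odot> z' = t f \<odot> z \<odot> z'"
      using D.reassoc[OF kt(4), of z'] D.reassoc[OF z(5), of z'] kt(1-3) zt uo f by simp
    then have tk: "t ?u \<odot> k \<odot> z' = t f" using z(4) f by simp
    have kz: "k \<odot> z' \<in> hom D (fob T f) (fob T ?u)" using kt(1-3) zt by simp
    obtain h' where h': "(f, h', ?u) \<in> Ar A" "far T (f, h', ?u) = k \<odot> z'"
      by (rule E_full[OF f uo kz tk])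
    have "eps Y \<odot> far T (f, h', ?u) = eps Y \<odot> far T a"
      unfolding h'(2) a(2) using D.reassoc[OF kt(5), of z'] kt(1-3) zt Y by simp
    then have "(f, h', ?u) = a"
      by - (rule TU.counit_uniqueness[where Y = Y], use h'(1) ar Y in \<open>simp_all only: h slice_simps(3,4)\<close>)
    then have "far T a \<odot> z = (k \<odot> z') \<odot> z" using h'(2) by simp
    then show "k = far T a \<odot> z" using kt(1-3) zt z'z[of k] by simp
  qed
qed (use Y in simp_all)

text \<open>A pullback over the terminal object is a product, and \<open>product_with_W\<close>
  exhibits \<open>fob T (fob U Y)\<close> as the product of \<open>W\<close> and \<open>Y\<close>.
  Thus pulling back along the map to the terminal object is \<open>U\<close> between two
  equivalences, and inherits Beck's conditions from it.\<close>

lemma pullback_along_bang: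
  "naturally_isomorphic (slice D (terminal_ob D)) (slice D W) ((E \<circ>\<^sub>F U) \<circ>\<^sub>F slice_dom D)
    (pullback_functor D (bang D W))"
proof -
  let ?S = "slice D (terminal_ob D)" and ?b = "bang D W"
  have b: "?b \<in> Ar D" "Dom D ?b = W" "Cod D ?b = terminal_ob D" by simp_all
  define th where "th g = (t (fob U (Dom D g)), pb_pair D ?b g (t (fob U (Dom D g))) (eps (Dom D g)), pb1 D ?b g)" for g
  have tt: "t (fob U Y) \<in> Ar D" "Dom D (t (fob U Y)) = fob T (fob U Y)" "Cod D (t (fob U Y)) = W" if "Y \<in> Ob D" for Y
    using that by simp_all
  have cone: "?b \<odot> t (fob U (Dom D g)) = g \<odot> eps (Dom D g)"
    if "g \<in> Ar D" "Cod D g = terminal_ob D" for g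
    by (rule D.bang_unique) (use tt[of "Dom D g"] b that in simp_all)
  have F1: "cat_functor ?S (slice D W) ((E \<circ>\<^sub>F U) \<circ>\<^sub>F slice_dom D)"
    by (rule comp_functor[OF D.slice_dom_functor comp_functor[OF TU.R.cat_functor_axioms]])
      (rule ff_eso_functor.axioms(1)[OF E_equivalence, THEN ff_functor.axioms(1)])
  have F2: "cat_functor ?S (slice D W) (pullback_functor D ?b)"
    using D.pullback_functor[of ?b] b by simp
  show ?thesis
  proof (rule naturally_isomorphicI[OF F1 F2, of th])
    fix g assume "g \<in> Ob ?S"
    then have g: "g \<in> Ar D" "Cod D g = terminal_ob D" by simp_all
    show th: "th g \<in> hom (slice D W) (fob ((E \<circ>\<^sub>F U) \<circ>\<^sub>F slice_dom D) g) (fob (pullback_functor D ?b) g)"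
      using cone[OF g] tt[of "Dom D g"] b g by (simp add: th_def)
    let ?h = "pb_pair D ?b g (t (fob U (Dom D g))) (eps (Dom D g))"
    have ht: "?h \<in> Ar D" "Cod D ?h = Dom D (pb1 D ?b g)" "pb1 D ?b g \<odot> ?h = t (fob U (Dom D g))"
      "pb2 D ?b g \<odot> ?h = eps (Dom D g)"
      using cone[OF g] tt[of "Dom D g"] b g by simp_all
    have pr: "is_product D W (Dom D g) (pb1 D ?b g) (pb2 D ?b g)"
      using D.terminal_pullback_product[of ?b W g "Dom D g"] D.chosen_pullback[of ?b g] b g by simp
    have "is_iso D ?h"
      using D.product_comparison_iso_iff[OF pr ht(1,2)] product_with_W[of "Dom D g"] ht(3,4) g by simp
    moreover have "(t (fob U (Dom D g)), ?h, pb1 D ?b g) \<in> Ar (slice D W)"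
      using th unfolding th_def mem_hom by blast
    ultimately show "is_iso (slice D W) (th g)"
      unfolding th_def by (simp only: D.slice_iso_iff)
  next
    fix a assume "a \<in> Ar ?S"
    then obtain g k g' where a: "a = (g, k, g')" "(g, k, g') \<in> Ar ?S" by (rule slice_ArE)
    note at = slice_ArD[OF a(2)]
    have k: "k \<in> hom D (Dom D g) (Dom D g')" using at by simp
    obtain w where w: "far U k = (fob U (Dom D g), w, fob U (Dom D g'))"
        "(fob U (Dom D g), w, fob U (Dom D g')) \<in> Ar A"
      using far_U_E[of k] k by (metis mem_hom)
    note Tw = far_T_in[OF w(2)]
    have en: "eps (Dom D g') \<odot> far T (fob U (Dom D g), w, fob U (Dom D g')) = k \<odot> eps (Dom D g)"
      using TU.counit_nat[of k] k w(1) by simp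
    have c1: "?b \<odot> pb1 D ?b g = g' \<odot> k \<odot> pb2 D ?b g"
      by (rule D.bang_unique) (use at b in simp_all)
    have c2: "?b \<odot> t (fob U (Dom D g)) = g' \<odot> k \<odot> eps (Dom D g)"
      by (rule D.bang_unique) (use at tt[of "Dom D g"] b in simp_all)
    have c3: "?b \<odot> t (fob U (Dom D g')) = g' \<odot> eps (Dom D g')" by (rule cone) (use at in simp_all)
    have c4: "?b \<odot> t (fob U (Dom D g)) = g \<odot> eps (Dom D g)" by (rule cone) (use at in simp_all)
    have "pb_pair D ?b g' (t (fob U (Dom D g'))) (eps (Dom D g')) \<odot> far T (fob U (Dom D g), w, fob U (Dom D g')) =
      pb_pair D ?b g' (t (fob U (Dom D g))) (k \<odot> eps (Dom D g))"
      using D.pb_pair_comp[of ?b g' "t (fob U (Dom D g'))" "eps (Dom D g')" "far T (fob U (Dom D g), w, fob U (Dom D g'))"]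
        at(1-7) tt[of "Dom D g'"] b c3 Tw t_far_T[OF w(2)] en by simp
    also have "\<dots> = pb_pair D ?b g' (pb1 D ?b g) (k \<odot> pb2 D ?b g) \<odot>
        pb_pair D ?b g (t (fob U (Dom D g))) (eps (Dom D g))"
      by (subst D.pb_pair_comp) (use at(1-7) tt[of "Dom D g"] b c1 c4 in simp_all)
    finally show "th (Cod ?S a) \<cdot>\<^bsub>slice D W\<^esub> far ((E \<circ>\<^sub>F U) \<circ>\<^sub>F slice_dom D) a =
        far (pullback_functor D ?b) a \<cdot>\<^bsub>slice D W\<^esub> th (Dom ?S a)"
      by (simp add: a(1) th_def w(1))
  qed
qed

lemma effective_descent_W:
  assumes "beck D A U"
  shows "effective_descent D (bang D W)"
proof -
  have "beck (slice D (terminal_ob D)) (slice D W) (pullback_functor D (bang D W))"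
    by (rule beck_naturally_isomorphic[OF beck_pre[OF beck_post[OF assms E_equivalence]
      D.slice_terminal_ff_eso] pullback_along_bang])
  then show ?thesis unfolding effective_descent_def monadic_iff_beck by simp
qed

end

proposition frobenius_at_imp_effective_descent:
  fixes C :: "('o, 'a) cat" and D :: "('p, 'b) cat"
  assumes "finite_limits C" "finite_limits D" and SD: "adjunction D C S Dst etaD epsD"
    and X0: "X0 \<in> Ob C" and TU: "adjunction (slice C X0) D T U eta eps"
    and frob: "frobenius_at (slice C X0) D T U eps (fob Dst X0)"
    and over: "naturally_isomorphic (slice C X0) C (S \<circ>\<^sub>F T) (slice_dom C)"
    and mon: "monadic D (slice C X0) U"
  shows "\<exists>W \<in> Ob D. effective_descent D (bang D W) \<and>
    equivalence_functor (slice D W) (slice C (fob S W)) (slice_functor S)"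
proof -
  interpret C: finite_limits C by fact
  interpret D: finite_limits D by fact
  interpret SD: adjunction D C S Dst etaD epsD by fact
  interpret TU: adjunction "slice C X0" D T U eta eps by fact
  let ?A = "slice C X0"
  obtain al be where al: "\<And>f. f \<in> Ob ?A \<Longrightarrow> al f \<in> hom C (fob (S \<circ>\<^sub>F T) f) (fob (slice_dom C) f)"
      "\<And>f. f \<in> Ob ?A \<Longrightarrow> be f \<in> hom C (fob (slice_dom C) f) (fob (S \<circ>\<^sub>F T) f)"
      "\<And>f. f \<in> Ob ?A \<Longrightarrow> be f \<cdot>\<^bsub>C\<^esub> al f = idt C (fob (S \<circ>\<^sub>F T) f)"
      "\<And>f. f \<in> Ob ?A \<Longrightarrow> al f \<cdot>\<^bsub>C\<^esub> be f = idt C (fob (slice_dom C) f)"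
      "\<And>a. a \<in> Ar ?A \<Longrightarrow> al (Cod ?A a) \<cdot>\<^bsub>C\<^esub> far (S \<circ>\<^sub>F T) a = far (slice_dom C) a \<cdot>\<^bsub>C\<^esub> al (Dom ?A a)"
    by (rule naturally_isomorphicE[OF over]) (rule that)
  interpret frobenius_over C D S Dst etaD epsD X0 T U eta eps al be
  proof
    fix f h g assume "(f, h, g) \<in> Ar (slice C X0)"
    from al(5)[OF this] show "al g \<cdot>\<^bsub>C\<^esub> far S (far T (f, h, g)) = h \<cdot>\<^bsub>C\<^esub> al f" by simp
  qed (use X0 frob al(1-4) in simp_all)
  have "W \<in> Ob D" by simp
  then show ?thesis
    using effective_descent_W mon monadic_iff_beck ff_eso_functor.is_equivalence[OF sliced_S_equivalence] by blast
qed

context finite_limits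
begin

lemma prd_map_simps [simp]:
  assumes "f \<in> Ar C" "g \<in> Ar C"
  shows "prd_map C f g \<in> Ar C" "Dom C (prd_map C f g) = Dom C (prd1 C (Dom C f) (Dom C g))"
    "Cod C (prd_map C f g) = Dom C (prd1 C (Cod C f) (Cod C g))"
    "prd1 C (Cod C f) (Cod C g) \<cdot> prd_map C f g = f \<cdot> prd1 C (Dom C f) (Dom C g)"
    "prd2 C (Cod C f) (Cod C g) \<cdot> prd_map C f g = g \<cdot> prd2 C (Dom C f) (Dom C g)"
  using assms by (simp_all add: prd_map_def)

lemma prd_map_pair:
  assumes "f \<in> Ar C" "g \<in> Ar C" "u \<in> Ar C" "v \<in> Ar C" "Dom C u = Dom C v" "Cod C u = Dom C f" "Cod C v = Dom C g"
  shows "prd_map C f g \<cdot> prd_pair C (Dom C f) (Dom C g) u v = prd_pair C (Cod C f) (Cod C g) (f \<cdot> u) (g \<cdot> v)"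
  using assms by (simp add: prd_map_def prd_pair_comp)

end

section \<open>Groupoid actions on generalized elements\<close>

text \<open>Maps into the underlying objects are treated as generalized elements, so that the laws of a
  groupoid and of its actions take their elementwise form.\<close>

locale groupoid_actions = internal_groupoid C G + finite_limits C
  for C :: "('o, 'a) cat" (structure) and G :: "('o, 'a) igpd"
begin

definition gm :: "'a \<Rightarrow> 'a \<Rightarrow> 'a" where
  "gm \<gamma> \<delta> = gmul G \<cdot> pb_pair C (d0 G) (d1 G) \<gamma> \<delta>"

definition act :: "'a \<times> 'a \<Rightarrow> 'a \<Rightarrow> 'a \<Rightarrow> 'a" where
  "act x \<gamma> u = snd x \<cdot> pb_pair C (d0 G) (fst x) \<gamma> u"

lemma groupoid_simps [simp]: "G0 G \<in> Ob C" "G1 G \<in> Ob C"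
  "d0 G \<in> Ar C" "Dom C (d0 G) = G1 G" "Cod C (d0 G) = G0 G"
  "d1 G \<in> Ar C" "Dom C (d1 G) = G1 G" "Cod C (d1 G) = G0 G"
  "gunit G \<in> Ar C" "Dom C (gunit G) = G0 G" "Cod C (gunit G) = G1 G"
  "ginv G \<in> Ar C" "Dom C (ginv G) = G1 G" "Cod C (ginv G) = G1 G"
  "gmul G \<in> Ar C" "Dom C (gmul G) = Dom C (pb1 C (d0 G) (d1 G))" "Cod C (gmul G) = G1 G"
  using G0_in G1_in d0_in d1_in e_in i_in m_in by simp_all

lemma d_unit [simp]: "\<lbrakk>x \<in> Ar C; Cod C x = G0 G\<rbrakk> \<Longrightarrow> d0 G \<cdot> gunit G \<cdot> x = x"
  "\<lbrakk>x \<in> Ar C; Cod C x = G0 G\<rbrakk> \<Longrightarrow> d1 G \<cdot> gunit G \<cdot> x = x"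
  using reassoc[OF d0_e, of x] reassoc[OF d1_e, of x] by simp_all

lemma d_inv [simp]: "\<lbrakk>x \<in> Ar C; Cod C x = G1 G\<rbrakk> \<Longrightarrow> d0 G \<cdot> ginv G \<cdot> x = d1 G \<cdot> x"
  "\<lbrakk>x \<in> Ar C; Cod C x = G1 G\<rbrakk> \<Longrightarrow> d1 G \<cdot> ginv G \<cdot> x = d0 G \<cdot> x"
  using reassoc[OF d0_i, of x] reassoc[OF d1_i, of x] by simp_all

lemma gm_simps [simp]:
  assumes "\<gamma> \<in> Ar C" "\<delta> \<in> Ar C" "Dom C \<gamma> = Dom C \<delta>" "Cod C \<gamma> = G1 G" "Cod C \<delta> = G1 G" "d0 G \<cdot> \<gamma> = d1 G \<cdot> \<delta>"
  shows "gm \<gamma> \<delta> \<in> Ar C" "Dom C (gm \<gamma> \<delta>) = Dom C \<delta>" "Cod C (gm \<gamma> \<delta>) = G1 G"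
    "d0 G \<cdot> gm \<gamma> \<delta> = d0 G \<cdot> \<delta>" "d1 G \<cdot> gm \<gamma> \<delta> = d1 G \<cdot> \<gamma>"
  using assms reassoc[OF d0_m, of "pb_pair C (d0 G) (d1 G) \<gamma> \<delta>"] reassoc[OF d1_m, of "pb_pair C (d0 G) (d1 G) \<gamma> \<delta>"]
  by (simp_all add: gm_def)

lemma gm_comp:
  assumes "\<gamma> \<in> Ar C" "\<delta> \<in> Ar C" "Dom C \<gamma> = Dom C \<delta>" "Cod C \<gamma> = G1 G" "Cod C \<delta> = G1 G" "d0 G \<cdot> \<gamma> = d1 G \<cdot> \<delta>"
    "k \<in> Ar C" "Cod C k = Dom C \<delta>"
  shows "gm \<gamma> \<delta> \<cdot> k = gm (\<gamma> \<cdot> k) (\<delta> \<cdot> k)"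
  using assms pb_pair_comp[of "d0 G" "d1 G" \<gamma> \<delta> k] by (simp add: gm_def)

text \<open>The axiom is stated for the generic composable triple, the projections of the triple
  pullback. The map \<open>h\<close> classifying the triple of \<alpha>, \<beta> and \<gamma>
  carries it to arbitrary elements.\<close>

lemma gm_assoc:
  assumes a: "\<alpha> \<in> Ar C" "Dom C \<alpha> = Z" "Cod C \<alpha> = G1 G" and b: "\<beta> \<in> Ar C" "Dom C \<beta> = Z" "Cod C \<beta> = G1 G"
    and c: "\<gamma> \<in> Ar C" "Dom C \<gamma> = Z" "Cod C \<gamma> = G1 G" and ab: "d0 G \<cdot> \<alpha> = d1 G \<cdot> \<beta>" and bc: "d0 G \<cdot> \<beta> = d1 G \<cdot> \<gamma>"
  shows "gm (gm \<alpha> \<beta>) \<gamma> = gm \<alpha> (gm \<beta> \<gamma>)"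
proof -
  define p q where "p = pb1 C (d0 G) (d1 G)" and "q = pb2 C (d0 G) (d1 G)"
  have pq: "p \<in> Ar C" "q \<in> Ar C" "Dom C q = Dom C p" "Cod C p = G1 G" "Cod C q = G1 G" "d0 G \<cdot> p = d1 G \<cdot> q"
    using pb_comm[of "d0 G" "d1 G"] by (simp_all add: p_def q_def)
  define gh k where "gh = pb1 C (d0 G \<cdot> q) (d1 G)" and "k = pb2 C (d0 G \<cdot> q) (d1 G)"
  have t: "gh \<in> Ar C" "k \<in> Ar C" "Dom C k = Dom C gh" "Cod C gh = Dom C p" "Cod C k = G1 G"
    and c1: "(d0 G \<cdot> q) \<cdot> gh = d1 G \<cdot> k"
    using pb_comm[of "d0 G \<cdot> q" "d1 G"] pq(1-5) by (simp_all add: gh_def k_def)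
  have c2: "d0 G \<cdot> p \<cdot> gh = d1 G \<cdot> q \<cdot> gh" using reassoc[OF pq(6), of gh] pq(1-5) t by simp
  have c3: "d0 G \<cdot> q \<cdot> gh = d1 G \<cdot> k" using c1 pq(1-5) t by simp
  define u where "u = pb_pair C (d0 G) (d1 G) \<alpha> \<beta>"
  have u: "u \<in> Ar C" "Dom C u = Z" "Cod C u = Dom C p" "p \<cdot> u = \<alpha>" "q \<cdot> u = \<beta>"
    using a b ab by (simp_all add: u_def p_def q_def)
  have "(d0 G \<cdot> q) \<cdot> u = d1 G \<cdot> \<gamma>" using u pq(1-5) bc by simp
  note comm = this
  have pbk: "is_pullback C (d0 G \<cdot> q) (d1 G) gh k"
    unfolding gh_def k_def by (rule chosen_pullback) (use pq(1-5) in simp_all)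
  obtain h where h': "h \<in> hom C Z (Dom C gh)" "gh \<cdot> h = u" "k \<cdot> h = \<gamma>"
    by (rule pullbackE[OF pbk _ _ comm]) (use u(1-3) pq(1-5) c in simp_all)
  then have h: "h \<in> Ar C" "Dom C h = Z" "Cod C h = Dom C gh" "gh \<cdot> h = u" "k \<cdot> h = \<gamma>" by simp_all
  \<comment> \<open>In this form \<open>gmul G \<cdot> gh\<close> is recognized as a value of
    \<open>gm\<close>.\<close>
  have ghe: "gh = pb_pair C (d0 G) (d1 G) (p \<cdot> gh) (q \<cdot> gh)"
    by (rule pb_eqI[of _ _ "d0 G" "d1 G"]) (use t c2 pq(1-5) pb_pair_simps[of "d0 G" "d1 G" "p \<cdot> gh" "q \<cdot> gh", folded p_def q_def]
        in \<open>simp_all flip: p_def q_def\<close>)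
  have m1: "gmul G \<cdot> gh = gm (p \<cdot> gh) (q \<cdot> gh)" by (simp only: gm_def ghe[symmetric])
  have e: "gm (gm (p \<cdot> gh) (q \<cdot> gh)) k = gm (p \<cdot> gh) (gm (q \<cdot> gh) k)"
    using m_assoc unfolding Let_def p_def[symmetric] q_def[symmetric] gh_def[symmetric] k_def[symmetric]
      m1 gm_def[symmetric] .
  define v w where "v = p \<cdot> gh" and "w = q \<cdot> gh"
  have vw: "v \<in> Ar C" "Dom C v = Dom C gh" "Cod C v = G1 G" "w \<in> Ar C" "Dom C w = Dom C gh" "Cod C w = G1 G"
    "v \<cdot> h = \<alpha>" "w \<cdot> h = \<beta>" "d0 G \<cdot> v = d1 G \<cdot> w" "d0 G \<cdot> w = d1 G \<cdot> k"
    using t pq(1-5) h u c2 c3 by (simp_all add: v_def w_def)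
  have "gm (gm v w) k \<cdot> h = gm (gm v w \<cdot> h) (k \<cdot> h)" by (rule gm_comp) (use vw t h in simp_all)
  also have "gm v w \<cdot> h = gm (v \<cdot> h) (w \<cdot> h)" by (rule gm_comp) (use vw t h in simp_all)
  finally have 1: "gm (gm v w) k \<cdot> h = gm (gm \<alpha> \<beta>) \<gamma>" using vw(7,8) h(5) by simp
  have "gm v (gm w k) \<cdot> h = gm (v \<cdot> h) (gm w k \<cdot> h)" by (rule gm_comp) (use vw t h in simp_all)
  also have "gm w k \<cdot> h = gm (w \<cdot> h) (k \<cdot> h)" by (rule gm_comp) (use vw t h in simp_all)
  finally have 2: "gm v (gm w k) \<cdot> h = gm \<alpha> (gm \<beta> \<gamma>)" using vw(7,8) h(5) by simp
  show ?thesis using e 1 2 unfolding v_def w_def by simp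
qed

lemma gm_unit_left: "\<lbrakk>\<gamma> \<in> Ar C; Cod C \<gamma> = G1 G\<rbrakk> \<Longrightarrow> gm (gunit G \<cdot> d1 G \<cdot> \<gamma>) \<gamma> = \<gamma>"
  using gm_comp[of "gunit G \<cdot> d1 G" "idt C (G1 G)" \<gamma>] unit_left by (simp add: gm_def[symmetric] d0_e)

lemma gm_inverse_left: "\<lbrakk>\<gamma> \<in> Ar C; Cod C \<gamma> = G1 G\<rbrakk> \<Longrightarrow> gm (ginv G \<cdot> \<gamma>) \<gamma> = gunit G \<cdot> d0 G \<cdot> \<gamma>"
  using gm_comp[of "ginv G" "idt C (G1 G)" \<gamma>] inverse_left by (simp add: gm_def[symmetric] d0_i)

lemma gm_inverse_right: "\<lbrakk>\<gamma> \<in> Ar C; Cod C \<gamma> = G1 G\<rbrakk> \<Longrightarrow> gm \<gamma> (ginv G \<cdot> \<gamma>) = gunit G \<cdot> d1 G \<cdot> \<gamma>"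
  using gm_comp[of "idt C (G1 G)" "ginv G" \<gamma>] inverse_right by (simp add: gm_def[symmetric] d1_i)

lemma gobjectD:
  assumes "is_gobject C G x"
  shows "fst x \<in> Ar C" "Cod C (fst x) = G0 G" "snd x \<in> Ar C" "Dom C (snd x) = Dom C (pb1 C (d0 G) (fst x))"
    "Cod C (snd x) = Dom C (fst x)"
  using assms unfolding is_gobject_def by (cases x; simp)+

lemma act_comp:
  assumes x: "is_gobject C G x" and "\<gamma> \<in> Ar C" "u \<in> Ar C" "Dom C \<gamma> = Dom C u" "Cod C \<gamma> = G1 G"
    "Cod C u = Dom C (fst x)" "d0 G \<cdot> \<gamma> = fst x \<cdot> u" "k \<in> Ar C" "Cod C k = Dom C u"
  shows "act x \<gamma> u \<cdot> k = act x (\<gamma> \<cdot> k) (u \<cdot> k)"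
  using assms(2-) gobjectD[OF x] pb_pair_comp[of "d0 G" "fst x" \<gamma> u k] by (simp add: act_def)

lemma act_simps [simp]:
  assumes x: "is_gobject C G x" and "\<gamma> \<in> Ar C" "u \<in> Ar C" "Dom C \<gamma> = Dom C u" "Cod C \<gamma> = G1 G"
    "Cod C u = Dom C (fst x)" "d0 G \<cdot> \<gamma> = fst x \<cdot> u"
  shows "act x \<gamma> u \<in> Ar C" "Dom C (act x \<gamma> u) = Dom C u" "Cod C (act x \<gamma> u) = Dom C (fst x)"
    "fst x \<cdot> act x \<gamma> u = d1 G \<cdot> \<gamma>"
proof -
  note d = gobjectD[OF x]
  show "act x \<gamma> u \<in> Ar C" "Dom C (act x \<gamma> u) = Dom C u" "Cod C (act x \<gamma> u) = Dom C (fst x)"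
    using assms(2-) d by (simp_all add: act_def)
  have e: "fst x \<cdot> snd x = d1 G \<cdot> pb1 C (d0 G) (fst x)" using x unfolding is_gobject_def by (cases x) simp
  define k where "k = pb_pair C (d0 G) (fst x) \<gamma> u"
  have k: "k \<in> Ar C" "Cod C k = Dom C (pb1 C (d0 G) (fst x))" "pb1 C (d0 G) (fst x) \<cdot> k = \<gamma>"
    using assms(2-) d by (simp_all add: k_def)
  have "fst x \<cdot> snd x \<cdot> k = (d1 G \<cdot> pb1 C (d0 G) (fst x)) \<cdot> k"
    by (rule reassoc[OF e]) (use k d in simp_all)
  also have "\<dots> = d1 G \<cdot> \<gamma>" using k d by simp
  finally show "fst x \<cdot> act x \<gamma> u = d1 G \<cdot> \<gamma>" by (simp add: act_def k_def)
qed

lemma act_unit: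
  assumes x: "is_gobject C G x" and u: "u \<in> Ar C" "Cod C u = Dom C (fst x)"
  shows "act x (gunit G \<cdot> fst x \<cdot> u) u = u"
proof -
  note d = gobjectD[OF x]
  have "act x (gunit G \<cdot> fst x) (idt C (Dom C (fst x))) = idt C (Dom C (fst x))"
    using x unfolding is_gobject_def act_def by (cases x) simp
  then have "act x (gunit G \<cdot> fst x) (idt C (Dom C (fst x))) \<cdot> u = u" using u d by simp
  then show ?thesis using act_comp[OF x, of "gunit G \<cdot> fst x" "idt C (Dom C (fst x))" u] u d by simp
qed

text \<open>As for \<open>gm_assoc\<close>, the law for the generic element of the triple pullback
  is pulled back along the map classifying \<alpha>, \<beta> and \<open>u\<close>.\<close>

lemma act_assoc:
  assumes x: "is_gobject C G x"
    and a: "\<alpha> \<in> Ar C" "Dom C \<alpha> = Z" "Cod C \<alpha> = G1 G" and b: "\<beta> \<in> Ar C" "Dom C \<beta> = Z" "Cod C \<beta> = G1 G"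
    and u: "u \<in> Ar C" "Dom C u = Z" "Cod C u = Dom C (fst x)" and ab: "d0 G \<cdot> \<alpha> = d1 G \<cdot> \<beta>" and bu: "d0 G \<cdot> \<beta> = fst x \<cdot> u"
  shows "act x (gm \<alpha> \<beta>) u = act x \<alpha> (act x \<beta> u)"
proof -
  define f where "f = fst x"
  have d: "f \<in> Ar C" "Cod C f = G0 G" using gobjectD[OF x] by (simp_all add: f_def)
  have u: "u \<in> Ar C" "Dom C u = Z" "Cod C u = Dom C f" and bu: "d0 G \<cdot> \<beta> = f \<cdot> u" using u bu by (simp_all add: f_def)
  define p q where "p = pb1 C (d0 G) (d1 G)" and "q = pb2 C (d0 G) (d1 G)"
  have pq: "p \<in> Ar C" "q \<in> Ar C" "Dom C q = Dom C p" "Cod C p = G1 G" "Cod C q = G1 G" "d0 G \<cdot> p = d1 G \<cdot> q"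
    using pb_comm[of "d0 G" "d1 G"] by (simp_all add: p_def q_def)
  define gh k where "gh = pb1 C (d0 G \<cdot> q) f" and "k = pb2 C (d0 G \<cdot> q) f"
  have t: "gh \<in> Ar C" "k \<in> Ar C" "Dom C k = Dom C gh" "Cod C gh = Dom C p" "Cod C k = Dom C f"
    and c1: "(d0 G \<cdot> q) \<cdot> gh = f \<cdot> k"
    using pb_comm[of "d0 G \<cdot> q" f] pq(1-5) d by (simp_all add: gh_def k_def)
  have c2: "d0 G \<cdot> p \<cdot> gh = d1 G \<cdot> q \<cdot> gh" using reassoc[OF pq(6), of gh] pq(1-5) t by simp
  have c3: "d0 G \<cdot> q \<cdot> gh = f \<cdot> k" using c1 pq(1-5) t by simp
  define ab' where "ab' = pb_pair C (d0 G) (d1 G) \<alpha> \<beta>"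
  have ab': "ab' \<in> Ar C" "Dom C ab' = Z" "Cod C ab' = Dom C p" "p \<cdot> ab' = \<alpha>" "q \<cdot> ab' = \<beta>"
    using a b ab by (simp_all add: ab'_def p_def q_def)
  have "(d0 G \<cdot> q) \<cdot> ab' = f \<cdot> u" using ab' pq(1-5) bu by simp
  note comm = this
  have pbk: "is_pullback C (d0 G \<cdot> q) f gh k"
    unfolding gh_def k_def by (rule chosen_pullback) (use pq(1-5) d in simp_all)
  obtain h where h': "h \<in> hom C Z (Dom C gh)" "gh \<cdot> h = ab'" "k \<cdot> h = u"
    by (rule pullbackE[OF pbk _ _ comm]) (use ab'(1-3) pq(1-5) u in simp_all)
  then have h: "h \<in> Ar C" "Dom C h = Z" "Cod C h = Dom C gh" "gh \<cdot> h = ab'" "k \<cdot> h = u" by simp_all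
  have ghe: "gh = pb_pair C (d0 G) (d1 G) (p \<cdot> gh) (q \<cdot> gh)"
    by (rule pb_eqI[of _ _ "d0 G" "d1 G"]) (use t c2 pq(1-5) pb_pair_simps[of "d0 G" "d1 G" "p \<cdot> gh" "q \<cdot> gh", folded p_def q_def]
        in \<open>simp_all flip: p_def q_def\<close>)
  have m1: "gmul G \<cdot> gh = gm (p \<cdot> gh) (q \<cdot> gh)" by (simp only: gm_def ghe[symmetric])
  have "act x (gmul G \<cdot> gh) k = act x (p \<cdot> gh) (act x (q \<cdot> gh) k)"
    using x unfolding is_gobject_def act_def by (cases x) (simp add: Let_def p_def q_def gh_def k_def f_def)
  then have e: "act x (gm (p \<cdot> gh) (q \<cdot> gh)) k = act x (p \<cdot> gh) (act x (q \<cdot> gh) k)"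
    unfolding m1 .
  define v w where "v = p \<cdot> gh" and "w = q \<cdot> gh"
  have vw: "v \<in> Ar C" "Dom C v = Dom C gh" "Cod C v = G1 G" "w \<in> Ar C" "Dom C w = Dom C gh" "Cod C w = G1 G"
    "v \<cdot> h = \<alpha>" "w \<cdot> h = \<beta>" "d0 G \<cdot> v = d1 G \<cdot> w" "d0 G \<cdot> w = fst x \<cdot> k"
    using t pq(1-5) h ab' c2 c3 by (simp_all add: v_def w_def f_def)
  have kf: "Cod C k = Dom C (fst x)" using t by (simp add: f_def)
  have "act x (gm v w) k \<cdot> h = act x (gm v w \<cdot> h) (k \<cdot> h)" by (rule act_comp[OF x]) (use vw t(1-4) kf h in simp_all)
  also have "gm v w \<cdot> h = gm (v \<cdot> h) (w \<cdot> h)" by (rule gm_comp) (use vw t(1-4) h in simp_all)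
  finally have 1: "act x (gm v w) k \<cdot> h = act x (gm \<alpha> \<beta>) u" using vw(7,8) h(5) by simp
  have "act x v (act x w k) \<cdot> h = act x (v \<cdot> h) (act x w k \<cdot> h)"
    by (rule act_comp[OF x]) (use vw t(1-4) kf h x in simp_all)
  also have "act x w k \<cdot> h = act x (w \<cdot> h) (k \<cdot> h)" by (rule act_comp[OF x]) (use vw t(1-4) kf h in simp_all)
  finally have 2: "act x v (act x w k) \<cdot> h = act x \<alpha> (act x \<beta> u)" using vw(7,8) h(5) by simp
  show ?thesis using e 1 2 unfolding v_def w_def by simp
qed

lemma act_generic:
  assumes "f \<in> Ar C" "Cod C f = G0 G" "a \<in> Ar C" "Dom C a = Dom C (pb1 C (d0 G) f)"
  shows "act (f, a) (pb1 C (d0 G) f) (pb2 C (d0 G) f) = a"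
  using assms by (simp add: act_def)

text \<open>The laws for all elements contain the axioms, which are their instances at the
  projections of the pullbacks and at the identity.\<close>

lemma gobjectI:
  assumes f: "f \<in> Ar C" "Cod C f = G0 G" and a: "a \<in> Ar C" "Dom C a = Dom C (pb1 C (d0 G) f)" "Cod C a = Dom C f"
    and over: "\<And>\<gamma> u. \<lbrakk>\<gamma> \<in> Ar C; u \<in> Ar C; Dom C \<gamma> = Dom C u; Cod C \<gamma> = G1 G; Cod C u = Dom C f; d0 G \<cdot> \<gamma> = f \<cdot> u\<rbrakk>
      \<Longrightarrow> f \<cdot> act (f, a) \<gamma> u = d1 G \<cdot> \<gamma>"
    and unit: "\<And>u. \<lbrakk>u \<in> Ar C; Cod C u = Dom C f\<rbrakk> \<Longrightarrow> act (f, a) (gunit G \<cdot> f \<cdot> u) u = u"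
    and ass: "\<And>\<alpha> \<beta> u. \<lbrakk>\<alpha> \<in> Ar C; \<beta> \<in> Ar C; u \<in> Ar C; Dom C \<alpha> = Dom C u; Dom C \<beta> = Dom C u; Cod C \<alpha> = G1 G; Cod C \<beta> = G1 G;
       Cod C u = Dom C f; d0 G \<cdot> \<alpha> = d1 G \<cdot> \<beta>; d0 G \<cdot> \<beta> = f \<cdot> u\<rbrakk> \<Longrightarrow>
       act (f, a) (gm \<alpha> \<beta>) u = act (f, a) \<alpha> (act (f, a) \<beta> u)"
  shows "is_gobject C G (f, a)"
proof -
  define p q where "p = pb1 C (d0 G) (d1 G)" and "q = pb2 C (d0 G) (d1 G)"
  have pq: "p \<in> Ar C" "q \<in> Ar C" "Dom C q = Dom C p" "Cod C p = G1 G" "Cod C q = G1 G" "d0 G \<cdot> p = d1 G \<cdot> q"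
    using pb_comm[of "d0 G" "d1 G"] by (simp_all add: p_def q_def)
  define gh k where "gh = pb1 C (d0 G \<cdot> q) f" and "k = pb2 C (d0 G \<cdot> q) f"
  have t: "gh \<in> Ar C" "k \<in> Ar C" "Dom C k = Dom C gh" "Cod C gh = Dom C p" "Cod C k = Dom C f"
    and c1: "(d0 G \<cdot> q) \<cdot> gh = f \<cdot> k"
    using pb_comm[of "d0 G \<cdot> q" f] pq(1-5) f by (simp_all add: gh_def k_def)
  have c2: "d0 G \<cdot> p \<cdot> gh = d1 G \<cdot> q \<cdot> gh" using reassoc[OF pq(6), of gh] pq(1-5) t by simp
  have c3: "d0 G \<cdot> q \<cdot> gh = f \<cdot> k" using c1 pq(1-5) t by simp
  have ghe: "gh = pb_pair C (d0 G) (d1 G) (p \<cdot> gh) (q \<cdot> gh)"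
    by (rule pb_eqI[of _ _ "d0 G" "d1 G"]) (use t c2 pq(1-5) pb_pair_simps[of "d0 G" "d1 G" "p \<cdot> gh" "q \<cdot> gh", folded p_def q_def]
        in \<open>simp_all flip: p_def q_def\<close>)
  have m1: "gmul G \<cdot> gh = gm (p \<cdot> gh) (q \<cdot> gh)" by (simp only: gm_def ghe[symmetric])
  have 1: "f \<cdot> a = d1 G \<cdot> pb1 C (d0 G) f"
    using over[of "pb1 C (d0 G) f" "pb2 C (d0 G) f"] act_generic[OF f a(1,2)] f pb_comm[of "d0 G" f] by simp
  have 2: "a \<cdot> pb_pair C (d0 G) f (gunit G \<cdot> f) (idt C (Dom C f)) = idt C (Dom C f)"
    using unit[of "idt C (Dom C f)"] f by (simp add: act_def)
  have 3: "act (f, a) (gmul G \<cdot> gh) k = act (f, a) (p \<cdot> gh) (act (f, a) (q \<cdot> gh) k)"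
    unfolding m1 by (rule ass) (use t pq(1-5) f c2 c3 in simp_all)
  show ?thesis unfolding is_gobject_def
    using f a 1 2 3 by (simp add: Let_def act_def p_def q_def gh_def k_def)
qed

lemma gobj_cat_simps [simp]: "x \<in> Ob (gobj_cat C G) \<longleftrightarrow> is_gobject C G x"
  "Dom (gobj_cat C G) (x, h, y) = x" "Cod (gobj_cat C G) (x, h, y) = y"
  "idt (gobj_cat C G) x = (x, idt C (Dom C (fst x)), x)"
  "(y', k, z) \<cdot>\<^bsub>gobj_cat C G\<^esub> (x, h, y) = (x, k \<cdot> h, z)"
  by (auto simp add: gobj_cat_def split: prod.split)

lemma gobj_ArD:
  assumes "(x, h, y) \<in> Ar (gobj_cat C G)"
  shows "is_gobject C G x" "is_gobject C G y" "h \<in> Ar C" "Dom C h = Dom C (fst x)" "Cod C h = Dom C (fst y)"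
    "fst y \<cdot> h = fst x"
  using assms unfolding gobj_cat_def by (cases x; cases y; simp)+

lemma gobj_ArE:
  assumes "c \<in> Ar (gobj_cat C G)"
  obtains x h y where "c = (x, h, y)" "(x, h, y) \<in> Ar (gobj_cat C G)"
  using assms by (cases c) blast

lemma equivariantD:
  assumes h: "(x, h, y) \<in> Ar (gobj_cat C G)" and g: "\<gamma> \<in> Ar C" "u \<in> Ar C" "Dom C \<gamma> = Dom C u" "Cod C \<gamma> = G1 G"
    "Cod C u = Dom C (fst x)" "d0 G \<cdot> \<gamma> = fst x \<cdot> u"
  shows "h \<cdot> act x \<gamma> u = act y \<gamma> (h \<cdot> u)"
proof -
  note d = gobj_ArD[OF h]
  note dx = gobjectD[OF d(1)] and dy = gobjectD[OF d(2)]
  let ?p = "pb1 C (d0 G) (fst x)" and ?q = "pb2 C (d0 G) (fst x)"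
  have "h \<cdot> snd x = snd y \<cdot> pb_pair C (d0 G) (fst y) ?p (h \<cdot> ?q)"
    using h unfolding gobj_cat_def by (cases x; cases y) simp
  then have e: "h \<cdot> snd x = act y ?p (h \<cdot> ?q)" by (simp add: act_def)
  have c: "fst y \<cdot> h \<cdot> z = fst x \<cdot> z" if "z \<in> Ar C" "Cod C z = Dom C (fst x)" for z
    using reassoc[OF d(6), of z] d(3-5) dx dy that by simp
  let ?k = "pb_pair C (d0 G) (fst x) \<gamma> u"
  have k: "?k \<in> Ar C" "Dom C ?k = Dom C u" "Cod C ?k = Dom C ?p" "?p \<cdot> ?k = \<gamma>" "?q \<cdot> ?k = u"
    using g dx by simp_all
  have "(h \<cdot> snd x) \<cdot> ?k = act y ?p (h \<cdot> ?q) \<cdot> ?k" using e by simp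
  also have "\<dots> = act y \<gamma> (h \<cdot> u)"
    by (subst act_comp[OF d(2)]) (use k d(3-5) dx dy c[of ?q] pb_comm[of "d0 G" "fst x"] in simp_all)
  finally show ?thesis using k d(3-5) dx by (simp add: act_def)
qed

lemma gobj_ArI:
  assumes x: "is_gobject C G x" and y: "is_gobject C G y" and h: "h \<in> Ar C" "Dom C h = Dom C (fst x)" "Cod C h = Dom C (fst y)"
    "fst y \<cdot> h = fst x"
    and eq: "\<And>\<gamma> u. \<lbrakk>\<gamma> \<in> Ar C; u \<in> Ar C; Dom C \<gamma> = Dom C u; Cod C \<gamma> = G1 G; Cod C u = Dom C (fst x);
      d0 G \<cdot> \<gamma> = fst x \<cdot> u\<rbrakk> \<Longrightarrow> h \<cdot> act x \<gamma> u = act y \<gamma> (h \<cdot> u)"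
  shows "(x, h, y) \<in> Ar (gobj_cat C G)"
proof -
  note dx = gobjectD[OF x] and dy = gobjectD[OF y]
  let ?p = "pb1 C (d0 G) (fst x)" and ?q = "pb2 C (d0 G) (fst x)"
  have "h \<cdot> act x ?p ?q = act y ?p (h \<cdot> ?q)"
    by (rule eq) (use dx pb_comm[of "d0 G" "fst x"] in simp_all)
  moreover have "act x ?p ?q = snd x" using act_generic[of "fst x" "snd x"] dx by simp
  ultimately have "h \<cdot> snd x = snd y \<cdot> pb_pair C (d0 G) (fst y) ?p (h \<cdot> ?q)" by (simp add: act_def)
  then show ?thesis using x y h unfolding gobj_cat_def by (cases x; cases y) simp
qed

lemma category_gobj: "category (gobj_cat C G)"
proof
  show "Dom (gobj_cat C G) c \<in> Ob (gobj_cat C G)" "Cod (gobj_cat C G) c \<in> Ob (gobj_cat C G)"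
    if "c \<in> Ar (gobj_cat C G)" for c
    using that gobj_ArD by (auto elim: gobj_ArE)
next
  fix x assume "x \<in> Ob (gobj_cat C G)"
  then have x: "is_gobject C G x" by simp
  have "(x, idt C (Dom C (fst x)), x) \<in> Ar (gobj_cat C G)"
    by (rule gobj_ArI[OF x x]) (use x gobjectD[OF x] in simp_all)
  then show "idt (gobj_cat C G) x \<in> hom (gobj_cat C G) x x" by simp
next
  fix c d x y z assume "c \<in> hom (gobj_cat C G) x y" "d \<in> hom (gobj_cat C G) y z"
  then obtain h k where c: "c = (x, h, y)" "(x, h, y) \<in> Ar (gobj_cat C G)" and d: "d = (y, k, z)" "(y, k, z) \<in> Ar (gobj_cat C G)"
    by (cases c; cases d) auto
  note h = gobj_ArD[OF c(2)] and k = gobj_ArD[OF d(2)]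
  have kh: "fst z \<cdot> k \<cdot> h = fst x"
    using reassoc[OF k(6), of h] h(3-6) k(3-5) gobjectD[OF k(2)] by simp
  have yh: "fst y \<cdot> h \<cdot> w = fst x \<cdot> w" if "w \<in> Ar C" "Cod C w = Dom C (fst x)" for w
    using reassoc[OF h(6), of w] h(3-5) gobjectD[OF h(2)] that by simp
  have "(x, k \<cdot> h, z) \<in> Ar (gobj_cat C G)"
  proof (rule gobj_ArI[OF h(1) k(2)])
    fix \<gamma> u assume g: "\<gamma> \<in> Ar C" "u \<in> Ar C" "Dom C \<gamma> = Dom C u" "Cod C \<gamma> = G1 G" "Cod C u = Dom C (fst x)"
      "d0 G \<cdot> \<gamma> = fst x \<cdot> u"
    have "k \<cdot> h \<cdot> act x \<gamma> u = k \<cdot> act y \<gamma> (h \<cdot> u)" using equivariantD[OF c(2) g] by simp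
    also have "\<dots> = act z \<gamma> (k \<cdot> h \<cdot> u)"
      by (rule equivariantD[OF d(2)]) (use g h(3-5) yh in simp_all)
    finally show "(k \<cdot> h) \<cdot> act x \<gamma> u = act z \<gamma> ((k \<cdot> h) \<cdot> u)"
      using g h(1,3-5) k(3-5) by simp
  qed (use h(3-5) k(3-5) kh in simp_all)
  then show "d \<cdot>\<^bsub>gobj_cat C G\<^esub> c \<in> hom (gobj_cat C G) x z" by (simp add: c(1) d(1))
next
  fix c x y assume "c \<in> hom (gobj_cat C G) x y"
  then obtain h where c: "c = (x, h, y)" "(x, h, y) \<in> Ar (gobj_cat C G)" by (cases c) auto
  show "c \<cdot>\<^bsub>gobj_cat C G\<^esub> idt (gobj_cat C G) x = c" "idt (gobj_cat C G) y \<cdot>\<^bsub>gobj_cat C G\<^esub> c = c"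
    using gobj_ArD[OF c(2)] by (simp_all add: c(1))
next
  fix b c d w x y z
  assume "b \<in> hom (gobj_cat C G) w x" "c \<in> hom (gobj_cat C G) x y" "d \<in> hom (gobj_cat C G) y z"
  then obtain g h k where b: "b = (w, g, x)" "(w, g, x) \<in> Ar (gobj_cat C G)"
    and c: "c = (x, h, y)" "(x, h, y) \<in> Ar (gobj_cat C G)" and d: "d = (y, k, z)" "(y, k, z) \<in> Ar (gobj_cat C G)"
    by (cases b; cases c; cases d) auto
  show "(d \<cdot>\<^bsub>gobj_cat C G\<^esub> c) \<cdot>\<^bsub>gobj_cat C G\<^esub> b = d \<cdot>\<^bsub>gobj_cat C G\<^esub> c \<cdot>\<^bsub>gobj_cat C G\<^esub> b"
    using gobj_ArD(3-5)[OF b(2)] gobj_ArD(3-5)[OF c(2)] gobj_ArD(3-5)[OF d(2)] by (simp add: b(1) c(1) d(1))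
qed

text \<open>The inverse \<open>k\<close> commutes with the actions because \<open>h\<close> does and
  can be cancelled.\<close>

lemma gobj_iso:
  assumes h: "(x, h, y) \<in> Ar (gobj_cat C G)" and iso: "is_iso C h"
  shows "is_iso (gobj_cat C G) (x, h, y)"
proof -
  interpret GC: category "gobj_cat C G" by (rule category_gobj)
  note d = gobj_ArD[OF h]
  note dx = gobjectD[OF d(1)] and dy = gobjectD[OF d(2)]
  obtain k where k: "k \<in> hom C (Dom C (fst y)) (Dom C (fst x))" "k \<cdot> h = idt C (Dom C (fst x))" "h \<cdot> k = idt C (Dom C (fst y))"
    by (rule is_isoE[OF iso, of "Dom C (fst x)" "Dom C (fst y)"]) (use d in simp_all)
  have kt: "k \<in> Ar C" "Dom C k = Dom C (fst y)" "Cod C k = Dom C (fst x)" using k(1) by simp_all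
  have hk: "h \<cdot> k \<cdot> w = w" if "w \<in> Ar C" "Cod C w = Dom C (fst y)" for w
    using reassoc[OF k(3), of w] that kt d(3-5) by simp
  have xk: "fst x \<cdot> k = fst y"
    using reassoc[OF d(6), of k] d(3-5) kt dy k(3) by simp
  have xkw: "fst x \<cdot> k \<cdot> w = fst y \<cdot> w" if "w \<in> Ar C" "Cod C w = Dom C (fst y)" for w
    using reassoc[OF xk, of w] that kt dx by simp
  have "(y, k, x) \<in> Ar (gobj_cat C G)"
  proof (rule gobj_ArI[OF d(2,1) kt xk])
    fix \<gamma> u assume g: "\<gamma> \<in> Ar C" "u \<in> Ar C" "Dom C \<gamma> = Dom C u" "Cod C \<gamma> = G1 G" "Cod C u = Dom C (fst y)"
      "d0 G \<cdot> \<gamma> = fst y \<cdot> u"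
    have "h \<cdot> act x \<gamma> (k \<cdot> u) = act y \<gamma> (h \<cdot> k \<cdot> u)"
      by (rule equivariantD[OF h]) (use g kt xkw in simp_all)
    also have "\<dots> = h \<cdot> k \<cdot> act y \<gamma> u" using g hk d(2) by simp
    finally show "k \<cdot> act y \<gamma> u = act x \<gamma> (k \<cdot> u)"
      by - (rule iso_cancel_left[OF iso], use g kt d(1-5) xkw in simp_all)
  qed
  then show ?thesis
    by - (rule GC.is_isoI[of _ x y "(y, k, x)"], use h k in simp_all)
qed

text \<open>In elements, \<gamma> takes \<open>(w, c)\<close> to \<open>(d1 \<gamma>, c)\<close>;
  the canonical isomorphism in the definition of \<open>gstar_ob\<close> disappears once the
  argument is given as a pair.\<close>

lemma gstar_act:
  assumes X: "X \<in> Ob C" and "\<gamma> \<in> Ar C" "u \<in> Ar C" "Dom C \<gamma> = Dom C u" "Cod C \<gamma> = G1 G" "Cod C u = Dom C (prd1 C (G0 G) X)"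
    "d0 G \<cdot> \<gamma> = prd1 C (G0 G) X \<cdot> u"
  shows "act (gstar_ob C G X) \<gamma> u = prd_pair C (G0 G) X (d1 G \<cdot> \<gamma>) (prd2 C (G0 G) X \<cdot> u)"
proof -
  let ?f = "prd1 C (G0 G) X"
  let ?a = "prd_map C (d1 G) (idt C X)" and ?b = "prd_pair C (G1 G) X (pb1 C (d0 G) ?f) (prd2 C (G0 G) X \<cdot> pb2 C (d0 G) ?f)"
  let ?k = "pb_pair C (d0 G) ?f \<gamma> u"
  have k: "?k \<in> Ar C" "Dom C ?k = Dom C u" "Cod C ?k = Dom C (pb1 C (d0 G) ?f)" "pb1 C (d0 G) ?f \<cdot> ?k = \<gamma>" "pb2 C (d0 G) ?f \<cdot> ?k = u"
    using assms by simp_all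
  have "?b \<cdot> ?k = prd_pair C (G1 G) X \<gamma> (prd2 C (G0 G) X \<cdot> u)"
    using k X by (simp add: prd_pair_comp)
  then have "(?a \<cdot> ?b) \<cdot> ?k = ?a \<cdot> prd_pair C (G1 G) X \<gamma> (prd2 C (G0 G) X \<cdot> u)" using k X by simp
  also have "\<dots> = prd_pair C (G0 G) X (d1 G \<cdot> \<gamma>) (prd2 C (G0 G) X \<cdot> u)"
    using prd_map_pair[of "d1 G" "idt C X" \<gamma> "prd2 C (G0 G) X \<cdot> u"] assms by simp
  finally show ?thesis by (simp add: act_def gstar_ob_def Let_def)
qed

lemma fst_gstar [simp]: "fst (gstar_ob C G X) = prd1 C (G0 G) X"
  by (simp add: gstar_ob_def Let_def)

lemma gstar_object:
  assumes X: "X \<in> Ob C"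
  shows "is_gobject C G (gstar_ob C G X)"
proof -
  let ?f = "prd1 C (G0 G) X"
  obtain a where a: "gstar_ob C G X = (?f, a)" by (simp add: gstar_ob_def Let_def)
  have at: "a \<in> Ar C" "Dom C a = Dom C (pb1 C (d0 G) ?f)" "Cod C a = Dom C ?f"
    using a X by (auto simp add: gstar_ob_def Let_def)
  note ga = gstar_act[OF X, unfolded a]
  show ?thesis unfolding a
  proof (rule gobjectI[OF _ _ at])
    fix u assume u: "u \<in> Ar C" "Cod C u = Dom C ?f"
    show "act (?f, a) (gunit G \<cdot> ?f \<cdot> u) u = u"
      by (rule prd_eqI[of _ _ "G0 G" X]) (use ga[of "gunit G \<cdot> ?f \<cdot> u" u] u X in simp_all)
  next
    fix \<alpha> \<beta> u assume g: "\<alpha> \<in> Ar C" "\<beta> \<in> Ar C" "u \<in> Ar C" "Dom C \<alpha> = Dom C u" "Dom C \<beta> = Dom C u" "Cod C \<alpha> = G1 G" "Cod C \<beta> = G1 G"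
       "Cod C u = Dom C ?f" "d0 G \<cdot> \<alpha> = d1 G \<cdot> \<beta>" "d0 G \<cdot> \<beta> = ?f \<cdot> u"
    show "act (?f, a) (gm \<alpha> \<beta>) u = act (?f, a) \<alpha> (act (?f, a) \<beta> u)"
      using ga[of \<beta> u] ga[of "gm \<alpha> \<beta>" u] ga[of \<alpha> "act (?f, a) \<beta> u"] g X by simp
  qed (use X ga in simp_all)
qed

lemma gstar_functor: "cat_functor C (gobj_cat C G) (gstar C G)"
proof (rule cat_functorI[OF category_axioms category_gobj])
  have gs: "fob (gstar C G) X = gstar_ob C G X"
    "far (gstar C G) f = (gstar_ob C G (Dom C f), prd_map C (idt C (G0 G)) f, gstar_ob C G (Cod C f))" for X f
    by (simp_all add: gstar_def)
  have pm: "prd_map C (idt C (G0 G)) f = prd_pair C (G0 G) (Cod C f) (prd1 C (G0 G) (Dom C f)) (f \<cdot> prd2 C (G0 G) (Dom C f))"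
    if "f \<in> Ar C" for f using that by (simp add: prd_map_def)
  fix X assume X: "X \<in> Ob C"
  then show "fob (gstar C G) X \<in> Ob (gobj_cat C G)" using gstar_object[OF X] by (simp add: gs)
  have "prd_pair C (G0 G) X (prd1 C (G0 G) X) (idt C X \<cdot> prd2 C (G0 G) X) = idt C (Dom C (prd1 C (G0 G) X))"
    by (rule prd_eqI[of _ _ "G0 G" X]) (use X in simp_all)
  then show "far (gstar C G) (idt C X) = idt (gobj_cat C G) (fob (gstar C G) X)"
    using X pm[of "idt C X"] by (simp add: gs)
next
  have gs: "fob (gstar C G) X = gstar_ob C G X"
    "far (gstar C G) f = (gstar_ob C G (Dom C f), prd_map C (idt C (G0 G)) f, gstar_ob C G (Cod C f))" for X f
    by (simp_all add: gstar_def)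
  have pm: "prd_map C (idt C (G0 G)) f = prd_pair C (G0 G) (Cod C f) (prd1 C (G0 G) (Dom C f)) (f \<cdot> prd2 C (G0 G) (Dom C f))"
    if "f \<in> Ar C" for f using that by (simp add: prd_map_def)
  {
    fix f assume f: "f \<in> Ar C"
    have X: "Dom C f \<in> Ob C" "Cod C f \<in> Ob C" using f by simp_all
    have "(gstar_ob C G (Dom C f), prd_map C (idt C (G0 G)) f, gstar_ob C G (Cod C f)) \<in> Ar (gobj_cat C G)"
    proof (rule gobj_ArI[OF gstar_object[OF X(1)] gstar_object[OF X(2)]])
      fix \<gamma> u assume g: "\<gamma> \<in> Ar C" "u \<in> Ar C" "Dom C \<gamma> = Dom C u" "Cod C \<gamma> = G1 G" "Cod C u = Dom C (fst (gstar_ob C G (Dom C f)))"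
        "d0 G \<cdot> \<gamma> = fst (gstar_ob C G (Dom C f)) \<cdot> u"
      show "prd_map C (idt C (G0 G)) f \<cdot> act (gstar_ob C G (Dom C f)) \<gamma> u =
          act (gstar_ob C G (Cod C f)) \<gamma> (prd_map C (idt C (G0 G)) f \<cdot> u)"
        using g f gstar_act[of "Dom C f" \<gamma> u] gstar_act[of "Cod C f" \<gamma> "prd_map C (idt C (G0 G)) f \<cdot> u"]
        by (simp add: pm prd_pair_comp)
    qed (use f in \<open>simp_all add: pm\<close>)
    then show "far (gstar C G) f \<in> hom (gobj_cat C G) (fob (gstar C G) (Dom C f)) (fob (gstar C G) (Cod C f))"
      by (simp add: gs)
  next
    fix f g assume "f \<in> Ar C" "g \<in> Ar C" "Dom C g = Cod C f"
    then show "far (gstar C G) (g \<cdot> f) = far (gstar C G) g \<cdot>\<^bsub>gobj_cat C G\<^esub> far (gstar C G) f"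
      by (simp add: gs pm prd_pair_comp)
  }
qed

end

section \<open>From effective descent to a groupoid\<close>

context finite_limits
begin

lemma prd_pair_prd [simp]: "\<lbrakk>X \<in> Ob C; Y \<in> Ob C\<rbrakk> \<Longrightarrow>
    prd_pair C X Y (prd1 C X Y) (prd2 C X Y) = idt C (Dom C (prd1 C X Y))"
  by (rule prd_eqI[of _ _ X Y]) simp_all

text \<open>The pullback functor along the map from \<open>W\<close> to the terminal object, with
  the slice over the terminal object replaced by the category itself and pullbacks by chosen
  products.\<close>

definition times :: "'o \<Rightarrow> ('o, 'a, 'a, 'a \<times> 'a \<times> 'a) func" where
  "times W = \<lparr>fob = prd1 C W, far = (\<lambda>h. (prd1 C W (Dom C h),
     prd_pair C W (Cod C h) (prd1 C W (Dom C h)) (h \<cdot> prd2 C W (Dom C h)), prd1 C W (Cod C h)))\<rparr>"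

lemma times_simps [simp]: "fob (times W) Y = prd1 C W Y"
  "far (times W) h = (prd1 C W (Dom C h),
     prd_pair C W (Cod C h) (prd1 C W (Dom C h)) (h \<cdot> prd2 C W (Dom C h)), prd1 C W (Cod C h))"
  by (simp_all add: times_def)

lemma times_functor: "W \<in> Ob C \<Longrightarrow> cat_functor C (slice C W) (times W)"
  by (rule cat_functorI[OF category_axioms category_slice]) (simp_all add: prd_pair_comp)

text \<open>An inverse, up to isomorphism, of the domain functor of that slice, pointing in the
  direction in which \<open>beck_pre\<close> is applied.\<close>

definition bang_functor :: "('o, 'a, 'a, 'a \<times> 'a \<times> 'a) func" where
  "bang_functor = \<lparr>fob = bang C, far = (\<lambda>h. (bang C (Dom C h), h, bang C (Cod C h)))\<rparr>"

lemma bang_functor_simps [simp]: "fob bang_functor Y = bang C Y"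
  "far bang_functor h = (bang C (Dom C h), h, bang C (Cod C h))"
  by (simp_all add: bang_functor_def)

lemma bang_comp: "f \<in> Ar C \<Longrightarrow> bang C (Cod C f) \<cdot> f = bang C (Dom C f)"
  by (rule bang_unique) simp_all

lemma bang_functor_ff_eso: "ff_eso_functor C (slice C (terminal_ob C)) bang_functor"
proof -
  let ?S = "slice C (terminal_ob C)"
  have "cat_functor C ?S bang_functor"
    by (rule cat_functorI[OF category_axioms category_slice]) (simp_all add: bang_comp)
  then interpret F: cat_functor C ?S bang_functor .
  show ?thesis
  proof
    fix X Y c assume X: "X \<in> Ob C" and Y: "Y \<in> Ob C" and c: "c \<in> hom ?S (fob bang_functor X) (fob bang_functor Y)"
    obtain h where h: "c = (bang C X, h, bang C Y)" using c by (cases c) simp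
    have ht: "h \<in> Ar C" "Dom C h = X" "Cod C h = Y" using c X Y unfolding h by simp_all
    show "\<exists>!f. f \<in> hom C X Y \<and> far bang_functor f = c"
      by (rule ex1I[of _ h]) (use ht in \<open>simp_all add: h\<close>)
  next
    fix g assume "g \<in> Ob ?S"
    then have g: "g \<in> Ar C" "Cod C g = terminal_ob C" by simp_all
    have "g = bang C (Dom C g)" by (rule bang_unique) (use g in simp_all)
    then show "\<exists>X \<in> Ob C. \<exists>i \<in> hom ?S g (fob bang_functor X). is_iso ?S i"
      using g F.B.iso_idt[of g] F.B.idt_in[of g] by (intro bexI[of _ "Dom C g"] bexI[of _ "idt ?S g"]) simp_all
  qed
qed

text \<open>The chosen pullback over the terminal object and the chosen product are both products,
  and the pairing of the one into the other is the natural isomorphism \<open>th\<close>.\<close>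

lemma times_beck:
  assumes W: "W \<in> Ob C" and bk: "beck (slice C (terminal_ob C)) (slice C W) (pullback_functor C (bang C W))"
  shows "beck C (slice C W) (times W)"
proof (rule beck_naturally_isomorphic[OF beck_pre[OF bk bang_functor_ff_eso]])
  let ?b = "bang C W"
  have F1: "cat_functor C (slice C W) (pullback_functor C ?b \<circ>\<^sub>F bang_functor)"
    by (rule comp_functor[OF ff_eso_functor.axioms(1)[OF bang_functor_ff_eso, THEN ff_functor.axioms(1)]
      beckD(1)[OF bk]])
  define p q where "p Y = pb1 C ?b (bang C Y)" and "q Y = pb2 C ?b (bang C Y)" for Y
  have pq: "p Y \<in> Ar C" "q Y \<in> Ar C" "Dom C (q Y) = Dom C (p Y)" "Cod C (p Y) = W" "Cod C (q Y) = Y"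
    "is_product C W Y (p Y) (q Y)" if "Y \<in> Ob C" for Y
    using terminal_pullback_product[of ?b W "bang C Y" Y] chosen_pullback[of ?b "bang C Y"] W that
    by (simp_all add: p_def q_def)
  define th where "th Y = (p Y, prd_pair C W Y (p Y) (q Y), prd1 C W Y)" for Y
  show "naturally_isomorphic C (slice C W) (pullback_functor C ?b \<circ>\<^sub>F bang_functor) (times W)"
  proof (rule naturally_isomorphicI[OF F1 times_functor[OF W], of th])
    fix Y assume Y: "Y \<in> Ob C"
    have ar: "(p Y, prd_pair C W Y (p Y) (q Y), prd1 C W Y) \<in> Ar (slice C W)"
      using pq[OF Y] W Y by simp
    then show "th Y \<in> hom (slice C W) (fob (pullback_functor C ?b \<circ>\<^sub>F bang_functor) Y) (fob (times W) Y)"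
      by (simp add: th_def p_def)
    have "is_iso C (prd_pair C W Y (p Y) (q Y))"
      using product_comparison_iso_iff[OF chosen_product[OF W Y], of "prd_pair C W Y (p Y) (q Y)"] pq[OF Y] W Y
      by simp
    then show "is_iso (slice C W) (th Y)" unfolding th_def by (simp only: slice_iso_iff[OF ar])
  next
    fix h assume h: "h \<in> Ar C"
    let ?Y = "Dom C h" and ?Z = "Cod C h"
    have ob: "?Y \<in> Ob C" "?Z \<in> Ob C" using h by simp_all
    have c: "?b \<cdot> p ?Y = bang C ?Z \<cdot> h \<cdot> q ?Y"
      by (rule bang_unique) (use pq[OF ob(1)] h W in simp_all)
    define k where "k = pb_pair C ?b (bang C ?Z) (p ?Y) (h \<cdot> q ?Y)"
    have k: "k \<in> Ar C" "Dom C k = Dom C (p ?Y)" "Cod C k = Dom C (p ?Z)" "p ?Z \<cdot> k = p ?Y" "q ?Z \<cdot> k = h \<cdot> q ?Y"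
      unfolding k_def p_def[of ?Z] q_def[of ?Z] using c pq[OF ob(1)] h W by simp_all
    have "prd_pair C W ?Z (p ?Z) (q ?Z) \<cdot> k = prd_pair C W ?Z (p ?Y) (h \<cdot> q ?Y)"
      using prd_pair_comp[of W ?Z "p ?Z" "q ?Z" k] pq[OF ob(2)] k W h by simp
    moreover have "prd_pair C W ?Z (prd1 C W ?Y) (h \<cdot> prd2 C W ?Y) \<cdot> prd_pair C W ?Y (p ?Y) (q ?Y) =
        prd_pair C W ?Z (p ?Y) (h \<cdot> q ?Y)"
      using prd_pair_comp[of W ?Z "prd1 C W ?Y" "h \<cdot> prd2 C W ?Y" "prd_pair C W ?Y (p ?Y) (q ?Y)"] pq[OF ob(1)] W h by simp
    ultimately show "th ?Z \<cdot>\<^bsub>slice C W\<^esub> far (pullback_functor C ?b \<circ>\<^sub>F bang_functor) h =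
        far (times W) h \<cdot>\<^bsub>slice C W\<^esub> th ?Y"
      by (simp add: th_def k_def p_def q_def)
  qed
qed

text \<open>Descent for \<open>W \<rightarrow> 1\<close>: an action \<open>b\<close> of the codiscrete groupoid on \<open>g : V \<rightarrow> W\<close> exhibits \<open>V\<close> as \<open>W \<times> Y\<close>.\<close>

lemma codiscrete_action_descends:
  assumes W: "W \<in> Ob C" and bk: "beck C (slice C W) (times W)"
    and g: "g \<in> hom C V W" and b: "b \<in> hom C (Dom C (prd1 C W V)) V" "g \<cdot> b = prd1 C W V"
    and unit: "b \<cdot> prd_pair C W V g (idt C V) = idt C V"
    and ass: "b \<cdot> prd_pair C W V (prd1 C W (Dom C (prd1 C W V))) (b \<cdot> prd2 C W (Dom C (prd1 C W V))) =
      b \<cdot> prd_pair C W V (prd1 C W (Dom C (prd1 C W V))) (prd2 C W V \<cdot> prd2 C W (Dom C (prd1 C W V)))"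
  obtains Y c where "Y \<in> Ob C" "c \<in> hom C V Y" "coequalizer C (prd2 C W V) b c" "is_iso C (prd_pair C W Y g c)"
proof -
  interpret SW: category "slice C W" by (rule category_slice)
  define WV p1 p2 where "WV = Dom C (prd1 C W V)" and "p1 = prd1 C W V" and "p2 = prd2 C W V"
  have V: "V \<in> Ob C" using g by auto
  have gt: "g \<in> Ar C" "Dom C g = V" "Cod C g = W" using g by simp_all
  have pt: "p1 \<in> Ar C" "Dom C p1 = WV" "Cod C p1 = W" "p2 \<in> Ar C" "Dom C p2 = WV" "Cod C p2 = V"
    using W V by (simp_all add: WV_def p1_def p2_def)
  have bt: "b \<in> Ar C" "Dom C b = WV" "Cod C b = V" using b by (simp_all add: WV_def)
  have WV: "WV \<in> Ob C" using pt by (metis Dom_ob)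
  define q1 q2 where "q1 = prd1 C W WV" and "q2 = prd2 C W WV"
  have qt: "q1 \<in> Ar C" "Dom C q2 = Dom C q1" "Cod C q1 = W" "q2 \<in> Ar C" "Cod C q2 = WV"
    using W WV by (simp_all add: q1_def q2_def)
  define s where "s = prd_pair C W V g (idt C V)"
  have s: "s \<in> Ar C" "Dom C s = V" "Cod C s = WV" "p1 \<cdot> s = g" "p2 \<cdot> s = idt C V" "b \<cdot> s = idt C V"
    using W V gt unit by (simp_all add: s_def p1_def p2_def WV_def)
  define t where "t = prd_pair C W WV p1 (idt C WV)"
  have t: "t \<in> Ar C" "Dom C t = WV" "Cod C t = Dom C q1" "q1 \<cdot> t = p1" "q2 \<cdot> t = idt C WV"
    using W WV pt by (simp_all add: t_def q1_def q2_def)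
  define F where "F h = prd_pair C W V q1 (h \<cdot> q2)" for h
  have F: "F h \<in> Ar C" "Dom C (F h) = Dom C q1" "Cod C (F h) = WV" "p1 \<cdot> F h = q1" "p2 \<cdot> F h = h \<cdot> q2"
    if "h \<in> hom C WV V" for h
    using that W V qt by (simp_all add: F_def p1_def p2_def WV_def)
  have bh: "b \<in> hom C WV V" "p2 \<in> hom C WV V" using bt pt by simp_all
  have Ft: "F h \<cdot> t = prd_pair C W V p1 h" if "h \<in> hom C WV V" for h
  proof (rule prd_eqI[of _ _ W V])
    have "p1 \<cdot> F h \<cdot> t = p1" "p2 \<cdot> F h \<cdot> t = h"
      using reassoc[OF F(4)[OF that], of t] reassoc[OF F(5)[OF that], of t] F(1-3)[OF that] pt qt t that by simp_all
    then show "prd1 C W V \<cdot> F h \<cdot> t = prd1 C W V \<cdot> prd_pair C W V p1 h"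
      "prd2 C W V \<cdot> F h \<cdot> t = prd2 C W V \<cdot> prd_pair C W V p1 h"
      using that pt W V by (simp_all add: p1_def p2_def)
  qed (use that F(1-3)[OF that] t pt W V in \<open>simp_all add: WV_def\<close>)
  have far: "far (times W) p2 = (q1, F p2, p1)" "far (times W) b = (q1, F b, p1)"
    using pt bt by (simp_all add: F_def q1_def q2_def p1_def)
  \<comment> \<open>In elements, with \<open>w v\<close> for the value of \<open>b\<close> at
    \<open>(w, v)\<close>, the pair sends \<open>(w, (w', v))\<close> to \<open>(w, v)\<close> and
    \<open>(w, w' v)\<close>. Its quotient is \<open>b\<close>, with the section \<open>s\<close>
    taking \<open>v\<close> to \<open>(g v, v)\<close> and \<open>t\<close> taking
    \<open>(w, v)\<close> to \<open>(w, (w, v))\<close>. The law \<open>w (w' v) = w v\<close> makes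
    \<open>b\<close> coequalize the pair, and \<open>g (w v) = w\<close> gives the last
    equation.\<close>
  have "split_coequalizer (slice C W) (far (times W) p2) (far (times W) b) (p1, b, g) (g, s, p1) (p1, t, q1)"
    unfolding split_coequalizer_def far
  proof (intro conjI)
    show "(p1, b, g) \<cdot>\<^bsub>slice C W\<^esub> (q1, F p2, p1) = (p1, b, g) \<cdot>\<^bsub>slice C W\<^esub> (q1, F b, p1)"
      using ass by (simp add: F_def p1_def p2_def q1_def q2_def WV_def)
    show "(q1, F p2, p1) \<cdot>\<^bsub>slice C W\<^esub> (p1, t, q1) = idt (slice C W) (Cod (slice C W) (q1, F p2, p1))"
      using Ft[OF bh(2)] W V pt by (simp add: p1_def p2_def)
    have "F b \<cdot> t = s \<cdot> b"
      unfolding Ft[OF bh(1)] s_def using prd_pair_comp[of W V g "idt C V" b] b(2) gt bt W V by (simp add: p1_def)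
    then show "(q1, F b, p1) \<cdot>\<^bsub>slice C W\<^esub> (p1, t, q1) = (g, s, p1) \<cdot>\<^bsub>slice C W\<^esub> (p1, b, g)" by simp
  qed (use F[OF bh(1)] F[OF bh(2)] b(2) gt bt pt qt s t in \<open>simp_all add: p1_def\<close>)
  from beck_coequalizerE[OF bk bh(2)[unfolded mem_hom, THEN conjunct1] bh(1)[unfolded mem_hom, THEN conjunct1] _ _ this]
  obtain c j where c: "coequalizer C p2 b c" and j: "j \<in> hom (slice C W) g (prd1 C W (Cod C c))" "is_iso (slice C W) j"
    "j \<cdot>\<^bsub>slice C W\<^esub> (p1, b, g) = far (times W) c"
    using pt bt by (simp del: times_simps(2)) metis
  have ct: "c \<in> Ar C" "Dom C c = V" using c pt by (simp_all add: coequalizer_def)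
  define Y where "Y = Cod C c"
  have Y: "Y \<in> Ob C" "Cod C c = Y" using ct by (simp_all add: Y_def)
  obtain j' where j': "j = (g, j', prd1 C W Y)" using j(1) Y by (cases j) simp
  have ar: "(g, j', prd1 C W Y) \<in> Ar (slice C W)" using j(1) unfolding j' by (simp only: mem_hom)
  have jt: "j' \<in> Ar C" "Dom C j' = V" "Cod C j' = Dom C (prd1 C W Y)" "prd1 C W Y \<cdot> j' = g" using slice_ArD[OF ar] gt by simp_all
  have jb: "j' \<cdot> b = prd_pair C W Y p1 (c \<cdot> p2)"
    using j(3) ct Y by (simp add: j' p1_def p2_def)
  \<comment> \<open>Beck's condition describes the isomorphism only after \<open>b\<close>; the
    section \<open>s\<close> of \<open>b\<close> recovers it.\<close>
  have "j' = (j' \<cdot> b) \<cdot> s" using jt bt s by simp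
  also have "\<dots> = prd_pair C W Y g c"
    unfolding jb using prd_pair_comp[of W Y p1 "c \<cdot> p2" s] s ct Y pt W by simp
  finally have "is_iso C (prd_pair C W Y g c)" using j(2) slice_iso_iff[OF ar] by (simp add: j')
  then show thesis using that[of Y c] Y c ct by (simp add: p2_def)
qed

text \<open>Descent applied to the action on \<open>W x Y\<close> that replaces the first coordinate
  gives a quotient \<open>Q\<close>, whose map \<open>k\<close> to \<open>Y\<close> becomes
  invertible after taking the product with \<open>W\<close>. That functor reflects isomorphisms, so
  \<open>Y\<close> is the quotient.\<close>

lemma projection_coequalizer:
  assumes W: "W \<in> Ob C" and bk: "beck C (slice C W) (times W)" and Y: "Y \<in> Ob C"
  defines "V \<equiv> Dom C (prd1 C W Y)"
  shows "coequalizer C (prd2 C W V) (prd_pair C W Y (prd1 C W V) (prd2 C W Y \<cdot> prd2 C W V)) (prd2 C W Y)"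
proof -
  define p1 p2 where "p1 = prd1 C W Y" and "p2 = prd2 C W Y"
  have pt: "p1 \<in> Ar C" "Dom C p1 = V" "Cod C p1 = W" "p2 \<in> Ar C" "Dom C p2 = V" "Cod C p2 = Y"
    using W Y by (simp_all add: V_def p1_def p2_def)
  have V: "V \<in> Ob C" using pt by (metis Dom_ob)
  define q1 q2 where "q1 = prd1 C W V" and "q2 = prd2 C W V"
  have qt: "q1 \<in> Ar C" "Dom C q2 = Dom C q1" "Cod C q1 = W" "q2 \<in> Ar C" "Cod C q2 = V"
    using W V by (simp_all add: q1_def q2_def)
  define b where "b = prd_pair C W Y q1 (p2 \<cdot> q2)"
  have bt: "b \<in> Ar C" "Dom C b = Dom C q1" "Cod C b = V" "p1 \<cdot> b = q1" "p2 \<cdot> b = p2 \<cdot> q2"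
    using qt pt W Y by (simp_all add: b_def p1_def p2_def V_def)
  have eqV: "h = h'" if "h \<in> Ar C" "h' \<in> Ar C" "Dom C h = Dom C h'" "Cod C h = V" "Cod C h' = V"
    "p1 \<cdot> h = p1 \<cdot> h'" "p2 \<cdot> h = p2 \<cdot> h'" for h h'
    by (rule prd_eqI[of _ _ W Y]) (use that W Y in \<open>simp_all add: p1_def p2_def V_def\<close>)
  have pb: "p1 \<cdot> b \<cdot> x = q1 \<cdot> x" "p2 \<cdot> b \<cdot> x = p2 \<cdot> q2 \<cdot> x" if "x \<in> Ar C" "Cod C x = Dom C q1" for x
    using reassoc[OF bt(4), of x] reassoc[OF bt(5), of x] bt(1-3) pt qt that by simp_all
  have pair: "q1 \<cdot> prd_pair C W V u v = u" "q2 \<cdot> prd_pair C W V u v = v" "prd_pair C W V u v \<in> Ar C"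
     "Dom C (prd_pair C W V u v) = Dom C v" "Cod C (prd_pair C W V u v) = Dom C q1"
    if "u \<in> Ar C" "v \<in> Ar C" "Dom C u = Dom C v" "Cod C u = W" "Cod C v = V" for u v
    using that W V by (simp_all add: q1_def q2_def)
  define VV where "VV = Dom C q1"
  have VV: "VV \<in> Ob C" "Dom C q1 = VV" using qt by (simp_all add: VV_def)
  have rt: "prd1 C W VV \<in> Ar C" "prd2 C W VV \<in> Ar C" "Dom C (prd2 C W VV) = Dom C (prd1 C W VV)" "Cod C (prd1 C W VV) = W"
    "Cod C (prd2 C W VV) = VV" using W VV by simp_all
  obtain Q c where Q: "Q \<in> Ob C" and c: "c \<in> hom C V Q" "coequalizer C q2 b c" "is_iso C (prd_pair C W Q p1 c)"
  proof (rule codiscrete_action_descends[OF W bk, of p1 V b])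
    show "b \<cdot> prd_pair C W V p1 (idt C V) = idt C V"
      by (rule eqV) (use pair[of p1 "idt C V"] pb[of "prd_pair C W V p1 (idt C V)"] bt(1-3) pt V in simp_all)
    show "b \<cdot> prd_pair C W V (prd1 C W (Dom C (prd1 C W V))) (b \<cdot> prd2 C W (Dom C (prd1 C W V))) =
      b \<cdot> prd_pair C W V (prd1 C W (Dom C (prd1 C W V))) (prd2 C W V \<cdot> prd2 C W (Dom C (prd1 C W V)))"
      unfolding q1_def[symmetric] q2_def[symmetric] VV(2)
      by (rule eqV)
        (use pair[of "prd1 C W VV" "b \<cdot> prd2 C W VV"] pair[of "prd1 C W VV" "q2 \<cdot> prd2 C W VV"]
          pb[of "prd_pair C W V (prd1 C W VV) (b \<cdot> prd2 C W VV)"]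
          pb[of "prd_pair C W V (prd1 C W VV) (q2 \<cdot> prd2 C W VV)"] pb[of "prd2 C W VV"]
          bt(1-3) qt pt rt VV in simp_all)
  qed (use pt bt qt q1_def q2_def in simp_all)
  have ct: "c \<in> Ar C" "Dom C c = V" "Cod C c = Q" using c(1) by simp_all
  have "p2 \<cdot> q2 = p2 \<cdot> b" using bt by simp
  then obtain k where k: "k \<in> hom C Q Y" "k \<cdot> c = p2"
    by (rule coequalizerE[OF c(2), of p2, rotated 2]) (use pt qt ct in simp_all)
  let ?i = "prd_pair C W Q p1 c" and ?k = "prd_pair C W Y (prd1 C W Q) (k \<cdot> prd2 C W Q)"
  have kt: "k \<in> Ar C" "Dom C k = Q" "Cod C k = Y" using k(1) by simp_all
  have i: "?i \<in> Ar C" "Dom C ?i = V" "Cod C ?i = Dom C (prd1 C W Q)" using ct pt W Q by simp_all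
  have "?k \<cdot> ?i = prd_pair C W Y p1 p2"
    using prd_pair_comp[of W Y "prd1 C W Q" "k \<cdot> prd2 C W Q" ?i] kt i ct pt W Q Y k(2) by simp
  then have ki: "?k \<cdot> ?i = idt C V" using W Y by (simp add: p1_def p2_def V_def)
  have "is_iso C ?k"
    by (rule right_inverse_iso[OF c(3), of V "Dom C (prd1 C W Q)"]) (use i ki kt W Q Y in \<open>simp_all add: V_def\<close>)
  moreover have "far (times W) k = (prd1 C W Q, ?k, prd1 C W Y)" using kt by simp
  moreover have "(prd1 C W Q, ?k, prd1 C W Y) \<in> Ar (slice C W)" using kt W Q Y by simp
  ultimately have "is_iso (slice C W) (far (times W) k)" by (simp only: slice_iso_iff)
  then have "is_iso C k" using beckD(3)[OF bk, of k] kt by simp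
  then have "coequalizer C q2 b (k \<cdot> c)"
    by (rule coequalizer_iso[OF c(2), rotated 4]) (use kt ct bt qt in simp_all)
  then show ?thesis unfolding k(2) by (simp add: p2_def q1_def q2_def b_def)
qed

end

section \<open>Elements over \<open>fob S W\<close> and preservation of pullbacks\<close>

locale descent_situation =
  C: finite_limits C + D: finite_limits D + SD: adjunction D C S Dst etaD epsD +
  FS: ff_eso_functor "slice D W" "slice C (fob S W)" "slice_functor S"
  for C :: "('o, 'a) cat" (structure) and D :: "('p, 'b) cat" and S Dst etaD epsD W +
  assumes W [simp]: "W \<in> Ob D" and bk: "beck D (slice D W) (finite_limits.times D W)"
begin

abbreviation compD (infixr \<open>\<odot>\<close> 70) where
  "g \<odot> f \<equiv> g \<cdot>\<^bsub>D\<^esub> f"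

lemma lift:
  assumes "f \<in> hom D Y W" "g \<in> hom D V W" "k \<in> hom C (fob S Y) (fob S V)" "far S g \<cdot> k = far S f"
  obtains z where "z \<in> hom D Y V" "g \<odot> z = f" "far S z = k"
proof -
  have "(far S f, k, far S g) \<in> hom (slice C (fob S W)) (fob (slice_functor S) f) (fob (slice_functor S) g)"
    using assms by simp
  then obtain a where a: "a \<in> hom (slice D W) f g" "far (slice_functor S) a = (far S f, k, far S g)"
    by (rule FS.full[rotated 2]) (use assms in simp_all)
  obtain z where z: "a = (f, z, g)" using a(1) by (cases a) simp
  have ar: "(f, z, g) \<in> Ar (slice D W)" using a(1) by (simp only: mem_hom z)
  show thesis using that[of z] slice_ArD[OF ar] a(2) assms by (simp add: z)
qed

lemma lift_unique:
  assumes "g \<in> Ar D" "Cod D g = W" "z \<in> Ar D" "z' \<in> Ar D" "Dom D z = Dom D z'" "Cod D z = Dom D g" "Cod D z' = Dom D g"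
    "g \<odot> z = g \<odot> z'" "far S z = far S z'"
  shows "z = z'"
proof -
  have "(g \<odot> z, z, g) = (g \<odot> z, z', g)"
    by (rule FS.faithful) (use assms in simp_all)
  then show ?thesis by simp
qed

text \<open>Essential surjectivity of \<open>S\<close> on slices. It lets the domain of a
  generalized element over \<open>fob S W\<close> be replaced by an object in the image of
  \<open>S\<close>.\<close>

lemma cover:
  assumes "z \<in> Ar C" "Cod C z = fob S W"
  obtains w i j where "w \<in> Ar D" "Cod D w = W" "i \<in> hom C (Dom C z) (fob S (Dom D w))" "j \<in> hom C (fob S (Dom D w)) (Dom C z)"
    "j \<cdot> i = idt C (Dom C z)" "i \<cdot> j = idt C (fob S (Dom D w))" "far S w \<cdot> i = z" "is_iso C i"
proof -
  obtain w a where w: "w \<in> Ob (slice D W)" and a: "a \<in> hom (slice C (fob S W)) z (fob (slice_functor S) w)" "is_iso (slice C (fob S W)) a"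
    using FS.eso[of z] assms by (metis slice_simps(1))
  obtain i where i: "a = (z, i, far S w)" using a by (cases a) simp
  have ar: "(z, i, far S w) \<in> Ar (slice C (fob S W))" using a(1) by (simp only: i mem_hom)
  have iso: "is_iso C i" using a(2) C.slice_iso_iff[OF ar] by (simp add: i)
  have it: "i \<in> hom C (Dom C z) (fob S (Dom D w))" using slice_ArD[OF ar] w by simp
  obtain j where "j \<in> hom C (fob S (Dom D w)) (Dom C z)" "j \<cdot> i = idt C (Dom C z)" "i \<cdot> j = idt C (fob S (Dom D w))"
    by (rule C.is_isoE[OF iso it])
  then show thesis using that[of w i j] w it iso slice_ArD(8)[OF ar] by simp
qed

text \<open>Once its domain is replaced along \<open>i\<close>, an element of
  \<open>fob S (Dom D g)\<close> over \<open>fob S W\<close> is the image of a map of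
  \<open>D\<close>, by fullness of \<open>S\<close> on slices.\<close>

lemma element:
  assumes g: "g \<in> Ar D" "Cod D g = W" and w: "w \<in> Ar D" "Cod D w = W"
    and i: "i \<in> Ar C" "is_iso C i" "Cod C i = fob S (Dom D w)"
    and x: "x \<in> Ar C" "Cod C x = fob S (Dom D g)" "Dom C x = Dom C i" "far S g \<cdot> x = far S w \<cdot> i"
  obtains x' where "x' \<in> Ar D" "Dom D x' = Dom D w" "Cod D x' = Dom D g" "g \<odot> x' = w" "far S x' \<cdot> i = x"
proof -
  obtain j where j: "j \<in> hom C (fob S (Dom D w)) (Dom C i)" "j \<cdot> i = idt C (Dom C i)" "i \<cdot> j = idt C (fob S (Dom D w))"
    by (rule C.is_isoE[OF i(2), of "Dom C i" "fob S (Dom D w)"]) (use i in simp_all)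
  have e: "far S g \<cdot> x \<cdot> j = far S w"
    using C.reassoc[OF x(4), of j] x(1-3) g w i j by simp
  obtain x' where "x' \<in> hom D (Dom D w) (Dom D g)" "g \<odot> x' = w" "far S x' = x \<cdot> j"
    by (rule lift[of w "Dom D w" g "Dom D g" "x \<cdot> j"]) (use g w x(1-3) j(1) e in simp_all)
  then show thesis using that[of x'] x(1-3) i j by simp
qed

text \<open>Both halves lift to \<open>D\<close>: a compatible pair of elements is covered by one
  object and becomes a compatible pair there, as both members lie over the same \<open>w\<close>.
  For uniqueness, lifts that agree after \<open>S\<close> are equal in \<open>D\<close> once they
  also agree over \<open>W\<close>, which is why \<open>h\<close> and \<open>h'\<close> are lifted
  along \<open>f \<odot> p\<close>.\<close>

lemma S_pullback:
  assumes f: "f \<in> Ar D" "Cod D f = W" and g: "g \<in> Ar D" "Cod D g = W" and pb: "is_pullback D f g p q"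
  shows "is_pullback C (far S f) (far S g) (far S p) (far S q)"
proof (rule pullbackI)
  note d = pullbackD[OF pb]
  show "far S p \<in> Ar C" "far S q \<in> Ar C" "Dom C (far S q) = Dom C (far S p)" "Cod C (far S p) = Dom C (far S f)"
    "Cod C (far S q) = Dom C (far S g)" using d f g by simp_all
  show "far S f \<cdot> far S p = far S g \<cdot> far S q"
    using arg_cong[OF d(6), of "far S"] d(1-5) f g by simp
  {
    fix Z u v assume u: "u \<in> hom C Z (Dom C (far S f))" and v: "v \<in> hom C Z (Dom C (far S g))"
      and uv: "far S f \<cdot> u = far S g \<cdot> v"
    have ut: "u \<in> Ar C" "Dom C u = Z" "Cod C u = fob S (Dom D f)" and vt: "v \<in> Ar C" "Dom C v = Z" "Cod C v = fob S (Dom D g)"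
      using u v f g by simp_all
    obtain w i j where w: "w \<in> Ar D" "Cod D w = W" and i: "i \<in> hom C Z (fob S (Dom D w))" "is_iso C i"
      and wi: "far S w \<cdot> i = far S f \<cdot> u"
      by (rule cover[of "far S f \<cdot> u"]) (use ut f in simp_all)
    obtain u' where u': "u' \<in> Ar D" "Dom D u' = Dom D w" "Cod D u' = Dom D f" "f \<odot> u' = w" "far S u' \<cdot> i = u"
      by (rule element[OF f w _ i(2), of u]) (use i(1) ut wi in simp_all)
    obtain v' where v': "v' \<in> Ar D" "Dom D v' = Dom D w" "Cod D v' = Dom D g" "g \<odot> v' = w" "far S v' \<cdot> i = v"
      by (rule element[OF g w _ i(2), of v]) (use i(1) vt wi uv in simp_all)
    obtain h where h: "h \<in> hom D (Dom D w) (Dom D p)" "p \<odot> h = u'" "q \<odot> h = v'"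
      by (rule pullbackE[OF pb, of u' "Dom D w" v']) (use u'(1-4) v'(1-4) in simp_all)
    have ht: "h \<in> Ar D" "Dom D h = Dom D w" "Cod D h = Dom D p" using h(1) by simp_all
    have "far S p \<cdot> far S h = far S u'" "far S q \<cdot> far S h = far S v'"
      using arg_cong[OF h(2), of "far S"] arg_cong[OF h(3), of "far S"] ht d by simp_all
    then have "far S p \<cdot> far S h \<cdot> i = u" "far S q \<cdot> far S h \<cdot> i = v"
      using C.reassoc[of "far S p" "far S h" "far S u'" i] C.reassoc[of "far S q" "far S h" "far S v'" i]
        u'(5) v'(5) ht d i(1) by simp_all
    then show "\<exists>h. h \<in> hom C Z (Dom C (far S p)) \<and> far S p \<cdot> h = u \<and> far S q \<cdot> h = v"
      using ht d i(1) by (intro exI[of _ "far S h \<cdot> i"]) simp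
  next
    fix Z h h' assume h: "h \<in> hom C Z (Dom C (far S p))" and h': "h' \<in> hom C Z (Dom C (far S p))"
      and e1: "far S p \<cdot> h = far S p \<cdot> h'" and e2: "far S q \<cdot> h = far S q \<cdot> h'"
    have ht: "h \<in> Ar C" "Dom C h = Z" "Cod C h = fob S (Dom D p)" and ht': "h' \<in> Ar C" "Dom C h' = Z" "Cod C h' = fob S (Dom D p)"
      using h h' d by simp_all
    define r where "r = f \<odot> p"
    have r: "r \<in> Ar D" "Cod D r = W" "Dom D r = Dom D p" using d(1-5) f by (simp_all add: r_def)
    have Sr: "far S r \<cdot> x = far S f \<cdot> far S p \<cdot> x" if "x \<in> Ar C" "Cod C x = fob S (Dom D p)" for x
      using that d(1-5) f by (simp add: r_def)
    obtain w i j where w: "w \<in> Ar D" "Cod D w = W" and i: "i \<in> hom C Z (fob S (Dom D w))" "is_iso C i"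
      and wi: "far S w \<cdot> i = far S r \<cdot> h"
      by (rule cover[of "far S r \<cdot> h"]) (use ht r in simp_all)
    obtain m where m: "m \<in> Ar D" "Dom D m = Dom D w" "Cod D m = Dom D r" "r \<odot> m = w" "far S m \<cdot> i = h"
      by (rule element[OF r(1,2) w _ i(2), of h]) (use i(1) ht wi r in simp_all)
    obtain m' where m': "m' \<in> Ar D" "Dom D m' = Dom D w" "Cod D m' = Dom D r" "r \<odot> m' = w" "far S m' \<cdot> i = h'"
      by (rule element[OF r(1,2) w _ i(2), of h']) (use i(1) ht ht' wi r Sr e1 in simp_all)
    have c: "far S x \<cdot> far S m = far S x \<cdot> far S m'" if "x \<in> Ar D" "Dom D x = Dom D p" "far S x \<cdot> h = far S x \<cdot> h'" for x
      by (rule C.iso_cancel_right[OF i(2)]) (use that m m' r i(1) in simp_all)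
    have fp: "f \<odot> p \<odot> m = f \<odot> p \<odot> m'" using m(4) m'(4) m(1-3) m'(1-3) d(1-5) f r unfolding r_def by simp
    have pm: "p \<odot> m = p \<odot> m'"
      by (rule lift_unique[OF f]) (use fp c[of p] e1 m(1-3) m'(1-3) d(1-5) r in simp_all)
    have "g \<odot> q \<odot> m = g \<odot> q \<odot> m'"
      using D.reassoc[OF d(6), of m] D.reassoc[OF d(6), of m'] fp m(1-3) m'(1-3) d(1-5) f g r by simp
    then have "q \<odot> m = q \<odot> m'"
      by - (rule lift_unique[OF g], use c[of q] e2 m(1-3) m'(1-3) d(1-5) r in simp_all)
    with pm have "m = m'"
      by - (rule D.pullback_eqI[OF pb], use m(1-3) m'(1-3) d(1-5) r f g in simp_all)
    then show "h = h'" using m(5) m'(5) by simp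
  }
qed

text \<open>The groupoid and its actions are defined on chosen pullbacks of \<open>C\<close>,
  whereas \<open>S\<close> delivers images of chosen pullbacks of \<open>D\<close>; this is the
  comparison from the former to the latter.\<close>

definition "kp f g = (SOME k. k \<in> hom C (Dom C (pb1 C (far S f) (far S g))) (fob S (Dom D (pb1 D f g))) \<and>
  far S (pb1 D f g) \<cdot> k = pb1 C (far S f) (far S g) \<and> far S (pb2 D f g) \<cdot> k = pb2 C (far S f) (far S g))"

lemma kp:
  assumes f: "f \<in> Ar D" "Cod D f = W" and g: "g \<in> Ar D" "Cod D g = W"
  shows "kp f g \<in> Ar C" "Dom C (kp f g) = Dom C (pb1 C (far S f) (far S g))" "Cod C (kp f g) = fob S (Dom D (pb1 D f g))"
    "far S (pb1 D f g) \<cdot> kp f g = pb1 C (far S f) (far S g)" "far S (pb2 D f g) \<cdot> kp f g = pb2 C (far S f) (far S g)"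
proof -
  have pb: "is_pullback C (far S f) (far S g) (far S (pb1 D f g)) (far S (pb2 D f g))"
    by (rule S_pullback[OF f g]) (rule D.chosen_pullback, use f g in simp_all)
  have "\<exists>k. k \<in> hom C (Dom C (pb1 C (far S f) (far S g))) (fob S (Dom D (pb1 D f g))) \<and>
    far S (pb1 D f g) \<cdot> k = pb1 C (far S f) (far S g) \<and> far S (pb2 D f g) \<cdot> k = pb2 C (far S f) (far S g)"
    by (rule pullbackE[OF pb, of "pb1 C (far S f) (far S g)" "Dom C (pb1 C (far S f) (far S g))" "pb2 C (far S f) (far S g)"])
      (use f g C.pb_comm[of "far S f" "far S g"] in \<open>simp_all, blast\<close>)
  from someI_ex[OF this, folded kp_def]
  show "kp f g \<in> Ar C" "Dom C (kp f g) = Dom C (pb1 C (far S f) (far S g))" "Cod C (kp f g) = fob S (Dom D (pb1 D f g))"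
    "far S (pb1 D f g) \<cdot> kp f g = pb1 C (far S f) (far S g)" "far S (pb2 D f g) \<cdot> kp f g = pb2 C (far S f) (far S g)"
    by simp_all
qed

text \<open>Tested on the projections of the preserved pullback. Through it, pairing in
  \<open>C\<close> is replaced by pairing in \<open>D\<close> under \<open>S\<close>.\<close>

lemma kp_pair:
  assumes f: "f \<in> Ar D" "Cod D f = W" and g: "g \<in> Ar D" "Cod D g = W"
    and u: "u \<in> Ar D" "Cod D u = Dom D f" and v: "v \<in> Ar D" "Cod D v = Dom D g" "Dom D u = Dom D v"
    and fu: "f \<odot> u = g \<odot> v" and i: "i \<in> Ar C" "Cod C i = fob S (Dom D v)"
  shows "kp f g \<cdot> pb_pair C (far S f) (far S g) (far S u \<cdot> i) (far S v \<cdot> i) = far S (pb_pair D f g u v) \<cdot> i"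
proof -
  note k = kp[OF f g]
  have pb: "is_pullback C (far S f) (far S g) (far S (pb1 D f g)) (far S (pb2 D f g))"
    by (rule S_pullback[OF f g]) (rule D.chosen_pullback, use f g in simp_all)
  have Sfu: "far S f \<cdot> far S u = far S g \<cdot> far S v" using arg_cong[OF fu, of "far S"] f g u v by simp
  have e: "far S f \<cdot> far S u \<cdot> i = far S g \<cdot> far S v \<cdot> i"
    using C.reassoc[OF Sfu, of i] f g u v i by simp
  define P where "P = pb_pair C (far S f) (far S g) (far S u \<cdot> i) (far S v \<cdot> i)"
  have P: "P \<in> Ar C" "Dom C P = Dom C i" "Cod C P = Dom C (pb1 C (far S f) (far S g))"
    "pb1 C (far S f) (far S g) \<cdot> P = far S u \<cdot> i" "pb2 C (far S f) (far S g) \<cdot> P = far S v \<cdot> i"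
    using e f g u v i by (simp_all add: P_def)
  define q where "q = pb_pair D f g u v"
  have q: "q \<in> Ar D" "Dom D q = Dom D v" "Cod D q = Dom D (pb1 D f g)" "pb1 D f g \<odot> q = u" "pb2 D f g \<odot> q = v"
    using f g u v fu by (simp_all add: q_def)
  have Sq: "far S (pb1 D f g) \<cdot> far S q = far S u" "far S (pb2 D f g) \<cdot> far S q = far S v"
    using arg_cong[OF q(4), of "far S"] arg_cong[OF q(5), of "far S"] q(1-3) f g by simp_all
  have "kp f g \<cdot> P = far S q \<cdot> i"
  proof (rule C.pullback_eqI[OF pb])
    show "far S (pb1 D f g) \<cdot> kp f g \<cdot> P = far S (pb1 D f g) \<cdot> far S q \<cdot> i"
      using C.reassoc[OF k(4), of P] C.reassoc[OF Sq(1), of i] k(1-3) P q(1-3) f g i by simp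
    show "far S (pb2 D f g) \<cdot> kp f g \<cdot> P = far S (pb2 D f g) \<cdot> far S q \<cdot> i"
      using C.reassoc[OF k(5), of P] C.reassoc[OF Sq(2), of i] k(1-3) P q(1-3) f g i by simp
  qed (use k(1-3) P(1-3) q(1-3) i f g in simp_all)
  then show ?thesis by (simp only: P_def q_def)
qed

section \<open>The image of the codiscrete groupoid on \<open>W\<close>\<close>

definition "WW = Dom D (prd1 D W W)"

text \<open>The first coordinate is the target and \<open>r0\<close>, the second, the source, so
  that \<open>(w2, w1)\<close> times \<open>(w1, w0)\<close> is \<open>(w2, w0)\<close> in the order
  of composition fixed for \<open>gmul\<close>.\<close>

definition "r1 = prd1 D W W"

definition "r0 = prd2 D W W"

abbreviation "pr \<equiv> prd_pair D W W"

lemma r_simps [simp]: "r0 \<in> Ar D" "Dom D r0 = WW" "Cod D r0 = W" "r1 \<in> Ar D" "Dom D r1 = WW" "Cod D r1 = W" "WW \<in> Ob D"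
  by (simp_all add: r0_def r1_def WW_def)

lemma pr_simps [simp]:
  assumes "u \<in> Ar D" "v \<in> Ar D" "Dom D u = Dom D v" "Cod D u = W" "Cod D v = W"
  shows "pr u v \<in> Ar D" "Dom D (pr u v) = Dom D v" "Cod D (pr u v) = WW" "r1 \<odot> pr u v = u" "r0 \<odot> pr u v = v"
  using assms by (simp_all add: r0_def r1_def WW_def)

lemma pr_comp:
  assumes "u \<in> Ar D" "v \<in> Ar D" "Dom D u = Dom D v" "Cod D u = W" "Cod D v = W" "k \<in> Ar D" "Cod D k = Dom D v"
  shows "pr u v \<odot> k = pr (u \<odot> k) (v \<odot> k)"
  by (rule D.prd_pair_comp) (use assms in simp_all)

lemma pr_eqI:
  assumes "h \<in> Ar D" "h' \<in> Ar D" "Dom D h = Dom D h'" "Cod D h = WW" "Cod D h' = WW" "r1 \<odot> h = r1 \<odot> h'" "r0 \<odot> h = r0 \<odot> h'"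
  shows "h = h'"
  by (rule D.prd_eqI[of _ _ W W]) (use assms in \<open>simp_all add: r0_def r1_def WW_def\<close>)

lemma Dom_prd_WW [simp]: "Dom D (prd1 D W W) = WW"
  by (simp add: WW_def)

text \<open>The image under \<open>S\<close> of the codiscrete groupoid on \<open>W\<close>.\<close>

definition "Gpd = \<lparr>G0 = fob S W, G1 = fob S WW, d0 = far S r0, d1 = far S r1,
  gmul = far S (pr (r1 \<odot> pb1 D r0 r1) (r0 \<odot> pb2 D r0 r1)) \<cdot> kp r0 r1,
  gunit = far S (pr (idt D W) (idt D W)), ginv = far S (pr r0 r1)\<rparr>"

lemma Gpd_simps: "G0 Gpd = fob S W" "G1 Gpd = fob S WW" "d0 Gpd = far S r0" "d1 Gpd = far S r1"
  "gmul Gpd = far S (pr (r1 \<odot> pb1 D r0 r1) (r0 \<odot> pb2 D r0 r1)) \<cdot> kp r0 r1"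
  "gunit Gpd = far S (pr (idt D W) (idt D W))" "ginv Gpd = far S (pr r0 r1)"
  by (simp_all add: Gpd_def)

text \<open>The factor \<open>i\<close> admits elements of \<open>C\<close> that come from
  \<open>D\<close> only after a change of domain, as those of a triple pullback do.\<close>

lemma mul_elements:
  assumes u: "u \<in> Ar D" "Cod D u = WW" and v: "v \<in> Ar D" "Cod D v = WW" "Dom D u = Dom D v"
    and uv: "r0 \<odot> u = r1 \<odot> v" and i: "i \<in> Ar C" "Cod C i = fob S (Dom D v)"
  shows "gmul Gpd \<cdot> pb_pair C (d0 Gpd) (d1 Gpd) (far S u \<cdot> i) (far S v \<cdot> i) =
    far S (pr (r1 \<odot> u) (r0 \<odot> v)) \<cdot> i"
proof -
  define m where "m = pr (r1 \<odot> pb1 D r0 r1) (r0 \<odot> pb2 D r0 r1)"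
  have m: "m \<in> Ar D" "Dom D m = Dom D (pb1 D r0 r1)" "Cod D m = WW" by (simp_all add: m_def)
  have Suv: "far S r0 \<cdot> far S u = far S r1 \<cdot> far S v" using arg_cong[OF uv, of "far S"] u v by simp
  have e: "far S r0 \<cdot> far S u \<cdot> i = far S r1 \<cdot> far S v \<cdot> i"
    using C.reassoc[OF Suv, of i] u v i by simp
  define P where "P = pb_pair C (far S r0) (far S r1) (far S u \<cdot> i) (far S v \<cdot> i)"
  have P: "P \<in> Ar C" "Cod C P = Dom C (pb1 C (far S r0) (far S r1))" using e u v i by (simp_all add: P_def)
  define q where "q = pb_pair D r0 r1 u v"
  have q: "q \<in> Ar D" "Dom D q = Dom D v" "Cod D q = Dom D (pb1 D r0 r1)" "pb1 D r0 r1 \<odot> q = u" "pb2 D r0 r1 \<odot> q = v"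
    using u v uv by (simp_all add: q_def)
  have mq: "m \<odot> q = pr (r1 \<odot> u) (r0 \<odot> v)"
    unfolding m_def using pr_comp[of "r1 \<odot> pb1 D r0 r1" "r0 \<odot> pb2 D r0 r1" q] q by simp
  have "(far S m \<cdot> kp r0 r1) \<cdot> P = far S m \<cdot> far S q \<cdot> i"
    using kp_pair[of r0 r1 u v i] kp(1-3)[of r0 r1] m P u v uv i by (simp add: P_def q_def)
  also have "\<dots> = far S (m \<odot> q) \<cdot> i" using m q i by simp
  finally show ?thesis unfolding mq by (simp only: Gpd_simps m_def P_def)
qed

lemma mul_elements':
  assumes u: "u \<in> Ar D" "Cod D u = WW" and v: "v \<in> Ar D" "Cod D v = WW" "Dom D u = Dom D v"
    and uv: "r0 \<odot> u = r1 \<odot> v"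
  shows "gmul Gpd \<cdot> pb_pair C (d0 Gpd) (d1 Gpd) (far S u) (far S v) = far S (pr (r1 \<odot> u) (r0 \<odot> v))"
  using mul_elements[OF assms, of "idt C (fob S (Dom D v))"] u v by simp

text \<open>The unit and inverse laws are equations of maps out of objects in the image of
  \<open>S\<close>, and reduce directly to pairs. Associativity lives on a chosen triple pullback of
  \<open>C\<close> and needs its generic triple to be lifted first.\<close>

lemma internal_groupoid: "internal_groupoid C Gpd"
proof
  note k = kp[of r0 r1, simplified]
  define m where "m = pr (r1 \<odot> pb1 D r0 r1) (r0 \<odot> pb2 D r0 r1)"
  have m: "m \<in> Ar D" "Dom D m = Dom D (pb1 D r0 r1)" "Cod D m = WW" "r1 \<odot> m = r1 \<odot> pb1 D r0 r1" "r0 \<odot> m = r0 \<odot> pb2 D r0 r1"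
    by (simp_all add: m_def)
  have Sm: "far S r1 \<cdot> far S m = far S r1 \<cdot> far S (pb1 D r0 r1)" "far S r0 \<cdot> far S m = far S r0 \<cdot> far S (pb2 D r0 r1)"
    using arg_cong[OF m(4), of "far S"] arg_cong[OF m(5), of "far S"] m(1-3) by simp_all
  show "gmul Gpd \<in> hom C (Dom C (pb1 C (d0 Gpd) (d1 Gpd))) (G1 Gpd)"
    using m k by (simp add: Gpd_simps m_def[symmetric])
  show "d0 Gpd \<cdot> gmul Gpd = d0 Gpd \<cdot> pb2 C (d0 Gpd) (d1 Gpd)"
    using C.reassoc[OF Sm(2), of "kp r0 r1"] m(1-3) k by (simp add: Gpd_simps m_def[symmetric])
  show "d1 Gpd \<cdot> gmul Gpd = d1 Gpd \<cdot> pb1 C (d0 Gpd) (d1 Gpd)"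
    using C.reassoc[OF Sm(1), of "kp r0 r1"] m(1-3) k by (simp add: Gpd_simps m_def[symmetric])
  have S_eq: "far S u \<cdot> far S v = far S w" if "u \<odot> v = w" "u \<in> Ar D" "v \<in> Ar D" "Dom D u = Cod D v" for u v w
    using that by (simp flip: SD.L.far_cmp)
  show "d0 Gpd \<cdot> gunit Gpd = idt C (G0 Gpd)" "d1 Gpd \<cdot> gunit Gpd = idt C (G0 Gpd)"
    "d0 Gpd \<cdot> ginv Gpd = d1 Gpd" "d1 Gpd \<cdot> ginv Gpd = d0 Gpd"
    unfolding Gpd_simps
    using S_eq[of r0 "pr (idt D W) (idt D W)" "idt D W"] S_eq[of r1 "pr (idt D W) (idt D W)" "idt D W"]
      S_eq[of r0 "pr r0 r1" r1] S_eq[of r1 "pr r0 r1" r0] by simp_all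
  have u1: "pr (idt D W) (idt D W) \<odot> x = pr x x" if "x \<in> Ar D" "Cod D x = W" for x
    using pr_comp[of "idt D W" "idt D W" x] that by simp
  have r10: "pr r1 r0 = idt D WW" by (rule pr_eqI) simp_all
  have ru: "r1 \<odot> pr (idt D W) (idt D W) \<odot> x = x" "r0 \<odot> pr (idt D W) (idt D W) \<odot> x = x" if "x \<in> Ar D" "Cod D x = W" for x
    using that by (simp_all add: u1)
  show "gmul Gpd \<cdot> pb_pair C (d0 Gpd) (d1 Gpd) (gunit Gpd \<cdot> d1 Gpd) (idt C (G1 Gpd)) = idt C (G1 Gpd)"
    using mul_elements'[of "pr (idt D W) (idt D W) \<odot> r1" "idt D WW"] ru r10 by (simp add: Gpd_simps)
  show "gmul Gpd \<cdot> pb_pair C (d0 Gpd) (d1 Gpd) (idt C (G1 Gpd)) (gunit Gpd \<cdot> d0 Gpd) = idt C (G1 Gpd)"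
    using mul_elements'[of "idt D WW" "pr (idt D W) (idt D W) \<odot> r0"] ru r10 by (simp add: Gpd_simps)
  have Su: "far S (pr x x) = far S (pr (idt D W) (idt D W)) \<cdot> far S x" if "x \<in> Ar D" "Cod D x = W" for x
    using arg_cong[OF u1[OF that], of "far S"] that by simp
  show "gmul Gpd \<cdot> pb_pair C (d0 Gpd) (d1 Gpd) (ginv Gpd) (idt C (G1 Gpd)) = gunit Gpd \<cdot> d0 Gpd"
    using mul_elements'[of "pr r0 r1" "idt D WW"] Su[of r0] by (simp add: Gpd_simps)
  show "gmul Gpd \<cdot> pb_pair C (d0 Gpd) (d1 Gpd) (idt C (G1 Gpd)) (ginv Gpd) = gunit Gpd \<cdot> d1 Gpd"
    using mul_elements'[of "idt D WW" "pr r0 r1"] Su[of r1] by (simp add: Gpd_simps)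
  show "let p = pb1 C (d0 Gpd) (d1 Gpd); q = pb2 C (d0 Gpd) (d1 Gpd);
          gh = pb1 C (d0 Gpd \<cdot> q) (d1 Gpd); k = pb2 C (d0 Gpd \<cdot> q) (d1 Gpd)
      in gmul Gpd \<cdot> pb_pair C (d0 Gpd) (d1 Gpd) (gmul Gpd \<cdot> gh) k =
         gmul Gpd \<cdot> pb_pair C (d0 Gpd) (d1 Gpd) (p \<cdot> gh)
          (gmul Gpd \<cdot> pb_pair C (d0 Gpd) (d1 Gpd) (q \<cdot> gh) k)"
  proof -
    define D0 D1 where "D0 = d0 Gpd" and "D1 = d1 Gpd"
    have D01: "D0 \<in> Ar C" "Dom C D0 = fob S WW" "Cod C D0 = fob S W" "D1 \<in> Ar C" "Dom C D1 = fob S WW" "Cod C D1 = fob S W"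
      by (simp_all add: D0_def D1_def Gpd_simps)
    define p q where "p = pb1 C D0 D1" and "q = pb2 C D0 D1"
    have pq: "p \<in> Ar C" "q \<in> Ar C" "Dom C q = Dom C p" "Cod C p = fob S WW" "Cod C q = fob S WW" "D0 \<cdot> p = D1 \<cdot> q"
      using C.pb_comm[of D0 D1] D01 by (simp_all add: p_def q_def)
    define gh l where "gh = pb1 C (D0 \<cdot> q) D1" and "l = pb2 C (D0 \<cdot> q) D1"
    have t: "gh \<in> Ar C" "l \<in> Ar C" "Dom C l = Dom C gh" "Cod C gh = Dom C p" "Cod C l = fob S WW"
      and c1: "(D0 \<cdot> q) \<cdot> gh = D1 \<cdot> l"
      using C.pb_comm[of "D0 \<cdot> q" D1] pq(1-5) D01 by (simp_all add: gh_def l_def)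
    define a b where "a = p \<cdot> gh" and "b = q \<cdot> gh"
    have ab: "a \<in> Ar C" "Dom C a = Dom C gh" "Cod C a = fob S WW" "b \<in> Ar C" "Dom C b = Dom C gh" "Cod C b = fob S WW"
      using t pq(1-5) by (simp_all add: a_def b_def)
    have c2: "D0 \<cdot> a = D1 \<cdot> b" using C.reassoc[OF pq(6), of gh] pq(1-5) t D01 by (simp add: a_def b_def)
    have c3: "D0 \<cdot> b = D1 \<cdot> l" using c1 pq(1-5) t D01 by (simp add: b_def)
    have ghe: "gh = pb_pair C D0 D1 a b"
      by (rule C.pb_eqI[of _ _ D0 D1])
        (use t c2 pq(1-5) D01 ab C.pb_pair_simps[of D0 D1 a b, folded p_def q_def] in \<open>simp_all flip: p_def q_def a_def b_def\<close>)
    \<comment> \<open>The cover is taken at the source of the middle factor. The middle and last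
      factors lift over it, and the first one then over the target of the lifted middle
      factor.\<close>
    obtain w i j where w: "w \<in> Ar D" "Cod D w = W" and i: "i \<in> hom C (Dom C gh) (fob S (Dom D w))" "is_iso C i"
      and wi: "far S w \<cdot> i = D0 \<cdot> b"
      by (rule cover[of "D0 \<cdot> b"]) (use ab D01 in simp_all)
    have it: "i \<in> Ar C" "Dom C i = Dom C gh" "Cod C i = fob S (Dom D w)" using i(1) by simp_all
    obtain b' where b': "b' \<in> Ar D" "Dom D b' = Dom D w" "Cod D b' = Dom D r0" "r0 \<odot> b' = w" "far S b' \<cdot> i = b"
      by (rule element[OF r_simps(1,3) w it(1) i(2) it(3), of b]) (use it ab wi in \<open>simp_all add: D0_def Gpd_simps\<close>)
    obtain l' where l': "l' \<in> Ar D" "Dom D l' = Dom D w" "Cod D l' = Dom D r1" "r1 \<odot> l' = w" "far S l' \<cdot> i = l"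
      by (rule element[OF r_simps(4,6) w it(1) i(2) it(3), of l]) (use it t wi c3 in \<open>simp_all add: D0_def D1_def Gpd_simps\<close>)
    have "far S r0 \<cdot> a = far S r1 \<cdot> far S b' \<cdot> i" using c2 b'(5) by (simp add: D0_def D1_def Gpd_simps)
    then have "far S r0 \<cdot> a = far S (r1 \<odot> b') \<cdot> i" using b'(1-3) it by simp
    then obtain a' where a': "a' \<in> Ar D" "Dom D a' = Dom D w" "Cod D a' = Dom D r0" "r0 \<odot> a' = r1 \<odot> b'" "far S a' \<cdot> i = a"
      by - (rule element[of r0 "r1 \<odot> b'" i a], use it i(2) ab b'(1-3) in simp_all)
    let ?m = "\<lambda>u v. gmul Gpd \<cdot> pb_pair C (d0 Gpd) (d1 Gpd) u v"
    have m1: "?m a b = far S (pr (r1 \<odot> a') (r0 \<odot> b')) \<cdot> i"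
      using mul_elements[of a' b' i] a' b' it by simp
    have m2: "?m b l = far S (pr (r1 \<odot> b') (r0 \<odot> l')) \<cdot> i"
      using mul_elements[of b' l' i] l' b' it by simp
    have "?m (?m a b) l = far S (pr (r1 \<odot> a') (r0 \<odot> l')) \<cdot> i"
      unfolding m1 using mul_elements[of "pr (r1 \<odot> a') (r0 \<odot> b')" l' i] a'(1-3) b'(1-4) l' it w by simp
    moreover have "?m a (?m b l) = far S (pr (r1 \<odot> a') (r0 \<odot> l')) \<cdot> i"
      unfolding m2 using mul_elements[of a' "pr (r1 \<odot> b') (r0 \<odot> l')" i] a' b'(1-3) l'(1-3) it w by simp
    moreover have "gmul Gpd \<cdot> gh = ?m a b" using ghe by (simp add: D0_def D1_def)
    ultimately show ?thesis
      unfolding Let_def p_def[unfolded D0_def D1_def, symmetric] q_def[unfolded D0_def D1_def, symmetric]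
        gh_def[unfolded D0_def D1_def, symmetric] l_def[unfolded D0_def D1_def, symmetric]
        a_def[symmetric] b_def[symmetric] by simp
  qed
qed (simp_all add: Gpd_simps)

sublocale GA: groupoid_actions C Gpd
  by (intro groupoid_actions.intro internal_groupoid C.finite_limits_axioms)

text \<open>A groupoid element and an element it acts on have a common image in
  \<open>fob S W\<close>; covering this once lifts both simultaneously, so that the laws of an
  action on \<open>far S g\<close> can be tested in \<open>D\<close>.\<close>

lemma elements:
  assumes g: "g \<in> Ar D" "Cod D g = W" and ga: "\<gamma> \<in> Ar C" "Cod C \<gamma> = G1 Gpd" and u: "u \<in> Ar C" "Cod C u = fob S (Dom D g)" "Dom C \<gamma> = Dom C u"
    and gu: "d0 Gpd \<cdot> \<gamma> = far S g \<cdot> u"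
  obtains \<gamma>' u' i where "u' \<in> Ar D" "Cod D u' = Dom D g" "\<gamma>' \<in> Ar D" "Cod D \<gamma>' = WW" "Dom D \<gamma>' = Dom D u'" "r0 \<odot> \<gamma>' = g \<odot> u'"
    "i \<in> Ar C" "is_iso C i" "Dom C i = Dom C u" "Cod C i = fob S (Dom D u')" "\<gamma> = far S \<gamma>' \<cdot> i" "u = far S u' \<cdot> i"
proof -
  obtain w i j where w: "w \<in> Ar D" "Cod D w = W" and i: "i \<in> hom C (Dom C u) (fob S (Dom D w))" "is_iso C i"
    and wi: "far S w \<cdot> i = far S g \<cdot> u"
    by (rule cover[of "far S g \<cdot> u"]) (use g u in simp_all)
  have it: "i \<in> Ar C" "Dom C i = Dom C u" "Cod C i = fob S (Dom D w)" using i(1) by simp_all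
  obtain u' where u': "u' \<in> Ar D" "Dom D u' = Dom D w" "Cod D u' = Dom D g" "g \<odot> u' = w" "far S u' \<cdot> i = u"
    by (rule element[OF g w it(1) i(2) it(3), of u]) (use it u wi in simp_all)
  obtain \<gamma>' where \<gamma>': "\<gamma>' \<in> Ar D" "Dom D \<gamma>' = Dom D w" "Cod D \<gamma>' = Dom D r0" "r0 \<odot> \<gamma>' = w" "far S \<gamma>' \<cdot> i = \<gamma>"
    by (rule element[OF r_simps(1,3) w it(1) i(2) it(3), of \<gamma>]) (use it u ga gu wi in \<open>simp_all add: Gpd_simps\<close>)
  show thesis by (rule that[of u' \<gamma>' i]) (use u' \<gamma>' it i(2) in simp_all)
qed

text \<open>For an action on the image of \<open>g\<close> that comes from a map \<open>t\<close> of
  \<open>D\<close>, acting is computed in \<open>D\<close>, with \<open>kp\<close> absorbed by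
  \<open>kp_pair\<close>.\<close>

lemma action_elements:
  assumes g: "g \<in> Ar D" "Cod D g = W" and t: "t \<in> Ar D" "Dom D t = Dom D (pb1 D r0 g)" "Cod D t = Dom D g"
    and u: "u \<in> Ar D" "Cod D u = Dom D g" and ga: "\<gamma> \<in> Ar D" "Cod D \<gamma> = WW" "Dom D \<gamma> = Dom D u" "r0 \<odot> \<gamma> = g \<odot> u"
    and i: "i \<in> Ar C" "Cod C i = fob S (Dom D u)"
  shows "GA.act (far S g, far S t \<cdot> kp r0 g) (far S \<gamma> \<cdot> i) (far S u \<cdot> i) = far S (t \<odot> pb_pair D r0 g \<gamma> u) \<cdot> i"
proof -
  have Suv: "far S r0 \<cdot> far S \<gamma> = far S g \<cdot> far S u" using arg_cong[OF ga(4), of "far S"] u ga(1-3) g by simp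
  have e: "far S r0 \<cdot> far S \<gamma> \<cdot> i = far S g \<cdot> far S u \<cdot> i"
    using C.reassoc[OF Suv, of i] u ga g i by simp
  define P where "P = pb_pair C (far S r0) (far S g) (far S \<gamma> \<cdot> i) (far S u \<cdot> i)"
  have P: "P \<in> Ar C" "Cod C P = Dom C (pb1 C (far S r0) (far S g))" using e u ga g i by (simp_all add: P_def)
  define q where "q = pb_pair D r0 g \<gamma> u"
  have q: "q \<in> Ar D" "Dom D q = Dom D u" "Cod D q = Dom D (pb1 D r0 g)" using u ga g by (simp_all add: q_def)
  have "(far S t \<cdot> kp r0 g) \<cdot> P = far S t \<cdot> far S q \<cdot> i"
    using kp_pair[of r0 g \<gamma> u i] kp(1-3)[of r0 g] t P u ga g i by (simp add: P_def q_def)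
  also have "\<dots> = far S (t \<odot> q) \<cdot> i" using t q i by simp
  finally show ?thesis by (simp only: GA.act_def Gpd_simps P_def q_def fst_conv snd_conv)
qed

lemma gm_elements:
  assumes "u \<in> Ar D" "Cod D u = WW" "v \<in> Ar D" "Cod D v = WW" "Dom D u = Dom D v" "r0 \<odot> u = r1 \<odot> v"
    "i \<in> Ar C" "Cod C i = fob S (Dom D v)"
  shows "GA.gm (far S u \<cdot> i) (far S v \<cdot> i) = far S (pr (r1 \<odot> u) (r0 \<odot> v)) \<cdot> i"
  using mul_elements[OF assms] by (simp add: GA.gm_def)

section \<open>The functor from \<open>D\<close> to actions\<close>

abbreviation "p1 Y \<equiv> prd1 D W Y"

abbreviation "p2 Y \<equiv> prd2 D W Y"

abbreviation "pair Y \<equiv> prd_pair D W Y"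

text \<open>The image under \<open>S\<close> of the codiscrete action on \<open>W x Y\<close>, in
  which \<open>(w1, w0)\<close> takes \<open>(w0, y)\<close> to \<open>(w1, y)\<close>.\<close>

definition "Th_ob Y = (far S (p1 Y),
  far S (pair Y (r1 \<odot> pb1 D r0 (p1 Y)) (p2 Y \<odot> pb2 D r0 (p1 Y))) \<cdot> kp r0 (p1 Y))"

definition "Theta = \<lparr>fob = Th_ob, far = (\<lambda>h. (Th_ob (Dom D h),
  far S (pair (Cod D h) (p1 (Dom D h)) (h \<odot> p2 (Dom D h))), Th_ob (Cod D h)))\<rparr>"

lemma Theta_simps [simp]: "fob Theta Y = Th_ob Y"
  "far Theta h = (Th_ob (Dom D h), far S (pair (Cod D h) (p1 (Dom D h)) (h \<odot> p2 (Dom D h))), Th_ob (Cod D h))"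
  by (simp_all add: Theta_def)

lemma fst_Th_ob [simp]: "fst (Th_ob Y) = far S (p1 Y)"
  by (simp add: Th_ob_def)

lemma Th_act:
  assumes Y: "Y \<in> Ob D" and u: "u \<in> Ar D" "Cod D u = Dom D (p1 Y)"
    and ga: "\<gamma> \<in> Ar D" "Cod D \<gamma> = WW" "Dom D \<gamma> = Dom D u" "r0 \<odot> \<gamma> = p1 Y \<odot> u"
    and i: "i \<in> Ar C" "Cod C i = fob S (Dom D u)"
  shows "GA.act (Th_ob Y) (far S \<gamma> \<cdot> i) (far S u \<cdot> i) = far S (pair Y (r1 \<odot> \<gamma>) (p2 Y \<odot> u)) \<cdot> i"
proof -
  define g where "g = p1 Y"
  have g: "g \<in> Ar D" "Cod D g = W" "Dom D (p2 Y) = Dom D g" "p2 Y \<in> Ar D" "Cod D (p2 Y) = Y" using Y by (simp_all add: g_def)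
  have u: "u \<in> Ar D" "Cod D u = Dom D g" and gu: "r0 \<odot> \<gamma> = g \<odot> u" using u ga by (simp_all add: g_def)
  define q where "q = pb_pair D r0 g \<gamma> u"
  have q: "q \<in> Ar D" "Dom D q = Dom D u" "Cod D q = Dom D (pb1 D r0 g)" "pb1 D r0 g \<odot> q = \<gamma>" "pb2 D r0 g \<odot> q = u"
    using u ga(1-3) gu g by (simp_all add: q_def)
  define t where "t = pair Y (r1 \<odot> pb1 D r0 g) (p2 Y \<odot> pb2 D r0 g)"
  have t: "t \<in> Ar D" "Dom D t = Dom D (pb1 D r0 g)" "Cod D t = Dom D g" using Y g by (simp_all add: t_def g_def)
  have "t \<odot> q = pair Y (r1 \<odot> \<gamma>) (p2 Y \<odot> u)"
    unfolding t_def using D.prd_pair_comp[of W Y "r1 \<odot> pb1 D r0 g" "p2 Y \<odot> pb2 D r0 g" q] q Y g by simp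
  then show ?thesis
    using action_elements[OF g(1,2) t u ga(1-3) gu i] by (simp add: Th_ob_def t_def q_def g_def)
qed

lemma pair_simps [simp]:
  assumes "Y \<in> Ob D" "u \<in> Ar D" "v \<in> Ar D" "Dom D u = Dom D v" "Cod D u = W" "Cod D v = Y"
  shows "far S (p1 Y) \<cdot> far S (pair Y u v) = far S u" "far S (p2 Y) \<cdot> far S (pair Y u v) = far S v"
  using SD.L.far_cmp[of "p1 Y" "pair Y u v"] SD.L.far_cmp[of "p2 Y" "pair Y u v"] assms by simp_all

lemma pair_reassoc [simp]:
  assumes "Y \<in> Ob D" "u \<in> Ar D" "v \<in> Ar D" "Dom D u = Dom D v" "Cod D u = W" "Cod D v = Y" "i \<in> Ar C" "Cod C i = fob S (Dom D v)"
  shows "far S (p1 Y) \<cdot> far S (pair Y u v) \<cdot> i = far S u \<cdot> i" "far S (p2 Y) \<cdot> far S (pair Y u v) \<cdot> i = far S v \<cdot> i"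
  using C.reassoc[OF pair_simps(1)[OF assms(1-6)], of i] C.reassoc[OF pair_simps(2)[OF assms(1-6)], of i] assms by simp_all

lemma Th_object:
  assumes Y: "Y \<in> Ob D"
  shows "is_gobject C Gpd (Th_ob Y)"
proof -
  define g where "g = p1 Y"
  have g: "g \<in> Ar D" "Cod D g = W" "Dom D (p2 Y) = Dom D g" "p2 Y \<in> Ar D" "Cod D (p2 Y) = Y" "Dom D (p1 Y) = Dom D g" "p1 Y = g"
    using Y by (simp_all add: g_def)
  define a where "a = far S (pair Y (r1 \<odot> pb1 D r0 g) (p2 Y \<odot> pb2 D r0 g)) \<cdot> kp r0 g"
  have a: "Th_ob Y = (far S g, a)" by (simp only: Th_ob_def g_def a_def)
  have at: "a \<in> Ar C" "Dom C a = Dom C (pb1 C (d0 Gpd) (far S g))" "Cod C a = Dom C (far S g)"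
    unfolding a_def using kp(1-3)[of r0 g] g(1-6) Y by (simp_all add: Gpd_simps)
  note ta = Th_act[OF Y, unfolded a g(6,7)]
  have pc: "p2 Y \<odot> pair Y x y = y" "g \<odot> pair Y x y = x" "pair Y x y \<in> Ar D" "Dom D (pair Y x y) = Dom D y" "Cod D (pair Y x y) = Dom D g"
    if "x \<in> Ar D" "y \<in> Ar D" "Dom D x = Dom D y" "Cod D x = W" "Cod D y = Y" for x y
    using that Y unfolding g_def by simp_all
  have eta: "pair Y (g \<odot> x) (p2 Y \<odot> x) = x" if "x \<in> Ar D" "Cod D x = Dom D g" for x
    using that Y D.prd_pair_comp[of W Y "p1 Y" "p2 Y" x] unfolding g_def by simp
  show ?thesis unfolding a
  proof (rule GA.gobjectI[OF _ _ at])
    fix \<gamma> u assume h: "\<gamma> \<in> Ar C" "u \<in> Ar C" "Dom C \<gamma> = Dom C u" "Cod C \<gamma> = G1 Gpd" "Cod C u = Dom C (far S g)"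
      "d0 Gpd \<cdot> \<gamma> = far S g \<cdot> u"
    have h': "Cod C u = fob S (Dom D g)" using h(5) g(1-5) by simp
    obtain \<gamma>' u' i where e: "u' \<in> Ar D" "Cod D u' = Dom D g" "\<gamma>' \<in> Ar D" "Cod D \<gamma>' = WW" "Dom D \<gamma>' = Dom D u'" "r0 \<odot> \<gamma>' = g \<odot> u'"
      "i \<in> Ar C" "is_iso C i" "Dom C i = Dom C u" "Cod C i = fob S (Dom D u')" "\<gamma> = far S \<gamma>' \<cdot> i" "u = far S u' \<cdot> i"
      by (rule elements[OF g(1,2) h(1,4,2) h' h(3,6)])
    have "far S g \<cdot> far S (pair Y (r1 \<odot> \<gamma>') (p2 Y \<odot> u')) \<cdot> i = far S (r1 \<odot> \<gamma>') \<cdot> i"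
      using pair_reassoc(1)[of Y "r1 \<odot> \<gamma>'" "p2 Y \<odot> u'" i] e(1-10) g Y by simp
    then show "far S g \<cdot> GA.act (far S g, a) \<gamma> u = d1 Gpd \<cdot> \<gamma>"
      unfolding e(11,12) ta[OF e(1-7,10)] using e(1-10) by (simp add: Gpd_simps)
  next
    fix u assume u: "u \<in> Ar C" "Cod C u = Dom C (far S g)"
    define \<gamma> where "\<gamma> = gunit Gpd \<cdot> far S g \<cdot> u"
    have \<gamma>: "\<gamma> \<in> Ar C" "Cod C \<gamma> = G1 Gpd" "Dom C \<gamma> = Dom C u" "d0 Gpd \<cdot> \<gamma> = far S g \<cdot> u"
      using u g(1-5) GA.d_unit(1)[of "far S g \<cdot> u"] by (simp_all add: \<gamma>_def Gpd_simps)
    have u2: "Cod C u = fob S (Dom D g)" using u(2) g(1-5) by simp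
    obtain \<gamma>' u' i where e: "u' \<in> Ar D" "Cod D u' = Dom D g" "\<gamma>' \<in> Ar D" "Cod D \<gamma>' = WW" "Dom D \<gamma>' = Dom D u'" "r0 \<odot> \<gamma>' = g \<odot> u'"
      "i \<in> Ar C" "is_iso C i" "Dom C i = Dom C u" "Cod C i = fob S (Dom D u')" "\<gamma> = far S \<gamma>' \<cdot> i" "u = far S u' \<cdot> i"
      by (rule elements[OF g(1,2) \<gamma>(1,2) u(1) u2 \<gamma>(3,4)])
    \<comment> \<open>The unit element at \<open>g \<odot> u'\<close>, formed in \<open>D\<close>.
      It replaces the lift returned by \<open>elements\<close>, of whose coordinates only the source
      is known.\<close>
    define un where "un = pr (g \<odot> u') (g \<odot> u')"
    have un: "un \<in> Ar D" "Cod D un = WW" "Dom D un = Dom D u'" "r0 \<odot> un = g \<odot> u'" "r1 \<odot> un = g \<odot> u'"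
      using e(1,2) g(1-5) by (simp_all add: un_def)
    have "pr (idt D W) (idt D W) \<odot> g \<odot> u' = un"
      unfolding un_def using pr_comp[of "idt D W" "idt D W" "g \<odot> u'"] e(1,2) g(1-5) by simp
    from arg_cong[OF this, of "far S"]
    have "far S (pr (idt D W) (idt D W)) \<cdot> far S g \<cdot> far S u' = far S un"
      using e(1,2) g(1-5) by simp
    then have "\<gamma> = far S un \<cdot> i"
      unfolding \<gamma>_def e(12) using e(1,2,7,10) g(1-5) by (simp add: Gpd_simps flip: C.assoc)
    then show "GA.act (far S g, a) (gunit Gpd \<cdot> far S g \<cdot> u) u = u"
      unfolding \<gamma>_def[symmetric]
      using ta[OF e(1,2) un(1-4) e(7,10)] un(5) eta[OF e(1,2)] e(12) by simp
  next
    fix \<alpha> \<beta> u assume h: "\<alpha> \<in> Ar C" "\<beta> \<in> Ar C" "u \<in> Ar C" "Dom C \<alpha> = Dom C u" "Dom C \<beta> = Dom C u" "Cod C \<alpha> = G1 Gpd" "Cod C \<beta> = G1 Gpd"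
      "Cod C u = Dom C (far S g)" "d0 Gpd \<cdot> \<alpha> = d1 Gpd \<cdot> \<beta>" "d0 Gpd \<cdot> \<beta> = far S g \<cdot> u"
    have h': "Cod C u = fob S (Dom D g)" using h(8) g(1-5) by simp
    obtain \<beta>' u' i where e: "u' \<in> Ar D" "Cod D u' = Dom D g" "\<beta>' \<in> Ar D" "Cod D \<beta>' = WW" "Dom D \<beta>' = Dom D u'" "r0 \<odot> \<beta>' = g \<odot> u'"
      "i \<in> Ar C" "is_iso C i" "Dom C i = Dom C u" "Cod C i = fob S (Dom D u')" "\<beta> = far S \<beta>' \<cdot> i" "u = far S u' \<cdot> i"
      by (rule elements[OF g(1,2) h(2,7,3) h' h(5,10)])
    have "far S r0 \<cdot> \<alpha> = far S (r1 \<odot> \<beta>') \<cdot> i" using h(9) e(1-10) unfolding e(11) by (simp add: Gpd_simps)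
    then obtain \<alpha>' where a': "\<alpha>' \<in> Ar D" "Dom D \<alpha>' = Dom D (r1 \<odot> \<beta>')" "Cod D \<alpha>' = Dom D r0" "r0 \<odot> \<alpha>' = r1 \<odot> \<beta>'" "far S \<alpha>' \<cdot> i = \<alpha>"
      by - (rule element[of r0 "r1 \<odot> \<beta>'" i \<alpha>], use h(1,4,6) e(1-10) in \<open>simp_all add: Gpd_simps\<close>)
    have at': "Dom D \<alpha>' = Dom D u'" "Cod D \<alpha>' = WW" using a'(2,3) e(1-10) by simp_all
    have gmab: "GA.gm \<alpha> \<beta> = far S (pr (r1 \<odot> \<alpha>') (r0 \<odot> \<beta>')) \<cdot> i"
      unfolding e(11) a'(5)[symmetric] by (rule gm_elements) (use a'(1,4) at' e(1-10) in simp_all)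
    have lhs: "GA.act (far S g, a) (GA.gm \<alpha> \<beta>) u = far S (pair Y (r1 \<odot> \<alpha>') (p2 Y \<odot> u')) \<cdot> i"
      unfolding gmab e(12)
      using ta[of u' "pr (r1 \<odot> \<alpha>') (r0 \<odot> \<beta>')" i] a'(1) at' e(1-10) g(1-5) by simp
    define v where "v = pair Y (r1 \<odot> \<beta>') (p2 Y \<odot> u')"
    have v: "v \<in> Ar D" "Dom D v = Dom D u'" "Cod D v = Dom D g" "g \<odot> v = r1 \<odot> \<beta>'" "p2 Y \<odot> v = p2 Y \<odot> u'"
      unfolding v_def using pc[of "r1 \<odot> \<beta>'" "p2 Y \<odot> u'"] e(1-10) g(1-5) by simp_all
    have "GA.act (far S g, a) \<beta> u = far S v \<cdot> i"
      unfolding e(11,12) v_def by (rule ta) (use e(1-10) in simp_all)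
    then have "GA.act (far S g, a) \<alpha> (GA.act (far S g, a) \<beta> u) = far S (pair Y (r1 \<odot> \<alpha>') (p2 Y \<odot> v)) \<cdot> i"
      using ta[of v \<alpha>' i] a'(1,4,5) at' v e(1-10) by simp
    then show "GA.act (far S g, a) (GA.gm \<alpha> \<beta>) u = GA.act (far S g, a) \<alpha> (GA.act (far S g, a) \<beta> u)"
      unfolding lhs v(5) by simp
  qed (use g(1,2) in \<open>simp_all add: Gpd_simps\<close>)
qed

lemma Theta_functor: "cat_functor D (gobj_cat C Gpd) Theta"
proof (rule cat_functorI[OF D.category_axioms GA.category_gobj])
  fix X assume X: "X \<in> Ob D"
  then show "fob Theta X \<in> Ob (gobj_cat C Gpd)" using Th_object by simp
  show "far Theta (idt D X) = idt (gobj_cat C Gpd) (fob Theta X)" using X by simp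
next
  fix f assume f: "f \<in> Ar D"
  let ?Y = "Dom D f" and ?Z = "Cod D f"
  have ob: "?Y \<in> Ob D" "?Z \<in> Ob D" using f by simp_all
  define k where "k = pair ?Z (p1 ?Y) (f \<odot> p2 ?Y)"
  have k: "k \<in> Ar D" "Dom D k = Dom D (p1 ?Y)" "Cod D k = Dom D (p1 ?Z)" "p1 ?Z \<odot> k = p1 ?Y" "p2 ?Z \<odot> k = f \<odot> p2 ?Y"
    using f by (simp_all add: k_def)
  have "(Th_ob ?Y, far S k, Th_ob ?Z) \<in> Ar (gobj_cat C Gpd)"
  proof (rule GA.gobj_ArI[OF Th_object[OF ob(1)] Th_object[OF ob(2)]])
    show "fst (Th_ob ?Z) \<cdot> far S k = fst (Th_ob ?Y)"
      using arg_cong[OF k(4), of "far S"] k(1-3) ob by simp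
    fix \<gamma> u assume h: "\<gamma> \<in> Ar C" "u \<in> Ar C" "Dom C \<gamma> = Dom C u" "Cod C \<gamma> = G1 Gpd" "Cod C u = Dom C (fst (Th_ob ?Y))"
      "d0 Gpd \<cdot> \<gamma> = fst (Th_ob ?Y) \<cdot> u"
    have pt: "p1 ?Y \<in> Ar D" "Cod D (p1 ?Y) = W" using ob by simp_all
    have h': "Cod C u = fob S (Dom D (p1 ?Y))" "d0 Gpd \<cdot> \<gamma> = far S (p1 ?Y) \<cdot> u" using h(5,6) pt by simp_all
    obtain \<gamma>' u' i where e: "u' \<in> Ar D" "Cod D u' = Dom D (p1 ?Y)" "\<gamma>' \<in> Ar D" "Cod D \<gamma>' = WW" "Dom D \<gamma>' = Dom D u'" "r0 \<odot> \<gamma>' = p1 ?Y \<odot> u'"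
      "i \<in> Ar C" "is_iso C i" "Dom C i = Dom C u" "Cod C i = fob S (Dom D u')" "\<gamma> = far S \<gamma>' \<cdot> i" "u = far S u' \<cdot> i"
      by (rule elements[OF pt h(1,4,2) h'(1) h(3) h'(2)])
    define v where "v = pair ?Y (r1 \<odot> \<gamma>') (p2 ?Y \<odot> u')"
    have v: "v \<in> Ar D" "Dom D v = Dom D u'" "Cod D v = Dom D (p1 ?Y)" "p1 ?Y \<odot> v = r1 \<odot> \<gamma>'" "p2 ?Y \<odot> v = p2 ?Y \<odot> u'"
      using e(1-10) ob by (simp_all add: v_def)
    have "k \<odot> v = pair ?Z (r1 \<odot> \<gamma>') (f \<odot> p2 ?Y \<odot> u')"
      unfolding k_def using D.prd_pair_comp[of W ?Z "p1 ?Y" "f \<odot> p2 ?Y" v] v f ob by simp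
    moreover have "p2 ?Z \<odot> k \<odot> u' = f \<odot> p2 ?Y \<odot> u'" "p1 ?Z \<odot> k \<odot> u' = p1 ?Y \<odot> u'"
      using D.reassoc[OF k(4), of u'] D.reassoc[OF k(5), of u'] k(1-3) e(1,2) f ob by simp_all
    ultimately have "GA.act (Th_ob ?Z) \<gamma> (far S (k \<odot> u') \<cdot> i) = far S (k \<odot> v) \<cdot> i"
      using Th_act[OF ob(2), of "k \<odot> u'" \<gamma>' i] e(1-10) k(1-3) by (simp add: e(11) del: SD.L.far_cmp)
    moreover have "GA.act (Th_ob ?Y) \<gamma> u = far S v \<cdot> i"
      unfolding e(11,12) v_def by (rule Th_act[OF ob(1)]) (use e(1-10) in simp_all)
    ultimately show "far S k \<cdot> GA.act (Th_ob ?Y) \<gamma> u = GA.act (Th_ob ?Z) \<gamma> (far S k \<cdot> u)"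
      using e(1,2,7,10) k(1-3) v(1-3) by (simp add: e(12))
  qed (use k(1-3) ob in simp_all)
  then show "far Theta f \<in> hom (gobj_cat C Gpd) (fob Theta ?Y) (fob Theta ?Z)" by (simp add: k_def)
next
  fix f g assume fg: "f \<in> Ar D" "g \<in> Ar D" "Dom D g = Cod D f"
  let ?X = "Dom D f" and ?Y = "Cod D f" and ?Z = "Cod D g"
  have "pair ?Z (p1 ?Y) (g \<odot> p2 ?Y) \<odot> pair ?Y (p1 ?X) (f \<odot> p2 ?X) = pair ?Z (p1 ?X) (g \<odot> f \<odot> p2 ?X)"
    using fg by (simp add: D.prd_pair_comp)
  from arg_cong[OF this, of "far S"]
  show "far Theta (g \<odot> f) = far Theta g \<cdot>\<^bsub>gobj_cat C Gpd\<^esub> far Theta f"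
    using fg by simp
qed

text \<open>An equivariant map lifts over \<open>W\<close> to \<open>k'\<close>, whose second
  coordinate is \<open>m\<close>. Equivariance at the generic pair makes \<open>m\<close>
  independent of the coordinate in \<open>W\<close>, so \<open>m\<close> descends along the
  projection to \<open>Y\<close>, a coequalizer by \<open>projection_coequalizer\<close>.\<close>

lemma Theta_full_faithful: "ff_functor D (gobj_cat C Gpd) Theta"
proof -
  interpret T: cat_functor D "gobj_cat C Gpd" Theta by (rule Theta_functor)
  show ?thesis
  proof
    fix Y Z c assume Y: "Y \<in> Ob D" and Z: "Z \<in> Ob D" and c: "c \<in> hom (gobj_cat C Gpd) (fob Theta Y) (fob Theta Z)"
    obtain k where k: "c = (Th_ob Y, k, Th_ob Z)" using c by (cases c) simp
    have ar: "(Th_ob Y, k, Th_ob Z) \<in> Ar (gobj_cat C Gpd)" using c by (simp add: k)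
    define V where "V = Dom D (p1 Y)"
    have V: "V \<in> Ob D" "Dom D (p1 Y) = V" using Y by (simp_all add: V_def)
    have pt: "p1 Y \<in> Ar D" "Cod D (p1 Y) = W" "p2 Y \<in> Ar D" "Dom D (p2 Y) = V" "Cod D (p2 Y) = Y" using Y V by simp_all
    have kt: "k \<in> Ar C" "Dom C k = fob S V" "Cod C k = fob S (Dom D (p1 Z))" "far S (p1 Z) \<cdot> k = far S (p1 Y)"
      using GA.gobj_ArD[OF ar] pt V Z by simp_all
    obtain k' where k': "k' \<in> hom D V (Dom D (p1 Z))" "p1 Z \<odot> k' = p1 Y" "far S k' = k"
      by (rule lift[of "p1 Y" V "p1 Z" "Dom D (p1 Z)" k]) (use kt pt V Z in simp_all)
    have kt': "k' \<in> Ar D" "Dom D k' = V" "Cod D k' = Dom D (p1 Z)" using k'(1) by simp_all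
    define m where "m = p2 Z \<odot> k'"
    have m: "m \<in> Ar D" "Dom D m = V" "Cod D m = Z" using kt' Z by (simp_all add: m_def)
    define q1 q2 where "q1 = p1 V" and "q2 = p2 V"
    have qt: "q1 \<in> Ar D" "Dom D q2 = Dom D q1" "Cod D q1 = W" "q2 \<in> Ar D" "Cod D q2 = V" using V by (simp_all add: q1_def q2_def)
    define b where "b = pair Y q1 (p2 Y \<odot> q2)"
    have b: "b \<in> Ar D" "Dom D b = Dom D q1" "Cod D b = V" "p1 Y \<odot> b = q1" using qt pt V Y by (simp_all add: b_def)
    \<comment> \<open>The generic instance: on triples \<open>(w, (w', y))\<close> this is the pair
      \<open>(w, w')\<close>, which moves \<open>(w', y)\<close> to \<open>(w, y)\<close>.\<close>
    define \<gamma> where "\<gamma> = pr q1 (p1 Y \<odot> q2)"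
    have \<gamma>: "\<gamma> \<in> Ar D" "Cod D \<gamma> = WW" "Dom D \<gamma> = Dom D q1" "r0 \<odot> \<gamma> = p1 Y \<odot> q2" "r1 \<odot> \<gamma> = q1"
      using qt pt V by (simp_all add: \<gamma>_def)
    have S\<gamma>: "far S r0 \<cdot> far S \<gamma> = far S (p1 Y) \<cdot> far S q2" using arg_cong[OF \<gamma>(4), of "far S"] \<gamma>(1-3) qt pt V by simp
    have "k \<cdot> GA.act (Th_ob Y) (far S \<gamma>) (far S q2) = GA.act (Th_ob Z) (far S \<gamma>) (k \<cdot> far S q2)"
      by (rule GA.equivariantD[OF ar]) (use \<gamma>(1-3) S\<gamma> qt pt V in \<open>simp_all add: Gpd_simps\<close>)
    moreover have "GA.act (Th_ob Y) (far S \<gamma>) (far S q2) = far S b"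
      using Th_act[OF Y, of q2 \<gamma> "idt C (fob S (Dom D q1))"] \<gamma> qt pt V Y b(1,2) by (simp add: b_def)
    moreover have kq: "p1 Z \<odot> k' \<odot> q2 = p1 Y \<odot> q2" "p2 Z \<odot> k' \<odot> q2 = m \<odot> q2"
      using D.reassoc[OF k'(2), of q2] kt' qt V Z by (simp_all add: m_def)
    have "GA.act (Th_ob Z) (far S \<gamma>) (k \<cdot> far S q2) = far S (pair Z q1 (m \<odot> q2))"
      using Th_act[OF Z, of "k' \<odot> q2" \<gamma> "idt C (fob S (Dom D q1))"] \<gamma> qt kt' kq k'(3) kt(1-3) m(1-3) Z by simp
    ultimately have "far S k' \<cdot> far S b = far S (pair Z q1 (m \<odot> q2))" using k'(3) by simp
    then have Skb: "far S (k' \<odot> b) = far S (pair Z q1 (m \<odot> q2))" using kt' b by simp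
    have "p1 Z \<odot> k' \<odot> b = q1" using D.reassoc[OF k'(2), of b] kt' b Z by simp
    then have kb: "k' \<odot> b = pair Z q1 (m \<odot> q2)"
      by - (rule lift_unique[of "p1 Z"], use Skb kt' b m qt Z in simp_all)
    have "m \<odot> q2 = m \<odot> b"
      using arg_cong[OF kb, of "\<lambda>x. p2 Z \<odot> x"] kt' b m(1-3) qt Z by (simp add: m_def)
    moreover have co: "coequalizer D q2 b (p2 Y)"
      using D.projection_coequalizer[OF W bk Y] by (simp add: V_def[symmetric] q1_def q2_def b_def)
    ultimately obtain n where n: "n \<in> hom D Y Z" "n \<odot> p2 Y = m"
      by - (rule coequalizerE[OF co, of m], use m qt pt in simp_all)
    have keq: "k' = pair Z (p1 Y) m"
      by (rule D.prd_eqI[of _ _ W Z]) (use kt' k'(2) m pt V Z in \<open>simp_all add: m_def\<close>)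
    show "\<exists>!f. f \<in> hom D Y Z \<and> far Theta f = c"
    proof (rule ex1I[of _ n])
      show "n \<in> hom D Y Z \<and> far Theta n = c" using n k'(3) by (simp add: k keq)
      fix f assume f: "f \<in> hom D Y Z \<and> far Theta f = c"
      then have ft: "f \<in> Ar D" "Dom D f = Y" "Cod D f = Z" and eq: "far S (pair Z (p1 Y) (f \<odot> p2 Y)) = far S k'"
        using k'(3) by (auto simp: k)
      have "pair Z (p1 Y) (f \<odot> p2 Y) = k'"
        by (rule lift_unique[of "p1 Z"]) (use eq ft kt' k'(2) pt V Z in simp_all)
      moreover have "p2 Z \<odot> pair Z (p1 Y) (f \<odot> p2 Y) = f \<odot> p2 Y" using ft pt V Z by simp
      ultimately have "f \<odot> p2 Y = m" by (simp add: m_def)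
      then have e: "f \<odot> p2 Y = n \<odot> p2 Y" using n(2) by simp
      show "f = n"
        by (rule D.coequalizer_epi[OF co _ _ _ _ _ _ _ _ e]) (use ft n(1) qt b pt in simp_all)
    qed
  qed
qed

text \<open>An action on \<open>f\<close> is carried along the cover \<open>i\<close> to one on
  \<open>far S g\<close>, and its value on the generic element lifts to a map \<open>b\<close> of
  \<open>D\<close>. Faithfulness of \<open>S\<close> over \<open>W\<close> turns the action laws of
  \<open>x\<close> into the laws of a codiscrete action, and descent makes the object over
  \<open>W\<close> a product with some \<open>Y\<close>.\<close>

lemma Theta_equivalence: "ff_eso_functor D (gobj_cat C Gpd) Theta"
proof -
  interpret T: ff_functor D "gobj_cat C Gpd" Theta by (rule Theta_full_faithful)
  show ?thesis
  proof
    fix x assume "x \<in> Ob (gobj_cat C Gpd)"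
    then have x: "is_gobject C Gpd x" by simp
    define f where "f = fst x"
    have f: "f \<in> Ar C" "Cod C f = fob S W" using GA.gobjectD[OF x] by (simp_all add: f_def Gpd_simps)
    obtain g i j where g: "g \<in> Ar D" "Cod D g = W" and i: "i \<in> hom C (Dom C f) (fob S (Dom D g))" and j: "j \<in> hom C (fob S (Dom D g)) (Dom C f)"
      and ji: "j \<cdot> i = idt C (Dom C f)" "i \<cdot> j = idt C (fob S (Dom D g))" and gi: "far S g \<cdot> i = f" and iso: "is_iso C i"
      by (rule cover[OF f])
    define V where "V = Dom D g"
    have V: "V \<in> Ob D" "Dom D g = V" using g by (simp_all add: V_def)
    have it: "i \<in> Ar C" "Dom C i = Dom C f" "Cod C i = fob S V" and jt: "j \<in> Ar C" "Dom C j = fob S V" "Cod C j = Dom C f"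
      using i j V by simp_all
    have ij: "i \<cdot> j \<cdot> y = y" if "y \<in> Ar C" "Cod C y = fob S V" for y
      using C.reassoc[OF ji(2), of y] that it jt V by simp
    have jiy: "j \<cdot> i \<cdot> y = y" if "y \<in> Ar C" "Cod C y = Dom C f" for y
      using C.reassoc[OF ji(1), of y] that it jt by simp
    have giy: "far S g \<cdot> i \<cdot> y = f \<cdot> y" if "y \<in> Ar C" "Cod C y = Dom C f" for y
      using C.reassoc[OF gi, of y] that it g V by simp
    have fjy: "f \<cdot> j \<cdot> y = far S g \<cdot> y" if "y \<in> Ar C" "Cod C y = fob S V" for y
      using giy[of "j \<cdot> y"] ij[OF that] that jt by simp
    define q1 q2 where "q1 = p1 V" and "q2 = p2 V"
    have qt: "q1 \<in> Ar D" "Dom D q2 = Dom D q1" "Cod D q1 = W" "q2 \<in> Ar D" "Cod D q2 = V" using V by (simp_all add: q1_def q2_def)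
    have S0: "far S r0 \<cdot> far S \<gamma> \<cdot> z = far S g \<cdot> far S u \<cdot> z"
      if "\<gamma> \<in> Ar D" "Cod D \<gamma> = WW" "u \<in> Ar D" "Cod D u = V" "Dom D \<gamma> = Dom D u" "r0 \<odot> \<gamma> = g \<odot> u" "z \<in> Ar C" "Cod C z = fob S (Dom D u)" for \<gamma> u z
      using arg_cong[OF that(6), of "\<lambda>x. far S x \<cdot> z"] that(1-5,7,8) g V by simp
    \<comment> \<open>The action of \<open>x\<close>, conjugated by the isomorphism \<open>i\<close>
      to act on elements of \<open>fob S V\<close>.\<close>
    define act' where "act' \<gamma> u = i \<cdot> GA.act x \<gamma> (j \<cdot> u)" for \<gamma> u
    have act': "act' (far S \<gamma> \<cdot> z) (far S u \<cdot> z) \<in> Ar C" "Dom C (act' (far S \<gamma> \<cdot> z) (far S u \<cdot> z)) = Dom C z"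
      "Cod C (act' (far S \<gamma> \<cdot> z) (far S u \<cdot> z)) = fob S V"
      "far S g \<cdot> act' (far S \<gamma> \<cdot> z) (far S u \<cdot> z) = far S r1 \<cdot> far S \<gamma> \<cdot> z"
      if "\<gamma> \<in> Ar D" "Cod D \<gamma> = WW" "u \<in> Ar D" "Cod D u = V" "Dom D \<gamma> = Dom D u" "r0 \<odot> \<gamma> = g \<odot> u" "z \<in> Ar C" "Cod C z = fob S (Dom D u)" for \<gamma> u z
    proof -
      let ?y = "GA.act x (far S \<gamma> \<cdot> z) (j \<cdot> far S u \<cdot> z)"
      have "d0 Gpd \<cdot> far S \<gamma> \<cdot> z = fst x \<cdot> j \<cdot> far S u \<cdot> z"
        using S0[OF that] fjy[of "far S u \<cdot> z"] that by (simp add: Gpd_simps f_def)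
      then have "?y \<in> Ar C" "Dom C ?y = Dom C z" "Cod C ?y = Dom C f" "f \<cdot> ?y = d1 Gpd \<cdot> far S \<gamma> \<cdot> z"
        using GA.act_simps[OF x, of "far S \<gamma> \<cdot> z" "j \<cdot> far S u \<cdot> z"] that jt by (simp_all add: Gpd_simps f_def)
      then show "act' (far S \<gamma> \<cdot> z) (far S u \<cdot> z) \<in> Ar C" "Dom C (act' (far S \<gamma> \<cdot> z) (far S u \<cdot> z)) = Dom C z"
        "Cod C (act' (far S \<gamma> \<cdot> z) (far S u \<cdot> z)) = fob S V"
        "far S g \<cdot> act' (far S \<gamma> \<cdot> z) (far S u \<cdot> z) = far S r1 \<cdot> far S \<gamma> \<cdot> z"
        using it giy[of ?y] by (simp_all add: act'_def Gpd_simps)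
    qed
    have jact': "j \<cdot> act' \<gamma> u = GA.act x \<gamma> (j \<cdot> u)" if "GA.act x \<gamma> (j \<cdot> u) \<in> Ar C" "Cod C (GA.act x \<gamma> (j \<cdot> u)) = Dom C f" for \<gamma> u
      using jiy[OF that] by (simp add: act'_def)
    \<comment> \<open>The generic element \<open>(w, g v)\<close>; every other compatible pair of
      \<gamma> and \<open>u\<close> factors through it by \<open>(r1 \<gamma>, u)\<close>, as
      \<open>star\<close> exploits.\<close>
    define \<gamma>0 where "\<gamma>0 = pr q1 (g \<odot> q2)"
    have \<gamma>0: "\<gamma>0 \<in> Ar D" "Cod D \<gamma>0 = WW" "Dom D \<gamma>0 = Dom D q1" "r0 \<odot> \<gamma>0 = g \<odot> q2" "r1 \<odot> \<gamma>0 = q1"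
      using qt g V by (simp_all add: \<gamma>0_def)
    have Sr1: "far S r1 \<cdot> far S \<gamma>0 = far S q1" using arg_cong[OF \<gamma>0(5), of "far S"] \<gamma>0(1-3) by simp
    note act0 = act'[of \<gamma>0 q2 "idt C (fob S (Dom D q1))"]
    have "act' (far S \<gamma>0) (far S q2) \<in> Ar C" "Dom C (act' (far S \<gamma>0) (far S q2)) = fob S (Dom D q1)"
      "Cod C (act' (far S \<gamma>0) (far S q2)) = fob S V" "far S g \<cdot> act' (far S \<gamma>0) (far S q2) = far S q1"
      using act0 \<gamma>0 qt Sr1 by simp_all
    then obtain b where b: "b \<in> hom D (Dom D q1) V" "g \<odot> b = q1" and Sb: "far S b = act' (far S \<gamma>0) (far S q2)"
      by - (rule lift[of q1 "Dom D q1" g V "act' (far S \<gamma>0) (far S q2)"], use qt g V in simp_all)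
    have bt: "b \<in> Ar D" "Dom D b = Dom D q1" "Cod D b = V" using b(1) by simp_all
    have pt: "pair V w u \<in> Ar D" "Dom D (pair V w u) = Dom D u" "Cod D (pair V w u) = Dom D q1" "q1 \<odot> pair V w u = w" "q2 \<odot> pair V w u = u"
      if "w \<in> Ar D" "Cod D w = W" "u \<in> Ar D" "Cod D u = V" "Dom D w = Dom D u" for w u
      using that V by (simp_all add: q1_def q2_def)
    have star: "act' (far S \<gamma> \<cdot> z) (far S u \<cdot> z) = far S (b \<odot> pair V (r1 \<odot> \<gamma>) u) \<cdot> z"
      if h: "\<gamma> \<in> Ar D" "Cod D \<gamma> = WW" "u \<in> Ar D" "Cod D u = V" "Dom D \<gamma> = Dom D u" "r0 \<odot> \<gamma> = g \<odot> u" and z: "z \<in> Ar C" "Cod C z = fob S (Dom D u)" for \<gamma> u z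
    proof -
      define v where "v = pair V (r1 \<odot> \<gamma>) u"
      have v: "v \<in> Ar D" "Dom D v = Dom D u" "Cod D v = Dom D q1" "q1 \<odot> v = r1 \<odot> \<gamma>" "q2 \<odot> v = u"
        using pt[of "r1 \<odot> \<gamma>" u] h by (simp_all add: v_def)
      have "\<gamma>0 \<odot> v = pr (r1 \<odot> \<gamma>) (r0 \<odot> \<gamma>)"
        unfolding \<gamma>0_def using pr_comp[of q1 "g \<odot> q2" v] v qt g V h by simp
      also have "\<dots> = \<gamma>" by (rule pr_eqI) (use h(1,2) in simp_all)
      finally have \<gamma>v: "\<gamma>0 \<odot> v = \<gamma>" .
      have e1: "far S \<gamma>0 \<cdot> far S v = far S \<gamma>" "far S q2 \<cdot> far S v = far S u"
        using arg_cong[OF \<gamma>v, of "far S"] arg_cong[OF v(5), of "far S"] \<gamma>0(1-3) v(1-3) qt by simp_all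
      have e2: "far S \<gamma>0 \<cdot> far S v \<cdot> z = far S \<gamma> \<cdot> z" "far S q2 \<cdot> far S v \<cdot> z = far S u \<cdot> z"
        using C.reassoc[OF e1(1), of z] C.reassoc[OF e1(2), of z] \<gamma>0(1-3) v(1-3) qt z by simp_all
      have c0: "d0 Gpd \<cdot> far S \<gamma>0 = fst x \<cdot> j \<cdot> far S q2"
        using S0[of \<gamma>0 q2 "idt C (fob S (Dom D q1))"] fjy[of "far S q2"] \<gamma>0 qt by (simp add: Gpd_simps f_def)
      have at: "GA.act x (far S \<gamma>0) (j \<cdot> far S q2) \<in> Ar C" "Dom C (GA.act x (far S \<gamma>0) (j \<cdot> far S q2)) = fob S (Dom D q1)"
        "Cod C (GA.act x (far S \<gamma>0) (j \<cdot> far S q2)) = Dom C f"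
        using GA.act_simps[OF x, of "far S \<gamma>0" "j \<cdot> far S q2"] c0 \<gamma>0(1-3) qt jt by (simp_all add: Gpd_simps f_def)
      have "GA.act x (far S \<gamma>0) (j \<cdot> far S q2) \<cdot> far S v \<cdot> z = GA.act x (far S \<gamma> \<cdot> z) (j \<cdot> far S u \<cdot> z)"
        using GA.act_comp[OF x, of "far S \<gamma>0" "j \<cdot> far S q2" "far S v \<cdot> z"] c0 \<gamma>0(1-3) qt jt v(1-3) z e2
        by (simp add: Gpd_simps f_def)
      then have "far S b \<cdot> far S v \<cdot> z = act' (far S \<gamma> \<cdot> z) (far S u \<cdot> z)"
        unfolding Sb act'_def using at it v(1-3) z by simp
      then show ?thesis using bt v(1-3) z by (simp add: v_def)
    qed
    have star': "act' (far S \<gamma>) (far S u) = far S (b \<odot> pair V (r1 \<odot> \<gamma>) u)"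
      if h: "\<gamma> \<in> Ar D" "Cod D \<gamma> = WW" "u \<in> Ar D" "Cod D u = V" "Dom D \<gamma> = Dom D u" "r0 \<odot> \<gamma> = g \<odot> u" for \<gamma> u
      using star[OF h, of "idt C (fob S (Dom D u))"] h pt[of "r1 \<odot> \<gamma>" u] bt by simp
    have b_unit: "b \<odot> pair V g (idt D V) = idt D V"
    proof (rule lift_unique[OF g])
      have pg: "pr g g \<in> Ar D" "Cod D (pr g g) = WW" "Dom D (pr g g) = V" "r0 \<odot> pr g g = g" "r1 \<odot> pr g g = g" using g V by simp_all
      have "pr (idt D W) (idt D W) \<odot> g = pr g g" using pr_comp[of "idt D W" "idt D W" g] g by simp
      from arg_cong[OF this, of "far S"] have "gunit Gpd \<cdot> far S g = far S (pr g g)" using g by (simp add: Gpd_simps)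
      moreover have "fst x \<cdot> j = far S g" using fjy[of "idt C (fob S V)"] jt g V by (simp add: f_def)
      ultimately have "act' (far S (pr g g)) (far S (idt D V)) = idt C (fob S V)"
        using GA.act_unit[OF x, of j] jt V ji(2) by (simp add: act'_def f_def)
      then show "far S (b \<odot> pair V g (idt D V)) = far S (idt D V)"
        using star'[of "pr g g" "idt D V"] pg g V by simp
      show "g \<odot> b \<odot> pair V g (idt D V) = g \<odot> idt D V"
        using D.reassoc[OF b(2), of "pair V g (idt D V)"] pt[of g "idt D V"] bt g V by simp
    qed (use pt[of g "idt D V"] bt g V in simp_all)
    define VV where "VV = Dom D q1"
    have VV: "VV \<in> Ob D" "Dom D q1 = VV" using qt by (simp_all add: VV_def)
    have b_assoc: "b \<odot> pair V (p1 VV) (b \<odot> p2 VV) = b \<odot> pair V (p1 VV) (q2 \<odot> p2 VV)"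
    proof (rule lift_unique[OF g])
      define w1 w0 v where "w1 = p1 VV" and "w0 = q1 \<odot> p2 VV" and "v = q2 \<odot> p2 VV"
      define Z where "Z = Dom D (p1 VV)"
      have wt: "w1 \<in> Ar D" "Dom D w1 = Z" "Cod D w1 = W" "w0 \<in> Ar D" "Dom D w0 = Z" "Cod D w0 = W" "v \<in> Ar D" "Dom D v = Z" "Cod D v = V"
        "Z \<in> Ob D"
        using qt VV by (simp_all add: w1_def w0_def v_def Z_def)
      have p2VV: "p2 VV = pair V w0 v"
        by (rule D.prd_eqI[of _ _ W V]) (use V VV qt in \<open>simp_all add: w0_def v_def q1_def q2_def\<close>)
      define u where "u = b \<odot> pair V w0 v"
      have u: "u \<in> Ar D" "Dom D u = Z" "Cod D u = V" "g \<odot> u = w0"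
        using pt[of w0 v] wt bt D.reassoc[OF b(2), of "pair V w0 v"] g V by (simp_all add: u_def)
      have gv: "g \<odot> v \<in> Ar D" "Dom D (g \<odot> v) = Z" "Cod D (g \<odot> v) = W" using g V wt by simp_all
      \<comment> \<open>In elements the points of \<open>W\<close> are \<open>w1\<close>,
        \<open>w0\<close> and \<open>g v\<close>, and associativity of the action at
        \<open>a = (w1, w0)\<close> and \<open>c = (w0, g v)\<close> yields
        \<open>w1 (w0 v) = w1 v\<close>.\<close>
      define a c where "a = pr w1 w0" and "c = pr w0 (g \<odot> v)"
      have ac: "a \<in> Ar D" "Dom D a = Z" "Cod D a = WW" "r1 \<odot> a = w1" "r0 \<odot> a = w0"
        "c \<in> Ar D" "Dom D c = Z" "Cod D c = WW" "r1 \<odot> c = w0" "r0 \<odot> c = g \<odot> v"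
        using wt gv by (simp_all add: a_def c_def)
      have S1: "d0 Gpd \<cdot> far S a = d1 Gpd \<cdot> far S c"
        using SD.L.far_cmp[of r0 a] SD.L.far_cmp[of r1 c] ac by (simp add: Gpd_simps)
      have S2: "d0 Gpd \<cdot> far S c = fst x \<cdot> j \<cdot> far S v"
        using S0[of c v "idt C (fob S Z)"] fjy[of "far S v"] ac wt by (simp add: Gpd_simps f_def)
      have S3: "d0 Gpd \<cdot> far S a = fst x \<cdot> j \<cdot> far S u"
        using S0[of a u "idt C (fob S Z)"] fjy[of "far S u"] ac u wt(10) by (simp add: Gpd_simps f_def)
      have Su: "far S u = act' (far S c) (far S v)" using star'[of c v] ac wt by (simp add: u_def)
      have act_v: "GA.act x (far S c) (j \<cdot> far S v) \<in> Ar C" "Cod C (GA.act x (far S c) (j \<cdot> far S v)) = Dom C f"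
        using GA.act_simps[OF x, of "far S c" "j \<cdot> far S v"] S2 ac wt jt by (simp_all add: Gpd_simps f_def)
      have gmac: "GA.gm (far S a) (far S c) = far S (pr w1 (g \<odot> v))"
        using gm_elements[of a c "idt C (fob S Z)"] ac wt gv by simp
      have "GA.act x (GA.gm (far S a) (far S c)) (j \<cdot> far S v) = GA.act x (far S a) (GA.act x (far S c) (j \<cdot> far S v))"
        by (rule GA.act_assoc[OF x, where Z = "fob S Z"]) (use S1 S2 ac wt jt in \<open>simp_all add: Gpd_simps f_def\<close>)
      also have "\<dots> = GA.act x (far S a) (j \<cdot> far S u)" unfolding Su using jact'[OF act_v] by simp
      finally have "act' (far S (pr w1 (g \<odot> v))) (far S v) = act' (far S a) (far S u)"
        unfolding gmac by (simp add: act'_def)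
      moreover have "act' (far S (pr w1 (g \<odot> v))) (far S v) = far S (b \<odot> pair V w1 v)"
        using star'[of "pr w1 (g \<odot> v)" v] wt gv by simp
      moreover have "act' (far S a) (far S u) = far S (b \<odot> pair V w1 u)"
        using star'[of a u] ac u by simp
      ultimately have "far S (b \<odot> pair V w1 u) = far S (b \<odot> pair V w1 v)" by simp
      moreover have "b \<odot> p2 VV = u" unfolding u_def p2VV ..
      ultimately show "far S (b \<odot> pair V (p1 VV) (b \<odot> p2 VV)) = far S (b \<odot> pair V (p1 VV) (q2 \<odot> p2 VV))"
        by (simp only: w1_def[symmetric] v_def[symmetric])
      have "g \<odot> b \<odot> pair V w1 y = w1" if "y \<in> Ar D" "Dom D y = Z" "Cod D y = V" for y
        using D.reassoc[OF b(2), of "pair V w1 y"] pt[of w1 y] that bt g V wt by simp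
      then show "g \<odot> b \<odot> pair V (p1 VV) (b \<odot> p2 VV) = g \<odot> b \<odot> pair V (p1 VV) (q2 \<odot> p2 VV)"
        using bt qt VV by (simp add: w1_def Z_def)
    qed (use pt[of "p1 VV" "b \<odot> p2 VV"] pt[of "p1 VV" "q2 \<odot> p2 VV"] bt qt g V VV in simp_all)
    obtain Y c where Y: "Y \<in> Ob D" and c: "c \<in> hom D V Y" "coequalizer D q2 b c" "is_iso D (pair Y g c)"
    proof (rule D.codiscrete_action_descends[OF W bk, of g V b])
      show "b \<odot> pair V (p1 (Dom D (p1 V))) (b \<odot> p2 (Dom D (p1 V))) =
          b \<odot> pair V (p1 (Dom D (p1 V))) (p2 V \<odot> p2 (Dom D (p1 V)))"
        using b_assoc unfolding VV_def q1_def q2_def .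
    qed (use g V bt b(2) b_unit q1_def q2_def in simp_all)
    have ct: "c \<in> Ar D" "Dom D c = V" "Cod D c = Y" "c \<odot> b = c \<odot> q2" using c by (simp_all add: coequalizer_def)
    define l where "l = pair Y g c"
    have l: "l \<in> Ar D" "Dom D l = V" "Cod D l = Dom D (p1 Y)" "p1 Y \<odot> l = g" "p2 Y \<odot> l = c" using g ct V Y by (simp_all add: l_def)
    have Sl: "far S (p1 Y) \<cdot> far S l = far S g" using arg_cong[OF l(4), of "far S"] l(1-3) Y by simp
    have ar: "(x, far S l \<cdot> i, Th_ob Y) \<in> Ar (gobj_cat C Gpd)"
    proof (rule GA.gobj_ArI[OF x Th_object[OF Y]])
      show "fst (Th_ob Y) \<cdot> far S l \<cdot> i = fst x"
        using C.reassoc[OF Sl, of i] l(1-3) Y it gi by (simp add: f_def)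
      fix \<gamma> u assume h: "\<gamma> \<in> Ar C" "u \<in> Ar C" "Dom C \<gamma> = Dom C u" "Cod C \<gamma> = G1 Gpd" "Cod C u = Dom C (fst x)" "d0 Gpd \<cdot> \<gamma> = fst x \<cdot> u"
      have h': "i \<cdot> u \<in> Ar C" "Cod C (i \<cdot> u) = fob S (Dom D g)" "Dom C \<gamma> = Dom C (i \<cdot> u)"
          "d0 Gpd \<cdot> \<gamma> = far S g \<cdot> i \<cdot> u"
        using h(2,3,5,6) it V giy[of u] by (simp_all add: f_def)
      obtain \<gamma>' u' z where e: "u' \<in> Ar D" "Cod D u' = Dom D g" "\<gamma>' \<in> Ar D" "Cod D \<gamma>' = WW" "Dom D \<gamma>' = Dom D u'" "r0 \<odot> \<gamma>' = g \<odot> u'"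
        "z \<in> Ar C" "is_iso C z" "Dom C z = Dom C (i \<cdot> u)" "Cod C z = fob S (Dom D u')" "\<gamma> = far S \<gamma>' \<cdot> z" "i \<cdot> u = far S u' \<cdot> z"
        by (rule elements[OF g h(1,4) h'])
      have u: "u = j \<cdot> far S u' \<cdot> z" using jiy[of u] h by (simp add: e(12) f_def)
      have acty: "GA.act x \<gamma> u \<in> Ar C" "Cod C (GA.act x \<gamma> u) = Dom C f" using GA.act_simps[OF x, of \<gamma> u] h by (simp_all add: f_def)
      have "i \<cdot> GA.act x \<gamma> u = act' \<gamma> (far S u' \<cdot> z)" by (simp add: act'_def u)
      also have "\<dots> = far S (b \<odot> pair V (r1 \<odot> \<gamma>') u') \<cdot> z"
        unfolding e(11) by (rule star) (use e(1-10) V in simp_all)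
      finally have ia: "i \<cdot> GA.act x \<gamma> u = far S (b \<odot> pair V (r1 \<odot> \<gamma>') u') \<cdot> z" .
      define y where "y = pair V (r1 \<odot> \<gamma>') u'"
      have y: "y \<in> Ar D" "Dom D y = Dom D u'" "Cod D y = Dom D q1" "q1 \<odot> y = r1 \<odot> \<gamma>'" "q2 \<odot> y = u'"
        using pt[of "r1 \<odot> \<gamma>'" u'] e(1-10) V by (simp_all add: y_def)
      have gby: "g \<odot> b \<odot> y = r1 \<odot> \<gamma>'" using D.reassoc[OF b(2), of y] y bt g V by simp
      have cby: "c \<odot> b \<odot> y = c \<odot> u'" using D.reassoc[OF ct(4), of y] y bt ct(1-3) qt by simp
      have lby: "l \<odot> b \<odot> y = pair Y (r1 \<odot> \<gamma>') (c \<odot> u')"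
        unfolding l_def using D.prd_pair_comp[of W Y g c "b \<odot> y"] gby cby y(1-3) bt ct(1-3) g V Y by simp
      have lu: "p1 Y \<odot> l \<odot> u' = g \<odot> u'" "p2 Y \<odot> l \<odot> u' = c \<odot> u'"
        using D.reassoc[OF l(4), of u'] D.reassoc[OF l(5), of u'] l(1-3) e(1,2) V Y by simp_all
      have "far S l \<cdot> i \<cdot> GA.act x \<gamma> u = far S (l \<odot> b \<odot> y) \<cdot> z"
        unfolding ia y_def[symmetric] using l(1-3) bt y(1-3) e(7,10) by simp
      also have "\<dots> = GA.act (Th_ob Y) \<gamma> (far S (l \<odot> u') \<cdot> z)"
        unfolding e(11) lby using Th_act[OF Y, of "l \<odot> u'" \<gamma>' z] lu e(1-10) l(1-3) V by (simp del: SD.L.far_cmp)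
      also have "far S (l \<odot> u') \<cdot> z = far S l \<cdot> i \<cdot> u"
        using l(1-3) e(1,2,7,10) V by (simp add: e(12))
      finally show "(far S l \<cdot> i) \<cdot> GA.act x \<gamma> u = GA.act (Th_ob Y) \<gamma> ((far S l \<cdot> i) \<cdot> u)"
        using l(1-3) it acty h by (simp add: f_def)
    qed (use l(1-3) it Y in \<open>simp_all add: f_def\<close>)
    have "is_iso C (far S l \<cdot> i)"
      by (rule C.iso_comp[OF SD.L.far_iso iso]) (use c(3) l(1-3) it in \<open>simp_all add: l_def[symmetric]\<close>)
    then have "is_iso (gobj_cat C Gpd) (x, far S l \<cdot> i, Th_ob Y)" by (rule GA.gobj_iso[OF ar])
    with ar Y show "\<exists>Y \<in> Ob D. \<exists>i \<in> hom (gobj_cat C Gpd) x (fob Theta Y). is_iso (gobj_cat C Gpd) i"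
      by (intro bexI[of _ Y] bexI[of _ "(x, far S l \<cdot> i, Th_ob Y)"]) simp_all
  qed
qed

text \<open>The comparison \<open>ph X\<close> from the image of \<open>W x Dst X\<close> to the
  product of \<open>fob S W\<close> and \<open>X\<close> is invertible because a pair of
  \<open>z\<close> and \<open>y\<close> in \<open>C\<close> lifts to \<open>D\<close>:
  \<open>z\<close> is covered by \<open>w\<close>, and \<open>y\<close> is transposed to a map into
  \<open>fob Dst X\<close>. In these coordinates both actions change only the point of
  \<open>W\<close>.\<close>

lemma Theta_Dstar: "naturally_isomorphic C (gobj_cat C Gpd) (Theta \<circ>\<^sub>F Dst) (gstar C Gpd)"
proof -
  define ph where "ph X = prd_pair C (fob S W) X (far S (p1 (fob Dst X))) (epsD X \<cdot> far S (p2 (fob Dst X)))" for X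
  have ph: "ph X \<in> Ar C" "Dom C (ph X) = fob S (Dom D (p1 (fob Dst X)))" "Cod C (ph X) = Dom C (prd1 C (fob S W) X)"
    "prd1 C (fob S W) X \<cdot> ph X = far S (p1 (fob Dst X))" "prd2 C (fob S W) X \<cdot> ph X = epsD X \<cdot> far S (p2 (fob Dst X))"
    if "X \<in> Ob C" for X
    using that by (simp_all add: ph_def)
  have ar: "(Th_ob (fob Dst X), ph X, gstar_ob C Gpd X) \<in> Ar (gobj_cat C Gpd)" if X: "X \<in> Ob C" for X
  proof (rule GA.gobj_ArI[OF Th_object GA.gstar_object[OF X]])
    have Y: "fob Dst X \<in> Ob D" using X by simp
    fix \<gamma> u assume h: "\<gamma> \<in> Ar C" "u \<in> Ar C" "Dom C \<gamma> = Dom C u" "Cod C \<gamma> = G1 Gpd" "Cod C u = Dom C (fst (Th_ob (fob Dst X)))"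
      "d0 Gpd \<cdot> \<gamma> = fst (Th_ob (fob Dst X)) \<cdot> u"
    let ?Y = "fob Dst X"
    have pt: "p1 ?Y \<in> Ar D" "Cod D (p1 ?Y) = W" using Y by simp_all
    have h': "Cod C u = fob S (Dom D (p1 ?Y))" "d0 Gpd \<cdot> \<gamma> = far S (p1 ?Y) \<cdot> u" using h(5,6) pt by simp_all
    obtain \<gamma>' u' i where e: "u' \<in> Ar D" "Cod D u' = Dom D (p1 ?Y)" "\<gamma>' \<in> Ar D" "Cod D \<gamma>' = WW" "Dom D \<gamma>' = Dom D u'" "r0 \<odot> \<gamma>' = p1 ?Y \<odot> u'"
      "i \<in> Ar C" "is_iso C i" "Dom C i = Dom C u" "Cod C i = fob S (Dom D u')" "\<gamma> = far S \<gamma>' \<cdot> i" "u = far S u' \<cdot> i"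
      by (rule elements[OF pt h(1,4,2) h'(1) h(3) h'(2)])
    have a: "GA.act (Th_ob ?Y) \<gamma> u = far S (pair ?Y (r1 \<odot> \<gamma>') (p2 ?Y \<odot> u')) \<cdot> i"
      unfolding e(11,12) by (rule Th_act[OF Y]) (use e(1-10) in simp_all)
    have phy: "prd1 C (fob S W) X \<cdot> ph X \<cdot> y = far S (p1 ?Y) \<cdot> y"
      "prd2 C (fob S W) X \<cdot> ph X \<cdot> y = epsD X \<cdot> far S (p2 ?Y) \<cdot> y"
      if "y \<in> Ar C" "Cod C y = fob S (Dom D (p1 ?Y))" for y
      using C.reassoc[OF ph(4)[OF X], of y] C.reassoc[OF ph(5)[OF X], of y] ph(1-3)[OF X] that X by simp_all
    have g: "GA.act (gstar_ob C Gpd X) \<gamma> (ph X \<cdot> u) =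
       prd_pair C (fob S W) X (d1 Gpd \<cdot> \<gamma>) (prd2 C (fob S W) X \<cdot> ph X \<cdot> u)"
      using GA.gstar_act[OF X, of \<gamma> "ph X \<cdot> u"] h ph(1-3)[OF X] phy[of u] Y by (simp add: Gpd_simps)
    show "ph X \<cdot> GA.act (Th_ob ?Y) \<gamma> u = GA.act (gstar_ob C Gpd X) \<gamma> (ph X \<cdot> u)"
      unfolding g a
      by (rule C.prd_eqI[of _ _ "fob S W" X])
        (use phy[of "far S (pair ?Y (r1 \<odot> \<gamma>') (p2 ?Y \<odot> u')) \<cdot> i"] phy[of u] e(1-10) ph(1-3)[OF X] X Y
          in \<open>simp_all add: Gpd_simps e(11,12)\<close>)
  qed (use that ph in \<open>simp_all add: Gpd_simps\<close>)
  have iso: "is_iso C (ph X)" if X: "X \<in> Ob C" for X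
  proof -
    let ?Y = "fob Dst X"
    have Y: "?Y \<in> Ob D" using X by simp
    have pt: "p1 ?Y \<in> Ar D" "Cod D (p1 ?Y) = W" "p2 ?Y \<in> Ar D" "Dom D (p2 ?Y) = Dom D (p1 ?Y)" "Cod D (p2 ?Y) = ?Y" using Y by simp_all
    have "is_product C (fob S W) X (far S (p1 ?Y)) (epsD X \<cdot> far S (p2 ?Y))"
      unfolding is_product_def
    proof (intro conjI allI ballI)
      fix Z z y assume z: "z \<in> hom C Z (fob S W)" and y: "y \<in> hom C Z X"
      have zt: "z \<in> Ar C" "Dom C z = Z" "Cod C z = fob S W" "y \<in> Ar C" "Dom C y = Z" "Cod C y = X" using z y by simp_all
      obtain w i j where w: "w \<in> Ar D" "Cod D w = W" and i: "i \<in> hom C Z (fob S (Dom D w))" and j: "j \<in> hom C (fob S (Dom D w)) Z"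
        and ji: "j \<cdot> i = idt C Z" and wi: "far S w \<cdot> i = z" and isoi: "is_iso C i"
        using cover[of z] zt by metis
      have it: "i \<in> Ar C" "Dom C i = Z" "Cod C i = fob S (Dom D w)" using i by simp_all
      obtain x where x: "x \<in> hom D (Dom D w) ?Y" "epsD X \<cdot> far S x = y \<cdot> j"
        by (rule SD.counit_existence[of "Dom D w" "y \<cdot> j" X]) (use w zt j in simp_all)
      have xt: "x \<in> Ar D" "Dom D x = Dom D w" "Cod D x = ?Y" using x by simp_all
      have xi: "epsD X \<cdot> far S x \<cdot> i = y" using C.reassoc[OF x(2), of i] xt it zt j ji X by simp
      define h where "h = pair ?Y w x"
      have h: "h \<in> Ar D" "Dom D h = Dom D w" "Cod D h = Dom D (p1 ?Y)" using w xt Y by (simp_all add: h_def)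
      show "\<exists>!h. h \<in> hom C Z (Dom C (far S (p1 ?Y))) \<and> far S (p1 ?Y) \<cdot> h = z \<and> (epsD X \<cdot> far S (p2 ?Y)) \<cdot> h = y"
      proof (rule ex1I[of _ "far S h \<cdot> i"])
        show "far S h \<cdot> i \<in> hom C Z (Dom C (far S (p1 ?Y))) \<and> far S (p1 ?Y) \<cdot> far S h \<cdot> i = z \<and>
            (epsD X \<cdot> far S (p2 ?Y)) \<cdot> far S h \<cdot> i = y"
          using pair_reassoc[of ?Y w x i] h it w xt xi wi pt X Y by (simp add: h_def)
        fix k assume k0: "k \<in> hom C Z (Dom C (far S (p1 ?Y))) \<and> far S (p1 ?Y) \<cdot> k = z \<and> (epsD X \<cdot> far S (p2 ?Y)) \<cdot> k = y"
        have kt: "k \<in> Ar C" "Dom C k = Z" "Cod C k = fob S (Dom D (p1 ?Y))" using k0 pt by simp_all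
        have "(epsD X \<cdot> far S (p2 ?Y)) \<cdot> k = epsD X \<cdot> far S (p2 ?Y) \<cdot> k" using kt pt X by simp
        with k0 kt have k: "k \<in> Ar C" "Dom C k = Z" "Cod C k = fob S (Dom D (p1 ?Y))" "far S (p1 ?Y) \<cdot> k = z" "epsD X \<cdot> far S (p2 ?Y) \<cdot> k = y"
          by simp_all
        obtain m where m: "m \<in> Ar D" "Dom D m = Dom D w" "Cod D m = Dom D (p1 ?Y)" "p1 ?Y \<odot> m = w" "far S m \<cdot> i = k"
          by (rule element[OF pt(1,2) w it(1) isoi it(3), of k]) (use k it wi in simp_all)
        have "(epsD X \<cdot> far S (p2 ?Y \<odot> m)) \<cdot> i = (epsD X \<cdot> far S x) \<cdot> i"
          using k(5) m xi xt it pt X by simp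
        then have "epsD X \<cdot> far S (p2 ?Y \<odot> m) = epsD X \<cdot> far S x"
          by - (rule C.iso_cancel_right[OF isoi], use m(1-3) xt it pt X in simp_all)
        then have "p2 ?Y \<odot> m = x"
          by - (rule SD.counit_uniqueness[where Y = X], use m(1-3) xt pt X in simp_all)
        then have "m = h"
          by - (rule D.prd_eqI[of _ _ W ?Y], use m h w xt Y in \<open>simp_all add: h_def\<close>)
        then show "k = far S h \<cdot> i" using m(5) by simp
      qed
    qed (use pt X in simp_all)
    then show ?thesis
      using C.product_comparison_iso_iff[OF C.chosen_product[of "fob S W" X], of "ph X"] ph[OF X] X by simp
  qed
  show ?thesis
  proof (rule naturally_isomorphicI[of _ _ _ _ "\<lambda>X. (Th_ob (fob Dst X), ph X, gstar_ob C Gpd X)"])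
    show "cat_functor C (gobj_cat C Gpd) (Theta \<circ>\<^sub>F Dst)" by (rule comp_functor[OF SD.R.cat_functor_axioms Theta_functor])
    show "cat_functor C (gobj_cat C Gpd) (gstar C Gpd)" by (rule GA.gstar_functor)
    show "(Th_ob (fob Dst X), ph X, gstar_ob C Gpd X) \<in> hom (gobj_cat C Gpd) (fob (Theta \<circ>\<^sub>F Dst) X) (fob (gstar C Gpd) X)"
      if "X \<in> Ob C" for X using ar[OF that] by (simp add: gstar_def)
    show "is_iso (gobj_cat C Gpd) (Th_ob (fob Dst X), ph X, gstar_ob C Gpd X)" if "X \<in> Ob C" for X
      using GA.gobj_iso[OF ar[OF that] iso[OF that]] .
  next
    fix f assume f: "f \<in> Ar C"
    let ?X = "Dom C f" and ?X' = "Cod C f"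
    let ?Y = "fob Dst ?X" and ?Y' = "fob Dst ?X'"
    have ob: "?X \<in> Ob C" "?X' \<in> Ob C" "?Y \<in> Ob D" "?Y' \<in> Ob D" using f by simp_all
    define k where "k = pair ?Y' (p1 ?Y) (far Dst f \<odot> p2 ?Y)"
    have k: "k \<in> Ar D" "Dom D k = Dom D (p1 ?Y)" "Cod D k = Dom D (p1 ?Y')" using f by (simp_all add: k_def)
    have Sk: "far S (p1 ?Y') \<cdot> far S k = far S (p1 ?Y)" "far S (p2 ?Y') \<cdot> far S k = far S (far Dst f) \<cdot> far S (p2 ?Y)"
      using pair_simps[of ?Y' "p1 ?Y" "far Dst f \<odot> p2 ?Y"] f by (simp_all add: k_def)
    have en: "epsD ?X' \<cdot> far S (far Dst f) \<cdot> far S (p2 ?Y) = f \<cdot> epsD ?X \<cdot> far S (p2 ?Y)"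
      using C.reassoc[OF SD.counit_nat[OF f], of "far S (p2 ?Y)"] f by simp
    have "ph ?X' \<cdot> far S k = prd_pair C (fob S W) ?X' (far S (p1 ?Y)) (f \<cdot> epsD ?X \<cdot> far S (p2 ?Y))"
      unfolding ph_def using C.prd_pair_comp[of "fob S W" ?X' "far S (p1 ?Y')" "epsD ?X' \<cdot> far S (p2 ?Y')" "far S k"] k Sk en f ob by simp
    also have "\<dots> = prd_map C (idt C (fob S W)) f \<cdot> ph ?X"
      unfolding ph_def using C.prd_map_pair[of "idt C (fob S W)" f "far S (p1 ?Y)" "epsD ?X \<cdot> far S (p2 ?Y)"] f ob by simp
    finally show "(Th_ob ?Y', ph ?X', gstar_ob C Gpd ?X') \<cdot>\<^bsub>gobj_cat C Gpd\<^esub> far (Theta \<circ>\<^sub>F Dst) f =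
        far (gstar C Gpd) f \<cdot>\<^bsub>gobj_cat C Gpd\<^esub> (Th_ob ?Y, ph ?X, gstar_ob C Gpd ?X)"
      using f by (simp add: gstar_def k_def Gpd_simps)
  qed
qed

end

proposition effective_descent_imp_groupoid:
  fixes C :: "('o, 'a) cat" and D :: "('p, 'b) cat"
  assumes "finite_limits C" "finite_limits D" and SD: "adjunction D C S Dst etaD epsD" and W: "W \<in> Ob D"
    and ed: "effective_descent D (bang D W)"
    and eq: "equivalence_functor (slice D W) (slice C (fob S W)) (slice_functor S)"
  shows "\<exists>G \<Theta>. internal_groupoid C G \<and> equivalence_functor D (gobj_cat C G) \<Theta> \<and>
    naturally_isomorphic C (gobj_cat C G) (\<Theta> \<circ>\<^sub>F Dst) (gstar C G)"
proof -
  interpret C: finite_limits C by fact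
  interpret D: finite_limits D by fact
  have "beck (slice D (terminal_ob D)) (slice D W) (pullback_functor D (bang D W))"
    using ed W unfolding effective_descent_def monadic_iff_beck by simp
  then have "beck D (slice D W) (D.times W)" by (rule D.times_beck[OF W])
  then interpret descent_situation C D S Dst etaD epsD W
    by (intro descent_situation.intro descent_situation_axioms.intro assms(1,2) SD equivalence_ff_eso[OF eq] W)
  show ?thesis
    using internal_groupoid ff_eso_functor.is_equivalence[OF Theta_equivalence] Theta_Dstar by blast
qed

section \<open>The forgetful functor of groupoid actions\<close>

definition forget :: "('a \<times> 'a, ('a \<times> 'a) \<times> 'a \<times> ('a \<times> 'a), 'a, 'a \<times> 'a \<times> 'a) func" where
  "forget = \<lparr>fob = fst, far = (\<lambda>(x, h, y). (fst x, h, fst y))\<rparr>"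

lemma forget_simps [simp]: "fob forget x = fst x" "far forget (x, h, y) = (fst x, h, fst y)"
  by (simp_all add: forget_def)

context groupoid_actions
begin

lemma gm_unit_right: "\<lbrakk>\<gamma> \<in> Ar C; Cod C \<gamma> = G1 G\<rbrakk> \<Longrightarrow> gm \<gamma> (gunit G \<cdot> d0 G \<cdot> \<gamma>) = \<gamma>"
  using gm_comp[of "idt C (G1 G)" "gunit G \<cdot> d0 G" \<gamma>] unit_right by (simp add: gm_def[symmetric] d1_e)

lemma forget_functor: "cat_functor (gobj_cat C G) (slice C (G0 G)) forget"
proof (rule cat_functorI[OF category_gobj category_slice])
  fix x assume "x \<in> Ob (gobj_cat C G)"
  then show "fob forget x \<in> Ob (slice C (G0 G))" using gobjectD[of x] by simp
next
  fix c assume "c \<in> Ar (gobj_cat C G)"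
  then obtain x h y where c: "c = (x, h, y)" "(x, h, y) \<in> Ar (gobj_cat C G)" by (rule gobj_ArE)
  note d = gobj_ArD[OF c(2)]
  show "far forget c \<in> hom (slice C (G0 G)) (fob forget (Dom (gobj_cat C G) c)) (fob forget (Cod (gobj_cat C G) c))"
    using d gobjectD[OF d(1)] gobjectD[OF d(2)] by (simp add: c(1))
next
  fix c d assume "c \<in> Ar (gobj_cat C G)" "d \<in> Ar (gobj_cat C G)" "Dom (gobj_cat C G) d = Cod (gobj_cat C G) c"
  then show "far forget (d \<cdot>\<^bsub>gobj_cat C G\<^esub> c) = far forget d \<cdot>\<^bsub>slice C (G0 G)\<^esub> far forget c"
    by (cases c; cases d) simp
qed simp

text \<open>The free action on \<open>f : X \<rightarrow> G0\<close> is the left translation action on \<open>G1 \<times>\<^bsub>G0\<^esub> X\<close>.\<close>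

definition free_ob :: "'a \<Rightarrow> 'a \<times> 'a" where
  "free_ob f = (let p = pb1 C (d0 G) f; q = pb2 C (d0 G) f; k = d1 G \<cdot> p in
    (k, pb_pair C (d0 G) f (gm (pb1 C (d0 G) k) (p \<cdot> pb2 C (d0 G) k)) (q \<cdot> pb2 C (d0 G) k)))"

definition free_unit :: "'a \<Rightarrow> 'a" where
  "free_unit f = pb_pair C (d0 G) f (gunit G \<cdot> f) (idt C (Dom C f))"

lemma fst_free_ob [simp]: "fst (free_ob f) = d1 G \<cdot> pb1 C (d0 G) f"
  by (simp add: free_ob_def Let_def)

lemma snd_free_ob: 
  assumes f: "f \<in> Ar C" "Cod C f = G0 G"
  shows "snd (free_ob f) \<in> Ar C" "Dom C (snd (free_ob f)) = Dom C (pb1 C (d0 G) (fst (free_ob f)))"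
    "Cod C (snd (free_ob f)) = Dom C (pb1 C (d0 G) f)"
  and free_act: "\<lbrakk>\<gamma> \<in> Ar C; u \<in> Ar C; Dom C \<gamma> = Dom C u; Cod C \<gamma> = G1 G; Cod C u = Dom C (pb1 C (d0 G) f);
    d0 G \<cdot> \<gamma> = d1 G \<cdot> pb1 C (d0 G) f \<cdot> u\<rbrakk> \<Longrightarrow>
    act (free_ob f) \<gamma> u = pb_pair C (d0 G) f (gm \<gamma> (pb1 C (d0 G) f \<cdot> u)) (pb2 C (d0 G) f \<cdot> u)"
proof -
  define p q where "p = pb1 C (d0 G) f" and "q = pb2 C (d0 G) f"
  have pq: "p \<in> Ar C" "q \<in> Ar C" "Dom C q = Dom C p" "Cod C p = G1 G" "Cod C q = Dom C f" "d0 G \<cdot> p = f \<cdot> q"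
    using f pb_comm[of "d0 G" f] by (simp_all add: p_def q_def)
  define k where "k = d1 G \<cdot> p"
  have k: "k \<in> Ar C" "Dom C k = Dom C p" "Cod C k = G0 G" using pq by (simp_all add: k_def)
  define r s where "r = pb1 C (d0 G) k" and "s = pb2 C (d0 G) k"
  have rs: "r \<in> Ar C" "s \<in> Ar C" "Dom C s = Dom C r" "Cod C r = G1 G" "Cod C s = Dom C p" "d0 G \<cdot> r = k \<cdot> s"
    using k pb_comm[of "d0 G" k] by (simp_all add: r_def s_def)
  have rs': "d0 G \<cdot> r = d1 G \<cdot> p \<cdot> s" using rs pq by (simp add: k_def)
  define v w where "v = gm r (p \<cdot> s)" and "w = q \<cdot> s"
  have vw: "v \<in> Ar C" "w \<in> Ar C" "Dom C v = Dom C r" "Dom C w = Dom C r" "Cod C v = G1 G" "Cod C w = Dom C f"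
    "d0 G \<cdot> v = f \<cdot> w"
    using rs(1-5) rs' pq(1-5) reassoc[OF pq(6), of s] f by (simp_all add: v_def w_def)
  define a where "a = pb_pair C (d0 G) f v w"
  have a: "a \<in> Ar C" "Dom C a = Dom C r" "Cod C a = Dom C p"
    using vw f by (simp_all add: a_def p_def)
  have fo: "free_ob f = (k, a)" by (simp add: free_ob_def Let_def p_def q_def k_def r_def s_def v_def w_def a_def)
  show "snd (free_ob f) \<in> Ar C" "Dom C (snd (free_ob f)) = Dom C (pb1 C (d0 G) (fst (free_ob f)))"
    "Cod C (snd (free_ob f)) = Dom C (pb1 C (d0 G) f)" using a by (simp_all only: fo fst_conv snd_conv p_def r_def)
  assume g: "\<gamma> \<in> Ar C" "u \<in> Ar C" "Dom C \<gamma> = Dom C u" "Cod C \<gamma> = G1 G" "Cod C u = Dom C (pb1 C (d0 G) f)"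
    "d0 G \<cdot> \<gamma> = d1 G \<cdot> pb1 C (d0 G) f \<cdot> u"
  have g': "Cod C u = Dom C p" "d0 G \<cdot> \<gamma> = d1 G \<cdot> p \<cdot> u" using g by (simp_all add: p_def)
  have gk: "d0 G \<cdot> \<gamma> = k \<cdot> u" using g(1-4) g' pq by (simp add: k_def)
  define h where "h = pb_pair C (d0 G) k \<gamma> u"
  have h: "h \<in> Ar C" "Dom C h = Dom C u" "Cod C h = Dom C r" "r \<cdot> h = \<gamma>" "s \<cdot> h = u"
    using g(1-4) g' gk k by (simp_all add: h_def r_def s_def)
  have "v \<cdot> h = gm (r \<cdot> h) ((p \<cdot> s) \<cdot> h)" unfolding v_def by (rule gm_comp) (use rs(1-5) rs' pq(1-5) h in simp_all)
  then have vh: "v \<cdot> h = gm \<gamma> (p \<cdot> u)" using h rs(1-5) pq(1-5) by simp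
  have wh: "w \<cdot> h = q \<cdot> u" using h rs(1-5) pq(1-5) by (simp add: w_def)
  have "a \<cdot> h = pb_pair C (d0 G) f (v \<cdot> h) (w \<cdot> h)" unfolding a_def by (rule pb_pair_comp) (use vw h f in simp_all)
  then show "act (free_ob f) \<gamma> u = pb_pair C (d0 G) f (gm \<gamma> (pb1 C (d0 G) f \<cdot> u)) (pb2 C (d0 G) f \<cdot> u)"
    unfolding vh wh by (simp add: act_def fo h_def p_def q_def)
qed

lemma free_object:
  assumes f: "f \<in> Ar C" "Cod C f = G0 G"
  shows "is_gobject C G (free_ob f)"
proof -
  define p q where "p = pb1 C (d0 G) f" and "q = pb2 C (d0 G) f"
  have pq: "p \<in> Ar C" "q \<in> Ar C" "Dom C q = Dom C p" "Cod C p = G1 G" "Cod C q = Dom C f" "d0 G \<cdot> p = f \<cdot> q"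
    using f pb_comm[of "d0 G" f] by (simp_all add: p_def q_def)
  obtain a where a: "free_ob f = (d1 G \<cdot> p, a)" by (simp add: free_ob_def Let_def p_def)
  define k where "k = d1 G \<cdot> p"
  have k: "k \<in> Ar C" "Cod C k = G0 G" "Dom C k = Dom C p" using pq by (simp_all add: k_def)
  note a = a[folded k_def]
  have at: "a \<in> Ar C" "Dom C a = Dom C (pb1 C (d0 G) k)" "Cod C a = Dom C k"
    using snd_free_ob[OF f] k(3) unfolding a by (simp_all add: p_def)
  have fa: "d0 G \<cdot> \<gamma> = d1 G \<cdot> p \<cdot> u \<and>
      act (k, a) \<gamma> u \<in> Ar C \<and> Dom C (act (k, a) \<gamma> u) = Dom C u \<and> Cod C (act (k, a) \<gamma> u) = Dom C p \<and>
      p \<cdot> act (k, a) \<gamma> u = gm \<gamma> (p \<cdot> u) \<and> q \<cdot> act (k, a) \<gamma> u = q \<cdot> u"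
    if g: "\<gamma> \<in> Ar C" "u \<in> Ar C" "Dom C \<gamma> = Dom C u" "Cod C \<gamma> = G1 G" "Cod C u = Dom C p" "d0 G \<cdot> \<gamma> = k \<cdot> u" for \<gamma> u
  proof -
    have c: "d0 G \<cdot> \<gamma> = d1 G \<cdot> p \<cdot> u" using g pq by (simp add: k_def)
    have c2: "d0 G \<cdot> p \<cdot> u = f \<cdot> q \<cdot> u" using reassoc[OF pq(6), of u] pq(1-5) g f by simp
    have e: "act (k, a) \<gamma> u = pb_pair C (d0 G) f (gm \<gamma> (p \<cdot> u)) (q \<cdot> u)"
      using free_act[OF f, of \<gamma> u] g c unfolding a by (simp add: p_def q_def)
    define m where "m = gm \<gamma> (p \<cdot> u)"
    have m: "m \<in> Ar C" "Dom C m = Dom C u" "Cod C m = G1 G" "d0 G \<cdot> m = f \<cdot> q \<cdot> u"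
      using g(1-5) c c2 pq(1-5) by (simp_all add: m_def)
    show ?thesis unfolding e m_def[symmetric] using c m g pq(1-5) f by (simp add: p_def q_def)
  qed
  have eqp: "x = y" if "x \<in> Ar C" "y \<in> Ar C" "Dom C x = Dom C y" "Cod C x = Dom C p" "Cod C y = Dom C p" "p \<cdot> x = p \<cdot> y" "q \<cdot> x = q \<cdot> y" for x y
    by (rule pb_eqI[of _ _ "d0 G" f]) (use that f in \<open>simp_all add: p_def q_def\<close>)
  have kx: "k \<cdot> x = d1 G \<cdot> p \<cdot> x" if "x \<in> Ar C" "Cod C x = Dom C p" for x using that pq by (simp add: k_def)
  show ?thesis unfolding a
  proof (rule gobjectI[OF k(1,2) at])
    fix \<gamma> u assume g: "\<gamma> \<in> Ar C" "u \<in> Ar C" "Dom C \<gamma> = Dom C u" "Cod C \<gamma> = G1 G" "Cod C u = Dom C k" "d0 G \<cdot> \<gamma> = k \<cdot> u"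
    have fa': "p \<cdot> act (k, a) \<gamma> u = gm \<gamma> (p \<cdot> u)" "d0 G \<cdot> \<gamma> = d1 G \<cdot> p \<cdot> u" "act (k, a) \<gamma> u \<in> Ar C" "Cod C (act (k, a) \<gamma> u) = Dom C p"
      using fa[OF g(1-4) _ g(6)] g(5) k(3) by simp_all
    show "k \<cdot> act (k, a) \<gamma> u = d1 G \<cdot> \<gamma>"
      unfolding kx[OF fa'(3,4)] fa'(1) using g(1-5) fa'(2) pq(1-5) k(3) by simp
  next
    fix u assume u: "u \<in> Ar C" "Cod C u = Dom C k"
    have u': "Cod C u = Dom C p" using u k(3) by simp
    define \<gamma> where "\<gamma> = gunit G \<cdot> k \<cdot> u"
    have g: "\<gamma> \<in> Ar C" "Dom C \<gamma> = Dom C u" "Cod C \<gamma> = G1 G" "d0 G \<cdot> \<gamma> = k \<cdot> u" using u k by (simp_all add: \<gamma>_def)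
    have eg: "\<gamma> = gunit G \<cdot> d1 G \<cdot> p \<cdot> u" using kx[OF u(1) u'] by (simp add: \<gamma>_def)
    have "gm \<gamma> (p \<cdot> u) = p \<cdot> u" unfolding eg by (rule gm_unit_left) (use u u' pq(1-5) in simp_all)
    then have "act (k, a) \<gamma> u = u"
      by - (rule eqp, use fa[OF g(1) u(1) g(2,3) u' g(4)] u u' in simp_all)
    then show "act (k, a) (gunit G \<cdot> k \<cdot> u) u = u" by (simp add: \<gamma>_def)
  next
    fix \<alpha> \<beta> u assume g: "\<alpha> \<in> Ar C" "\<beta> \<in> Ar C" "u \<in> Ar C" "Dom C \<alpha> = Dom C u" "Dom C \<beta> = Dom C u" "Cod C \<alpha> = G1 G" "Cod C \<beta> = G1 G"
       "Cod C u = Dom C k" "d0 G \<cdot> \<alpha> = d1 G \<cdot> \<beta>" "d0 G \<cdot> \<beta> = k \<cdot> u"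
    have u': "Cod C u = Dom C p" using g(8) k(3) by simp
    have b: "act (k, a) \<beta> u \<in> Ar C" "Dom C (act (k, a) \<beta> u) = Dom C u" "Cod C (act (k, a) \<beta> u) = Dom C p"
      "p \<cdot> act (k, a) \<beta> u = gm \<beta> (p \<cdot> u)" "q \<cdot> act (k, a) \<beta> u = q \<cdot> u" "d0 G \<cdot> \<beta> = d1 G \<cdot> p \<cdot> u"
      using fa[OF g(2,3,5,7) u' g(10)] by simp_all
    have pu: "p \<cdot> u \<in> Ar C" "Dom C (p \<cdot> u) = Dom C u" "Cod C (p \<cdot> u) = G1 G" using g(3) u' pq(1-5) by simp_all
    have c: "d0 G \<cdot> \<alpha> = k \<cdot> act (k, a) \<beta> u"
      unfolding kx[OF b(1,3)] b(4) using g(1-7,9) b(6) pu by simp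
    have c': "d0 G \<cdot> gm \<alpha> \<beta> = k \<cdot> u" using g by simp
    have gg: "gm (gm \<alpha> \<beta>) (p \<cdot> u) = gm \<alpha> (gm \<beta> (p \<cdot> u))"
      by (rule gm_assoc[where Z = "Dom C u"]) (use g(1-7,9) pu b(6) in simp_all)
    have gab: "gm \<alpha> \<beta> \<in> Ar C" "Dom C (gm \<alpha> \<beta>) = Dom C u" "Cod C (gm \<alpha> \<beta>) = G1 G" using g by simp_all
    have da: "Dom C \<alpha> = Dom C (act (k, a) \<beta> u)" using g(4) b(2) by simp
    have L: "act (k, a) (gm \<alpha> \<beta>) u \<in> Ar C" "Dom C (act (k, a) (gm \<alpha> \<beta>) u) = Dom C u" "Cod C (act (k, a) (gm \<alpha> \<beta>) u) = Dom C p"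
        "p \<cdot> act (k, a) (gm \<alpha> \<beta>) u = gm (gm \<alpha> \<beta>) (p \<cdot> u)" "q \<cdot> act (k, a) (gm \<alpha> \<beta>) u = q \<cdot> u"
      using fa[OF gab(1) g(3) gab(2,3) u' c'] by simp_all
    have R: "act (k, a) \<alpha> (act (k, a) \<beta> u) \<in> Ar C" "Dom C (act (k, a) \<alpha> (act (k, a) \<beta> u)) = Dom C u"
        "Cod C (act (k, a) \<alpha> (act (k, a) \<beta> u)) = Dom C p"
        "p \<cdot> act (k, a) \<alpha> (act (k, a) \<beta> u) = gm \<alpha> (gm \<beta> (p \<cdot> u))" "q \<cdot> act (k, a) \<alpha> (act (k, a) \<beta> u) = q \<cdot> u"
      using fa[OF g(1) b(1) da g(6) b(3) c] b(2,4,5) by simp_all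
    show "act (k, a) (gm \<alpha> \<beta>) u = act (k, a) \<alpha> (act (k, a) \<beta> u)"
      by (rule eqp) (use L R gg in simp_all)
  qed
qed

text \<open>An element \<open>(\<gamma>, x)\<close> of the free action is the unit at
  \<open>x\<close> moved by \<gamma>, so equivariance leaves only the extension \<open>m\<close>,
  which sends it to \<gamma> acting on \<open>h x\<close>.\<close>

lemma free_universal:
  assumes f: "f \<in> Ar C" "Cod C f = G0 G"
  shows "universal_arrow (slice C (G0 G)) (gobj_cat C G) forget f (free_ob f) (f, free_unit f, fst (free_ob f))"
  unfolding universal_arrow_def
proof (intro conjI ballI)
  define p q where "p = pb1 C (d0 G) f" and "q = pb2 C (d0 G) f"
  have pq: "p \<in> Ar C" "q \<in> Ar C" "Dom C q = Dom C p" "Cod C p = G1 G" "Cod C q = Dom C f" "d0 G \<cdot> p = f \<cdot> q"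
    using f pb_comm[of "d0 G" f] by (simp_all add: p_def q_def)
  define k where "k = d1 G \<cdot> p"
  have k: "k \<in> Ar C" "Cod C k = G0 G" "Dom C k = Dom C p" using pq by (simp_all add: k_def)
  have fk: "fst (free_ob f) = k" by (simp add: k_def p_def)
  define e where "e = free_unit f"
  have e: "e \<in> Ar C" "Dom C e = Dom C f" "Cod C e = Dom C p" "p \<cdot> e = gunit G \<cdot> f" "q \<cdot> e = idt C (Dom C f)"
    using f by (simp_all add: e_def free_unit_def p_def q_def d0_e)
  have ke: "k \<cdot> e = f" using e pq f by (simp add: k_def)
  note fo = free_object[OF f]
  show "free_ob f \<in> Ob (gobj_cat C G)" using fo by simp
  show "(f, free_unit f, fst (free_ob f)) \<in> hom (slice C (G0 G)) f (fob forget (free_ob f))"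
    unfolding e_def[symmetric] using e ke k f fk by simp
  fix y c assume y: "y \<in> Ob (gobj_cat C G)" and c: "c \<in> hom (slice C (G0 G)) f (fob forget y)"
  from y have y: "is_gobject C G y" by simp
  note dy = gobjectD[OF y]
  obtain h where h: "c = (f, h, fst y)" using c by (cases c) simp
  have ar: "(f, h, fst y) \<in> Ar (slice C (G0 G))" using c by (simp only: h mem_hom)
  note ht = slice_ArD(5-8)[OF ar]
  have hq: "fst y \<cdot> h \<cdot> x = f \<cdot> x" if "x \<in> Ar C" "Cod C x = Dom C f" for x
    using reassoc[OF ht(4), of x] ht(1-3) dy that by simp
  define m where "m = act y p (h \<cdot> q)"
  have pc: "d0 G \<cdot> p = fst y \<cdot> h \<cdot> q" using hq[of q] pq by simp
  have m: "m \<in> Ar C" "Dom C m = Dom C p" "Cod C m = Dom C (fst y)" "fst y \<cdot> m = k"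
    using act_simps[OF y, of p "h \<cdot> q"] pc pq(1-5) ht(1-3) by (simp_all add: m_def k_def)
  have mx: "m \<cdot> x = act y (p \<cdot> x) (h \<cdot> q \<cdot> x)" if "x \<in> Ar C" "Cod C x = Dom C p" for x
    unfolding m_def using act_comp[OF y, of p "h \<cdot> q" x] pc pq(1-5) ht(1-3) that by simp
  have fact: "d0 G \<cdot> \<gamma> = d1 G \<cdot> p \<cdot> u \<and> p \<cdot> act (free_ob f) \<gamma> u = gm \<gamma> (p \<cdot> u) \<and> q \<cdot> act (free_ob f) \<gamma> u = q \<cdot> u \<and>
     act (free_ob f) \<gamma> u \<in> Ar C \<and> Dom C (act (free_ob f) \<gamma> u) = Dom C u \<and> Cod C (act (free_ob f) \<gamma> u) = Dom C p"
    if g: "\<gamma> \<in> Ar C" "u \<in> Ar C" "Dom C \<gamma> = Dom C u" "Cod C \<gamma> = G1 G" "Cod C u = Dom C p" "d0 G \<cdot> \<gamma> = k \<cdot> u" for \<gamma> u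
  proof -
    have c: "d0 G \<cdot> \<gamma> = d1 G \<cdot> p \<cdot> u" using g pq by (simp add: k_def)
    have c2: "d0 G \<cdot> p \<cdot> u = f \<cdot> q \<cdot> u" using reassoc[OF pq(6), of u] pq(1-5) g f by simp
    have e: "act (free_ob f) \<gamma> u = pb_pair C (d0 G) f (gm \<gamma> (p \<cdot> u)) (q \<cdot> u)"
      using free_act[OF f, of \<gamma> u] g c by (simp add: p_def q_def)
    define m where "m = gm \<gamma> (p \<cdot> u)"
    have m: "m \<in> Ar C" "Dom C m = Dom C u" "Cod C m = G1 G" "d0 G \<cdot> m = f \<cdot> q \<cdot> u"
      using g(1-5) c c2 pq(1-5) by (simp_all add: m_def)
    show ?thesis unfolding e m_def[symmetric] using c m g pq(1-5) f by (simp add: p_def q_def)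
  qed
  show "\<exists>!n. n \<in> hom (gobj_cat C G) (free_ob f) y \<and> far forget n \<cdot>\<^bsub>slice C (G0 G)\<^esub> (f, free_unit f, fst (free_ob f)) = c"
  proof (rule ex1I[of _ "(free_ob f, m, y)"])
    have "(free_ob f, m, y) \<in> Ar (gobj_cat C G)"
    proof (rule gobj_ArI[OF fo y])
      fix \<gamma> u assume g: "\<gamma> \<in> Ar C" "u \<in> Ar C" "Dom C \<gamma> = Dom C u" "Cod C \<gamma> = G1 G" "Cod C u = Dom C (fst (free_ob f))"
        "d0 G \<cdot> \<gamma> = fst (free_ob f) \<cdot> u"
      have u': "Cod C u = Dom C p" "d0 G \<cdot> \<gamma> = k \<cdot> u" using g(5,6) k(3) by (simp_all only: fk)
      have F: "p \<cdot> act (free_ob f) \<gamma> u = gm \<gamma> (p \<cdot> u)" "q \<cdot> act (free_ob f) \<gamma> u = q \<cdot> u" "d0 G \<cdot> \<gamma> = d1 G \<cdot> p \<cdot> u"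
        "act (free_ob f) \<gamma> u \<in> Ar C" "Cod C (act (free_ob f) \<gamma> u) = Dom C p"
        using fact[OF g(1-4) u'] by simp_all
      have pu: "d0 G \<cdot> p \<cdot> u = fst y \<cdot> h \<cdot> q \<cdot> u"
        using reassoc[OF pq(6), of u] hq[of "q \<cdot> u"] pq(1-5) g(2) u' f by simp
      have "m \<cdot> act (free_ob f) \<gamma> u = act y (gm \<gamma> (p \<cdot> u)) (h \<cdot> q \<cdot> u)" using mx[OF F(4,5)] F(1,2) by simp
      also have "\<dots> = act y \<gamma> (act y (p \<cdot> u) (h \<cdot> q \<cdot> u))"
        by (rule act_assoc[OF y, where Z = "Dom C u"]) (use g(1-4) u' pq(1-5) ht(1-3) F(3) pu in simp_all)
      also have "\<dots> = act y \<gamma> (m \<cdot> u)" using mx[of u] g(2) u' by simp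
      finally show "m \<cdot> act (free_ob f) \<gamma> u = act y \<gamma> (m \<cdot> u)" .
    qed (use m k fk in simp_all)
    moreover have "m \<cdot> e = h"
    proof -
      have "m \<cdot> e = act y (gunit G \<cdot> f) h" using mx[of e] e ht(1-3) by simp
      also have "\<dots> = h" using act_unit[OF y, of h] ht by simp
      finally show ?thesis .
    qed
    ultimately show "(free_ob f, m, y) \<in> hom (gobj_cat C G) (free_ob f) y \<and>
        far forget (free_ob f, m, y) \<cdot>\<^bsub>slice C (G0 G)\<^esub> (f, free_unit f, fst (free_ob f)) = c"
      by (simp add: h e_def)
    fix n assume n: "n \<in> hom (gobj_cat C G) (free_ob f) y \<and> far forget n \<cdot>\<^bsub>slice C (G0 G)\<^esub> (f, free_unit f, fst (free_ob f)) = c"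
    obtain n' where n': "n = (free_ob f, n', y)" using n by (cases n) simp
    have nar: "(free_ob f, n', y) \<in> Ar (gobj_cat C G)" using n unfolding n' mem_hom by blast
    have ne: "n' \<cdot> e = h" using n unfolding n' h e_def by simp
    note nt = gobj_ArD(3-5)[OF nar]
    have nt': "n' \<in> Ar C" "Dom C n' = Dom C p" "Cod C n' = Dom C (fst y)" using nt k(3) by (simp_all only: fk)
    have eq: "e \<cdot> q \<in> Ar C" "Dom C (e \<cdot> q) = Dom C p" "Cod C (e \<cdot> q) = Dom C p" "k \<cdot> e \<cdot> q = f \<cdot> q"
      "p \<cdot> e \<cdot> q = gunit G \<cdot> f \<cdot> q" "q \<cdot> e \<cdot> q = q"
      using reassoc[OF ke, of q] reassoc[OF e(4), of q] reassoc[OF e(5), of q] e(1-3) pq(1-5) k f by simp_all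
    have F: "p \<cdot> act (free_ob f) p (e \<cdot> q) = gm p (p \<cdot> e \<cdot> q)" "q \<cdot> act (free_ob f) p (e \<cdot> q) = q \<cdot> e \<cdot> q"
      "act (free_ob f) p (e \<cdot> q) \<in> Ar C" "Dom C (act (free_ob f) p (e \<cdot> q)) = Dom C p" "Cod C (act (free_ob f) p (e \<cdot> q)) = Dom C p"
      using fact[of p "e \<cdot> q"] eq pq by simp_all
    have "gm p (p \<cdot> e \<cdot> q) = p" unfolding eq(5) pq(6)[symmetric] by (rule gm_unit_right) (use pq in simp_all)
    \<comment> \<open>The generic element is \<open>p\<close> acting on the unit at
      \<open>q\<close>; inserting this before \<open>n'\<close> determines \<open>n'\<close> by its
      values on units.\<close>
    then have "act (free_ob f) p (e \<cdot> q) = idt C (Dom C p)"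
      by - (rule pb_eqI[of _ _ "d0 G" f], use F eq(6) pq(1-5) f in \<open>simp_all flip: p_def q_def\<close>)
    then have "n' = n' \<cdot> act (free_ob f) p (e \<cdot> q)" using nt' by simp
    also have "\<dots> = act y p (n' \<cdot> e \<cdot> q)"
      by (rule equivariantD[OF nar]) (use pq eq in \<open>simp_all only: fk k(3) pq(6) eq\<close>)
    also have "n' \<cdot> e \<cdot> q = h \<cdot> q" using reassoc[OF ne, of q] nt' e(1-3) pq(1-5) by simp
    finally show "n = (free_ob f, m, y)" by (simp add: n' m_def)
  qed
qed

text \<open>Actions pass to split quotients: an element over \<open>r\<close> is lifted along the
  section \<open>s'\<close>, moved in \<open>Q\<close>, and projected by \<open>q'\<close>. By
  \<open>coeq_act\<close>, a map that identifies \<open>f\<close> and \<open>g\<close> ignores the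
  passage through the section, which yields associativity and equivariance of
  \<open>q'\<close>.\<close>

lemma forget_beck: "beck (gobj_cat C G) (slice C (G0 G)) forget"
  unfolding beck_def
proof (intro conjI ballI allI impI)
  show "cat_functor (gobj_cat C G) (slice C (G0 G)) forget" by (rule forget_functor)
  show "\<exists>P e. universal_arrow (slice C (G0 G)) (gobj_cat C G) forget f P e" if "f \<in> Ob (slice C (G0 G))" for f
    by (intro exI, rule free_universal) (use that in simp_all)
next
  fix c assume "c \<in> Ar (gobj_cat C G)" and iso: "is_iso (slice C (G0 G)) (far forget c)"
  then obtain x h y where c: "c = (x, h, y)" "(x, h, y) \<in> Ar (gobj_cat C G)" by (metis gobj_ArE)
  interpret F: cat_functor "gobj_cat C G" "slice C (G0 G)" forget by (rule forget_functor)
  have "(fst x, h, fst y) \<in> Ar (slice C (G0 G))" using F.far_Ar[OF c(2)] by (simp only: forget_simps)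
  then have "is_iso C h" using iso slice_iso_iff unfolding c(1) forget_simps by blast
  then show "is_iso (gobj_cat C G) c" unfolding c(1) by (rule gobj_iso[OF c(2)])
next
  interpret F: cat_functor "gobj_cat C G" "slice C (G0 G)" forget by (rule forget_functor)
  fix b c q s t assume ba: "b \<in> Ar (gobj_cat C G)" and ca: "c \<in> Ar (gobj_cat C G)"
    and bc: "Dom (gobj_cat C G) b = Dom (gobj_cat C G) c" "Cod (gobj_cat C G) b = Cod (gobj_cat C G) c"
    and sp: "split_coequalizer (slice C (G0 G)) (far forget b) (far forget c) q s t"
  obtain P f Q where b: "b = (P, f, Q)" "(P, f, Q) \<in> Ar (gobj_cat C G)" by (rule gobj_ArE[OF ba])
  obtain P' g Q' where c': "c = (P', g, Q')" "(P', g, Q') \<in> Ar (gobj_cat C G)" by (rule gobj_ArE[OF ca])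
  have "P' = P" "Q' = Q" using bc by (simp_all add: b(1) c'(1))
  then have c: "c = (P, g, Q)" "(P, g, Q) \<in> Ar (gobj_cat C G)" using c' by simp_all
  note df = gobj_ArD[OF b(2)] and dg = gobj_ArD[OF c(2)]
  note dQ = gobjectD[OF df(2)] and dP = gobjectD[OF df(1)]
  have sp': "q \<in> Ar (slice C (G0 G))" "Dom (slice C (G0 G)) q = fst Q" "s \<in> hom (slice C (G0 G)) (Cod (slice C (G0 G)) q) (fst Q)"
    "t \<in> hom (slice C (G0 G)) (fst Q) (fst P)"
    "q \<cdot>\<^bsub>slice C (G0 G)\<^esub> (fst P, f, fst Q) = q \<cdot>\<^bsub>slice C (G0 G)\<^esub> (fst P, g, fst Q)"
    "q \<cdot>\<^bsub>slice C (G0 G)\<^esub> s = idt (slice C (G0 G)) (Cod (slice C (G0 G)) q)"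
    "(fst P, f, fst Q) \<cdot>\<^bsub>slice C (G0 G)\<^esub> t = idt (slice C (G0 G)) (fst Q)"
    "(fst P, g, fst Q) \<cdot>\<^bsub>slice C (G0 G)\<^esub> t = s \<cdot>\<^bsub>slice C (G0 G)\<^esub> q"
    using sp unfolding split_coequalizer_def b(1) c(1) by (simp_all only: forget_simps slice_simps(3,4))
  obtain q' r where q': "q = (fst Q, q', r)" using sp'(2) by (cases q) simp
  obtain s' where s': "s = (r, s', fst Q)" using sp'(3) unfolding q' by (cases s) simp
  obtain t' where t': "t = (fst Q, t', fst P)" using sp'(4) by (cases t) simp
  have qa: "(fst Q, q', r) \<in> Ar (slice C (G0 G))" using sp'(1) by (simp only: q')
  have sa: "(r, s', fst Q) \<in> Ar (slice C (G0 G))" using sp'(3) by (simp only: s' mem_hom)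
  have ta: "(fst Q, t', fst P) \<in> Ar (slice C (G0 G))" using sp'(4) by (simp only: t' mem_hom)
  note qt = slice_ArD[OF qa] and st = slice_ArD[OF sa] and tt = slice_ArD[OF ta]
  have e: "q' \<cdot> f = q' \<cdot> g" "q' \<cdot> s' = idt C (Dom C r)" "f \<cdot> t' = idt C (Dom C (fst Q))" "g \<cdot> t' = s' \<cdot> q'"
    using sp'(5-8) by (simp_all add: q' s' t')
  have rx: "r \<cdot> q' \<cdot> x = fst Q \<cdot> x" if "x \<in> Ar C" "Cod C x = Dom C (fst Q)" for x
    using reassoc[OF qt(8), of x] qt(3-7) that by simp
  have Qs: "fst Q \<cdot> s' \<cdot> x = r \<cdot> x" if "x \<in> Ar C" "Cod C x = Dom C r" for x
    using reassoc[OF st(8), of x] st(1-7) that by simp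
  have Pt: "fst P \<cdot> t' \<cdot> x = fst Q \<cdot> x" if "x \<in> Ar C" "Cod C x = Dom C (fst Q)" for x
    using reassoc[OF tt(8), of x] tt(1-7) that by simp
  have qs: "q' \<cdot> s' \<cdot> x = x" if "x \<in> Ar C" "Cod C x = Dom C r" for x
    using reassoc[OF e(2), of x] qt(3-7) st(5-7) that by simp
  have ft: "f \<cdot> t' \<cdot> x = x" "g \<cdot> t' \<cdot> x = s' \<cdot> q' \<cdot> x" if "x \<in> Ar C" "Cod C x = Dom C (fst Q)" for x
    using reassoc[OF e(3), of x] reassoc[OF e(4), of x] df(3-5) dg(3-5) tt(5-7) qt(5-7) st(5-7) that by simp_all
  \<comment> \<open>The element \<open>u\<close> is moved into \<open>P\<close> by
    \<open>t'\<close>; there equivariance of \<open>g\<close> and of \<open>f\<close> evaluates the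
    action on \<open>s' \<cdot> q' \<cdot> u\<close> and on \<open>u\<close>, and \<open>z\<close>
    identifies the two.\<close>
  have coeq_act: "z \<cdot> act Q \<gamma> (s' \<cdot> q' \<cdot> u) = z \<cdot> act Q \<gamma> u"
    if z: "z \<in> Ar C" "Dom C z = Dom C (fst Q)" "z \<cdot> f = z \<cdot> g"
      and g: "\<gamma> \<in> Ar C" "u \<in> Ar C" "Dom C \<gamma> = Dom C u" "Cod C \<gamma> = G1 G" "Cod C u = Dom C (fst Q)" "d0 G \<cdot> \<gamma> = fst Q \<cdot> u" for z \<gamma> u
  proof -
    have tu: "t' \<cdot> u \<in> Ar C" "Dom C (t' \<cdot> u) = Dom C u" "Cod C (t' \<cdot> u) = Dom C (fst P)" "d0 G \<cdot> \<gamma> = fst P \<cdot> t' \<cdot> u"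
      using g tt(5-7) Pt[of u] by simp_all
    have d: "Dom C \<gamma> = Dom C (t' \<cdot> u)" using tu(2) g(3) by simp
    note ap = act_simps[OF df(1) g(1) tu(1) d g(4) tu(3,4)]
    have "z \<cdot> act Q \<gamma> (s' \<cdot> q' \<cdot> u) = z \<cdot> g \<cdot> act P \<gamma> (t' \<cdot> u)"
      using equivariantD[OF c(2) g(1) tu(1) d g(4) tu(3,4)] ft(2)[OF g(2,5)] by simp
    also have "\<dots> = z \<cdot> f \<cdot> act P \<gamma> (t' \<cdot> u)"
      using reassoc[OF z(3), of "act P \<gamma> (t' \<cdot> u)"] z(1,2) df(3-5) dg(3-5) ap by simp
    also have "\<dots> = z \<cdot> act Q \<gamma> u"
      using equivariantD[OF b(2) g(1) tu(1) d g(4) tu(3,4)] ft(1)[OF g(2,5)] by simp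
    finally show ?thesis .
  qed
  define P1 P2 where "P1 = pb1 C (d0 G) r" and "P2 = pb2 C (d0 G) r"
  have P12: "P1 \<in> Ar C" "P2 \<in> Ar C" "Dom C P2 = Dom C P1" "Cod C P1 = G1 G" "Cod C P2 = Dom C r" "d0 G \<cdot> P1 = r \<cdot> P2"
    using qt(3,4) pb_comm[of "d0 G" r] by (simp_all add: P1_def P2_def)
  define a where "a = q' \<cdot> act Q P1 (s' \<cdot> P2)"
  have aQ: "act Q \<gamma> (s' \<cdot> u) \<in> Ar C" "Dom C (act Q \<gamma> (s' \<cdot> u)) = Dom C u" "Cod C (act Q \<gamma> (s' \<cdot> u)) = Dom C (fst Q)"
    "fst Q \<cdot> act Q \<gamma> (s' \<cdot> u) = d1 G \<cdot> \<gamma>" "d0 G \<cdot> \<gamma> = fst Q \<cdot> s' \<cdot> u"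
    if g: "\<gamma> \<in> Ar C" "u \<in> Ar C" "Dom C \<gamma> = Dom C u" "Cod C \<gamma> = G1 G" "Cod C u = Dom C r" "d0 G \<cdot> \<gamma> = r \<cdot> u" for \<gamma> u
    using act_simps[OF df(2), of \<gamma> "s' \<cdot> u"] g Qs[of u] st(5-7) by simp_all
  have at: "a \<in> Ar C" "Dom C a = Dom C (pb1 C (d0 G) r)" "Cod C a = Dom C r"
    using aQ[of P1 P2] P12 qt(5-7) by (simp_all add: a_def P1_def)
  have act_a: "act (r, a) \<gamma> u = q' \<cdot> act Q \<gamma> (s' \<cdot> u)"
    if g: "\<gamma> \<in> Ar C" "u \<in> Ar C" "Dom C \<gamma> = Dom C u" "Cod C \<gamma> = G1 G" "Cod C u = Dom C r" "d0 G \<cdot> \<gamma> = r \<cdot> u" for \<gamma> u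
  proof -
    define k where "k = pb_pair C (d0 G) r \<gamma> u"
    have k: "k \<in> Ar C" "Cod C k = Dom C P1" "P1 \<cdot> k = \<gamma>" "P2 \<cdot> k = u"
      using g qt(3,4) by (simp_all add: k_def P1_def P2_def)
    have "act Q P1 (s' \<cdot> P2) \<cdot> k = act Q (P1 \<cdot> k) ((s' \<cdot> P2) \<cdot> k)"
      by (rule act_comp[OF df(2)]) (use aQ(5)[of P1 P2] P12(1-6) k st(5-7) in simp_all)
    then have "a \<cdot> k = q' \<cdot> act Q \<gamma> (s' \<cdot> u)"
      using aQ[of P1 P2] P12 k st(5-7) qt(5-7) by (simp add: a_def)
    then show ?thesis by (simp add: act_def k_def)
  qed
  have X: "is_gobject C G (r, a)"
  proof (rule gobjectI[OF qt(3,4) at])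
    fix \<gamma> u assume g: "\<gamma> \<in> Ar C" "u \<in> Ar C" "Dom C \<gamma> = Dom C u" "Cod C \<gamma> = G1 G" "Cod C u = Dom C r" "d0 G \<cdot> \<gamma> = r \<cdot> u"
    show "r \<cdot> act (r, a) \<gamma> u = d1 G \<cdot> \<gamma>"
      unfolding act_a[OF g] using rx[of "act Q \<gamma> (s' \<cdot> u)"] aQ[OF g] by simp
  next
    fix u assume u: "u \<in> Ar C" "Cod C u = Dom C r"
    have "act (r, a) (gunit G \<cdot> r \<cdot> u) u = q' \<cdot> act Q (gunit G \<cdot> r \<cdot> u) (s' \<cdot> u)"
      by (rule act_a) (use u qt(3,4) in simp_all)
    also have "act Q (gunit G \<cdot> r \<cdot> u) (s' \<cdot> u) = s' \<cdot> u"
      using act_unit[OF df(2), of "s' \<cdot> u"] u st(5-7) Qs[of u] by simp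
    finally show "act (r, a) (gunit G \<cdot> r \<cdot> u) u = u" using qs u by simp
  next
    fix \<alpha> \<beta> u assume g: "\<alpha> \<in> Ar C" "\<beta> \<in> Ar C" "u \<in> Ar C" "Dom C \<alpha> = Dom C u" "Dom C \<beta> = Dom C u" "Cod C \<alpha> = G1 G" "Cod C \<beta> = G1 G"
       "Cod C u = Dom C r" "d0 G \<cdot> \<alpha> = d1 G \<cdot> \<beta>" "d0 G \<cdot> \<beta> = r \<cdot> u"
    note B = aQ[OF g(2,3,5,7,8,10)]
    have y: "q' \<cdot> act Q \<beta> (s' \<cdot> u) \<in> Ar C" "Dom C (q' \<cdot> act Q \<beta> (s' \<cdot> u)) = Dom C u" "Cod C (q' \<cdot> act Q \<beta> (s' \<cdot> u)) = Dom C r"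
      "d0 G \<cdot> \<alpha> = r \<cdot> q' \<cdot> act Q \<beta> (s' \<cdot> u)"
      using B(1-4) qt(5-7) rx[OF B(1,3)] g(9) by simp_all
    have ay: "Dom C \<alpha> = Dom C (q' \<cdot> act Q \<beta> (s' \<cdot> u))" using y(2) g(4) by simp
    have ab: "Dom C \<alpha> = Dom C (act Q \<beta> (s' \<cdot> u))" "d0 G \<cdot> \<alpha> = fst Q \<cdot> act Q \<beta> (s' \<cdot> u)" using g(4,9) B(2,4) by simp_all
    have "act (r, a) \<alpha> (act (r, a) \<beta> u) = q' \<cdot> act Q \<alpha> (s' \<cdot> q' \<cdot> act Q \<beta> (s' \<cdot> u))"
      unfolding act_a[OF g(2,3,5,7,8,10)] by (rule act_a[OF g(1) y(1) ay g(6) y(3,4)])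
    also have "\<dots> = q' \<cdot> act Q \<alpha> (act Q \<beta> (s' \<cdot> u))"
      by (rule coeq_act[OF qt(5,6) e(1) g(1) B(1) ab(1) g(6) B(3) ab(2)])
    also have "\<dots> = q' \<cdot> act Q (gm \<alpha> \<beta>) (s' \<cdot> u)"
      by (subst act_assoc[OF df(2), where Z = "Dom C u"]) (use g B(5) st(5-7) in simp_all)
    also have "\<dots> = act (r, a) (gm \<alpha> \<beta>) u"
      by (rule act_a[symmetric]) (use g in simp_all)
    finally show "act (r, a) (gm \<alpha> \<beta>) u = act (r, a) \<alpha> (act (r, a) \<beta> u)" ..
  qed
  have qar: "(Q, q', (r, a)) \<in> Ar (gobj_cat C G)"
  proof (rule gobj_ArI[OF df(2) X])
    fix \<gamma> u assume g: "\<gamma> \<in> Ar C" "u \<in> Ar C" "Dom C \<gamma> = Dom C u" "Cod C \<gamma> = G1 G" "Cod C u = Dom C (fst Q)" "d0 G \<cdot> \<gamma> = fst Q \<cdot> u"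
    have "act (r, a) \<gamma> (q' \<cdot> u) = q' \<cdot> act Q \<gamma> (s' \<cdot> q' \<cdot> u)"
      by (rule act_a) (use g qt(5-7) rx[of u] in simp_all)
    then show "q' \<cdot> act Q \<gamma> u = act (r, a) \<gamma> (q' \<cdot> u)" using coeq_act[OF qt(5,6) e(1) g] by simp
  qed (use qt in simp_all)
  have "coequalizer (gobj_cat C G) b c (Q, q', (r, a))"
    unfolding coequalizer_def
  proof (intro conjI ballI impI)
    fix zz assume zz: "zz \<in> Ar (gobj_cat C G)" "Dom (gobj_cat C G) zz = Cod (gobj_cat C G) b"
      "zz \<cdot>\<^bsub>gobj_cat C G\<^esub> b = zz \<cdot>\<^bsub>gobj_cat C G\<^esub> c"
    obtain z Z where z: "zz = (Q, z, Z)" using zz(2) by (cases zz) (simp add: b(1))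
    have za: "(Q, z, Z) \<in> Ar (gobj_cat C G)" using zz(1) by (simp only: z)
    have zfg: "z \<cdot> f = z \<cdot> g" using zz(3) by (simp add: z b(1) c(1))
    note dz = gobj_ArD[OF za]
    note dZ = gobjectD[OF dz(2)]
    have zt: "z \<in> Ar C" "Dom C z = Dom C (fst Q)" using dz by simp_all
    have zsq: "z \<cdot> s' \<cdot> q' = z"
    proof -
      have "z \<cdot> s' \<cdot> q' = z \<cdot> g \<cdot> t'" using e(4) by simp
      also have "\<dots> = z \<cdot> f \<cdot> t'" using reassoc[OF zfg, of t'] df(3-5) dg(3-5) tt(5-7) zt by simp
      also have "\<dots> = z" using e(3) zt by simp
      finally show ?thesis .
    qed
    have Zz: "fst Z \<cdot> z \<cdot> x = fst Q \<cdot> x" if "x \<in> Ar C" "Cod C x = Dom C (fst Q)" for x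
      using reassoc[OF dz(6), of x] dz(3-5) dZ that by simp
    have ka: "((r, a), z \<cdot> s', Z) \<in> Ar (gobj_cat C G)"
    proof (rule gobj_ArI[OF X dz(2)])
      show "fst Z \<cdot> z \<cdot> s' = fst (r, a)" using Zz[of s'] st(5-8) by simp
      fix \<gamma> u assume g: "\<gamma> \<in> Ar C" "u \<in> Ar C" "Dom C \<gamma> = Dom C u" "Cod C \<gamma> = G1 G" "Cod C u = Dom C (fst (r, a))" "d0 G \<cdot> \<gamma> = fst (r, a) \<cdot> u"
      have g': "Cod C u = Dom C r" "d0 G \<cdot> \<gamma> = r \<cdot> u" using g(5,6) by simp_all
      note B = aQ[OF g(1-4) g']
      have su: "s' \<cdot> u \<in> Ar C" "Dom C \<gamma> = Dom C (s' \<cdot> u)" "Cod C (s' \<cdot> u) = Dom C (fst Q)" using g(2,3) g' st(5-7) by simp_all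
      have "(z \<cdot> s') \<cdot> act (r, a) \<gamma> u = (z \<cdot> s' \<cdot> q') \<cdot> act Q \<gamma> (s' \<cdot> u)"
        unfolding act_a[OF g(1-4) g'] using B(1-3) zt st(5-7) qt(5-7) by simp
      also have "\<dots> = z \<cdot> act Q \<gamma> (s' \<cdot> u)" using zsq by simp
      also have "\<dots> = act Z \<gamma> (z \<cdot> s' \<cdot> u)" by (rule equivariantD[OF za g(1) su(1,2) g(4) su(3) B(5)])
      finally show "(z \<cdot> s') \<cdot> act (r, a) \<gamma> u = act Z \<gamma> ((z \<cdot> s') \<cdot> u)" using zt st(5-7) g(2) g' by simp
    qed (use dz(3-5) st(5-7) in simp_all)
    show "\<exists>!k. k \<in> hom (gobj_cat C G) (Cod (gobj_cat C G) (Q, q', (r, a))) (Cod (gobj_cat C G) zz) \<and>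
        k \<cdot>\<^bsub>gobj_cat C G\<^esub> (Q, q', (r, a)) = zz"
    proof (rule ex1I[of _ "((r, a), z \<cdot> s', Z)"])
      show "((r, a), z \<cdot> s', Z) \<in> hom (gobj_cat C G) (Cod (gobj_cat C G) (Q, q', (r, a))) (Cod (gobj_cat C G) zz) \<and>
        ((r, a), z \<cdot> s', Z) \<cdot>\<^bsub>gobj_cat C G\<^esub> (Q, q', (r, a)) = zz"
        using ka zsq zt st(5-7) qt(5-7) by (simp add: z)
      fix k assume k: "k \<in> hom (gobj_cat C G) (Cod (gobj_cat C G) (Q, q', (r, a))) (Cod (gobj_cat C G) zz) \<and>
        k \<cdot>\<^bsub>gobj_cat C G\<^esub> (Q, q', (r, a)) = zz"
      obtain k' where k': "k = ((r, a), k', Z)" using k by (cases k) (simp add: z)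
      have "((r, a), k', Z) \<in> Ar (gobj_cat C G)" using k unfolding k' mem_hom by blast
      note kt = gobj_ArD(3-5)[OF this]
      have "k' \<cdot> q' = z" using k by (simp add: k' z)
      from reassoc[OF this, of s'] have "k' = z \<cdot> s'" using kt qt(5-7) st(5-7) e(2) by simp
      then show "k = ((r, a), z \<cdot> s', Z)" by (simp add: k')
    qed
  qed (use qar e(1) in \<open>simp_all add: b(1) c(1)\<close>)
  \<comment> \<open>The quotient object is \<open>r\<close> itself, so the comparison isomorphism is
    the identity.\<close>
  moreover have "idt (slice C (G0 G)) r \<in> hom (slice C (G0 G)) r r \<and> is_iso (slice C (G0 G)) (idt (slice C (G0 G)) r)"
    using F.B.idt_in[of r] F.B.iso_idt[of r] qt(3,4) by simp
  moreover have "idt (slice C (G0 G)) r \<cdot>\<^bsub>slice C (G0 G)\<^esub> q = far forget (Q, q', (r, a))"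
    using qt(3-7) by (simp add: q')
  ultimately show "\<exists>k j. coequalizer (gobj_cat C G) b c k \<and>
      j \<in> hom (slice C (G0 G)) (Cod (slice C (G0 G)) q) (fob forget (Cod (gobj_cat C G) k)) \<and> is_iso (slice C (G0 G)) j \<and>
      j \<cdot>\<^bsub>slice C (G0 G)\<^esub> q = far forget k"
    by (intro exI[of _ "(Q, q', (r, a))"] exI[of _ "idt (slice C (G0 G)) r"]) (simp only: q' slice_simps(4) gobj_cat_simps(3) forget_simps fst_conv)
qed

end

section \<open>From groupoid actions to a stably Frobenius adjunction\<close>

text \<open>Every object of \<open>B\<close> is isomorphic to one in the image of \<open>P\<close>,
  so universality against the image suffices. It serves to recognize the values of a left adjoint of
  \<open>forget\<close> after \<open>Theta\<close> as free actions up to isomorphism.\<close>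

lemma universal_arrow_of_composite:
  fixes A :: "('o, 'a) cat" (structure)
  assumes R: "cat_functor B A R" and P: "ff_eso_functor B' B P"
    and u: "universal_arrow A B' (R \<circ>\<^sub>F P) X Q e"
  shows "universal_arrow A B R X (fob P Q) e"
proof -
  interpret R: cat_functor B A R by fact
  interpret P: ff_eso_functor B' B P by fact
  interpret RP: cat_functor B' A "R \<circ>\<^sub>F P" by (rule comp_functor[OF P.cat_functor_axioms R])
  have e: "Q \<in> Ob B'" "e \<in> Ar A" "Dom A e = X" "Cod A e = fob R (fob P Q)"
    using u unfolding universal_arrow_def by simp_all
  show ?thesis unfolding universal_arrow_def
  proof (intro conjI ballI)
    fix z c assume z: "z \<in> Ob B" and c: "c \<in> hom A X (fob R z)"
    obtain Y i j where Y: "Y \<in> Ob B'" and i: "i \<in> hom B z (fob P Y)" and j: "j \<in> hom B (fob P Y) z"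
      and ji: "j \<cdot>\<^bsub>B\<^esub> i = idt B z" "i \<cdot>\<^bsub>B\<^esub> j = idt B (fob P Y)" and iso: "is_iso B i" "is_iso B j"
      by (rule P.eso[OF z])
    have t: "c \<in> Ar A" "Dom A c = X" "Cod A c = fob R z" "i \<in> Ar B" "Dom B i = z" "Cod B i = fob P Y"
      "j \<in> Ar B" "Dom B j = fob P Y" "Cod B j = z" using c i j by simp_all
    obtain h where h0: "h \<in> hom B' Q Y" and he: "far (R \<circ>\<^sub>F P) h \<cdot> e = far R i \<cdot> c"
      by (rule universal_arrowE[OF u Y, of "far R i \<cdot> c"]) (use t in simp_all)
    have h: "h \<in> Ar B'" "Dom B' h = Q" "Cod B' h = Y" using h0 by simp_all
    have Rji: "far R j \<cdot> far R i \<cdot> y = y" if "y \<in> Ar A" "Cod A y = fob R z" for y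
      using arg_cong[OF ji(1), of "\<lambda>k. far R k \<cdot> y"] t that z by simp
    show "\<exists>!n. n \<in> hom B (fob P Q) z \<and> far R n \<cdot> e = c"
    proof (rule ex1I[of _ "j \<cdot>\<^bsub>B\<^esub> far P h"])
      show "j \<cdot>\<^bsub>B\<^esub> far P h \<in> hom B (fob P Q) z \<and> far R (j \<cdot>\<^bsub>B\<^esub> far P h) \<cdot> e = c"
        using h t e he Rji[of c] by simp
      fix n assume n': "n \<in> hom B (fob P Q) z \<and> far R n \<cdot> e = c"
      then have n: "n \<in> Ar B" "Dom B n = fob P Q" "Cod B n = z" "far R n \<cdot> e = c" by simp_all
      obtain k where k0: "k \<in> hom B' Q Y" and ke: "far P k = i \<cdot>\<^bsub>B\<^esub> n"
        by (rule P.full[OF e(1) Y, of "i \<cdot>\<^bsub>B\<^esub> n"]) (use n t in simp_all)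
      have "k = h"
        by (rule universal_arrow_unique[OF u RP.cat_functor_axioms]) (use h k0 he ke n t e in simp_all)
      then have "far P h = i \<cdot>\<^bsub>B\<^esub> n" using ke by simp
      then show "n = j \<cdot>\<^bsub>B\<^esub> far P h" using R.A.reassoc[OF ji(1), of n] n t by simp
    qed
  qed (use e in simp_all)
qed

context groupoid_actions
begin

lemma act_inverse:
  assumes x: "is_gobject C G x" and g: "\<gamma> \<in> Ar C" "Cod C \<gamma> = G1 G" and u: "u \<in> Ar C" "Dom C \<gamma> = Dom C u" "Cod C u = Dom C (fst x)"
  shows "d0 G \<cdot> \<gamma> = fst x \<cdot> u \<Longrightarrow> act x (ginv G \<cdot> \<gamma>) (act x \<gamma> u) = u"
    and "d1 G \<cdot> \<gamma> = fst x \<cdot> u \<Longrightarrow> act x \<gamma> (act x (ginv G \<cdot> \<gamma>) u) = u"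
proof -
  assume c: "d0 G \<cdot> \<gamma> = fst x \<cdot> u"
  have "act x (ginv G \<cdot> \<gamma>) (act x \<gamma> u) = act x (gm (ginv G \<cdot> \<gamma>) \<gamma>) u"
    by (rule act_assoc[OF x, symmetric, where Z = "Dom C u"]) (use g u c in simp_all)
  also have "\<dots> = u" using gm_inverse_left[OF g] act_unit[OF x u(1,3)] c by simp
  finally show "act x (ginv G \<cdot> \<gamma>) (act x \<gamma> u) = u" .
next
  assume c: "d1 G \<cdot> \<gamma> = fst x \<cdot> u"
  have "act x \<gamma> (act x (ginv G \<cdot> \<gamma>) u) = act x (gm \<gamma> (ginv G \<cdot> \<gamma>)) u"
    by (rule act_assoc[OF x, symmetric, where Z = "Dom C u"]) (use g u c in simp_all)
  also have "\<dots> = u" using gm_inverse_right[OF g] act_unit[OF x u(1,3)] c by simp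
  finally show "act x \<gamma> (act x (ginv G \<cdot> \<gamma>) u) = u" .
qed

lemma free_unit_simps:
  assumes f: "f \<in> Ar C" "Cod C f = G0 G"
  shows "free_unit f \<in> Ar C" "Dom C (free_unit f) = Dom C f" "Cod C (free_unit f) = Dom C (pb1 C (d0 G) f)"
    "pb1 C (d0 G) f \<cdot> free_unit f = gunit G \<cdot> f" "pb2 C (d0 G) f \<cdot> free_unit f = idt C (Dom C f)"
  using f by (simp_all add: free_unit_def d0_e)

text \<open>Multiplying \<gamma> by the unit at its source returns \<gamma>. This is the normal form
  of elements of a free action, with the unit map as generator.\<close>

lemma free_elements:
  assumes f: "f \<in> Ar C" "Cod C f = G0 G" and g: "\<gamma> \<in> Ar C" "v \<in> Ar C" "Dom C \<gamma> = Dom C v" "Cod C \<gamma> = G1 G" "Cod C v = Dom C f"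
    "d0 G \<cdot> \<gamma> = f \<cdot> v"
  shows "act (free_ob f) \<gamma> (free_unit f \<cdot> v) = pb_pair C (d0 G) f \<gamma> v"
proof -
  note e = free_unit_simps[OF f]
  define p q where "p = pb1 C (d0 G) f" and "q = pb2 C (d0 G) f"
  have pq: "p \<in> Ar C" "q \<in> Ar C" "Dom C q = Dom C p" "Cod C p = G1 G" "Cod C q = Dom C f"
    using f by (simp_all add: p_def q_def)
  define w where "w = free_unit f \<cdot> v"
  have w: "w \<in> Ar C" "Dom C w = Dom C v" "Cod C w = Dom C p" "p \<cdot> w = gunit G \<cdot> f \<cdot> v" "q \<cdot> w = v"
    using reassoc[OF e(4), of v] reassoc[OF e(5), of v] e(1-3) g f pq by (simp_all add: w_def p_def q_def)
  have "act (free_ob f) \<gamma> w = pb_pair C (d0 G) f (gm \<gamma> (p \<cdot> w)) (q \<cdot> w)"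
    unfolding p_def q_def by (rule free_act[OF f]) (use w g f in \<open>simp_all flip: p_def q_def\<close>)
  also have "gm \<gamma> (p \<cdot> w) = \<gamma>" unfolding w(4) g(6)[symmetric] by (rule gm_unit_right) (use g in simp_all)
  finally show ?thesis unfolding w(5) by (simp only: w_def)
qed

end

text \<open>The category \<open>D\<close> stands for the category of actions through
  \<open>Theta\<close>, and \<open>T\<close> is any left adjoint of the resulting forgetful functor;
  its values agree with the free actions constructed above only up to isomorphism.\<close>

locale groupoid_model =
  groupoid_actions C G + D: finite_limits D + Th: ff_eso_functor D "gobj_cat C G" Theta +
  TU: adjunction "slice C (G0 G)" D T "forget \<circ>\<^sub>F Theta" eta eps
  for C :: "('o, 'a) cat" (structure) and G and D :: "('p, 'b) cat" and Theta T eta eps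
begin

abbreviation compD (infixr \<open>\<odot>\<close> 70) where
  "g \<odot> f \<equiv> g \<cdot>\<^bsub>D\<^esub> f"

abbreviation "E \<equiv> slice C (G0 G)"

abbreviation "x f \<equiv> fob Theta (fob T f)"

abbreviation "base Y \<equiv> fst (fob Theta Y)"

definition "und h = fst (snd (far Theta h))"

definition "unt f = fst (snd (eta f))"

lemma Theta_ob: "Y \<in> Ob D \<Longrightarrow> is_gobject C G (fob Theta Y)"
  using Th.fob_Ob[of Y] by simp

lemma base_simps [simp]: "Y \<in> Ob D \<Longrightarrow> base Y \<in> Ar C" "Y \<in> Ob D \<Longrightarrow> Cod C (base Y) = G0 G"
  using gobjectD[OF Theta_ob] by simp_all

lemma T_ob [simp]: "\<lbrakk>f \<in> Ar C; Cod C f = G0 G\<rbrakk> \<Longrightarrow> fob T f \<in> Ob D"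
  using TU.L.fob_Ob[of f] by simp

lemma far_Theta:
  assumes h: "h \<in> Ar D"
  shows "far Theta h = (fob Theta (Dom D h), und h, fob Theta (Cod D h))"
    and "(fob Theta (Dom D h), und h, fob Theta (Cod D h)) \<in> Ar (gobj_cat C G)"
proof -
  obtain x k y where e: "far Theta h = (x, k, y)" by (cases "far Theta h")
  have "x = fob Theta (Dom D h)" "y = fob Theta (Cod D h)" using Th.Dom_far[OF h] Th.Cod_far[OF h] by (simp_all add: e)
  then show "far Theta h = (fob Theta (Dom D h), und h, fob Theta (Cod D h))" by (simp add: e und_def)
  then show "(fob Theta (Dom D h), und h, fob Theta (Cod D h)) \<in> Ar (gobj_cat C G)" using Th.far_Ar[OF h] by simp
qed

lemma und_simps [simp]:
  assumes "h \<in> Ar D"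
  shows "und h \<in> Ar C" "Dom C (und h) = Dom C (base (Dom D h))" "Cod C (und h) = Dom C (base (Cod D h))"
    "base (Cod D h) \<cdot> und h = base (Dom D h)"
  using gobj_ArD[OF far_Theta(2)[OF assms]] by simp_all

lemma und_comp: "\<lbrakk>h \<in> Ar D; k \<in> Ar D; Dom D h = Cod D k\<rbrakk> \<Longrightarrow> und (h \<odot> k) = und h \<cdot> und k"
  using Th.far_cmp[of h k] by (simp add: far_Theta(1))

lemma und_faithful: "\<lbrakk>h \<in> Ar D; k \<in> Ar D; Dom D h = Dom D k; Cod D h = Cod D k; und h = und k\<rbrakk> \<Longrightarrow> h = k"
  by (rule Th.faithful) (simp_all add: far_Theta(1))

lemma und_full:
  assumes "Y \<in> Ob D" "Z \<in> Ob D" "(fob Theta Y, k, fob Theta Z) \<in> Ar (gobj_cat C G)"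
  obtains h where "h \<in> hom D Y Z" "und h = k"
proof -
  obtain h where "h \<in> hom D Y Z" "far Theta h = (fob Theta Y, k, fob Theta Z)"
    by (rule Th.full[OF assms(1,2), of "(fob Theta Y, k, fob Theta Z)"]) (use assms(3) in simp_all)
  then show thesis using that by (simp add: und_def)
qed

lemma far_U: "h \<in> Ar D \<Longrightarrow> far (forget \<circ>\<^sub>F Theta) h = (base (Dom D h), und h, base (Cod D h))"
  by (simp add: far_Theta(1))

lemma eta_eq:
  assumes f: "f \<in> Ar C" "Cod C f = G0 G"
  shows "eta f = (f, unt f, fst (x f))" and "(f, unt f, fst (x f)) \<in> Ar E"
proof -
  obtain a k b where e: "eta f = (a, k, b)" by (cases "eta f")
  have t: "eta f \<in> Ar E" "Dom E (eta f) = f" "Cod E (eta f) = fst (x f)" using TU.unit_Ar[of f] f by simp_all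
  then have "a = f" "b = fst (x f)" unfolding e slice_simps(3,4) by blast+
  then show "eta f = (f, unt f, fst (x f))" by (simp add: e unt_def)
  then show "(f, unt f, fst (x f)) \<in> Ar E" using t(1) by (simp only:)
qed

lemma unt_simps [simp]:
  assumes "f \<in> Ar C" "Cod C f = G0 G"
  shows "unt f \<in> Ar C" "Dom C (unt f) = Dom C f" "Cod C (unt f) = Dom C (fst (x f))" "fst (x f) \<cdot> unt f = f"
  using slice_ArD(5-8)[OF eta_eq(2)[OF assms]] by simp_all

lemma equivariant:
  assumes h: "h \<in> Ar D" and g: "\<gamma> \<in> Ar C" "u \<in> Ar C" "Dom C \<gamma> = Dom C u" "Cod C \<gamma> = G1 G"
    "Cod C u = Dom C (base (Dom D h))" "d0 G \<cdot> \<gamma> = base (Dom D h) \<cdot> u"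
  shows "und h \<cdot> act (fob Theta (Dom D h)) \<gamma> u = act (fob Theta (Cod D h)) \<gamma> (und h \<cdot> u)"
  by (rule equivariantD[OF far_Theta(2)[OF h] g])

text \<open>The mediating map \<open>k\<close> exists in \<open>C\<close>; it is equivariant because
  its composites with the jointly monic \<open>und c\<close> and \<open>und d\<close> are, and full
  faithfulness of \<open>Theta\<close> brings it back to \<open>D\<close>.\<close>

lemma reflects_pullbacks:
  assumes ar: "a \<in> Ar D" "b \<in> Ar D" "c \<in> Ar D" "d \<in> Ar D" "Cod D a = Cod D b" "Dom D d = Dom D c" "Cod D c = Dom D a" "Cod D d = Dom D b"
    and pb: "is_pullback C (und a) (und b) (und c) (und d)"
  shows "is_pullback D a b c d"
proof (rule pullbackI)
  show "a \<odot> c = b \<odot> d"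
    by (rule und_faithful) (use ar pullbackD(6)[OF pb] in \<open>simp_all add: und_comp\<close>)
next
  fix Z s t assume "s \<in> hom D Z (Dom D a)" "t \<in> hom D Z (Dom D b)" and eq: "a \<odot> s = b \<odot> t"
  then have st: "s \<in> Ar D" "Dom D s = Z" "Cod D s = Dom D a" "t \<in> Ar D" "Dom D t = Z" "Cod D t = Dom D b" by simp_all
  have Z: "Z \<in> Ob D" using D.Dom_ob[OF st(1)] st(2) by simp
  have "und a \<cdot> und s = und b \<cdot> und t" using arg_cong[OF eq, of und] st ar by (simp add: und_comp)
  then obtain k where k: "k \<in> hom C (Dom C (base Z)) (Dom C (und c))" "und c \<cdot> k = und s" "und d \<cdot> k = und t"
    by - (rule pullbackE[OF pb, of "und s" "Dom C (base Z)" "und t"], use st ar in simp_all)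
  have kt: "k \<in> Ar C" "Dom C k = Dom C (base Z)" "Cod C k = Dom C (base (Dom D c))" using k(1) ar by simp_all
  have kc: "und c \<cdot> k \<cdot> v = und s \<cdot> v" "und d \<cdot> k \<cdot> v = und t \<cdot> v" if "v \<in> Ar C" "Cod C v = Dom C (base Z)" for v
    using reassoc[OF k(2), of v] reassoc[OF k(3), of v] kt ar that by simp_all
  have bk: "base (Dom D c) \<cdot> k = base Z"
  proof -
    have "base (Dom D c) \<cdot> k = (base (Dom D a) \<cdot> und c) \<cdot> k" using und_simps(4)[OF ar(3)] ar by simp
    also have "\<dots> = base (Dom D a) \<cdot> und s" using kt ar k(2) by simp
    also have "\<dots> = base Z" using und_simps(4)[OF st(1)] st by simp
    finally show ?thesis .
  qed
  have "(fob Theta Z, k, fob Theta (Dom D c)) \<in> Ar (gobj_cat C G)"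
  proof (rule gobj_ArI[OF Theta_ob[OF Z] Theta_ob])
    show "Dom D c \<in> Ob D" using ar by simp
    show "base (Dom D c) \<cdot> k = base Z" by (rule bk)
    fix \<gamma> u assume g: "\<gamma> \<in> Ar C" "u \<in> Ar C" "Dom C \<gamma> = Dom C u" "Cod C \<gamma> = G1 G" "Cod C u = Dom C (base Z)" "d0 G \<cdot> \<gamma> = base Z \<cdot> u"
    have c: "Dom D c \<in> Ob D" using ar by simp
    have ku: "k \<cdot> u \<in> Ar C" "Dom C \<gamma> = Dom C (k \<cdot> u)" "Cod C (k \<cdot> u) = Dom C (base (Dom D c))" "d0 G \<cdot> \<gamma> = base (Dom D c) \<cdot> k \<cdot> u"
      using g kt reassoc[OF bk, of u] c by simp_all
    note A1 = act_simps(1-3)[OF Theta_ob[OF Z] g] and A2 = act_simps(1-3)[OF Theta_ob[OF c] g(1) ku(1,2) g(4) ku(3,4)]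
    have S: "und s \<cdot> act (fob Theta Z) \<gamma> u = act (fob Theta (Dom D a)) \<gamma> (und s \<cdot> u)"
      "und t \<cdot> act (fob Theta Z) \<gamma> u = act (fob Theta (Dom D b)) \<gamma> (und t \<cdot> u)"
      using equivariant[OF st(1), of \<gamma> u] equivariant[OF st(4), of \<gamma> u] g st by simp_all
    have K: "und c \<cdot> act (fob Theta (Dom D c)) \<gamma> (k \<cdot> u) = act (fob Theta (Dom D a)) \<gamma> (und c \<cdot> k \<cdot> u)"
      "und d \<cdot> act (fob Theta (Dom D c)) \<gamma> (k \<cdot> u) = act (fob Theta (Dom D b)) \<gamma> (und d \<cdot> k \<cdot> u)"
      using equivariant[OF ar(3), of \<gamma> "k \<cdot> u"] equivariant[OF ar(4), of \<gamma> "k \<cdot> u"] g(1,4) ku ar by simp_all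
    show "k \<cdot> act (fob Theta Z) \<gamma> u = act (fob Theta (Dom D c)) \<gamma> (k \<cdot> u)"
      by (rule pullback_eqI[OF pb])
        (use A1 A2 kt ar kc[OF A1(1,3)] kc[OF g(2,5)] S K ku(2) g(3) in simp_all)
  qed (use kt in simp_all)
  then obtain h where h: "h \<in> hom D Z (Dom D c)" "und h = k"
    by - (rule und_full[OF Z], use ar in simp_all)
  have "c \<odot> h = s" by (rule und_faithful) (use h k(2) ar st in \<open>simp_all add: und_comp\<close>)
  moreover have "d \<odot> h = t" by (rule und_faithful) (use h k(3) ar st in \<open>simp_all add: und_comp\<close>)
  ultimately show "\<exists>h. h \<in> hom D Z (Dom D c) \<and> c \<odot> h = s \<and> d \<odot> h = t" using h(1) by blast
next
  fix Z h h' assume "h \<in> hom D Z (Dom D c)" "h' \<in> hom D Z (Dom D c)" and eq: "c \<odot> h = c \<odot> h'" "d \<odot> h = d \<odot> h'"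
  then have h: "h \<in> Ar D" "Dom D h = Z" "Cod D h = Dom D c" "h' \<in> Ar D" "Dom D h' = Z" "Cod D h' = Dom D c" by simp_all
  have u: "und c \<cdot> und h = und c \<cdot> und h'" "und d \<cdot> und h = und d \<cdot> und h'"
    using arg_cong[OF eq(1), of und] arg_cong[OF eq(2), of und] h ar by (simp_all add: und_comp)
  have "und h = und h'" by (rule pullback_eqI[OF pb]) (use h ar u in simp_all)
  then show "h = h'" by - (rule und_faithful, use h in simp_all)
qed (use ar in simp_all)

text \<open>Both \<open>x f\<close> and \<open>free_ob f\<close> are universal, so an isomorphism of
  actions matches their units. Being equivariant, it also matches the normal forms, through which
  statements about \<open>T\<close> are reduced to the explicit free action.\<close>

lemma free_comparison:
  assumes f: "f \<in> Ar C" "Cod C f = G0 G"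
  obtains k where "is_iso C k" "k \<in> hom C (Dom C (pb1 C (d0 G) f)) (Dom C (fst (x f)))"
    "\<And>\<gamma> v. \<lbrakk>\<gamma> \<in> Ar C; v \<in> Ar C; Dom C \<gamma> = Dom C v; Cod C \<gamma> = G1 G; Cod C v = Dom C f; d0 G \<cdot> \<gamma> = f \<cdot> v\<rbrakk> \<Longrightarrow>
      act (x f) \<gamma> (unt f \<cdot> v) = k \<cdot> pb_pair C (d0 G) f \<gamma> v"
proof -
  have "universal_arrow E D (forget \<circ>\<^sub>F Theta) f (fob T f) (eta f)" by (rule TU.universal_unit) (use f in simp)
  from universal_arrow_of_composite[OF forget_functor Th.ff_eso_functor_axioms this]
  have "universal_arrow E (gobj_cat C G) forget f (x f) (f, unt f, fst (x f))" by (simp only: eta_eq(1)[OF f])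
  then obtain \<kappa> where \<kappa>: "\<kappa> \<in> hom (gobj_cat C G) (free_ob f) (x f)" "is_iso (gobj_cat C G) \<kappa>"
    "far forget \<kappa> \<cdot>\<^bsub>E\<^esub> (f, free_unit f, fst (free_ob f)) = (f, unt f, fst (x f))"
    by (rule universal_arrow_iso[OF forget_functor free_universal[OF f]])
  obtain k where k: "\<kappa> = (free_ob f, k, x f)" using \<kappa>(1) by (cases \<kappa>) simp
  have ar: "(free_ob f, k, x f) \<in> Ar (gobj_cat C G)" using \<kappa>(1) unfolding k mem_hom by blast
  interpret F: cat_functor "gobj_cat C G" E forget by (rule forget_functor)
  note d = gobj_ArD[OF ar]
  note e = free_unit_simps[OF f]
  have sa: "(fst (free_ob f), k, fst (x f)) \<in> Ar E" using F.far_Ar[OF ar] unfolding forget_simps .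
  have iso: "is_iso C k" using F.far_iso[OF \<kappa>(2)] slice_iso_iff[OF sa] unfolding k forget_simps by simp
  have kf: "k \<cdot> free_unit f = unt f" using \<kappa>(3) unfolding k forget_simps slice_simps(6) by simp
  have dk: "Dom C k = Dom C (pb1 C (d0 G) f)" using d(4) f by simp
  show thesis
  proof (rule that[OF iso])
    show "k \<in> hom C (Dom C (pb1 C (d0 G) f)) (Dom C (fst (x f)))" using d(3,5) dk by simp
    fix \<gamma> v assume g: "\<gamma> \<in> Ar C" "v \<in> Ar C" "Dom C \<gamma> = Dom C v" "Cod C \<gamma> = G1 G" "Cod C v = Dom C f" "d0 G \<cdot> \<gamma> = f \<cdot> v"
    define w where "w = free_unit f \<cdot> v"
    have w: "w \<in> Ar C" "Dom C w = Dom C v" "Cod C w = Dom C (fst (free_ob f))" using e(1-3) g f by (simp_all add: w_def)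
    have fw: "fst (free_ob f) \<cdot> w = f \<cdot> v"
    proof -
      have "fst (free_ob f) \<cdot> free_unit f = f" using e f by (simp add: d1_e)
      then show ?thesis unfolding w_def using reassoc[of "fst (free_ob f)" "free_unit f" f v] e(1-3) g f by simp
    qed
    have kw: "k \<cdot> w = unt f \<cdot> v" unfolding w_def using reassoc[OF kf, of v] d(3) dk e(1-3) g by simp
    have "k \<cdot> act (free_ob f) \<gamma> w = act (x f) \<gamma> (k \<cdot> w)"
      by (rule equivariantD[OF ar]) (use g w fw in simp_all)
    then show "act (x f) \<gamma> (unt f \<cdot> v) = k \<cdot> pb_pair C (d0 G) f \<gamma> v"
      unfolding kw unfolding w_def free_elements[OF f g] by simp
  qed
qed

lemma free_element_exists:
  assumes f: "f \<in> Ar C" "Cod C f = G0 G" and y: "y \<in> Ar C" "Cod C y = Dom C (fst (x f))"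
  obtains \<gamma> v where "\<gamma> \<in> Ar C" "v \<in> Ar C" "Dom C \<gamma> = Dom C y" "Dom C v = Dom C y" "Cod C \<gamma> = G1 G" "Cod C v = Dom C f"
    "d0 G \<cdot> \<gamma> = f \<cdot> v" "act (x f) \<gamma> (unt f \<cdot> v) = y"
proof -
  obtain k where k: "is_iso C k" "k \<in> hom C (Dom C (pb1 C (d0 G) f)) (Dom C (fst (x f)))"
    and ak: "\<And>\<gamma> v. \<lbrakk>\<gamma> \<in> Ar C; v \<in> Ar C; Dom C \<gamma> = Dom C v; Cod C \<gamma> = G1 G; Cod C v = Dom C f; d0 G \<cdot> \<gamma> = f \<cdot> v\<rbrakk> \<Longrightarrow>
      act (x f) \<gamma> (unt f \<cdot> v) = k \<cdot> pb_pair C (d0 G) f \<gamma> v"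
    by (rule free_comparison[OF f]) (rule that)
  obtain l where l: "l \<in> hom C (Dom C (fst (x f))) (Dom C (pb1 C (d0 G) f))" "k \<cdot> l = idt C (Dom C (fst (x f)))"
    using is_isoE[OF k] by metis
  have kt: "k \<in> Ar C" "Dom C k = Dom C (pb1 C (d0 G) f)" "Cod C k = Dom C (fst (x f))"
    and lt: "l \<in> Ar C" "Dom C l = Dom C (fst (x f))" "Cod C l = Dom C (pb1 C (d0 G) f)" using k(2) l(1) by simp_all
  define z where "z = l \<cdot> y"
  have z: "z \<in> Ar C" "Dom C z = Dom C y" "Cod C z = Dom C (pb1 C (d0 G) f)" "k \<cdot> z = y"
    using lt y kt reassoc[OF l(2), of y] by (simp_all add: z_def)
  define p q where "p = pb1 C (d0 G) f" and "q = pb2 C (d0 G) f"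
  have pq: "p \<in> Ar C" "q \<in> Ar C" "Dom C q = Dom C p" "Cod C p = G1 G" "Cod C q = Dom C f" "d0 G \<cdot> p = f \<cdot> q"
    using f pb_comm[of "d0 G" f] by (simp_all add: p_def q_def)
  have zp: "Cod C z = Dom C p" using z(3) by (simp add: p_def)
  have c: "d0 G \<cdot> p \<cdot> z = f \<cdot> q \<cdot> z" using reassoc[OF pq(6), of z] pq(1-5) z(1) zp f by simp
  have "pb_pair C (d0 G) f (p \<cdot> z) (q \<cdot> z) = z"
    by (rule pb_eqI[of _ _ "d0 G" f])
      (use c pq(1-5) z(1) zp f pb_pair_simps[of "d0 G" f "p \<cdot> z" "q \<cdot> z"] in \<open>simp_all flip: p_def q_def\<close>)
  then have "act (x f) (p \<cdot> z) (unt f \<cdot> q \<cdot> z) = y"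
    using ak[of "p \<cdot> z" "q \<cdot> z"] c pq(1-5) z zp f by simp
  then show thesis
    by - (rule that[of "p \<cdot> z" "q \<cdot> z"], use c pq(1-5) z(1,2) zp in simp_all)
qed

lemma free_element_unique:
  assumes f: "f \<in> Ar C" "Cod C f = G0 G"
    and g: "\<gamma> \<in> Ar C" "v \<in> Ar C" "Dom C \<gamma> = Dom C v" "Cod C \<gamma> = G1 G" "Cod C v = Dom C f" "d0 G \<cdot> \<gamma> = f \<cdot> v"
    and g': "\<gamma>' \<in> Ar C" "v' \<in> Ar C" "Dom C \<gamma>' = Dom C v'" "Cod C \<gamma>' = G1 G" "Cod C v' = Dom C f" "d0 G \<cdot> \<gamma>' = f \<cdot> v'"
    and eq: "Dom C v = Dom C v'" "act (x f) \<gamma> (unt f \<cdot> v) = act (x f) \<gamma>' (unt f \<cdot> v')"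
  shows "\<gamma> = \<gamma>'" "v = v'"
proof -
  obtain k where k: "is_iso C k" "k \<in> hom C (Dom C (pb1 C (d0 G) f)) (Dom C (fst (x f)))"
    and ak: "\<And>\<gamma> v. \<lbrakk>\<gamma> \<in> Ar C; v \<in> Ar C; Dom C \<gamma> = Dom C v; Cod C \<gamma> = G1 G; Cod C v = Dom C f; d0 G \<cdot> \<gamma> = f \<cdot> v\<rbrakk> \<Longrightarrow>
      act (x f) \<gamma> (unt f \<cdot> v) = k \<cdot> pb_pair C (d0 G) f \<gamma> v"
    by (rule free_comparison[OF f]) (rule that)
  have kt: "Dom C k = Dom C (pb1 C (d0 G) f)" using k(2) by simp
  define a a' where "a = pb_pair C (d0 G) f \<gamma> v" and "a' = pb_pair C (d0 G) f \<gamma>' v'"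
  have a: "a \<in> Ar C" "Dom C a = Dom C v" "Cod C a = Dom C (pb1 C (d0 G) f)" "pb1 C (d0 G) f \<cdot> a = \<gamma>" "pb2 C (d0 G) f \<cdot> a = v"
    using g f by (simp_all add: a_def)
  have a': "a' \<in> Ar C" "Dom C a' = Dom C v'" "Cod C a' = Dom C (pb1 C (d0 G) f)" "pb1 C (d0 G) f \<cdot> a' = \<gamma>'" "pb2 C (d0 G) f \<cdot> a' = v'"
    using g' f by (simp_all add: a'_def)
  have "k \<cdot> a = k \<cdot> a'" using eq(2) unfolding ak[OF g] ak[OF g'] a_def a'_def .
  then have "a = a'" by - (rule iso_cancel_left[OF k(1)], use a a' kt in simp_all)
  then show "\<gamma> = \<gamma>'" "v = v'" using a(4,5) a'(4,5) by simp_all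
qed

text \<open>An element of \<open>fob T w\<close> is some \<gamma> acting on the unit at
  \<open>v\<close>. If it meets \<open>y\<close> over \<open>X\<close>, the inverse of \<gamma>
  moves \<open>y\<close> to \<open>y0\<close> with \<open>f' \<cdot> v = und g \<cdot> y0\<close>;
  the resulting point \<open>t\<close> of the original pullback, taken to its unit and moved by
  \<gamma>, is the element sought.\<close>

lemma frobenius_square:
  assumes X: "X \<in> Ob D" and f: "f \<in> Ar E" "Cod E f = base X" and g: "g \<in> Ar D" "Cod D g = X"
    and pb: "is_pullback E f (far (forget \<circ>\<^sub>F Theta) g) p q"
  shows "is_pullback D (eps X \<odot> far T f) g (far T p) (eps (Dom D g) \<odot> far T q)"
proof -
  let ?Y = "Dom D g" and ?o = "base X" and ?r = "base (Dom D g)"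
  have Y: "?Y \<in> Ob D" using g by simp
  obtain w f' where f': "f = (w, f', ?o)" using f(2) by (cases f) simp
  have fa: "(w, f', ?o) \<in> Ar E" using f(1) by (simp only: f')
  note wt = slice_ArD[OF fa]
  have ga: "(?r, und g, ?o) \<in> Ar E" using und_simps[OF g(1)] Y X g(2) by simp
  have Ug: "far (forget \<circ>\<^sub>F Theta) g = (?r, und g, ?o)" using far_U[OF g(1)] g(2) by simp
  note pq = pullbackD[OF pb[unfolded Ug f']]
  obtain r p' where p': "p = (r, p', w)" using pq(4) by (cases p) simp
  obtain q' where q': "q = (r, q', ?r)" using pq(3,5) unfolding p' by (cases q) simp
  have pa: "(r, p', w) \<in> Ar E" and qa: "(r, q', ?r) \<in> Ar E" using pq(1,2) by (simp_all only: p' q')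
  note rt = slice_ArD[OF pa] and qt = slice_ArD[OF qa]
  have pbC: "is_pullback C f' (und g) p' q'" using slice_pullback[OF fa ga] pb unfolding Ug f' p' q' by blast
  define F P Q where "F = eps X \<odot> far T f" and "P = far T p" and "Q = eps ?Y \<odot> far T q"
  have T1: "far T f \<in> Ar D" "Dom D (far T f) = fob T w" "Cod D (far T f) = fob T ?o"
    using TU.L.far_Ar[OF f(1)] TU.L.Dom_far[OF f(1)] TU.L.Cod_far[OF f(1)] f(2) f' by simp_all
  have T2: "P \<in> Ar D" "Dom D P = fob T r" "Cod D P = fob T w"
    using TU.L.far_Ar[OF pq(1)] TU.L.Dom_far[OF pq(1)] TU.L.Cod_far[OF pq(1)] p' by (simp_all add: P_def)
  have T3: "far T q \<in> Ar D" "Dom D (far T q) = fob T r" "Cod D (far T q) = fob T ?r"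
    using TU.L.far_Ar[OF pq(2)] TU.L.Dom_far[OF pq(2)] TU.L.Cod_far[OF pq(2)] q' by simp_all
  have ep: "eps X \<in> Ar D" "Dom D (eps X) = fob T ?o" "Cod D (eps X) = X" "eps ?Y \<in> Ar D" "Dom D (eps ?Y) = fob T ?r" "Cod D (eps ?Y) = ?Y"
    using TU.counit_Ar[OF X] TU.counit_Ar[OF Y] by simp_all
  have Ft: "F \<in> Ar D" "Dom D F = fob T w" "Cod D F = X" and Qt: "Q \<in> Ar D" "Dom D Q = fob T r" "Cod D Q = ?Y"
    using T1 T3 ep by (simp_all add: F_def Q_def)
  have UF: "far (forget \<circ>\<^sub>F Theta) F \<cdot>\<^bsub>E\<^esub> eta w = f" "far (forget \<circ>\<^sub>F Theta) Q \<cdot>\<^bsub>E\<^esub> eta r = q"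
    using TU.transpose_right'[of f X] TU.transpose_right'[of q ?Y] f pq(2) X Y unfolding F_def[symmetric] Q_def[symmetric]
    by (simp_all only: f' q' slice_simps(3,4) comp_functor_simps forget_simps)
  have UP: "far (forget \<circ>\<^sub>F Theta) P \<cdot>\<^bsub>E\<^esub> eta r = eta w \<cdot>\<^bsub>E\<^esub> p"
    using TU.unit_nat[OF pq(1)[folded p']] unfolding P_def by (simp only: p' slice_simps(3,4))
  have Fe: "und F \<cdot> unt w = f'" and Qe: "und Q \<cdot> unt r = q'"
    using UF unfolding far_U[OF Ft(1)] far_U[OF Qt(1)] eta_eq(1)[OF wt(1,2)] eta_eq(1)[OF rt(1,2)] slice_simps(6) f' q'
    by blast+
  have Pe: "und P \<cdot> unt r = unt w \<cdot> p'"
    using UP unfolding far_U[OF T2(1)] eta_eq(1)[OF wt(1,2)] eta_eq(1)[OF rt(1,2)] slice_simps(6) p' by blast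
  have comm: "F \<odot> P = g \<odot> Q"
    unfolding F_def P_def Q_def g(2)[symmetric]
    by (rule TU.transpose_square[OF g(1) f(1) _ pq(1) _ pq(2)])
      (use pq(3-6) f(2) g(2) in \<open>simp_all only: f' p' q' Ug[unfolded comp_functor_simps] slice_simps(3,4) comp_functor_simps forget_simps\<close>)
  have "is_pullback C (und F) (und g) (und P) (und Q)"
  proof (rule pullbackI)
    show "und F \<cdot> und P = und g \<cdot> und Q" using arg_cong[OF comm, of und] Ft T2 Qt g by (simp add: und_comp)
  next
    fix Z a y assume "a \<in> hom C Z (Dom C (und F))" "y \<in> hom C Z (Dom C (und g))" and eq: "und F \<cdot> a = und g \<cdot> y"
    then have ay: "a \<in> Ar C" "Dom C a = Z" "Cod C a = Dom C (fst (x w))" "y \<in> Ar C" "Dom C y = Z" "Cod C y = Dom C ?r"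
      using Ft g by simp_all
    obtain \<gamma> v where g0: "\<gamma> \<in> Ar C" "v \<in> Ar C" "Dom C \<gamma> = Dom C a" "Dom C v = Dom C a" "Cod C \<gamma> = G1 G" "Cod C v = Dom C w"
        "d0 G \<cdot> \<gamma> = w \<cdot> v" "act (x w) \<gamma> (unt w \<cdot> v) = a"
      by (rule free_element_exists[OF wt(1,2) ay(1,3)])
    define y0 where "y0 = act (fob Theta ?Y) (ginv G \<cdot> \<gamma>) y"
    define z where "z = act (x w) \<gamma> (unt w \<cdot> v)"
    have za: "z = a" using g0(8) by (simp add: z_def)
    have wo: "?o \<cdot> f' \<cdot> v = w \<cdot> v" using reassoc[OF wt(8), of v] wt(1-7) g0(2,6) by simp
    have uv: "unt w \<cdot> v \<in> Ar C" "Dom C \<gamma> = Dom C (unt w \<cdot> v)" "Cod C (unt w \<cdot> v) = Dom C (fst (x w))" "d0 G \<cdot> \<gamma> = fst (x w) \<cdot> unt w \<cdot> v"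
      using unt_simps[OF wt(1,2)] reassoc[OF unt_simps(4)[OF wt(1,2)], of v] g0(1-7) wt(1,2) by simp_all
    note wob = T_ob[OF wt(1,2)]
    have zd: "fst (x w) \<cdot> a = d1 G \<cdot> \<gamma>"
      using act_simps(4)[OF Theta_ob[OF wob] g0(1) uv(1,2) g0(5) uv(3,4)] za by (simp add: z_def)
    have "?o \<cdot> und F \<cdot> a = d1 G \<cdot> \<gamma>"
      using reassoc[OF und_simps(4)[OF Ft(1)], of a] ay Ft X wob zd by simp
    moreover have "?o \<cdot> und g \<cdot> y = ?r \<cdot> y"
      using reassoc[OF und_simps(4)[OF g(1)], of y] ay g X Y by simp
    ultimately have d1y: "d1 G \<cdot> \<gamma> = ?r \<cdot> y" using eq by simp
    have iy: "ginv G \<cdot> \<gamma> \<in> Ar C" "Dom C (ginv G \<cdot> \<gamma>) = Dom C y" "Cod C (ginv G \<cdot> \<gamma>) = G1 G" "d0 G \<cdot> ginv G \<cdot> \<gamma> = ?r \<cdot> y"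
      using g0(1,3,5) ay d1y by simp_all
    have y0: "y0 \<in> Ar C" "Dom C y0 = Z" "Cod C y0 = Dom C ?r"
      using act_simps(1-3)[OF Theta_ob[OF Y] iy(1) ay(4) iy(2,3) ay(6) iy(4)] ay by (simp_all add: y0_def)
    have "und F \<cdot> a = act (fob Theta X) \<gamma> (und F \<cdot> unt w \<cdot> v)"
      using equivariant[OF Ft(1), of \<gamma> "unt w \<cdot> v"] uv g0(1,5,8) Ft by simp
    also have "und F \<cdot> unt w \<cdot> v = f' \<cdot> v" using reassoc[OF Fe, of v] Ft unt_simps[OF wt(1,2)] g0(2,6) by simp
    finally have Fa: "und F \<cdot> a = act (fob Theta X) \<gamma> (f' \<cdot> v)" .
    have fv: "f' \<cdot> v \<in> Ar C" "Dom C \<gamma> = Dom C (f' \<cdot> v)" "Cod C (f' \<cdot> v) = Dom C ?o" using wt(5-7) g0(2,3,4,6) by simp_all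
    have "und g \<cdot> y0 = act (fob Theta X) (ginv G \<cdot> \<gamma>) (und g \<cdot> y)"
      using equivariant[OF g(1) iy(1) ay(4) iy(2,3) ay(6) iy(4)] g(2) by (simp add: y0_def)
    also have "\<dots> = f' \<cdot> v"
      unfolding eq[symmetric] Fa by (rule act_inverse(1)[OF Theta_ob[OF X] g0(1,5) fv]) (use g0(7) wo in simp)
    finally have "f' \<cdot> v = und g \<cdot> y0" ..
    then obtain t where "t \<in> hom C Z (Dom C p')" "p' \<cdot> t = v" "q' \<cdot> t = y0"
      by - (rule pullbackE[OF pbC, of v Z y0], use g0(2,4,6) ay(2) wt(6) y0 g in simp_all)
    then have t: "t \<in> Ar C" "Dom C t = Z" "Cod C t = Dom C p'" "p' \<cdot> t = v" "q' \<cdot> t = y0" by simp_all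
    have rtt: "r \<cdot> t = w \<cdot> v" using reassoc[OF rt(8), of t] rt(1-7) t by simp
    note urt = unt_simps[OF rt(1,2)]
    have ut: "unt r \<cdot> t \<in> Ar C" "Dom C \<gamma> = Dom C (unt r \<cdot> t)" "Cod C (unt r \<cdot> t) = Dom C (fst (x r))" "d0 G \<cdot> \<gamma> = fst (x r) \<cdot> unt r \<cdot> t"
      using urt reassoc[OF urt(4), of t] t rt(6) g0(3,7) ay rtt T_ob[OF rt(1,2)] by simp_all
    define h where "h = act (x r) \<gamma> (unt r \<cdot> t)"
    have h: "h \<in> Ar C" "Dom C h = Z" "Cod C h = Dom C (fst (x r))"
      using act_simps(1-3)[OF Theta_ob[OF T_ob[OF rt(1,2)]] g0(1) ut(1,2) g0(5) ut(3,4)] urt t rt(6) by (simp_all add: h_def)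
    have Pt: "und P \<cdot> unt r \<cdot> t = unt w \<cdot> v" "und Q \<cdot> unt r \<cdot> t = y0"
      using reassoc[OF Pe, of t] reassoc[OF Qe, of t] T2 Qt urt rt(5-7) qt(5-7) t unt_simps[OF wt(1,2)] by simp_all
    have "und P \<cdot> h = a"
      using equivariant[OF T2(1), of \<gamma> "unt r \<cdot> t"] T2(2,3) g0(1,5,8) ut Pt by (simp add: h_def)
    moreover have "und Q \<cdot> h = y"
    proof -
      have "und Q \<cdot> h = act (fob Theta ?Y) \<gamma> y0"
        using equivariant[OF Qt(1), of \<gamma> "unt r \<cdot> t"] Qt(2,3) g0(1,5) ut Pt by (simp add: h_def)
      also have "\<dots> = y"
        unfolding y0_def by (rule act_inverse(2)[OF Theta_ob[OF Y] g0(1,5) ay(4) _ ay(6) d1y]) (use g0(3) ay in simp)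
      finally show ?thesis .
    qed
    ultimately show "\<exists>h. h \<in> hom C Z (Dom C (und P)) \<and> und P \<cdot> h = a \<and> und Q \<cdot> h = y"
      using h T2 by (intro exI[of _ h]) simp
  next
    fix Z h h' assume "h \<in> hom C Z (Dom C (und P))" "h' \<in> hom C Z (Dom C (und P))" and eq: "und P \<cdot> h = und P \<cdot> h'" "und Q \<cdot> h = und Q \<cdot> h'"
    then have h: "h \<in> Ar C" "Dom C h = Z" "Cod C h = Dom C (fst (x r))" "h' \<in> Ar C" "Dom C h' = Z" "Cod C h' = Dom C (fst (x r))"
      using T2 by simp_all
    note urt = unt_simps[OF rt(1,2)]
    have elt: "und P \<cdot> act (x r) \<gamma> (unt r \<cdot> t) = act (x w) \<gamma> (unt w \<cdot> p' \<cdot> t) \<and>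
        und Q \<cdot> act (x r) \<gamma> (unt r \<cdot> t) = act (fob Theta ?Y) \<gamma> (q' \<cdot> t) \<and>
        d0 G \<cdot> \<gamma> = w \<cdot> p' \<cdot> t \<and> d0 G \<cdot> \<gamma> = ?r \<cdot> q' \<cdot> t"
      if t: "\<gamma> \<in> Ar C" "t \<in> Ar C" "Dom C \<gamma> = Dom C t" "Cod C \<gamma> = G1 G" "Cod C t = Dom C r" "d0 G \<cdot> \<gamma> = r \<cdot> t" for \<gamma> t
    proof -
      have ut: "unt r \<cdot> t \<in> Ar C" "Dom C \<gamma> = Dom C (unt r \<cdot> t)" "Cod C (unt r \<cdot> t) = Dom C (fst (x r))" "d0 G \<cdot> \<gamma> = fst (x r) \<cdot> unt r \<cdot> t"
        using urt reassoc[OF urt(4), of t] t T_ob[OF rt(1,2)] by simp_all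
      have Pt: "und P \<cdot> unt r \<cdot> t = unt w \<cdot> p' \<cdot> t" "und Q \<cdot> unt r \<cdot> t = q' \<cdot> t"
        using reassoc[OF Pe, of t] reassoc[OF Qe, of t] T2 Qt urt rt(5-7) qt(5-7) t(2,5) unt_simps[OF wt(1,2)] by simp_all
      show ?thesis
        using equivariant[OF T2(1), of \<gamma> "unt r \<cdot> t"] equivariant[OF Qt(1), of \<gamma> "unt r \<cdot> t"] T2(2,3) Qt(2,3) t(1,4,6) ut Pt
          reassoc[OF rt(8), of t] reassoc[OF qt(8), of t] rt(3-7) qt(3-7) t(2,5) by simp
    qed
    obtain \<gamma> t where g: "\<gamma> \<in> Ar C" "t \<in> Ar C" "Dom C \<gamma> = Dom C h" "Dom C t = Dom C h" "Cod C \<gamma> = G1 G" "Cod C t = Dom C r"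
        "d0 G \<cdot> \<gamma> = r \<cdot> t" "act (x r) \<gamma> (unt r \<cdot> t) = h"
      by (rule free_element_exists[OF rt(1,2) h(1,3)])
    obtain \<delta> s where d: "\<delta> \<in> Ar C" "s \<in> Ar C" "Dom C \<delta> = Dom C h'" "Dom C s = Dom C h'" "Cod C \<delta> = G1 G" "Cod C s = Dom C r"
        "d0 G \<cdot> \<delta> = r \<cdot> s" "act (x r) \<delta> (unt r \<cdot> s) = h'"
      by (rule free_element_exists[OF rt(1,2) h(4,6)])
    have D: "Dom C \<gamma> = Dom C t" "Dom C \<delta> = Dom C s" "Dom C t = Dom C s" using g(3,4) d(3,4) h(2,5) by simp_all
    note eg = elt[OF g(1,2) D(1) g(5-7)] and ed = elt[OF d(1,2) D(2) d(5-7)]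
    have pt: "p' \<cdot> t \<in> Ar C" "Dom C \<gamma> = Dom C (p' \<cdot> t)" "Cod C (p' \<cdot> t) = Dom C w" "q' \<cdot> t \<in> Ar C" "Dom C \<gamma> = Dom C (q' \<cdot> t)" "Cod C (q' \<cdot> t) = Dom C ?r"
      using rt(5-7) qt(5-7) g(2,6) D by simp_all
    have ps: "p' \<cdot> s \<in> Ar C" "Dom C \<delta> = Dom C (p' \<cdot> s)" "Cod C (p' \<cdot> s) = Dom C w" "q' \<cdot> s \<in> Ar C" "Dom C \<delta> = Dom C (q' \<cdot> s)" "Cod C (q' \<cdot> s) = Dom C ?r"
      using rt(5-7) qt(5-7) d(2,6) D by simp_all
    have dd: "d0 G \<cdot> \<gamma> = w \<cdot> p' \<cdot> t" "d0 G \<cdot> \<gamma> = ?r \<cdot> q' \<cdot> t" "d0 G \<cdot> \<delta> = w \<cdot> p' \<cdot> s" "d0 G \<cdot> \<delta> = ?r \<cdot> q' \<cdot> s"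
      using eg ed by blast+
    \<comment> \<open>The first projections lie in a free action, whose normal form gives
      \<open>\<gamma> = \<delta>\<close> at once; only then can \<gamma> be cancelled in the second
      projections.\<close>
    have "act (x w) \<gamma> (unt w \<cdot> p' \<cdot> t) = act (x w) \<delta> (unt w \<cdot> p' \<cdot> s)"
      using eg ed eq(1) g(8) d(8) by metis
    moreover have "Dom C (p' \<cdot> t) = Dom C (p' \<cdot> s)" using pt(2) ps(2) D by metis
    ultimately have e1: "\<gamma> = \<delta>" "p' \<cdot> t = p' \<cdot> s"
      using free_element_unique[OF wt(1,2) g(1) pt(1,2) g(5) pt(3) dd(1) d(1) ps(1,2) d(5) ps(3) dd(3)] by blast+
    have "act (fob Theta ?Y) \<gamma> (q' \<cdot> t) = act (fob Theta ?Y) \<gamma> (q' \<cdot> s)"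
      using eg ed eq(2) g(8) d(8) e1(1) by metis
    then have e2: "q' \<cdot> t = q' \<cdot> s"
      using act_inverse(1)[OF Theta_ob[OF Y] g(1,5) pt(4-6) dd(2)] act_inverse(1)[OF Theta_ob[OF Y] d(1,5) ps(4-6) dd(4)] e1(1) by metis
    have "t = s"
      by (rule pullback_eqI[OF pbC _ _ _ _ _ e1(2) e2]) (use g(2,6) d(2,6) D rt(6) wt(5) und_simps(1)[OF assms(4)] in simp_all)
    then show "h = h'" using g(8) d(8) e1(1) by simp
  qed (use Ft T2 Qt g in simp_all)
  then show ?thesis
    unfolding F_def[symmetric] P_def[symmetric] Q_def[symmetric]
    by - (rule reflects_pullbacks, use Ft T2 Qt g in simp_all)
qed

lemma stably_frobenius: "stably_frobenius E D T (forget \<circ>\<^sub>F Theta) eps"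
  unfolding stably_frobenius_def
proof
  fix X assume X: "X \<in> Ob D"
  show "frobenius_at E D T (forget \<circ>\<^sub>F Theta) eps X"
    by (rule TU.frobenius_atI[OF slice_has_pullbacks[OF has_pullbacks] D.has_pullbacks X])
      (rule frobenius_square, use X in simp_all)
qed

text \<open>Maps from \<open>fob S (fob T f)\<close> to \<open>X\<close> are maps from
  \<open>fob T f\<close> to \<open>fob Dst X\<close>, hence slice maps from \<open>f\<close> to the
  projection of the product of \<open>G0 G\<close> and \<open>X\<close>, hence maps from
  \<open>Dom C f\<close> to \<open>X\<close>. Both objects represent the same functor, and
  \<open>a f\<close> is the universal element, invertible by uniqueness of factorizations.\<close>

lemma over_base:
  assumes SD: "adjunction D C S Dst etaD epsD" and iso: "naturally_isomorphic C (gobj_cat C G) (Theta \<circ>\<^sub>F Dst) (gstar C G)"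
  shows "naturally_isomorphic E C (S \<circ>\<^sub>F T) (slice_dom C)"
proof -
  interpret SD: adjunction D C S Dst etaD epsD by fact
  obtain \<alpha> \<beta> where ab: "\<And>X. X \<in> Ob C \<Longrightarrow> \<alpha> X \<in> hom (gobj_cat C G) (fob (Theta \<circ>\<^sub>F Dst) X) (fob (gstar C G) X)"
    "\<And>X. X \<in> Ob C \<Longrightarrow> \<beta> X \<in> hom (gobj_cat C G) (fob (gstar C G) X) (fob (Theta \<circ>\<^sub>F Dst) X)"
    "\<And>X. X \<in> Ob C \<Longrightarrow> \<beta> X \<cdot>\<^bsub>gobj_cat C G\<^esub> \<alpha> X = idt (gobj_cat C G) (fob (Theta \<circ>\<^sub>F Dst) X)"
    "\<And>X. X \<in> Ob C \<Longrightarrow> \<alpha> X \<cdot>\<^bsub>gobj_cat C G\<^esub> \<beta> X = idt (gobj_cat C G) (fob (gstar C G) X)"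
    "\<And>f. f \<in> Ar C \<Longrightarrow> \<alpha> (Cod C f) \<cdot>\<^bsub>gobj_cat C G\<^esub> far (Theta \<circ>\<^sub>F Dst) f = far (gstar C G) f \<cdot>\<^bsub>gobj_cat C G\<^esub> \<alpha> (Dom C f)"
    by (rule naturally_isomorphicE[OF iso]) (rule that)
  define b b' where "b X = fst (snd (\<alpha> X))" and "b' X = fst (snd (\<beta> X))" for X
  have al: "\<alpha> X = (fob Theta (fob Dst X), b X, gstar_ob C G X)" and be: "\<beta> X = (gstar_ob C G X, b' X, fob Theta (fob Dst X))"
    if "X \<in> Ob C" for X
    using ab(1,2)[OF that] unfolding b_def b'_def by (cases "\<alpha> X", cases "\<beta> X", simp add: gstar_def)+
  have fst_gstar: "fst (gstar_ob C G X) = prd1 C (G0 G) X" for X by (simp add: gstar_ob_def Let_def)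
  have bt: "b X \<in> Ar C" "Dom C (b X) = Dom C (base (fob Dst X))" "Cod C (b X) = Dom C (prd1 C (G0 G) X)"
    "prd1 C (G0 G) X \<cdot> b X = base (fob Dst X)" if X: "X \<in> Ob C" for X
  proof -
    have "(fob Theta (fob Dst X), b X, gstar_ob C G X) \<in> Ar (gobj_cat C G)" using ab(1)[OF X] unfolding al[OF X] mem_hom by blast
    from gobj_ArD[OF this] show "b X \<in> Ar C" "Dom C (b X) = Dom C (base (fob Dst X))" "Cod C (b X) = Dom C (prd1 C (G0 G) X)"
      "prd1 C (G0 G) X \<cdot> b X = base (fob Dst X)" by (simp_all add: fst_gstar)
  qed
  have bt': "b' X \<in> Ar C" "Dom C (b' X) = Dom C (prd1 C (G0 G) X)" "Cod C (b' X) = Dom C (base (fob Dst X))"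
    "base (fob Dst X) \<cdot> b' X = prd1 C (G0 G) X" if X: "X \<in> Ob C" for X
  proof -
    have "(gstar_ob C G X, b' X, fob Theta (fob Dst X)) \<in> Ar (gobj_cat C G)" using ab(2)[OF X] unfolding be[OF X] mem_hom by blast
    from gobj_ArD[OF this] show "b' X \<in> Ar C" "Dom C (b' X) = Dom C (prd1 C (G0 G) X)" "Cod C (b' X) = Dom C (base (fob Dst X))"
      "base (fob Dst X) \<cdot> b' X = prd1 C (G0 G) X" by (simp_all add: fst_gstar)
  qed
  have b'b: "b' X \<cdot> b X = idt C (Dom C (base (fob Dst X)))" and bb': "b X \<cdot> b' X = idt C (Dom C (prd1 C (G0 G) X))" if X: "X \<in> Ob C" for X
    using ab(3,4)[OF X] by (simp_all add: al[OF X] be[OF X] fst_gstar gstar_def)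
  have bnat: "b (Cod C k) \<cdot> und (far Dst k) = prd_map C (idt C (G0 G)) k \<cdot> b (Dom C k)" if k: "k \<in> Ar C" for k
    using ab(5)[OF k] k by (simp add: al far_Theta(1) gstar_def)
  \<comment> \<open>The underlying object of \<open>fob Dst X\<close> is the product of
    \<open>G0 G\<close> and \<open>X\<close> up to \<open>b X\<close>; this is its projection to
    \<open>X\<close>.\<close>
  define j where "j X = prd2 C (G0 G) X \<cdot> b X" for X
  have jt: "j X \<in> Ar C" "Dom C (j X) = Dom C (base (fob Dst X))" "Cod C (j X) = X" if "X \<in> Ob C" for X
    using that bt[OF that] by (simp_all add: j_def)
  have jnat: "j (Cod C k) \<cdot> und (far Dst k) = k \<cdot> j (Dom C k)" if k: "k \<in> Ar C" for k
  proof -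
    have "j (Cod C k) \<cdot> und (far Dst k) = prd2 C (G0 G) (Cod C k) \<cdot> prd_map C (idt C (G0 G)) k \<cdot> b (Dom C k)"
      using bnat[OF k] bt[of "Cod C k"] k by (simp add: j_def)
    also have "\<dots> = k \<cdot> j (Dom C k)"
      using reassoc[OF prd_map_simps(5)[of "idt C (G0 G)" k], of "b (Dom C k)"] bt[of "Dom C k"] k by (simp add: j_def)
    finally show ?thesis .
  qed
  have ext: "\<exists>!h. h \<in> hom D (fob T f) (fob Dst X) \<and> j X \<cdot> und h \<cdot> unt f = w"
    if f: "f \<in> Ar C" "Cod C f = G0 G" and w: "w \<in> Ar C" "Dom C w = Dom C f" "Cod C w = X" and X: "X \<in> Ob C" for f w X
  proof -
    note ut = unt_simps[OF f]
    have DX: "fob Dst X \<in> Ob D" using X by simp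
    define m where "m = prd_pair C (G0 G) X f w"
    have m: "m \<in> Ar C" "Dom C m = Dom C f" "Cod C m = Dom C (prd1 C (G0 G) X)" "prd1 C (G0 G) X \<cdot> m = f" "prd2 C (G0 G) X \<cdot> m = w"
      using f w X by (simp_all add: m_def)
    have bm: "base (fob Dst X) \<cdot> b' X \<cdot> m = f" using reassoc[OF bt'(4)[OF X], of m] bt'(1-3)[OF X] m X by simp
    have key: "j X \<cdot> und h \<cdot> unt f = w \<longleftrightarrow> far (forget \<circ>\<^sub>F Theta) h \<cdot>\<^bsub>E\<^esub> eta f = (f, b' X \<cdot> m, base (fob Dst X))"
      if h': "h \<in> hom D (fob T f) (fob Dst X)" for h
    proof -
      have h: "h \<in> Ar D" "Dom D h = fob T f" "Cod D h = fob Dst X" using h' by simp_all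
      define y where "y = und h \<cdot> unt f"
      have y: "y \<in> Ar C" "Dom C y = Dom C f" "Cod C y = Dom C (base (fob Dst X))"
        using h ut by (simp_all add: y_def)
      have base_y: "base (fob Dst X) \<cdot> y = f" 
        unfolding y_def using reassoc[OF und_simps(4)[OF h(1)], of "unt f"] h ut DX T_ob[OF f] by simp
      have pby: "prd1 C (G0 G) X \<cdot> b X \<cdot> y = f"
        using reassoc[OF bt(4)[OF X], of y] bt(1-3)[OF X] y base_y X by simp
      have "j X \<cdot> y = w \<longleftrightarrow> b X \<cdot> y = m"
      proof
        assume a: "j X \<cdot> y = w"
        then have "prd2 C (G0 G) X \<cdot> b X \<cdot> y = w" using bt(1-3)[OF X] y X by (simp add: j_def)
        then show "b X \<cdot> y = m"
          by - (rule prd_eqI[of _ _ "G0 G" X], use pby m bt(1-3)[OF X] y X in simp_all)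
      next
        assume a: "b X \<cdot> y = m"
        then show "j X \<cdot> y = w" using bt(1-3)[OF X] y X m(5) by (simp add: j_def)
      qed
      also have "\<dots> \<longleftrightarrow> y = b' X \<cdot> m"
      proof
        assume "b X \<cdot> y = m"
        then show "y = b' X \<cdot> m" using reassoc[OF b'b[OF X], of y] bt(1-3)[OF X] bt'(1-3)[OF X] y by auto
      next
        assume "y = b' X \<cdot> m"
        then show "b X \<cdot> y = m" using reassoc[OF bb'[OF X], of m] bt(1-3)[OF X] bt'(1-3)[OF X] m by simp
      qed
      finally show ?thesis unfolding far_U[OF h(1)] eta_eq(1)[OF f] h(2,3) slice_simps(6) y_def by simp
    qed
    have U: "universal_arrow E D (forget \<circ>\<^sub>F Theta) f (fob T f) (eta f)" by (rule TU.universal_unit) (use f in simp)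
    have c: "(f, b' X \<cdot> m, base (fob Dst X)) \<in> hom E f (fob (forget \<circ>\<^sub>F Theta) (fob Dst X))"
      using bm bt'(1-3)[OF X] m f DX by simp
    have "\<exists>!h. h \<in> hom D (fob T f) (fob Dst X) \<and> far (forget \<circ>\<^sub>F Theta) h \<cdot>\<^bsub>E\<^esub> eta f = (f, b' X \<cdot> m, base (fob Dst X))"
      using U c DX unfolding universal_arrow_def by blast
    then show ?thesis using key by blast
  qed
  \<comment> \<open>The map that corresponds to the identity of \<open>fob S (fob T f)\<close> under
    the chain of bijections.\<close>
  define a where "a f = j (fob S (fob T f)) \<cdot> und (etaD (fob T f)) \<cdot> unt f" for f
  have at: "a f \<in> Ar C" "Dom C (a f) = Dom C f" "Cod C (a f) = fob S (fob T f)" if f: "f \<in> Ar C" "Cod C f = G0 G" for f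
    using jt[of "fob S (fob T f)"] unt_simps[OF f] T_ob[OF f] by (simp_all add: a_def)
  have ka: "k \<cdot> a f = j (Cod C k) \<cdot> und (far Dst k \<odot> etaD (fob T f)) \<cdot> unt f"
    if f: "f \<in> Ar C" "Cod C f = G0 G" and k: "k \<in> Ar C" "Dom C k = fob S (fob T f)" for f k
  proof -
    note ut = unt_simps[OF f] and To = T_ob[OF f]
    have "k \<cdot> a f = (k \<cdot> j (Dom C k)) \<cdot> und (etaD (fob T f)) \<cdot> unt f"
      using k jt[of "Dom C k"] ut To by (simp add: a_def)
    also have "\<dots> = j (Cod C k) \<cdot> und (far Dst k) \<cdot> und (etaD (fob T f)) \<cdot> unt f"
      unfolding jnat[OF k(1), symmetric] using k jt[of "Cod C k"] ut To by simp
    also have "und (far Dst k) \<cdot> und (etaD (fob T f)) \<cdot> unt f = und (far Dst k \<odot> etaD (fob T f)) \<cdot> unt f"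
      using k ut To by (simp add: und_comp)
    finally show ?thesis .
  qed
  have uniq: "\<exists>!k. k \<in> hom C (fob S (fob T f)) X \<and> k \<cdot> a f = w"
    if f: "f \<in> Ar C" "Cod C f = G0 G" and w: "w \<in> Ar C" "Dom C w = Dom C f" "Cod C w = X" and X: "X \<in> Ob C" for f w X
  proof -
    note To = T_ob[OF f]
    obtain h where h: "h \<in> hom D (fob T f) (fob Dst X)" "j X \<cdot> und h \<cdot> unt f = w"
      and hu: "\<And>h'. h' \<in> hom D (fob T f) (fob Dst X) \<Longrightarrow> j X \<cdot> und h' \<cdot> unt f = w \<Longrightarrow> h' = h"
      using ext[OF f w X] by blast
    note UU = SD.universal_unit[OF To]
    obtain k where k: "k \<in> hom C (fob S (fob T f)) X" "far Dst k \<odot> etaD (fob T f) = h"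
      by (rule universal_arrowE[OF UU X h(1)])
    show ?thesis
    proof (rule ex1I[of _ k])
      show "k \<in> hom C (fob S (fob T f)) X \<and> k \<cdot> a f = w" using ka[OF f, of k] k h by simp
      fix k' assume k': "k' \<in> hom C (fob S (fob T f)) X \<and> k' \<cdot> a f = w"
      then have kt': "k' \<in> Ar C" "Dom C k' = fob S (fob T f)" "Cod C k' = X" "k' \<cdot> a f = w" by simp_all
      have "far Dst k' \<odot> etaD (fob T f) = h"
        by (rule hu) (use kt' To ka[OF f kt'(1,2)] in simp_all)
      then show "k' = k"
        by - (rule universal_arrow_unique[OF UU SD.R.cat_functor_axioms], use kt' k in simp_all)
    qed
  qed
  have iso: "is_iso C (a f)" if f: "f \<in> Ar C" "Cod C f = G0 G" for f
  proof -
    note A = at[OF f] and To = T_ob[OF f]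
    obtain k where k: "k \<in> hom C (fob S (fob T f)) (Dom C f)" "k \<cdot> a f = idt C (Dom C f)"
      using uniq[OF f, of "idt C (Dom C f)" "Dom C f"] f by auto
    have "a f \<cdot> k = idt C (fob S (fob T f))"
    proof -
      have "\<exists>!l. l \<in> hom C (fob S (fob T f)) (fob S (fob T f)) \<and> l \<cdot> a f = a f"
        by (rule uniq[OF f A]) (use To in simp)
      moreover have "(a f \<cdot> k) \<cdot> a f = a f" using k A by simp
      moreover have "idt C (fob S (fob T f)) \<cdot> a f = a f" using A by simp
      moreover have "a f \<cdot> k \<in> hom C (fob S (fob T f)) (fob S (fob T f))" "idt C (fob S (fob T f)) \<in> hom C (fob S (fob T f)) (fob S (fob T f))"
        using k A To by simp_all
      ultimately show ?thesis by blast
    qed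
    then show ?thesis by - (rule is_isoI[OF _ k(1) k(2)], use A in simp_all)
  qed
  have "naturally_isomorphic E C (slice_dom C) (S \<circ>\<^sub>F T)"
  proof (rule naturally_isomorphicI[where \<alpha> = a])
    show "cat_functor E C (slice_dom C)" by (rule slice_dom_functor)
    show "cat_functor E C (S \<circ>\<^sub>F T)" by (rule comp_functor[OF TU.L.cat_functor_axioms SD.L.cat_functor_axioms])
    show "a f \<in> hom C (fob (slice_dom C) f) (fob (S \<circ>\<^sub>F T) f)" if "f \<in> Ob E" for f using at[of f] that by simp
    show "is_iso C (a f)" if "f \<in> Ob E" for f using iso[of f] that by simp
  next
    fix c assume c: "c \<in> Ar E"
    then obtain f h g where e: "c = (f, h, g)" "(f, h, g) \<in> Ar E" by (rule slice_ArE)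
    note d = slice_ArD[OF e(2)]
    note uf = unt_simps[OF d(1,2)] and ug = unt_simps[OF d(3,4)]
    note Tf = T_ob[OF d(1,2)] and Tg = T_ob[OF d(3,4)]
    define P where "P = far T c"
    have P: "P \<in> Ar D" "Dom D P = fob T f" "Cod D P = fob T g"
      using TU.L.far_Ar[OF c] TU.L.Dom_far[OF c] TU.L.Cod_far[OF c] e(1) by (simp_all add: P_def)
    have Pe: "und P \<cdot> unt f = unt g \<cdot> h"
      using TU.unit_nat[OF e(2)] unfolding e(1)[symmetric] P_def[symmetric] far_U[OF P(1)] P(2,3) unfolding e(1) slice_simps(3,4) eta_eq(1)[OF d(1,2)] eta_eq(1)[OF d(3,4)] slice_simps(6)
      by blast
    have "far S P \<cdot> a f = j (fob S (fob T g)) \<cdot> und (far Dst (far S P) \<odot> etaD (fob T f)) \<cdot> unt f"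
      using ka[OF d(1,2), of "far S P"] P by simp
    also have "far Dst (far S P) \<odot> etaD (fob T f) = etaD (fob T g) \<odot> P" using SD.unit_nat[OF P(1)] P(2,3) by simp
    also have "und (etaD (fob T g) \<odot> P) \<cdot> unt f = und (etaD (fob T g)) \<cdot> unt g \<cdot> h"
      using P Pe uf Tg by (simp add: und_comp)
    also have "j (fob S (fob T g)) \<cdot> und (etaD (fob T g)) \<cdot> unt g \<cdot> h = a g \<cdot> h"
      using jt[of "fob S (fob T g)"] Tg ug d(5-7) by (simp add: a_def)
    finally show "a (Cod E c) \<cdot> far (slice_dom C) c = far (S \<circ>\<^sub>F T) c \<cdot> a (Dom E c)"
      by (simp only: P_def e(1) slice_simps(3,4) slice_dom_simps comp_functor_simps)
  qed
  then show ?thesis by (rule naturally_isomorphic_sym)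
qed

end

proposition groupoid_imp_stably_frobenius:
  fixes C :: "('o, 'a) cat" and D :: "('p, 'b) cat"
  assumes C: "finite_limits C" and D: "finite_limits D" and SD: "adjunction D C S Dst etaD epsD" and G: "internal_groupoid C G"
    and Th: "equivalence_functor D (gobj_cat C G) \<Theta>"
    and iso: "naturally_isomorphic C (gobj_cat C G) (\<Theta> \<circ>\<^sub>F Dst) (gstar C G)"
  shows "\<exists>X0 \<in> Ob C. \<exists>T U eta eps. adjunction (slice C X0) D T U eta eps \<and> stably_frobenius (slice C X0) D T U eps \<and>
    naturally_isomorphic (slice C X0) C (S \<circ>\<^sub>F T) (slice_dom C) \<and> monadic D (slice C X0) U"
proof -
  interpret C: finite_limits C by fact
  interpret G: groupoid_actions C G by (intro groupoid_actions.intro G C)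
  interpret D: finite_limits D by fact
  interpret Th: ff_eso_functor D "gobj_cat C G" \<Theta> by (rule equivalence_ff_eso[OF Th])
  have bk: "beck D (slice C (G0 G)) (forget \<circ>\<^sub>F \<Theta>)" by (rule beck_pre[OF G.forget_beck Th.ff_eso_functor_axioms])
  obtain T eta eps where TU: "adjunction (slice C (G0 G)) D T (forget \<circ>\<^sub>F \<Theta>) eta eps"
    using adjunction_from_universal_arrows[OF beckD(1)[OF bk] beckD(2)[OF bk]] by blast
  interpret groupoid_model C G D \<Theta> T eta eps
    by (intro groupoid_model.intro TU G.groupoid_actions_axioms D Th.ff_eso_functor_axioms)
  show ?thesis
    using G.groupoid_simps(1) TU stably_frobenius over_base[OF SD iso] bk unfolding monadic_iff_beck by blast
qed

theorem proposition7p3: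
  fixes C :: "('o, 'a) cat" and D :: "('p, 'b) cat"
    and SigmaD :: "('p, 'b, 'o, 'a) func" and Dstar :: "('o, 'a, 'p, 'b) func"
    and etaD :: "'p \<Rightarrow> 'b" and epsD :: "'o \<Rightarrow> 'a"
  assumes "category C" and "has_finite_limits C"
    and "category D" and "has_finite_limits D"
    and "adjunction D C SigmaD Dstar etaD epsD"
  shows
    "let
       P1 = (\<exists>G \<Theta>. internal_groupoid C G \<and> equivalence_functor D (gobj_cat C G) \<Theta> \<and>
               naturally_isomorphic C (gobj_cat C G) (\<Theta> \<circ>\<^sub>F Dstar) (gstar C G));
       P2 = (\<exists>X0 \<in> Ob C. \<exists>T U \<eta> \<epsilon>. adjunction (slice C X0) D T U \<eta> \<epsilon> \<and>
               stably_frobenius (slice C X0) D T U \<epsilon> \<and>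
               naturally_isomorphic (slice C X0) C (SigmaD \<circ>\<^sub>F T) (slice_dom C) \<and>
               monadic D (slice C X0) U);
       P3 = (\<exists>X0 \<in> Ob C. \<exists>T U \<eta> \<epsilon>. adjunction (slice C X0) D T U \<eta> \<epsilon> \<and>
               frobenius_at (slice C X0) D T U \<epsilon> (fob Dstar X0) \<and>
               naturally_isomorphic (slice C X0) C (SigmaD \<circ>\<^sub>F T) (slice_dom C) \<and>
               monadic D (slice C X0) U);
       P4 = (\<exists>W \<in> Ob D. effective_descent D (bang D W) \<and>
               equivalence_functor (slice D W) (slice C (fob SigmaD W)) (slice_functor SigmaD))
     in (P1 \<longleftrightarrow> P2) \<and> (P2 \<longleftrightarrow> P3) \<and> (P3 \<longleftrightarrow> P4)"
proof -
  have C: "finite_limits C" and D: "finite_limits D" using assms(1-4) by (simp_all add: finite_limits_def finite_limits_axioms_def)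
  note SD = assms(5)
  interpret SD: adjunction D C SigmaD Dstar etaD epsD by fact
  note a = groupoid_imp_stably_frobenius[OF C D SD]
  note b = frobenius_at_imp_effective_descent[OF C D SD]
  note c = effective_descent_imp_groupoid[OF C D SD]
  have d: "frobenius_at (slice C X0) D T U \<epsilon> (fob Dstar X0)"
    if "stably_frobenius (slice C X0) D T U \<epsilon>" "X0 \<in> Ob C" for X0 T U \<epsilon>
    using that unfolding stably_frobenius_def by simp
  have cycle: "(P1 \<longleftrightarrow> P2) \<and> (P2 \<longleftrightarrow> P3) \<and> (P3 \<longleftrightarrow> P4)"
    if "P1 \<Longrightarrow> P2" "P2 \<Longrightarrow> P3" "P3 \<Longrightarrow> P4" "P4 \<Longrightarrow> P1" for P1 P2 P3 P4
    using that by blast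
  show ?thesis
    unfolding Let_def
  proof (rule cycle, goal_cases)
    case 1
    then show ?case by (elim exE conjE) (rule a)
  next
    case 2
    then show ?case using d by (elim bexE exE conjE) (intro bexI exI conjI)
  next
    case 3
    then show ?case by (elim bexE exE conjE) (rule b)
  next
    case 4
    then show ?case by (elim bexE conjE) (rule c)
  qed
qed

end
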